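(* There is a constant $C>0$ such that, with $C_1:=3+C\|K\|_{H^{-1}(0,2\pi)\to L^2(0,2\pi)}$, for every $n\ge1$, every $\delta\geq 0$, every $b\in K(L^2(0,2\pi))$ and every $b^\delta\in L^2(0,2\pi)$ with $\|b^\delta-b\|_{L^2}\le\delta$, the least squares method satisfies $$\big\|K^{-1}b-(K_n^{LS})^{-1}Q_n^{LS}b^\delta\big\|_{L^2}\le C\,n\,\delta+C_1\min\{\|K^{-1}b-z_n\|_{L^2}: z_n\in X_n^{LS}\}.$$ If moreover $K^{-1}b\in H^r(0,2\pi)$ with $0\le r\le2$, then $$\big\|K^{-1}b-(K_n^{LS})^{-1}Q_n^{LS}b^\delta\big\|_{L^2}\le C\,n\,\delta+\frac{C_1}{n^r}\|K^{-1}b\|_{H^r},$$ and with the choice $n=\lceil\delta^{-1/(r+1)}\rceil$ one has $\|K^{-1}b-(K_n^{LS})^{-1}Q_n^{LS}b^\delta\|_{L^2}=O(\delta^{r/(r+1)})$ as $\delta\to0^+$.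
   Context: Setting: $\Omega\subset\mathbb{R}^2$ is a bounded simply connected domain whose boundary $\partial\Omega$ is a closed curve of class $C^3$, i.e. it has a $2\pi$-periodic, three times continuously differentiable (simple closed) parametrization $\gamma(s)=(a(s),b(s))$, $s\in[0,2\pi]$, with $|\dot\gamma(s)|>0$ for all $s$. It is assumed that there exists $z_0\in\Omega$ with $|x-z_0|\neq1$ for all $x\in\partial\Omega$. Symm's integral operator is $K:L^2(0,2\pi)\to L^2(0,2\pi)$, $$(K\Psi)(t)=-\frac1\pi\int_0^{2\pi}\Psi(s)\ln|\gamma(t)-\gamma(s)|\,ds ;$$ it is injective, and it extends continuously to a bounded operator $H^{-1}(0,2\pi)\to L^2(0,2\pi)$, whose norm is denoted $\|K\|_{H^{-1}(0,2\pi)\to L^2(0,2\pi)}$. For $r\in\mathbb{R}$, $H^r(0,2\pi)$ is the periodic Sobolev space with norm $\|x\|_{H^r}=(\sum_{k\in\mathbb{Z}}(1+k^2)^r|a_k|^2)^{1/2}$, $a_k$ the Fourier coefficients of $x$; $L^2(0,2\pi)=H^0(0,2\pi)$. Least squares method: $X_n^{LS}=\mathrm{span}\{e^{ikt}:-n\le k\le n\}$, $Y_n^{LS}=K(X_n^{LS})$, $P_n^{LS}$ and $Q_n^{LS}$ are the orthogonal projections of $L^2(0,2\pi)$ onto $X_n^{LS}$ and $Y_n^{LS}$, and $K_n^{LS}=Q_n^{LS}KP_n^{LS}:X_n^{LS}\to Y_n^{LS}$, which is invertible. *)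

theory Defs
  imports "HOL-Analysis.Analysis" "HOL-Library.Landau_Symbols"
begin

section \<open>The space of square-integrable complex functions on the interval from 0 to \<open>2\<pi>\<close>\<close>

text \<open>
  Elements are represented by functions; two functions represent the same element iff they are
  \<open>l2_eq\<close>. The values outside \<open>{0..2*pi}\<close> are irrelevant.
\<close>

abbreviation circ_measure :: "real measure" where
  "circ_measure \<equiv> lebesgue_on {0..2*pi}"

definition L2 :: "(real \<Rightarrow> complex) set" where
  "L2 = {f. f \<in> borel_measurable circ_measure \<and> integrable circ_measure (\<lambda>t. (cmod (f t))\<^sup>2)}"

definition l2_eq :: "(real \<Rightarrow> complex) \<Rightarrow> (real \<Rightarrow> complex) \<Rightarrow> bool" where
  "l2_eq f g \<longleftrightarrow> (AE t in circ_measure. f t = g t)"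

definition l2_inner :: "(real \<Rightarrow> complex) \<Rightarrow> (real \<Rightarrow> complex) \<Rightarrow> complex" where
  "l2_inner f g = (LINT t|circ_measure. f t * cnj (g t))"

definition l2_norm :: "(real \<Rightarrow> complex) \<Rightarrow> real" where
  "l2_norm f = sqrt (LINT t|circ_measure. (cmod (f t))\<^sup>2)"

definition l2_dist :: "(real \<Rightarrow> complex) \<Rightarrow> (real \<Rightarrow> complex) \<Rightarrow> real" where
  "l2_dist f g = l2_norm (\<lambda>t. f t - g t)"

text \<open>Image and inverse of an operator \<open>T\<close> with domain \<open>D\<close>, modulo equality almost everywhere.\<close>

definition l2_image :: "((real \<Rightarrow> complex) \<Rightarrow> (real \<Rightarrow> complex)) \<Rightarrow>
    (real \<Rightarrow> complex) set \<Rightarrow> (real \<Rightarrow> complex) set" where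
  "l2_image T D = {y \<in> L2. \<exists>x\<in>D. l2_eq (T x) y}"

definition l2_inverse :: "((real \<Rightarrow> complex) \<Rightarrow> (real \<Rightarrow> complex)) \<Rightarrow>
    (real \<Rightarrow> complex) set \<Rightarrow> (real \<Rightarrow> complex) \<Rightarrow> (real \<Rightarrow> complex)" where
  "l2_inverse T D y = (SOME x. x \<in> D \<and> l2_eq (T x) y)"

definition orth_proj :: "(real \<Rightarrow> complex) set \<Rightarrow> (real \<Rightarrow> complex) \<Rightarrow> (real \<Rightarrow> complex)" where
  "orth_proj V f = (SOME g. g \<in> V \<and> (\<forall>h\<in>V. l2_inner (\<lambda>t. f t - g t) h = 0))"


section \<open>Periodic Sobolev spaces\<close>

text \<open>
  Fourier coefficients are taken with respect to the orthonormal system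
  \<open>exp (i k t) / sqrt (2 \<pi>)\<close>, so that the Sobolev space of order 0 is isometric to \<open>L2\<close>.
\<close>

definition fourier_coeff :: "(real \<Rightarrow> complex) \<Rightarrow> int \<Rightarrow> complex" where
  "fourier_coeff f k =
     (1 / complex_of_real (sqrt (2*pi))) *
     (LINT t|circ_measure. f t * exp (- (\<i> * of_int k * complex_of_real t)))"

text \<open>
  An element of the space of order \<open>r\<close> (for negative \<open>r\<close> a periodic distribution) is
  represented by its sequence of Fourier coefficients; \<open>L2\<close> is embedded by \<open>fourier_coeff\<close>.
\<close>

definition sobolev :: "real \<Rightarrow> (int \<Rightarrow> complex) set" where
  "sobolev r = {a. (\<lambda>k. (1 + (real_of_int k)\<^sup>2) powr r * (cmod (a k))\<^sup>2) summable_on UNIV}"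

definition sobolev_norm :: "real \<Rightarrow> (int \<Rightarrow> complex) \<Rightarrow> real" where
  "sobolev_norm r a = sqrt (\<Sum>\<^sub>\<infinity>k. (1 + (real_of_int k)\<^sup>2) powr r * (cmod (a k))\<^sup>2)"


section \<open>The boundary curve\<close>

text \<open>The plane is modelled by the type \<open>complex\<close>.\<close>

primrec C_diff :: "nat \<Rightarrow> (real \<Rightarrow> 'a::real_normed_vector) \<Rightarrow> bool" where
  "C_diff 0 f \<longleftrightarrow> continuous_on UNIV f"
| "C_diff (Suc k) f \<longleftrightarrow> (\<exists>f'. (\<forall>t. (f has_vector_derivative f' t) (at t)) \<and> C_diff k f')"

definition regular_closed_C3_curve :: "(real \<Rightarrow> complex) \<Rightarrow> bool" where
  "regular_closed_C3_curve \<gamma> \<longleftrightarrow>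
     (\<forall>s. \<gamma> (s + 2*pi) = \<gamma> s) \<and> inj_on \<gamma> {0..<2*pi} \<and> C_diff 3 \<gamma> \<and>
     (\<forall>s. norm (vector_derivative \<gamma> (at s)) > 0)"


section \<open>Symm's integral operator\<close>

definition symm_op :: "(real \<Rightarrow> complex) \<Rightarrow> (real \<Rightarrow> complex) \<Rightarrow> (real \<Rightarrow> complex)" where
  "symm_op \<gamma> \<Psi> t =
     complex_of_real (- 1 / pi) *
     (LINT s|circ_measure. \<Psi> s * complex_of_real (ln (norm (\<gamma> t - \<gamma> s))))"

definition symm_inverse :: "(real \<Rightarrow> complex) \<Rightarrow> (real \<Rightarrow> complex) \<Rightarrow> (real \<Rightarrow> complex)" where
  "symm_inverse \<gamma> = l2_inverse (symm_op \<gamma>) L2"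

text \<open>\<open>T\<close> is a bounded linear operator from the space of order \<open>-1\<close> to \<open>L2\<close> extending \<open>symm_op \<gamma>\<close>.
  By density of \<open>L2\<close> it is unique modulo equality almost everywhere.\<close>

definition is_symm_extension ::
    "(real \<Rightarrow> complex) \<Rightarrow> ((int \<Rightarrow> complex) \<Rightarrow> (real \<Rightarrow> complex)) \<Rightarrow> bool" where
  "is_symm_extension \<gamma> T \<longleftrightarrow>
     (\<forall>a\<in>sobolev (-1). T a \<in> L2) \<and>
     (\<forall>a\<in>sobolev (-1). \<forall>b\<in>sobolev (-1). l2_eq (T (\<lambda>k. a k + b k)) (\<lambda>t. T a t + T b t)) \<and>
     (\<forall>c. \<forall>a\<in>sobolev (-1). l2_eq (T (\<lambda>k. c * a k)) (\<lambda>t. c * T a t)) \<and>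
     (\<exists>M. \<forall>a\<in>sobolev (-1). l2_norm (T a) \<le> M * sobolev_norm (-1) a) \<and>
     (\<forall>\<Psi>\<in>L2. l2_eq (T (fourier_coeff \<Psi>)) (symm_op \<gamma> \<Psi>))"

definition symm_extension :: "(real \<Rightarrow> complex) \<Rightarrow> (int \<Rightarrow> complex) \<Rightarrow> (real \<Rightarrow> complex)" where
  "symm_extension \<gamma> = (SOME T. is_symm_extension \<gamma> T)"

definition symm_ext_norm :: "(real \<Rightarrow> complex) \<Rightarrow> real" where
  "symm_ext_norm \<gamma> =
     (SUP a\<in>{a \<in> sobolev (-1). sobolev_norm (-1) a \<le> 1}. l2_norm (symm_extension \<gamma> a))"


section \<open>The least squares method\<close>

definition X_LS :: "nat \<Rightarrow> (real \<Rightarrow> complex) set" where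
  "X_LS n = {\<lambda>t. \<Sum>k\<in>{- int n..int n}. c k * exp (\<i> * of_int k * complex_of_real t) | c.
               (c :: int \<Rightarrow> complex) \<in> UNIV}"

definition Y_LS :: "(real \<Rightarrow> complex) \<Rightarrow> nat \<Rightarrow> (real \<Rightarrow> complex) set" where
  "Y_LS \<gamma> n = symm_op \<gamma> ` X_LS n"

definition P_LS :: "nat \<Rightarrow> (real \<Rightarrow> complex) \<Rightarrow> (real \<Rightarrow> complex)" where
  "P_LS n = orth_proj (X_LS n)"

definition Q_LS :: "(real \<Rightarrow> complex) \<Rightarrow> nat \<Rightarrow> (real \<Rightarrow> complex) \<Rightarrow> (real \<Rightarrow> complex)" where
  "Q_LS \<gamma> n = orth_proj (Y_LS \<gamma> n)"

definition K_LS :: "(real \<Rightarrow> complex) \<Rightarrow> nat \<Rightarrow> (real \<Rightarrow> complex) \<Rightarrow> (real \<Rightarrow> complex)" where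
  "K_LS \<gamma> n z = Q_LS \<gamma> n (symm_op \<gamma> (P_LS n z))"

definition K_LS_inverse :: "(real \<Rightarrow> complex) \<Rightarrow> nat \<Rightarrow> (real \<Rightarrow> complex) \<Rightarrow> (real \<Rightarrow> complex)" where
  "K_LS_inverse \<gamma> n = l2_inverse (K_LS \<gamma> n) (X_LS n)"

definition LS_error ::
    "(real \<Rightarrow> complex) \<Rightarrow> nat \<Rightarrow> (real \<Rightarrow> complex) \<Rightarrow> (real \<Rightarrow> complex) \<Rightarrow> real" where
  "LS_error \<gamma> n b b\<^sub>\<delta> = l2_dist (symm_inverse \<gamma> b) (K_LS_inverse \<gamma> n (Q_LS \<gamma> n b\<^sub>\<delta>))"

end

theory Submission
  imports Defs "HOL-Complex_Analysis.Great_Picard"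
begin

text \<open>
  Write \<open>K = A + B\<close>, where \<open>A\<close> is Symm's operator of the unit circle, the Fourier multiplier
  \<open>1 / \<bar>k\<bar>\<close>, and the kernel of \<open>B\<close> is twice continuously differentiable because the curve is of class
  \<open>C\<^sup>3\<close>. In Fourier coordinates, weighted by the Sobolev norm of order \<open>-1\<close>, \<open>K\<close> is therefore the
  identity plus a Hilbert--Schmidt matrix. Once \<open>K\<close> is known to be injective, compactness gives
  \<open>c \<parallel>\<psi>\<parallel> \<le> \<parallel>K \<psi>\<parallel>\<close> with the norm of order \<open>-1\<close> on the left.

  A null vector in the space of order \<open>-1\<close> has, by a bootstrap, an absolutely convergent Fourier
  series, so it is a continuous density whose logarithmic potential vanishes on the curve. The
  condition on \<open>z\<^sub>0\<close> forces its total charge to be zero; the maximum principle then makes the potential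
  vanish in the whole plane, and its circle means, given by Jensen's formula, determine the density.

  For the least squares method, the difference of the discrete solution and the truncated Fourier series
  \<open>p\<close> of the exact solution \<open>x\<close> is a trigonometric polynomial \<open>e\<close> of degree \<open>n\<close>. By orthogonality
  \<open>\<parallel>K e\<parallel> \<le> \<delta> + \<parallel>K (x - p)\<parallel>\<close>. Passing from the norm of order \<open>-1\<close> to that of \<open>L\<^sup>2\<close> costs a
  factor of order \<open>n\<close> for \<open>e\<close>, while the norm of order \<open>-1\<close> of \<open>x - p\<close> gains a factor \<open>1 / n\<close>.
\<close>

section \<open>Square-integrable functions\<close>

text \<open>Symm's operator raises the Sobolev order by one, so the lower bound lives in the norm of
  order -1, and injectivity is needed on that whole space and not only on L2: compactness alone
  cannot exclude a distributional null vector, hence the bootstrap. Its input is the smoothness of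
  the kernel of \<open>B\<close>. Dividing a chord by the parameter difference costs one derivative,
  so a curve of class C^3 leaves two; they give the square-summable weight
  \<open>(1 + j^2)^2\<close>, which together with the symmetry of the kernel covers both steps of
  the bootstrap. Injectivity can fail without a condition on the scale: on the unit circle constants
  are annihilated. The point charge at \<open>z\<^sub>0\<close> is the right comparison because the
  condition gives its logarithm a constant strict sign on the curve. Normal derivatives and jump
  relations are avoided; harmonicity enters only through circle means, and the circles may cross the
  curve. In the final estimate the factor n cancels against the gain 1 / n in the approximation term
  and survives only in front of the data error.\<close>

definition sqi :: "'a measure \<Rightarrow> ('a \<Rightarrow> complex) \<Rightarrow> bool" where
  "sqi M f \<longleftrightarrow> f \<in> borel_measurable M \<and> integrable M (\<lambda>x. (cmod (f x))\<^sup>2)"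

text \<open>The measure is left arbitrary so that functions on the circle and sequences over the
  integers share one set of norm and Cauchy-Schwarz lemmas.\<close>

definition nrm :: "'a measure \<Rightarrow> ('a \<Rightarrow> complex) \<Rightarrow> real" where
  "nrm M f = sqrt (LINT x|M. (cmod (f x))\<^sup>2)"

lemma sqi_measurable: "sqi M f \<Longrightarrow> f \<in> borel_measurable M"
  by (simp add: sqi_def)

lemma nrm_nonneg [simp]: "nrm M f \<ge> 0"
  by (simp add: nrm_def)

lemma nrm_sq: "(nrm M f)\<^sup>2 = (LINT x|M. (cmod (f x))\<^sup>2)"
  by (simp add: nrm_def)

lemma cmod_mult_le_sq: "cmod (a * b) \<le> (cmod a)\<^sup>2 + (cmod b)\<^sup>2"
  using sum_squares_bound[of "cmod a" "cmod b"] mult_nonneg_nonneg[of "cmod a" "cmod b"]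
  by (simp add: norm_mult del: zero_le_mult_iff mult_nonneg_nonneg)

lemma cmod_add_sq_le: "(cmod (a + b))\<^sup>2 \<le> 2 * (cmod a)\<^sup>2 + 2 * (cmod b)\<^sup>2"
proof -
  have "(cmod (a + b))\<^sup>2 \<le> (cmod a + cmod b)\<^sup>2"
    by (simp add: norm_triangle_ineq power_mono)
  also have "\<dots> \<le> 2 * (cmod a)\<^sup>2 + 2 * (cmod b)\<^sup>2"
    using sum_squares_bound[of "cmod a" "cmod b"] by (simp add: power2_sum)
  finally show ?thesis .
qed

lemma sqi_mult_integrable:
  assumes "sqi M f" "sqi M g"
  shows "integrable M (\<lambda>x. f x * g x)"
proof (rule Bochner_Integration.integrable_bound)
  show "integrable M (\<lambda>x. (cmod (f x))\<^sup>2 + (cmod (g x))\<^sup>2)"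
    using assms by (auto simp: sqi_def)
  show "(\<lambda>x. f x * g x) \<in> borel_measurable M"
    using assms by (auto simp: sqi_def)
  show "AE x in M. cmod (f x * g x) \<le> norm ((cmod (f x))\<^sup>2 + (cmod (g x))\<^sup>2)"
    using cmod_mult_le_sq by auto
qed

lemma sqi_add:
  assumes "sqi M f" "sqi M g"
  shows "sqi M (\<lambda>x. f x + g x)"
  unfolding sqi_def
proof
  show "(\<lambda>x. f x + g x) \<in> borel_measurable M"
    using assms by (auto simp: sqi_def)
  show "integrable M (\<lambda>x. (cmod (f x + g x))\<^sup>2)"
  proof (rule Bochner_Integration.integrable_bound)
    show "integrable M (\<lambda>x. 2 * (cmod (f x))\<^sup>2 + 2 * (cmod (g x))\<^sup>2)"
      using assms by (auto simp: sqi_def)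
    show "(\<lambda>x. (cmod (f x + g x))\<^sup>2) \<in> borel_measurable M"
      using assms by (auto simp: sqi_def)
    show "AE x in M. norm ((cmod (f x + g x))\<^sup>2) \<le> norm (2 * (cmod (f x))\<^sup>2 + 2 * (cmod (g x))\<^sup>2)"
      using cmod_add_sq_le by auto
  qed
qed

lemma sqi_cmult: "sqi M f \<Longrightarrow> sqi M (\<lambda>x. c * f x)"
  by (auto simp: sqi_def norm_mult power_mult_distrib)

lemma sqi_uminus: "sqi M f \<Longrightarrow> sqi M (\<lambda>x. - f x)"
  by (auto simp: sqi_def)

lemma sqi_diff: "sqi M f \<Longrightarrow> sqi M g \<Longrightarrow> sqi M (\<lambda>x. f x - g x)"
  using sqi_add[OF _ sqi_uminus, of M f g] by simp

lemma sqi_cnj: "sqi M f \<Longrightarrow> sqi M (\<lambda>x. cnj (f x))"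
  unfolding sqi_def by (auto intro!: borel_measurable_continuous_on[where f=cnj] continuous_intros)

lemma sqi_zero: "sqi M (\<lambda>x. 0)"
  by (auto simp: sqi_def)

lemma sqi_sum:
  assumes "\<And>i. i \<in> I \<Longrightarrow> sqi M (f i)"
  shows "sqi M (\<lambda>x. \<Sum>i\<in>I. f i x)"
proof (cases "finite I")
  case True
  then show ?thesis using assms
    by (induction I rule: finite_induct) (auto intro: sqi_zero sqi_add)
qed (simp add: sqi_zero)

lemma sqi_bounded:
  assumes "finite_measure M" "f \<in> borel_measurable M" "\<And>x. x \<in> space M \<Longrightarrow> cmod (f x) \<le> B"
  shows "sqi M f"
  unfolding sqi_def
proof
  interpret finite_measure M by fact
  show "integrable M (\<lambda>x. (cmod (f x))\<^sup>2)"
  proof (rule integrable_const_bound[of _ "B\<^sup>2"])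
    show "AE x in M. norm ((cmod (f x))\<^sup>2) \<le> B\<^sup>2"
      using assms(3) by (auto intro!: AE_I2 power_mono)
  qed (use assms in auto)
qed (use assms in auto)

lemma sqi_cong_AE:
  assumes "sqi M f" "g \<in> borel_measurable M" "AE x in M. f x = g x"
  shows "sqi M g"
  unfolding sqi_def
proof
  have "integrable M (\<lambda>x. (cmod (f x))\<^sup>2) = integrable M (\<lambda>x. (cmod (g x))\<^sup>2)"
    using assms by (intro integrable_cong_AE) (auto simp: sqi_def)
  then show "integrable M (\<lambda>x. (cmod (g x))\<^sup>2)" using assms by (simp add: sqi_def)
qed fact

lemma nrm_cong_AE:
  assumes "f \<in> borel_measurable M" "g \<in> borel_measurable M" "AE x in M. f x = g x"
  shows "nrm M f = nrm M g"
  unfolding nrm_def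
  by (rule arg_cong[of _ _ sqrt], rule integral_cong_AE) (use assms in auto)

lemma nrm_eq_0_iff:
  assumes "sqi M f"
  shows "nrm M f = 0 \<longleftrightarrow> (AE x in M. f x = 0)"
proof -
  have "(LINT x|M. (cmod (f x))\<^sup>2) = 0 \<longleftrightarrow> (AE x in M. (cmod (f x))\<^sup>2 = 0)"
    by (rule integral_nonneg_eq_0_iff_AE) (use assms in \<open>auto simp: sqi_def\<close>)
  then show ?thesis by (simp add: nrm_def)
qed

lemma nrm_cmult: "nrm M (\<lambda>x. c * f x) = cmod c * nrm M f"
  by (simp add: nrm_def norm_mult power_mult_distrib real_sqrt_mult)

lemma nrm_uminus: "nrm M (\<lambda>x. - f x) = nrm M f"
  by (simp add: nrm_def)

lemma nrm_minus_commute: "nrm M (\<lambda>x. f x - g x) = nrm M (\<lambda>x. g x - f x)"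
  by (simp add: nrm_def norm_minus_commute)

lemma sqi_norm_mult_integrable:
  assumes "sqi M f" "sqi M g"
  shows "integrable M (\<lambda>x. cmod (f x) * cmod (g x))"
  using integrable_norm[OF sqi_mult_integrable[OF assms]] by (simp add: norm_mult)

lemma Cauchy_Schwarz_sqi_norm:
  assumes f: "sqi M f" and g: "sqi M g"
  shows "(LINT x|M. cmod (f x) * cmod (g x)) \<le> nrm M f * nrm M g"
proof -
  define A B C where "A = (LINT x|M. (cmod (f x))\<^sup>2)" and "B = (LINT x|M. cmod (f x) * cmod (g x))"
    and "C = (LINT x|M. (cmod (g x))\<^sup>2)"
  have A0: "A \<ge> 0" and B0: "B \<ge> 0" and C0: "C \<ge> 0" unfolding A_def B_def C_def by (auto intro: integral_nonneg_AE)
  note fg = sqi_norm_mult_integrable[OF f g]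
  have ff: "integrable M (\<lambda>x. (cmod (f x))\<^sup>2)" and gg: "integrable M (\<lambda>x. (cmod (g x))\<^sup>2)"
    using f g by (auto simp: sqi_def)
  have "B\<^sup>2 \<le> A * C"
  proof (cases "A = 0")
    case True
    then have "AE x in M. f x = 0" using nrm_eq_0_iff[OF f] by (simp add: nrm_def A_def)
    then have "AE x in M. cmod (f x) * cmod (g x) = 0" by auto
    then have "B = 0" unfolding B_def by (rule integral_eq_zero_AE)
    then show ?thesis using True by simp
  next
    case False
    \<comment> \<open>The coefficient \<open>B / A\<close> minimises the integral of
      \<open>(c * |f| - |g|)^2\<close> over \<open>c\<close>; that the minimum is nonnegative is the
      inequality.\<close>
    have "0 \<le> (LINT x|M. (B / A * cmod (f x) - cmod (g x))\<^sup>2)" by (auto intro: integral_nonneg_AE)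
    also have "(\<lambda>x. (B / A * cmod (f x) - cmod (g x))\<^sup>2)
        = (\<lambda>x. (B / A)\<^sup>2 * (cmod (f x))\<^sup>2 - 2 * (B / A) * (cmod (f x) * cmod (g x)) + (cmod (g x))\<^sup>2)"
      by (auto simp: power2_eq_square algebra_simps)
    also have "(LINT x|M. \<dots> x) = (B / A)\<^sup>2 * A - 2 * (B / A) * B + C"
      using fg ff gg by (simp add: A_def B_def C_def)
    also have "\<dots> = C - B\<^sup>2 / A" using False by (simp add: field_simps power2_eq_square)
    finally show ?thesis using False A0 by (simp add: field_simps)
  qed
  then have "B \<le> sqrt (A * C)" by (rule real_le_rsqrt)
  then show ?thesis by (simp add: A_def B_def C_def nrm_def real_sqrt_mult)
qed

lemma Cauchy_Schwarz_sqi: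
  assumes "sqi M f" "sqi M g"
  shows "cmod (LINT x|M. f x * g x) \<le> nrm M f * nrm M g"
proof -
  have "cmod (LINT x|M. f x * g x) \<le> (LINT x|M. cmod (f x * g x))" by (rule integral_norm_bound)
  also have "\<dots> \<le> nrm M f * nrm M g" using Cauchy_Schwarz_sqi_norm[OF assms] by (simp add: norm_mult)
  finally show ?thesis .
qed

lemma nrm_add:
  assumes f: "sqi M f" and g: "sqi M g"
  shows "nrm M (\<lambda>x. f x + g x) \<le> nrm M f + nrm M g"
proof -
  note fg = sqi_norm_mult_integrable[OF f g]
  have ff: "integrable M (\<lambda>x. (cmod (f x))\<^sup>2)" and gg: "integrable M (\<lambda>x. (cmod (g x))\<^sup>2)"
    using f g by (auto simp: sqi_def)
  have "(nrm M (\<lambda>x. f x + g x))\<^sup>2 \<le> (LINT x|M. (cmod (f x))\<^sup>2 + 2 * (cmod (f x) * cmod (g x)) + (cmod (g x))\<^sup>2)"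
    unfolding nrm_sq
  proof (rule integral_mono)
    show "integrable M (\<lambda>x. (cmod (f x + g x))\<^sup>2)" using sqi_add[OF f g] by (simp add: sqi_def)
    show "integrable M (\<lambda>x. (cmod (f x))\<^sup>2 + 2 * (cmod (f x) * cmod (g x)) + (cmod (g x))\<^sup>2)"
      using fg ff gg by auto
    show "(cmod (f x + g x))\<^sup>2 \<le> (cmod (f x))\<^sup>2 + 2 * (cmod (f x) * cmod (g x)) + (cmod (g x))\<^sup>2" for x
      using power_mono[OF norm_triangle_ineq[of "f x" "g x"], of 2] by (simp add: power2_sum)
  qed
  also have "\<dots> = (nrm M f)\<^sup>2 + 2 * (LINT x|M. cmod (f x) * cmod (g x)) + (nrm M g)\<^sup>2"
    using fg ff gg by (simp add: nrm_sq)
  also have "\<dots> \<le> (nrm M f)\<^sup>2 + 2 * (nrm M f * nrm M g) + (nrm M g)\<^sup>2"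
    using Cauchy_Schwarz_sqi_norm[OF f g] by simp
  also have "\<dots> = (nrm M f + nrm M g)\<^sup>2" by (simp add: power2_sum)
  finally show ?thesis by (rule power2_le_imp_le) simp
qed

lemma nrm_diff_le:
  assumes "sqi M f" "sqi M g"
  shows "nrm M (\<lambda>x. f x - g x) \<le> nrm M f + nrm M g"
  using nrm_add[OF assms(1) sqi_uminus[OF assms(2)]] by (simp add: nrm_uminus)

lemma nrm_triangle_mid:
  assumes "sqi M f" "sqi M g" "sqi M h"
  shows "nrm M (\<lambda>x. f x - h x) \<le> nrm M (\<lambda>x. f x - g x) + nrm M (\<lambda>x. g x - h x)"
  using nrm_add[OF sqi_diff[OF assms(1,2)] sqi_diff[OF assms(2,3)]] by simp

text \<open>Used mostly with counting measure, where a coefficientwise comparison becomes a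
  comparison of norms.\<close>

lemma nrm_mono:
  assumes "sqi M g" "f \<in> borel_measurable M" "\<And>x. x \<in> space M \<Longrightarrow> cmod (f x) \<le> cmod (g x)"
  shows "sqi M f" "nrm M f \<le> nrm M g"
proof -
  show f: "sqi M f" unfolding sqi_def
  proof
    show "integrable M (\<lambda>x. (cmod (f x))\<^sup>2)"
    proof (rule Bochner_Integration.integrable_bound)
      show "integrable M (\<lambda>x. (cmod (g x))\<^sup>2)" using assms by (simp add: sqi_def)
      show "AE x in M. norm ((cmod (f x))\<^sup>2) \<le> norm ((cmod (g x))\<^sup>2)"
        using assms(3) by (intro AE_I2) (simp add: power_mono)
    qed (use assms in auto)
  qed fact
  show "nrm M f \<le> nrm M g" unfolding nrm_def
    using f assms by (intro real_sqrt_le_mono integral_mono) (auto simp: sqi_def power_mono)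
qed

section \<open>Square-summable families over the integers\<close>

text \<open>Sums over the integers are treated as integrals, so dominated convergence and the lemmas
  on \<open>sqi\<close> and \<open>nrm\<close> apply to them directly.\<close>

abbreviation cZ :: "int measure" where "cZ \<equiv> count_space (UNIV :: int set)"

lemma summable_iff_integrable_cZ:
  fixes f :: "int \<Rightarrow> real"
  assumes "\<And>k. f k \<ge> 0"
  shows "f summable_on UNIV \<longleftrightarrow> integrable cZ f"
  using abs_summable_equivalent[of f UNIV] assms by (simp add: Infinite_Set_Sum.abs_summable_on_def)

lemma infsum_eq_integral_cZ:
  fixes f :: "int \<Rightarrow> real"
  assumes "integrable cZ f"
  shows "infsum f UNIV = (LINT k|cZ. f k)"
  using assms infsetsum_infsum[of f UNIV] by (simp add: infsetsum_def Infinite_Set_Sum.abs_summable_on_def)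

lemma integrable_cZ_bounded:
  fixes f :: "int \<Rightarrow> real"
  assumes "\<And>k. f k \<ge> 0" "\<And>F. finite F \<Longrightarrow> (\<Sum>k\<in>F. f k) \<le> B"
  shows "integrable cZ f" "(LINT k|cZ. f k) \<le> B"
proof -
  have s: "f summable_on UNIV"
    by (rule nonneg_bdd_above_summable_on) (use assms in \<open>auto intro!: bdd_aboveI[of _ B]\<close>)
  then show i: "integrable cZ f" using assms summable_iff_integrable_cZ by blast
  have "infsum f UNIV \<le> B" by (rule infsum_le_finite_sums[OF s]) (use assms in auto)
  then show "(LINT k|cZ. f k) \<le> B" using infsum_eq_integral_cZ[OF i] by simp
qed

lemma sum_le_integral_cZ:
  fixes f :: "int \<Rightarrow> real"
  assumes "integrable cZ f" "\<And>k. f k \<ge> 0" "finite F"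
  shows "(\<Sum>k\<in>F. f k) \<le> (LINT k|cZ. f k)"
proof -
  have "(\<Sum>k\<in>F. f k) \<le> infsum f UNIV"
    by (rule finite_sum_le_infsum) (use assms summable_iff_integrable_cZ in auto)
  then show ?thesis using infsum_eq_integral_cZ assms by simp
qed

lemma sqi_cZ_bounded:
  assumes "\<And>F. finite F \<Longrightarrow> (\<Sum>k\<in>F. (cmod (f k))\<^sup>2) \<le> B\<^sup>2" "B \<ge> 0"
  shows "sqi cZ f" "nrm cZ f \<le> B"
proof -
  note * = integrable_cZ_bounded[of "\<lambda>k. (cmod (f k))\<^sup>2", OF _ assms(1)]
  show "sqi cZ f" using * by (simp add: sqi_def)
  show "nrm cZ f \<le> B" unfolding nrm_def using * assms(2) by (intro real_le_lsqrt) auto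
qed

lemma sum_le_nrm_cZ:
  assumes "sqi cZ f" "finite F"
  shows "(\<Sum>k\<in>F. (cmod (f k))\<^sup>2) \<le> (nrm cZ f)\<^sup>2"
  unfolding nrm_sq using assms by (intro sum_le_integral_cZ) (auto simp: sqi_def)

lemma cmod_le_nrm_cZ: "sqi cZ f \<Longrightarrow> cmod (f k) \<le> nrm cZ f"
  using sum_le_nrm_cZ[of f "{k}"] by (auto intro: power2_le_imp_le)

lemma integral_cZ_finite_support:
  fixes f :: "int \<Rightarrow> 'b :: {banach, second_countable_topology}"
  assumes "finite F" "\<And>k. k \<notin> F \<Longrightarrow> f k = 0"
  shows "integrable cZ f" "(LINT k|cZ. f k) = (\<Sum>k\<in>F. f k)"
proof -
  have eq: "{k. f k \<noteq> 0} \<subseteq> F" using assms(2) by auto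
  then have fin: "finite {k. f k \<noteq> 0}" using assms(1) finite_subset by blast
  then have "(\<lambda>k. norm (f k)) summable_on UNIV"
    using fin by (intro finite_nonzero_values_imp_summable_on) auto
  then have "integrable cZ (\<lambda>k. norm (f k))" by (subst (asm) summable_iff_integrable_cZ) auto
  then show "integrable cZ f" by (subst (asm) integrable_norm_iff) auto
  have "(LINT k|cZ. f k) = (\<Sum>k | f k \<noteq> 0. f k)"
    using lebesgue_integral_count_space_finite_support[of UNIV f] fin by simp
  also have "\<dots> = (\<Sum>k\<in>F. f k)"
    by (rule sum.mono_neutral_left) (use assms eq in auto)
  finally show "(LINT k|cZ. f k) = (\<Sum>k\<in>F. f k)" .
qed

lemma sqi_cZ_finite_support:
  assumes "finite F" "\<And>k. k \<notin> F \<Longrightarrow> f k = 0"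
  shows "sqi cZ f" "(nrm cZ f)\<^sup>2 = (\<Sum>k\<in>F. (cmod (f k))\<^sup>2)"
  using integral_cZ_finite_support[of F "\<lambda>k. (cmod (f k))\<^sup>2"] assms by (auto simp: sqi_def nrm_sq)

lemma tendsto_symmetric_sum:
  fixes f :: "int \<Rightarrow> 'b :: {banach, second_countable_topology}"
  assumes "integrable cZ f"
  shows "(\<lambda>n. \<Sum>k\<in>{- int n..int n}. f k) \<longlonglongrightarrow> (LINT k|cZ. f k)"
proof -
  have "(\<lambda>n. LINT k|cZ. (if k \<in> {- int n..int n} then f k else 0)) \<longlonglongrightarrow> (LINT k|cZ. f k)"
  proof (rule integral_dominated_convergence)
    show "integrable cZ (\<lambda>k. norm (f k))" using assms by simp
    show "AE k in cZ. (\<lambda>n. if k \<in> {- int n..int n} then f k else 0) \<longlonglongrightarrow> f k"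
    proof (rule AE_I2)
      fix k :: int
      show "(\<lambda>n. if k \<in> {- int n..int n} then f k else 0) \<longlonglongrightarrow> f k"
      proof (rule tendsto_eventually, unfold eventually_sequentially, intro exI allI impI)
        fix n assume "nat \<bar>k\<bar> \<le> n"
        then show "(if k \<in> {- int n..int n} then f k else 0) = f k" by auto
      qed
    qed
  qed auto
  moreover have "(LINT k|cZ. (if k \<in> {- int n..int n} then f k else 0)) = (\<Sum>k\<in>{- int n..int n}. f k)" for n
    by (subst integral_cZ_finite_support(2)[of "{- int n..int n}"]) auto
  ultimately show ?thesis by simp
qed

section \<open>Completeness\<close>

text \<open>On a finite measure space the L1 norm is at most a constant times the L2 norm, so the
  integrals of \<open>cmod (d i x)\<close> are summable; by monotone convergence so is the series
  itself almost everywhere.\<close>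

lemma AE_summable_of_norms:
  fixes d :: "nat \<Rightarrow> 'a \<Rightarrow> complex"
  assumes fm: "finite_measure M" and d: "\<And>i. sqi M (d i)" and s: "summable (\<lambda>i. nrm M (d i))"
  shows "AE x in M. summable (\<lambda>i. cmod (d i x))"
proof -
  interpret finite_measure M by fact
  have one: "sqi M (\<lambda>x. 1)" using fm by (auto intro: sqi_bounded)
  have le: "(LINT x|M. cmod (d i x)) \<le> nrm M (d i) * nrm M (\<lambda>x. 1)" for i
    using Cauchy_Schwarz_sqi_norm[OF d one] by simp
  have int: "integrable M (\<lambda>x. cmod (d i x))" for i
    using sqi_norm_mult_integrable[OF d one] by simp
  have meas [measurable]: "d i \<in> borel_measurable M" for i using d by (simp add: sqi_def)
  have sum: "summable (\<lambda>i. LINT x|M. cmod (d i x))"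
    by (rule summable_comparison_test'[OF summable_mult2[OF s, of "nrm M (\<lambda>x. 1)"], of 0])
       (use le in \<open>auto simp: integral_nonneg_AE\<close>)
  have "(\<integral>\<^sup>+x. (\<Sum>i. ennreal (cmod (d i x))) \<partial>M) = (\<Sum>i. \<integral>\<^sup>+x. ennreal (cmod (d i x)) \<partial>M)"
    by (rule nn_integral_suminf) auto
  also have "\<dots> = (\<Sum>i. ennreal (LINT x|M. cmod (d i x)))"
    using int by (simp add: nn_integral_eq_integral)
  also have "\<dots> \<noteq> \<infinity>"
    using sum by (simp add: suminf_ennreal2 integral_nonneg_AE)
  finally have "AE x in M. (\<Sum>i. ennreal (cmod (d i x))) \<noteq> \<infinity>"
    by (intro nn_integral_noteq_infinite) auto
  then show ?thesis
  proof eventually_elim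
    case (elim x)
    then show ?case by (intro summable_suminf_not_top) auto
  qed
qed

text \<open>A subsequence whose successive distances are dominated by a geometric series converges
  almost everywhere, and Fatou's lemma passes the Cauchy estimate to the limit.\<close>

lemma sqi_complete:
  fixes s :: "nat \<Rightarrow> 'a \<Rightarrow> complex"
  assumes fm: "finite_measure M" and s: "\<And>n. sqi M (s n)"
    and C: "\<And>e. e > 0 \<Longrightarrow> \<exists>N. \<forall>m\<ge>N. \<forall>n\<ge>N. nrm M (\<lambda>x. s m x - s n x) < e"
  obtains f where "sqi M f" "(\<lambda>n. nrm M (\<lambda>x. s n x - f x)) \<longlonglongrightarrow> 0"
proof -
  have meas [measurable]: "s i \<in> borel_measurable M" for i using s by (simp add: sqi_def)
  obtain N where N: "\<And>i m n. m \<ge> N i \<Longrightarrow> n \<ge> N i \<Longrightarrow> nrm M (\<lambda>x. s m x - s n x) < (1/2) ^ i"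
    using C[of "(1/2) ^ i" for i] by (metis zero_less_power half_gt_zero_iff zero_less_one)
  \<comment> \<open>Summing the thresholds makes \<open>r j\<close> at least \<open>N i\<close> for
    all \<open>i \<le> j\<close>; the added \<open>i\<close> gives \<open>i \<le> r i\<close>, which
    takes the place of strict monotonicity.\<close>
  define r where "r i = (\<Sum>j\<le>i. N j) + i" for i
  have rN: "N i \<le> r j" if "i \<le> j" for i j
    unfolding r_def using that by (meson atMost_iff finite_atMost member_le_sum trans_le_add1 zero_le)
  have ri: "i \<le> r i" for i by (simp add: r_def)
  define d where "d i x = s (r (Suc i)) x - s (r i) x" for i x
  have d: "sqi M (d i)" for i unfolding d_def by (intro sqi_diff s)
  have "summable (\<lambda>i. nrm M (d i))"
  proof (rule summable_comparison_test'[of "\<lambda>i. (1/2) ^ i" 0])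
    show "norm (nrm M (d i)) \<le> (1/2) ^ i" for i
      using N[of i "r (Suc i)" "r i"] rN[of i i] rN[of i "Suc i"] unfolding d_def by simp
  qed (simp add: summable_geometric)
  then have ae: "AE x in M. summable (\<lambda>i. cmod (d i x))"
    by (rule AE_summable_of_norms[OF fm d])
  \<comment> \<open>\<open>lim\<close> is total, so \<open>f\<close> has arbitrary values where the
    subsequence diverges; by \<open>conv\<close> this is a null set.\<close>
  define f where "f x = lim (\<lambda>i. s (r i) x)" for x
  have f_meas [measurable]: "f \<in> borel_measurable M" unfolding f_def by measurable
  have conv: "AE x in M. (\<lambda>i. s (r i) x) \<longlonglongrightarrow> f x"
    using ae
  proof eventually_elim
    case (elim x)
    then have "summable (\<lambda>i. d i x)" by (rule summable_norm_cancel)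
    then have "convergent (\<lambda>n. \<Sum>i<n. d i x)" by (simp add: summable_iff_convergent)
    then have "convergent (\<lambda>n. s (r 0) x + (\<Sum>i<n. d i x))" by (intro convergent_add convergent_const)
    also have "(\<lambda>n. s (r 0) x + (\<Sum>i<n. d i x)) = (\<lambda>i. s (r i) x)"
      using sum_lessThan_telescope[of "\<lambda>i. s (r i) x"] by (auto simp: d_def)
    finally show ?case unfolding f_def by (simp add: convergent_LIMSEQ_iff)
  qed
  have fat: "sqi M (\<lambda>x. s n x - f x)" "nrm M (\<lambda>x. s n x - f x) \<le> e"
    if e: "e > 0" and n: "\<And>m m'. m \<ge> K \<Longrightarrow> m' \<ge> K \<Longrightarrow> nrm M (\<lambda>x. s m x - s m' x) < e" and nK: "n \<ge> K" for n e K
  proof -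
    have "(\<integral>\<^sup>+x. ennreal ((cmod (s n x - f x))\<^sup>2) \<partial>M)
        = (\<integral>\<^sup>+x. liminf (\<lambda>i. ennreal ((cmod (s n x - s (r i) x))\<^sup>2)) \<partial>M)"
    proof (rule nn_integral_cong_AE)
      show "AE x in M. ennreal ((cmod (s n x - f x))\<^sup>2) = liminf (\<lambda>i. ennreal ((cmod (s n x - s (r i) x))\<^sup>2))"
        using conv
      proof eventually_elim
        case (elim x)
        then have "(\<lambda>i. ennreal ((cmod (s n x - s (r i) x))\<^sup>2)) \<longlonglongrightarrow> ennreal ((cmod (s n x - f x))\<^sup>2)"
          by (intro tendsto_ennrealI tendsto_intros)
        then show ?case by (intro lim_imp_Liminf[symmetric]) auto
      qed
    qed
    also have "\<dots> \<le> liminf (\<lambda>i. \<integral>\<^sup>+x. ennreal ((cmod (s n x - s (r i) x))\<^sup>2) \<partial>M)"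
      by (rule nn_integral_liminf) auto
    also have "\<dots> \<le> ennreal (e\<^sup>2)"
    proof (rule Liminf_le)
      show "\<forall>\<^sub>F i in sequentially. (\<integral>\<^sup>+x. ennreal ((cmod (s n x - s (r i) x))\<^sup>2) \<partial>M) \<le> ennreal (e\<^sup>2)"
        unfolding eventually_sequentially
      proof (intro exI allI impI)
        fix i assume "K \<le> i"
        then have "nrm M (\<lambda>x. s n x - s (r i) x) < e" using n[of n "r i"] nK ri[of i] by auto
        then have "(LINT x|M. (cmod (s n x - s (r i) x))\<^sup>2) \<le> e\<^sup>2"
          using power_mono[of "nrm M (\<lambda>x. s n x - s (r i) x)" e 2] by (simp add: nrm_sq)
        then show "(\<integral>\<^sup>+x. ennreal ((cmod (s n x - s (r i) x))\<^sup>2) \<partial>M) \<le> ennreal (e\<^sup>2)"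
          using sqi_diff[OF s s, of n "r i"] by (subst nn_integral_eq_integral) (auto simp: sqi_def ennreal_leI)
      qed
    qed simp
    finally have le: "(\<integral>\<^sup>+x. ennreal ((cmod (s n x - f x))\<^sup>2) \<partial>M) \<le> ennreal (e\<^sup>2)" .
    have int: "integrable M (\<lambda>x. (cmod (s n x - f x))\<^sup>2)"
      using le by (intro integrableI_bounded) (auto simp: less_top[symmetric] top_unique)
    then show "sqi M (\<lambda>x. s n x - f x)" by (simp add: sqi_def)
    have "(LINT x|M. (cmod (s n x - f x))\<^sup>2) \<le> e\<^sup>2"
      using le int by (subst (asm) nn_integral_eq_integral) auto
    then show "nrm M (\<lambda>x. s n x - f x) \<le> e" unfolding nrm_def using e by (intro real_le_lsqrt) auto
  qed
  show thesis
  proof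
    have "sqi M (\<lambda>x. s (N 0) x - f x)" by (rule fat(1)[of 1 "N 0"]) (use N[of 0] in auto)
    from sqi_diff[OF s[of "N 0"] this] show "sqi M f" by simp
    show "(\<lambda>n. nrm M (\<lambda>x. s n x - f x)) \<longlonglongrightarrow> 0"
    proof (rule LIMSEQ_I)
      fix e :: real assume "e > 0"
      then obtain K where "\<And>m m'. m \<ge> K \<Longrightarrow> m' \<ge> K \<Longrightarrow> nrm M (\<lambda>x. s m x - s m' x) < e / 2"
        using C[of "e/2"] by auto
      then have half: "nrm M (\<lambda>x. s n x - f x) \<le> e / 2" if "n \<ge> K" for n
        using fat(2)[of "e/2" K n] \<open>e > 0\<close> that by auto
      have "nrm M (\<lambda>x. s n x - f x) < e" if "n \<ge> K" for n
        by (rule le_less_trans[OF half[OF that]]) (use \<open>e > 0\<close> in simp)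
      then show "\<exists>no. \<forall>n\<ge>no. norm (nrm M (\<lambda>x. s n x - f x) - 0) < e"
        by (intro exI[of _ K]) auto
    qed
  qed
qed

section \<open>Fourier series\<close>

lemma L2_iff_sqi: "f \<in> L2 \<longleftrightarrow> sqi circ_measure f"
  by (simp add: L2_def sqi_def)

lemma l2_norm_eq_nrm: "l2_norm f = nrm circ_measure f"
  by (simp add: l2_norm_def nrm_def)

lemma finite_circ_measure: "finite_measure circ_measure"
  by (rule finite_measure_lebesgue_on) auto

lemma continuous_on_circ_measurable:
  fixes f :: "real \<Rightarrow> 'b :: topological_space"
  shows "continuous_on {0..2*pi} f \<Longrightarrow> f \<in> borel_measurable circ_measure"
  by (rule continuous_imp_measurable_on_sets_lebesgue) auto

lemma measure_circ [simp]: "measure circ_measure {0..2*pi} = 2 * pi"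
  by (simp add: measure_restrict_space)

lemma integrable_circ_bounded:
  fixes f :: "real \<Rightarrow> 'b :: {banach, second_countable_topology}"
  assumes "f \<in> borel_measurable circ_measure" "\<And>t. t \<in> {0..2*pi} \<Longrightarrow> norm (f t) \<le> B"
  shows "integrable circ_measure f" "norm (LINT t|circ_measure. f t) \<le> 2 * pi * B"
proof -
  interpret finite_measure circ_measure by (rule finite_circ_measure)
  show i: "integrable circ_measure f"
    by (rule integrable_const_bound[of _ B]) (use assms in \<open>auto intro!: AE_I2\<close>)
  have "norm (LINT t|circ_measure. f t) \<le> (LINT t|circ_measure. norm (f t))"
    by (rule integral_norm_bound)
  also have "\<dots> \<le> (LINT t|circ_measure. B)"
    by (rule integral_mono) (use i assms in auto)
  finally show "norm (LINT t|circ_measure. f t) \<le> 2 * pi * B" by simp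
qed

lemma nrm_circ_bounded:
  assumes "f \<in> borel_measurable circ_measure" "\<And>t. t \<in> {0..2*pi} \<Longrightarrow> cmod (f t) \<le> B" "B \<ge> 0"
  shows "nrm circ_measure f \<le> sqrt (2 * pi) * B"
proof -
  have "(LINT t|circ_measure. (cmod (f t))\<^sup>2) \<le> 2 * pi * B\<^sup>2"
    using integrable_circ_bounded(2)[of "\<lambda>t. (cmod (f t))\<^sup>2" "B\<^sup>2"] assms by (auto simp: power_mono)
  then have "nrm circ_measure f \<le> sqrt (2 * pi * B\<^sup>2)" unfolding nrm_def by simp
  then show ?thesis using assms(3) by (simp add: real_sqrt_mult)
qed

definition trig :: "int \<Rightarrow> real \<Rightarrow> complex" where
  "trig k t = exp (\<i> * of_int k * complex_of_real t)"

lemma continuous_on_trig [continuous_intros]: "continuous_on A (trig k)"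
  unfolding trig_def by (intro continuous_intros)

lemma trig_measurable [measurable]: "trig k \<in> borel_measurable circ_measure"
  by (rule continuous_on_circ_measurable) (rule continuous_on_trig)

lemma norm_trig [simp]: "cmod (trig k t) = 1"
  by (simp add: trig_def)

lemma trig_0 [simp]: "trig 0 t = 1"
  by (simp add: trig_def)

lemma trig_mult: "trig j t * trig k t = trig (j + k) t"
  by (simp add: trig_def exp_add[symmetric] algebra_simps)

lemma cnj_trig: "cnj (trig k t) = trig (- k) t"
  by (simp add: trig_def exp_cnj)

lemma trig_add: "trig k (s + t) = trig k s * trig k t"
  by (simp add: trig_def exp_add[symmetric] algebra_simps)

lemma trig_2pi [simp]: "trig k (2 * pi) = 1"
  unfolding trig_def using exp_integer_2pi[of "of_int k"] by (simp add: mult_ac)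

lemma trig_has_vector_derivative:
  "(trig k has_vector_derivative (\<i> * of_int k * trig k t)) (at t within A)"
  unfolding trig_def
  by (rule has_vector_derivative_real_field) (auto intro!: derivative_eq_intros simp: algebra_simps)

lemma sqi_trig: "sqi circ_measure (trig k)"
  by (rule sqi_bounded[OF finite_circ_measure, of _ 1]) auto

lemma integral_trig: "(LINT t|circ_measure. trig k t) = (if k = 0 then of_real (2 * pi) else 0)"
proof (cases "k = 0")
  case False
  have "((trig k) has_integral (trig k (2*pi) / (\<i> * of_int k) - trig k 0 / (\<i> * of_int k))) {0..2*pi}"
  proof (rule fundamental_theorem_of_calculus)
    fix t
    have "((\<lambda>t. trig k t / (\<i> * of_int k)) has_vector_derivative (\<i> * of_int k * trig k t) / (\<i> * of_int k)) (at t within {0..2*pi})"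
      by (intro has_vector_derivative_divide trig_has_vector_derivative)
    then show "((\<lambda>t. trig k t / (\<i> * of_int k)) has_vector_derivative trig k t) (at t within {0..2*pi})"
      using False by simp
  qed simp
  moreover have "trig k 0 = 1" by (simp add: trig_def)
  ultimately have "((trig k) has_integral 0) {0..2*pi}" by simp
  moreover have "(trig k has_integral (LINT t|circ_measure. trig k t)) {0..2*pi}"
    by (rule has_integral_integral_lebesgue_on) (auto intro!: continuous_imp_integrable_real continuous_intros)
  ultimately show ?thesis using False has_integral_unique by auto
qed (simp add: scaleR_conv_of_real)

abbreviation sq2pi :: complex where "sq2pi \<equiv> complex_of_real (sqrt (2 * pi))"

lemma sq2pi_sq: "sq2pi * sq2pi = 2 * pi"
  by (simp flip: of_real_mult)

lemma fourier_coeff_trig: "fourier_coeff f k = (LINT t|circ_measure. f t * trig (- k) t) / sq2pi"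
  by (simp add: fourier_coeff_def trig_def)

lemma integrable_mult_trig:
  assumes "integrable circ_measure f"
  shows "integrable circ_measure (\<lambda>t. f t * trig k t)"
  by (rule Bochner_Integration.integrable_bound[OF integrable_norm[OF assms]])
     (use assms in \<open>auto simp: norm_mult\<close>)

lemma sqi_integrable: "sqi circ_measure f \<Longrightarrow> integrable circ_measure f"
  using sqi_mult_integrable[OF _ sqi_trig[of 0]] by simp

text \<open>Divided by \<open>sq2pi\<close> so that, for finite \<open>F\<close>, the numbers
  \<open>c k\<close> are exactly its coefficients in the normalisation of
  \<open>fourier_coeff\<close>.\<close>

definition tpoly :: "int set \<Rightarrow> (int \<Rightarrow> complex) \<Rightarrow> real \<Rightarrow> complex" where
  "tpoly F c t = (\<Sum>k\<in>F. c k * trig k t) / sq2pi"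

lemma tpoly_continuous [continuous_intros]: "continuous_on A (tpoly F c)"
  unfolding tpoly_def by (cases "finite F") (auto intro!: continuous_intros)

lemma sqi_continuous: "continuous_on {0..2*pi} f \<Longrightarrow> sqi circ_measure f"
proof -
  assume c: "continuous_on {0..2*pi} f"
  then have "compact (f ` {0..2*pi})" by (intro compact_continuous_image) auto
  then obtain B where "\<And>t. t \<in> {0..2*pi} \<Longrightarrow> cmod (f t) \<le> B"
    using compact_imp_bounded bounded_iff by (metis imageI)
  then show ?thesis
    by (intro sqi_bounded[OF finite_circ_measure continuous_on_circ_measurable[OF c]]) auto
qed

lemma sqi_tpoly: "sqi circ_measure (tpoly F c)"
  by (rule sqi_continuous) (rule tpoly_continuous)

lemma fourier_coeff_diff:
  assumes "integrable circ_measure f" "integrable circ_measure g"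
  shows "fourier_coeff (\<lambda>t. f t - g t) k = fourier_coeff f k - fourier_coeff g k"
  using assms by (simp add: fourier_coeff_trig left_diff_distrib integrable_mult_trig diff_divide_distrib)

lemma fourier_coeff_add:
  assumes "integrable circ_measure f" "integrable circ_measure g"
  shows "fourier_coeff (\<lambda>t. f t + g t) k = fourier_coeff f k + fourier_coeff g k"
  using assms by (simp add: fourier_coeff_trig ring_distribs integrable_mult_trig add_divide_distrib)

lemma fourier_coeff_cmult: "fourier_coeff (\<lambda>t. c * f t) k = c * fourier_coeff f k"
  by (simp add: fourier_coeff_trig mult.assoc)

lemma fourier_coeff_tpoly:
  assumes "finite F"
  shows "fourier_coeff (tpoly F c) k = (if k \<in> F then c k else 0)"
proof -
  have "(LINT t|circ_measure. tpoly F c t * trig (- k) t)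
      = (LINT t|circ_measure. (\<Sum>j\<in>F. c j / sq2pi * trig (j - k) t))"
    by (simp add: tpoly_def sum_divide_distrib sum_distrib_right trig_mult mult.assoc flip: trig_mult[of _ _ "-k"])
  also have "\<dots> = (\<Sum>j\<in>F. c j / sq2pi * (if j = k then of_real (2 * pi) else 0))"
    by (subst Bochner_Integration.integral_sum) (auto simp: integral_trig sqi_integrable[OF sqi_trig])
  also have "\<dots> = (if k \<in> F then c k / sq2pi * of_real (2 * pi) else 0)"
    using assms by (simp add: if_distrib sum.delta cong: if_cong)
  finally show ?thesis
    using sq2pi_sq by (simp add: fourier_coeff_trig field_simps)
qed

lemma inner_tpoly:
  assumes "integrable circ_measure f"
  shows "(LINT t|circ_measure. f t * cnj (tpoly F c t)) = (\<Sum>k\<in>F. fourier_coeff f k * cnj (c k))"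
proof -
  have "(LINT t|circ_measure. f t * cnj (tpoly F c t))
      = (LINT t|circ_measure. (\<Sum>k\<in>F. (cnj (c k) / sq2pi) * (f t * trig (- k) t)))"
    by (rule Bochner_Integration.integral_cong)
       (auto simp: tpoly_def sum_divide_distrib sum_distrib_left cnj_trig mult_ac)
  also have "\<dots> = (\<Sum>k\<in>F. (cnj (c k) / sq2pi) * (LINT t|circ_measure. f t * trig (- k) t))"
    by (subst Bochner_Integration.integral_sum) (auto simp: integrable_mult_trig[OF assms])
  also have "\<dots> = (\<Sum>k\<in>F. fourier_coeff f k * cnj (c k))"
    by (simp add: fourier_coeff_trig mult_ac)
  finally show ?thesis .
qed

lemma nrm_tpoly:
  assumes "finite F"
  shows "(nrm circ_measure (tpoly F c))\<^sup>2 = (\<Sum>k\<in>F. (cmod (c k))\<^sup>2)"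
proof -
  have "complex_of_real ((nrm circ_measure (tpoly F c))\<^sup>2) = (LINT t|circ_measure. tpoly F c t * cnj (tpoly F c t))"
    unfolding nrm_sq integral_complex_of_real[symmetric] by (simp add: complex_norm_square del: of_real_power)
  also have "\<dots> = (\<Sum>k\<in>F. c k * cnj (c k))"
    by (subst inner_tpoly) (auto simp: sqi_integrable[OF sqi_tpoly] fourier_coeff_tpoly[OF assms])
  also have "\<dots> = complex_of_real (\<Sum>k\<in>F. (cmod (c k))\<^sup>2)"
    by (simp add: complex_norm_square del: of_real_power)
  finally show ?thesis using of_real_eq_iff by blast
qed

text \<open>Pythagoras: \<open>f\<close> paired with its own partial sum gives the same sum of
  squares as the partial sum paired with itself. Bessel's inequality is the nonnegativity of the
  left side.\<close>

lemma nrm_diff_tpoly: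
  assumes "finite F" and f: "sqi circ_measure f"
  shows "(nrm circ_measure (\<lambda>t. f t - tpoly F (fourier_coeff f) t))\<^sup>2
    = (nrm circ_measure f)\<^sup>2 - (\<Sum>k\<in>F. (cmod (fourier_coeff f k))\<^sup>2)"
proof -
  let ?p = "tpoly F (fourier_coeff f)"
  have fi: "integrable circ_measure (\<lambda>t. f t * cnj (?p t))"
    by (intro sqi_mult_integrable f sqi_cnj sqi_tpoly)
  have "(nrm circ_measure (\<lambda>t. f t - ?p t))\<^sup>2
     = (LINT t|circ_measure. (cmod (f t))\<^sup>2 - 2 * Re (f t * cnj (?p t)) + (cmod (?p t))\<^sup>2)"
    unfolding nrm_sq
    by (rule Bochner_Integration.integral_cong) (unfold cmod_power2, auto simp: power2_eq_square algebra_simps)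
  also have "\<dots> = (nrm circ_measure f)\<^sup>2 - 2 * (LINT t|circ_measure. Re (f t * cnj (?p t))) + (nrm circ_measure ?p)\<^sup>2"
  proof -
    have "integrable circ_measure (\<lambda>t. Re (f t * cnj (?p t)))" using fi by (rule integrable_Re)
    moreover have "integrable circ_measure (\<lambda>t. (cmod (f t))\<^sup>2)" using f by (simp add: sqi_def)
    moreover have "integrable circ_measure (\<lambda>t. (cmod (?p t))\<^sup>2)" using sqi_tpoly by (simp add: sqi_def)
    ultimately show ?thesis by (simp add: nrm_sq del: times_complex.sel)
  qed
  also have "(LINT t|circ_measure. Re (f t * cnj (?p t))) = Re (LINT t|circ_measure. f t * cnj (?p t))"
    using integral_Re[OF fi] by simp
  also have "\<dots> = (\<Sum>k\<in>F. (cmod (fourier_coeff f k))\<^sup>2)"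
    by (subst inner_tpoly[OF sqi_integrable[OF f]], unfold cmod_power2) (simp add: power2_eq_square)
  finally show ?thesis using nrm_tpoly[OF assms(1)] by simp
qed

lemma bessel:
  assumes "finite F" "sqi circ_measure f"
  shows "(\<Sum>k\<in>F. (cmod (fourier_coeff f k))\<^sup>2) \<le> (nrm circ_measure f)\<^sup>2"
  using nrm_diff_tpoly[OF assms] zero_le_power2[of "nrm circ_measure (\<lambda>t. f t - tpoly F (fourier_coeff f) t)"] by linarith

lemma sqi_fourier_coeff: "sqi circ_measure f \<Longrightarrow> sqi cZ (fourier_coeff f)"
  by (rule sqi_cZ_bounded(1)[of _ "nrm circ_measure f"]) (auto intro: bessel)

lemma norm_fourier_coeff_le:
  assumes "sqi circ_measure f"
  shows "cmod (fourier_coeff f k) \<le> nrm circ_measure f"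
  using bessel[OF _ assms, of "{k}"] by (auto intro: power2_le_imp_le)

lemma nrm_tail_tendsto:
  assumes "sqi cZ a"
  shows "(\<lambda>n. (nrm cZ a)\<^sup>2 - (\<Sum>k\<in>{- int n..int n}. (cmod (a k))\<^sup>2)) \<longlonglongrightarrow> 0"
proof -
  have "(\<lambda>n. \<Sum>k\<in>{- int n..int n}. (cmod (a k))\<^sup>2) \<longlonglongrightarrow> (nrm cZ a)\<^sup>2"
    unfolding nrm_sq by (rule tendsto_symmetric_sum) (use assms in \<open>simp add: sqi_def\<close>)
  from tendsto_diff[OF tendsto_const[of "(nrm cZ a)\<^sup>2"] this] show ?thesis by simp
qed

text \<open>The difference of two partial sums is again a trigonometric polynomial, and its squared
  norm is a section of the convergent series of squares; completeness supplies the limit.\<close>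

lemma riesz_fischer:
  assumes a: "sqi cZ a"
  obtains f where "sqi circ_measure f" "fourier_coeff f = a"
    "(\<lambda>n. nrm circ_measure (\<lambda>t. tpoly {- int n..int n} a t - f t)) \<longlonglongrightarrow> 0"
proof -
  let ?s = "\<lambda>n. tpoly {- int n..int n} a"
  let ?T = "\<lambda>n. (nrm cZ a)\<^sup>2 - (\<Sum>k\<in>{- int n..int n}. (cmod (a k))\<^sup>2)"
  have mono: "(nrm circ_measure (\<lambda>t. ?s m t - ?s n t))\<^sup>2 \<le> ?T n" if "n \<le> m" for m n
  proof -
    have sub: "{- int n..int n} \<subseteq> {- int m..int m}" using that by auto
    have "(\<lambda>t. ?s m t - ?s n t) = tpoly ({- int m..int m} - {- int n..int n}) a"
      using sub by (auto simp: tpoly_def sum_diff diff_divide_distrib)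
    then have "(nrm circ_measure (\<lambda>t. ?s m t - ?s n t))\<^sup>2
        = (\<Sum>k\<in>{- int m..int m}. (cmod (a k))\<^sup>2) - (\<Sum>k\<in>{- int n..int n}. (cmod (a k))\<^sup>2)"
      using sub by (simp add: nrm_tpoly sum_diff)
    then show ?thesis using sum_le_nrm_cZ[OF a, of "{- int m..int m}"] by simp
  qed
  obtain f where f: "sqi circ_measure f" and lim: "(\<lambda>n. nrm circ_measure (\<lambda>t. ?s n t - f t)) \<longlonglongrightarrow> 0"
  proof (rule sqi_complete[OF finite_circ_measure, of ?s])
    show "sqi circ_measure (?s n)" for n by (rule sqi_tpoly)
    fix e :: real assume e: "e > 0"
    then have "\<forall>\<^sub>F n in sequentially. ?T n < e\<^sup>2"
      using order_tendstoD(2)[OF nrm_tail_tendsto[OF a], of "e\<^sup>2"] by simp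
    then obtain N where N: "\<And>n. n \<ge> N \<Longrightarrow> ?T n < e\<^sup>2" by (auto simp: eventually_sequentially)
    have *: "nrm circ_measure (\<lambda>t. ?s m t - ?s n t) < e" if "n \<ge> N" "m \<ge> n" for m n
      using mono[OF that(2)] N[OF that(1)] e by (intro power2_less_imp_less[of _ e]) auto
    have "nrm circ_measure (\<lambda>t. ?s m t - ?s n t) < e" if "n \<ge> N" "m \<ge> N" for m n
      using *[of n m] *[of m n] that nrm_minus_commute[of circ_measure "?s m" "?s n"] by (cases "m \<ge> n") auto
    then show "\<exists>N. \<forall>m\<ge>N. \<forall>n\<ge>N. nrm circ_measure (\<lambda>t. ?s m t - ?s n t) < e" by blast
  qed
  have "fourier_coeff f k = a k" for k
  proof -
    have "(\<lambda>n. a k - fourier_coeff f k) \<longlonglongrightarrow> 0"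
    proof (rule tendsto_norm_zero_cancel, rule tendsto_sandwich[OF _ _ tendsto_const lim])
      show "\<forall>\<^sub>F n in sequentially. cmod (a k - fourier_coeff f k) \<le> nrm circ_measure (\<lambda>t. ?s n t - f t)"
        unfolding eventually_sequentially
      proof (intro exI[of _ "nat \<bar>k\<bar>"] allI impI)
        fix n assume "nat \<bar>k\<bar> \<le> n"
        then have "k \<in> {- int n..int n}" by auto
        then have "fourier_coeff (\<lambda>t. ?s n t - f t) k = a k - fourier_coeff f k"
          by (subst fourier_coeff_diff) (auto simp: fourier_coeff_tpoly sqi_integrable f sqi_tpoly)
        then show "cmod (a k - fourier_coeff f k) \<le> nrm circ_measure (\<lambda>t. ?s n t - f t)"
          using norm_fourier_coeff_le[OF sqi_diff[OF sqi_tpoly f], of _ a k] by metis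
      qed
    qed simp
    then show ?thesis using LIMSEQ_unique[OF tendsto_const] by fastforce
  qed
  with f lim that show thesis by blast
qed

section \<open>Uniqueness of Fourier coefficients\<close>

text \<open>A real linear function of \<open>cis t\<close> is a combination of \<open>trig 1\<close>
  and \<open>trig (-1)\<close>, so multiplying by it shifts frequencies by one and preserves
  orthogonality to all exponentials. Keeping \<open>f\<close> arbitrary makes the product case two
  successive uses of the induction hypotheses.\<close>

lemma integral_mult_polynomial_cis:
  assumes "real_polynomial_function p" "integrable circ_measure f"
    and "\<And>k. (LINT t|circ_measure. f t * trig k t) = 0"
  shows "integrable circ_measure (\<lambda>t. f t * of_real (p (cis t))) \<and>
    (\<forall>k. (LINT t|circ_measure. (f t * of_real (p (cis t))) * trig k t) = 0)"
  using assms
proof (induction p arbitrary: f rule: real_polynomial_function.induct)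
  case (linear l)
  let ?a = "complex_of_real (l 1)" and ?b = "complex_of_real (l \<i>)"
  have lc: "complex_of_real (l (cis t)) = (?a / 2 - \<i> * ?b / 2) * trig 1 t + (?a / 2 + \<i> * ?b / 2) * trig (-1) t" for t
  proof -
    interpret bounded_linear l by fact
    have "cis t = cos t *\<^sub>R 1 + sin t *\<^sub>R \<i>" by (auto simp: complex_eq_iff)
    then have "l (cis t) = cos t * l 1 + sin t * l \<i>" by (simp add: add scaleR)
    moreover have "trig 1 t = cos t + \<i> * sin t" "trig (-1) t = cos t - \<i> * sin t"
      using cis_conv_exp[of t] cis_conv_exp[of "- t"] by (simp_all add: trig_def complex_eq_iff)
    ultimately show ?thesis by (simp add: complex_eq_iff algebra_simps)
  qed
  then have eq: "f t * complex_of_real (l (cis t))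
      = (?a / 2 - \<i> * ?b / 2) * (f t * trig 1 t) + (?a / 2 + \<i> * ?b / 2) * (f t * trig (-1) t)" for t
    unfolding lc by (simp add: algebra_simps)
  have i: "integrable circ_measure (\<lambda>t. f t * complex_of_real (l (cis t)))"
    unfolding eq using linear by (intro Bochner_Integration.integrable_add integrable_mult_right integrable_mult_trig)
  have "(LINT t|circ_measure. (f t * complex_of_real (l (cis t))) * trig k t) = 0" for k
  proof -
    have "(f t * complex_of_real (l (cis t))) * trig k t
      = (?a / 2 - \<i> * ?b / 2) * (f t * trig (1 + k) t) + (?a / 2 + \<i> * ?b / 2) * (f t * trig (-1 + k) t)" for t
      unfolding eq trig_mult[symmetric] by (simp add: algebra_simps)
    then show ?thesis using linear by (simp add: integrable_mult_trig)
  qed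
  with i show ?case by blast
next
  case (const c)
  have *: "(\<lambda>t. (f t * complex_of_real c) * trig k t) = (\<lambda>t. complex_of_real c * (f t * trig k t))" for k
    by (simp add: fun_eq_iff)
  show ?case unfolding * using const by simp
next
  case (add p q)
  have "f t * complex_of_real (p (cis t) + q (cis t)) = f t * of_real (p (cis t)) + f t * of_real (q (cis t))" for t
    by (simp add: algebra_simps)
  moreover have "integrable circ_measure (\<lambda>t. f t * of_real (p (cis t)))" "integrable circ_measure (\<lambda>t. f t * of_real (q (cis t)))"
    using add by auto
  ultimately show ?case using add by (simp add: ring_distribs integrable_mult_trig)
next
  case (mult p q)
  from mult.IH(1)[OF mult.prems] have "integrable circ_measure (\<lambda>t. f t * of_real (p (cis t)))"
    "\<And>k. (LINT t|circ_measure. (f t * of_real (p (cis t))) * trig k t) = 0" by auto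
  from mult.IH(2)[OF this] show ?case by (simp add: mult.assoc)
qed

lemma integral_mult_periodic_continuous:
  assumes f: "integrable circ_measure f" and z: "\<And>k. (LINT t|circ_measure. f t * trig k t) = 0"
    and g: "continuous_on {0..2*pi} g" "g 0 = g (2 * pi)"
  shows "(LINT t|circ_measure. f t * g t) = (0::complex)"
proof -
  \<comment> \<open>\<open>g\<close> is transplanted to the unit circle for Stone-Weierstrass.
    \<open>Arg2pi\<close> jumps at 1, so continuity of \<open>G\<close> is read off from its graph,
    a continuous image of a compact interval; \<open>g 0 = g (2 * pi)\<close> makes that image a
    graph.\<close>
  define G where "G z = g (Arg2pi z)" for z
  have Gcis: "G (cis t) = g t" if "t \<in> {0..2*pi}" for t
  proof (cases "t = 2 * pi")
    case False
    then have "Arg2pi (cis t) = t" using that by (intro Arg2pi_unique[of 1]) (auto simp: cis_conv_exp)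
    then show ?thesis by (simp add: G_def)
  next
    case True
    have "Arg2pi 1 = 0" by (rule Arg2pi_unique[of 1]) auto
    then show ?thesis using True g by (simp add: G_def)
  qed
  have sph: "sphere 0 1 = cis ` {0..2*pi}"
  proof
    show "sphere 0 1 \<subseteq> cis ` {0..2*pi}"
    proof
      fix z :: complex assume "z \<in> sphere 0 1"
      then have "z = cis (Arg2pi z)" using Arg2pi_eq[of z] by (simp add: cis_conv_exp)
      then show "z \<in> cis ` {0..2*pi}"
        using Arg2pi_ge_0[of z] Arg2pi_lt_2pi[of z] by (intro image_eqI[of _ _ "Arg2pi z"]) auto
    qed
  qed auto
  have "(\<lambda>x. (x, G x)) ` sphere 0 1 = (\<lambda>t. (cis t, g t)) ` {0..2*pi}"
    unfolding sph using Gcis by (force simp: image_image)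
  moreover have "compact ((\<lambda>t. (cis t, g t)) ` {0..2*pi})"
    by (intro compact_continuous_image continuous_intros g) auto
  ultimately have clo: "closed ((\<lambda>x. (x, G x)) ` sphere 0 1)" by (simp add: compact_imp_closed)
  have "compact (g ` {0..2*pi})" by (intro compact_continuous_image g) auto
  moreover have "G \<in> sphere 0 1 \<rightarrow> g ` {0..2*pi}" unfolding sph using Gcis by auto
  ultimately have cG: "continuous_on (sphere 0 1) G" using clo by (rule continuous_from_closed_graph)
  define A where "A = (LINT t|circ_measure. cmod (f t))"
  have A0: "A \<ge> 0" unfolding A_def by (auto intro: integral_nonneg_AE)
  have main: "cmod (LINT t|circ_measure. f t * g t) \<le> e * A" if e: "e > 0" for e
  proof -
    obtain P where P: "polynomial_function P" "\<And>x. x \<in> sphere 0 1 \<Longrightarrow> cmod (G x - P x) < e"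
      using Stone_Weierstrass_polynomial_function[OF compact_sphere cG e] by auto
    have re: "real_polynomial_function (\<lambda>x. Re (P x))" and im: "real_polynomial_function (\<lambda>x. Im (P x))"
      using P(1) bounded_linear_Re bounded_linear_Im unfolding polynomial_function_def by (auto simp: o_def)
    have cP: "continuous_on A P" for A by (rule continuous_on_polymonial_function[OF P(1)])
    have dec: "f t * P (cis t) = f t * of_real (Re (P (cis t))) + \<i> * (f t * of_real (Im (P (cis t))))" for t
      by (simp add: complex_eq_iff algebra_simps)
    have ir: "integrable circ_measure (\<lambda>t. f t * of_real (Re (P (cis t))))"
      and ii: "integrable circ_measure (\<lambda>t. f t * of_real (Im (P (cis t))))"
      using integral_mult_polynomial_cis[OF re f z] integral_mult_polynomial_cis[OF im f z] by auto
    have Pz: "(LINT t|circ_measure. f t * P (cis t)) = 0"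
    proof -
      have "(LINT t|circ_measure. f t * of_real (Re (P (cis t)))) = 0"
        using integral_mult_polynomial_cis[OF re f z, THEN conjunct2, THEN spec, of 0] by simp
      moreover have "(LINT t|circ_measure. f t * of_real (Im (P (cis t)))) = 0"
        using integral_mult_polynomial_cis[OF im f z, THEN conjunct2, THEN spec, of 0] by simp
      ultimately show ?thesis unfolding dec using ir ii by simp
    qed
    have iP: "integrable circ_measure (\<lambda>t. f t * P (cis t))" unfolding dec using ir ii by simp
    have gm: "g \<in> borel_measurable circ_measure" using g by (intro continuous_on_circ_measurable)
    obtain B where B: "\<And>t. t \<in> {0..2*pi} \<Longrightarrow> cmod (g t) \<le> B"
      using \<open>compact (g ` {0..2*pi})\<close> compact_imp_bounded bounded_iff by (metis imageI)
    have ig: "integrable circ_measure (\<lambda>t. f t * g t)"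
    proof (rule Bochner_Integration.integrable_bound)
      show "integrable circ_measure (\<lambda>t. B * cmod (f t))" using f by simp
      show "(\<lambda>t. f t * g t) \<in> borel_measurable circ_measure" using f gm by simp
      show "AE t in circ_measure. cmod (f t * g t) \<le> norm (B * cmod (f t))"
      proof (rule AE_I2)
        fix t assume "t \<in> space circ_measure"
        then have "cmod (g t) * cmod (f t) \<le> \<bar>B\<bar> * cmod (f t)" using B[of t] by (intro mult_right_mono) auto
        then show "cmod (f t * g t) \<le> norm (B * cmod (f t))" by (simp add: norm_mult abs_mult mult.commute)
      qed
    qed
    have "(LINT t|circ_measure. f t * g t) = (LINT t|circ_measure. f t * g t - f t * P (cis t))"
      using Pz ig iP by simp
    also have "cmod \<dots> \<le> (LINT t|circ_measure. cmod (f t * g t - f t * P (cis t)))"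
      by (rule integral_norm_bound)
    also have "\<dots> \<le> (LINT t|circ_measure. e * cmod (f t))"
    proof (rule integral_mono)
      fix t assume "t \<in> space circ_measure"
      then have "cmod (g t - P (cis t)) \<le> e" using P(2)[of "cis t"] Gcis[of t] by auto
      then have "cmod (f t) * cmod (g t - P (cis t)) \<le> cmod (f t) * e" by (rule mult_left_mono) simp
      then show "cmod (f t * g t - f t * P (cis t)) \<le> e * cmod (f t)"
        by (simp add: norm_mult flip: right_diff_distrib) (simp add: mult.commute)
    qed (use ig iP f in auto)
    finally show ?thesis using f by (simp add: A_def)
  qed
  have "cmod (LINT t|circ_measure. f t * g t) \<le> 0 + e" if "e > 0" for e
  proof -
    \<comment> \<open>Dividing by \<open>A + 1\<close> instead of \<open>A\<close> covers the case
      \<open>A = 0\<close>.\<close>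
    have "cmod (LINT t|circ_measure. f t * g t) \<le> e / (A + 1) * A"
      by (rule main) (use that A0 in simp)
    also have "\<dots> \<le> e" using that A0 by (simp add: field_simps)
    finally show ?thesis by simp
  qed
  then have "cmod (LINT t|circ_measure. f t * g t) \<le> 0" by (rule field_le_epsilon)
  then show ?thesis by simp
qed

text \<open>Orthogonality to periodic continuous functions passes, by dominated convergence, to
  their bounded almost everywhere limits. The conjugate of \<open>sgn (f t)\<close> is such a limit,
  and pairing \<open>f\<close> with it gives the integral of its modulus.\<close>

lemma fourier_uniqueness:
  assumes f: "integrable circ_measure f" and z: "\<And>k. fourier_coeff f k = 0"
  shows "AE t in circ_measure. f t = 0"
proof -
  have z': "(LINT t|circ_measure. f t * trig k t) = 0" for k
    using z[of "-k"] by (simp add: fourier_coeff_trig)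
  have fm [measurable]: "f \<in> borel_measurable circ_measure" using f by simp
  define h where "h t = cnj (sgn (f t))" for t
  have "(\<lambda>t. sgn (f t)) \<in> borel_measurable circ_measure" unfolding sgn_div_norm by measurable
  then have hm: "h \<in> borel_measurable circ_measure" unfolding h_def
    by (intro borel_measurable_continuous_on[where f=cnj] continuous_intros)
  then have "h measurable_on {0..2*pi}" by (subst measurable_on_iff_borel_measurable) auto
  then obtain N g where N: "negligible N" and g: "\<And>n. continuous_on UNIV (g n)"
    and lim: "\<And>t. t \<notin> N \<Longrightarrow> (\<lambda>n. g n t) \<longlonglongrightarrow> (if t \<in> {0..2*pi} then h t else 0)"
    unfolding measurable_on_def by auto
  \<comment> \<open>The first factor retracts the approximants \<open>g n\<close> to the unit disc,
    which provides the majorant; the second vanishes at both ends of the interval, which makes them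
    periodic, and is eventually 1 at every interior point.\<close>
  define G where "G n t = g n t / of_real (max 1 (cmod (g n t))) * of_real (min 1 (real n * (t * (2 * pi - t))))" for n :: nat and t
  have cG: "continuous_on {0..2*pi} (G n)" for n
    unfolding G_def
    by (intro continuous_intros continuous_on_subset[OF g]) auto
  have G0: "G n 0 = G n (2*pi)" for n by (simp add: G_def)
  have bd: "cmod (G n t) \<le> 1" if "t \<in> {0..2*pi}" for n t
  proof -
    have "0 \<le> real n * (t * (2 * pi - t))" using that by auto
    then have "\<bar>min 1 (real n * (t * (2 * pi - t)))\<bar> \<le> 1" by auto
    moreover have "cmod (g n t) / max 1 (cmod (g n t)) \<le> 1" by (simp add: field_simps)
    ultimately show ?thesis unfolding G_def norm_mult norm_divide norm_of_real
      by (intro mult_le_one) auto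
  qed
  have Gl: "(\<lambda>n. G n t) \<longlonglongrightarrow> h t" if t: "t \<in> {0..2*pi}" "t \<notin> N \<union> {0, 2*pi}" for t
  proof -
    have gl: "(\<lambda>n. g n t) \<longlonglongrightarrow> h t" using lim[of t] t by simp
    then have "(\<lambda>n. g n t / of_real (max 1 (cmod (g n t)))) \<longlonglongrightarrow> h t / of_real (max 1 (cmod (h t)))"
      by (intro tendsto_intros) auto
    moreover have "max 1 (cmod (h t)) = 1" by (simp add: h_def norm_sgn)
    moreover have "(\<lambda>n. complex_of_real (min 1 (real n * (t * (2 * pi - t))))) \<longlonglongrightarrow> of_real 1"
    proof (intro tendsto_of_real tendsto_eventually)
      have p: "t * (2 * pi - t) > 0" using t by auto
      obtain n0 :: nat where n0: "1 / (t * (2 * pi - t)) < n0" using reals_Archimedean2 by blast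
      show "\<forall>\<^sub>F n in sequentially. min 1 (real n * (t * (2 * pi - t))) = 1"
        unfolding eventually_sequentially
      proof (intro exI[of _ n0] allI impI)
        fix n assume "n0 \<le> n"
        then have "1 / (t * (2 * pi - t)) \<le> n" using n0 by linarith
        then have "1 \<le> real n * (t * (2 * pi - t))" using p by (simp add: field_simps)
        then show "min 1 (real n * (t * (2 * pi - t))) = 1" by simp
      qed
    qed
    ultimately show ?thesis unfolding G_def using tendsto_mult by fastforce
  qed
  have "(\<lambda>n. LINT t|circ_measure. f t * G n t) \<longlonglongrightarrow> (LINT t|circ_measure. f t * h t)"
  proof (rule integral_dominated_convergence)
    show "(\<lambda>t. f t * h t) \<in> borel_measurable circ_measure" using hm by measurable
    show "(\<lambda>t. f t * G n t) \<in> borel_measurable circ_measure" for n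
      using continuous_on_circ_measurable[OF cG] by measurable
    show "integrable circ_measure (\<lambda>t. cmod (f t))" using f by simp
    show "AE t in circ_measure. cmod (f t * G n t) \<le> cmod (f t)" for n
      by (intro AE_I2) (use bd in \<open>auto simp: norm_mult intro!: mult_right_le_one_le\<close>)
    have "negligible (N \<union> {0, 2*pi})" using N by auto
    then have "AE t in lebesgue. t \<notin> N \<union> {0, 2*pi}"
      unfolding negligible_iff_null_sets by (rule AE_not_in)
    then have "AE t in circ_measure. t \<notin> N \<union> {0, 2*pi}"
      by (subst AE_restrict_space_iff) auto
    then show "AE t in circ_measure. (\<lambda>n. f t * G n t) \<longlonglongrightarrow> f t * h t"
      using AE_space
    proof eventually_elim
      case (elim t)
      then show ?case by (intro tendsto_mult tendsto_const Gl) auto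
    qed
  qed
  then have "(LINT t|circ_measure. f t * h t) = 0"
    using integral_mult_periodic_continuous[OF f z' cG G0] LIMSEQ_unique[OF tendsto_const] by fastforce
  moreover have "f t * h t = of_real (cmod (f t))" for t
    unfolding h_def sgn_div_norm using complex_norm_square[of "f t"]
    by (cases "f t = 0") (simp_all add: field_simps power2_eq_square scaleR_conv_of_real)
  ultimately have "(LINT t|circ_measure. cmod (f t)) = 0" by simp
  then have "AE t in circ_measure. cmod (f t) = 0"
    using integral_nonneg_eq_0_iff_AE[of circ_measure "\<lambda>t. cmod (f t)"] f by auto
  then show ?thesis by simp
qed

lemma fourier_eq_AE:
  assumes "sqi circ_measure f" "sqi circ_measure g" "fourier_coeff f = fourier_coeff g"
  shows "AE t in circ_measure. f t = g t"
proof -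
  have "AE t in circ_measure. f t - g t = 0"
    by (rule fourier_uniqueness) (use assms in \<open>auto simp: sqi_integrable fourier_coeff_diff\<close>)
  then show ?thesis by simp
qed

text \<open>Riesz-Fischer gives a limit of the partial sums with the same coefficients as
  \<open>f\<close>, and uniqueness identifies it with \<open>f\<close>.\<close>

lemma parseval_tendsto:
  assumes f: "sqi circ_measure f"
  shows "nrm circ_measure f = nrm cZ (fourier_coeff f)"
    "(\<lambda>n. nrm circ_measure (\<lambda>t. tpoly {- int n..int n} (fourier_coeff f) t - f t)) \<longlonglongrightarrow> 0"
proof -
  let ?s = "\<lambda>n. tpoly {- int n..int n} (fourier_coeff f)"
  obtain g where g: "sqi circ_measure g" "fourier_coeff g = fourier_coeff f"
     and lim: "(\<lambda>n. nrm circ_measure (\<lambda>t. ?s n t - g t)) \<longlonglongrightarrow> 0"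
    by (rule riesz_fischer[OF sqi_fourier_coeff[OF f]]) (rule that)
  have "AE t in circ_measure. g t = f t" using fourier_eq_AE[OF g(1) f g(2)] .
  then have "nrm circ_measure (\<lambda>t. ?s n t - g t) = nrm circ_measure (\<lambda>t. ?s n t - f t)" for n
    using f g(1) sqi_tpoly by (intro nrm_cong_AE sqi_measurable sqi_diff) auto
  then show lim': "(\<lambda>n. nrm circ_measure (\<lambda>t. ?s n t - f t)) \<longlonglongrightarrow> 0" using lim by simp
  have "(\<lambda>n. (nrm circ_measure (\<lambda>t. ?s n t - f t))\<^sup>2) \<longlonglongrightarrow> 0\<^sup>2" by (intro tendsto_intros lim')
  then have "(\<lambda>n. (nrm circ_measure f)\<^sup>2 - (\<Sum>k\<in>{- int n..int n}. (cmod (fourier_coeff f k))\<^sup>2)) \<longlonglongrightarrow> 0"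
    using nrm_diff_tpoly[OF _ f] by (simp add: nrm_minus_commute[of _ _ f])
  from tendsto_diff[OF this nrm_tail_tendsto[OF sqi_fourier_coeff[OF f]]]
  have "(nrm circ_measure f)\<^sup>2 - (nrm cZ (fourier_coeff f))\<^sup>2 = 0"
    using LIMSEQ_unique[OF tendsto_const] by fastforce
  then have "(nrm circ_measure f)\<^sup>2 = (nrm cZ (fourier_coeff f))\<^sup>2" by linarith
  then show "nrm circ_measure f = nrm cZ (fourier_coeff f)"
    by (rule power2_eq_imp_eq) (rule nrm_nonneg)+
qed

section \<open>Logarithmic kernels\<close>

lemma has_bochner_integral_lebesgue_on_shift:
  fixes f :: "real \<Rightarrow> 'b :: euclidean_space"
  shows "has_bochner_integral (lebesgue_on {a + c..b + c}) f i \<longleftrightarrow>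
    has_bochner_integral (lebesgue_on {a..b}) (\<lambda>t. f (t + c)) i"
proof -
  have "has_bochner_integral (lebesgue_on {a + c..b + c}) f i \<longleftrightarrow>
      has_bochner_integral lebesgue (\<lambda>t. indicator {a + c..b + c} t *\<^sub>R f t) i"
    by (rule has_bochner_integral_restrict_space) simp
  also have "\<dots> \<longleftrightarrow> has_bochner_integral lebesgue (\<lambda>t. indicator {a + c..b + c} (c + 1 * t) *\<^sub>R f (c + 1 * t)) (i /\<^sub>R \<bar>1\<bar>)"
    by (rule has_bochner_integral_lebesgue_real_affine_iff) simp
  also have "(\<lambda>t. indicator {a + c..b + c} (c + 1 * t) *\<^sub>R f (c + 1 * t)) = (\<lambda>t. indicator {a..b} t *\<^sub>R f (t + c))"
    by (auto simp: fun_eq_iff indicator_def add.commute)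
  also have "has_bochner_integral lebesgue (\<lambda>t. indicator {a..b} t *\<^sub>R f (t + c)) (i /\<^sub>R \<bar>1\<bar>) \<longleftrightarrow>
      has_bochner_integral (lebesgue_on {a..b}) (\<lambda>t. f (t + c)) i"
    by (subst has_bochner_integral_restrict_space) auto
  finally show ?thesis .
qed

lemma integrable_lebesgue_on_subset:
  fixes f :: "real \<Rightarrow> 'b :: euclidean_space"
  assumes "integrable (lebesgue_on {a..b}) f" "a \<le> c" "d \<le> b"
  shows "integrable (lebesgue_on {c..d}) f"
proof -
  have "set_integrable lebesgue {a..b} f"
    using assms(1) by (simp add: integrable_restrict_space set_integrable_def)
  then have "set_integrable lebesgue {c..d} f"
    by (rule set_integrable_subset) (use assms in auto)
  then show ?thesis by (simp add: integrable_restrict_space set_integrable_def)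
qed

lemma periodic_int:
  assumes "\<And>t. f (t + 2 * pi) = f t"
  shows "f (t + 2 * pi * of_int n) = f t"
proof -
  have nat: "f (t + 2 * pi * real m) = f t" for m t
    using assms[of "t + 2 * pi * real m" for m] by (induction m) (simp_all add: algebra_simps)
  show ?thesis
  proof (cases "n \<ge> 0")
    case True
    then show ?thesis using nat[of t "nat n"] by simp
  next
    case False
    then show ?thesis using nat[of "t + 2 * pi * of_int n" "nat (- n)"] by simp
  qed
qed

text \<open>For a shift within one period, the piece over \<open>{0..a}\<close> is moved by a period
  to the right end; a general shift is first reduced modulo \<open>2 * pi\<close>.\<close>

lemma has_bochner_integral_periodic_interval:
  fixes f :: "real \<Rightarrow> 'b :: euclidean_space"
  assumes f: "integrable circ_measure f" and per: "\<And>t. f (t + 2 * pi) = f t"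
  shows "has_bochner_integral circ_measure (\<lambda>t. f (t + a)) (LINT t|circ_measure. f t)"
    "has_bochner_integral (lebesgue_on {a..a + 2 * pi}) f (LINT t|circ_measure. f t)"
proof -
  have main: "has_bochner_integral circ_measure (\<lambda>t. f (t + a)) (LINT t|circ_measure. f t)"
    if a: "0 \<le> a" "a \<le> 2 * pi" for a
  proof -
    let ?i = "integral\<^sup>L (lebesgue_on {0..a}) f" and ?j = "integral\<^sup>L (lebesgue_on {a..2 * pi}) f"
    have i: "has_bochner_integral (lebesgue_on {0..a}) f ?i" and j: "has_bochner_integral (lebesgue_on {a..2*pi}) f ?j"
      using integrable_lebesgue_on_subset[OF f] a by (auto simp: has_bochner_integral_iff)
    have ij: "?i + ?j = (LINT t|circ_measure. f t)"
      using has_bochner_integral_combine[OF a i j] by (simp add: has_bochner_integral_iff)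
    have "has_bochner_integral (lebesgue_on {0..a}) (\<lambda>t. f (t + 2 * pi)) ?i" using i by (simp add: per)
    then have i': "has_bochner_integral (lebesgue_on {2 * pi..a + 2 * pi}) f ?i"
      using has_bochner_integral_lebesgue_on_shift[of 0 "2 * pi" a f ?i] by simp
    have "has_bochner_integral (lebesgue_on {a..a + 2 * pi}) f (?j + ?i)"
      using a by (intro has_bochner_integral_combine[OF _ _ j i']) auto
    then have "has_bochner_integral (lebesgue_on {0 + a..2 * pi + a}) f (LINT t|circ_measure. f t)"
      unfolding ij[symmetric] by (simp add: add.commute)
    then show ?thesis by (subst (asm) has_bochner_integral_lebesgue_on_shift)
  qed
  define n where "n = \<lfloor>a / (2 * pi)\<rfloor>"
  define a' where "a' = a - 2 * pi * of_int n"
  have "0 \<le> a'" "a' \<le> 2 * pi"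
    using floor_divide_lower[of "2 * pi" a] floor_divide_upper[of "2 * pi" a]
    by (auto simp: a'_def n_def algebra_simps)
  then have "has_bochner_integral circ_measure (\<lambda>t. f (t + a')) (LINT t|circ_measure. f t)" by (rule main)
  also have "(\<lambda>t. f (t + a')) = (\<lambda>t. f (t + a))"
  proof
    show "f (t + a') = f (t + a)" for t
      using periodic_int[of f "t + a'" n, OF per] by (simp add: a'_def algebra_simps)
  qed
  finally show "has_bochner_integral circ_measure (\<lambda>t. f (t + a)) (LINT t|circ_measure. f t)" .
  then have "has_bochner_integral (lebesgue_on {0 + a..2 * pi + a}) f (LINT t|circ_measure. f t)"
    by (subst has_bochner_integral_lebesgue_on_shift)
  then show "has_bochner_integral (lebesgue_on {a..a + 2 * pi}) f (LINT t|circ_measure. f t)"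
    by (simp add: add.commute)
qed

lemmas periodic_shift = has_bochner_integral_periodic_interval(1)[unfolded has_bochner_integral_iff]
lemma AE_circ_countable:
  assumes "countable A"
  shows "AE t in circ_measure. t \<notin> A"
proof -
  have "A \<in> null_sets lborel" using assms by (rule countable_imp_null_set_lborel)
  then have "A \<in> null_sets lebesgue" by (rule null_sets_completionI)
  then have "AE t in lebesgue. t \<notin> A" by (rule AE_not_in)
  then show ?thesis by (subst AE_restrict_space_iff) auto
qed

lemma countable_sin_half_zeros: "countable {t::real. sin ((t - a) / 2) = 0}"
proof (rule countable_subset)
  show "{t. sin ((t - a) / 2) = 0} \<subseteq> range (\<lambda>n::int. a + 2 * pi * of_int n)"
  proof
    fix t assume "t \<in> {t::real. sin ((t - a) / 2) = 0}"
    then obtain n :: int where "(t - a) / 2 = of_int n * pi" by (auto simp: sin_zero_iff_int2)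
    then have "t = a + 2 * pi * of_int n" by (simp add: field_simps)
    then show "t \<in> range (\<lambda>n::int. a + 2 * pi * of_int n)" by blast
  qed
qed auto

lemma AE_sin_half_nonzero: "AE t in circ_measure. sin ((t - a) / 2) \<noteq> 0"
  using AE_circ_countable[OF countable_sin_half_zeros[of a]] by simp

text \<open>The model singularity: \<open>ln (cmod (1 - trig 1 t))\<close> is
  \<open>ln 2 + lsin t\<close> wherever the sine does not vanish.\<close>

definition lsin :: "real \<Rightarrow> real" where "lsin t = ln \<bar>sin (t / 2)\<bar>"

lemma lsin_periodic: "lsin (t + 2 * pi) = lsin t"
  by (simp add: lsin_def add_divide_distrib)

lemma borel_measurable_lsin [measurable]: "lsin \<in> borel_measurable borel"
  unfolding lsin_def by measurable

lemma borel_imp_circ_measurable: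
  assumes "f \<in> borel_measurable borel"
  shows "f \<in> borel_measurable circ_measure"
proof -
  have "f \<in> borel_measurable lebesgue" using measurable_completion assms by (metis measurable_lborel2)
  then show ?thesis by (rule measurable_restrict_space1)
qed

text \<open>Jordan's inequality: the concave sine lies above its secant from 0 to
  \<open>pi / 2\<close>.\<close>

lemma sin_ge_linear:
  assumes "0 \<le> x" "x \<le> pi / 2"
  shows "sin x \<ge> 2 * x / pi"
proof -
  have "convex_on {0..pi} (\<lambda>x. - sin x)"
    by (rule f''_ge0_imp_convex[where f' = "\<lambda>x. - cos x" and f'' = sin])
       (auto intro!: derivative_eq_intros sin_ge_zero)
  then have "- sin ((1 - 2 * x / pi) *\<^sub>R 0 + (2 * x / pi) *\<^sub>R (pi / 2)) \<le> (1 - 2 * x / pi) * (- sin 0) + (2 * x / pi) * (- sin (pi / 2))"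
    using assms by (intro convex_onD) (auto simp: field_simps)
  then show ?thesis by simp
qed

text \<open>Apply \<open>ln x \<le> x - 1\<close> to \<open>x = y powr (- 1 / 4)\<close>; the
  exponent is chosen so that the square of the bound is still integrable at 0.\<close>

lemma ln_sq_le:
  assumes "0 < y" "y \<le> (1::real)"
  shows "(ln y)\<^sup>2 \<le> 16 * y powr (- 1 / 2)"
proof -
  have "- ln y = 4 * ln (y powr (- 1 / 4))" using assms by (simp add: ln_powr)
  also have "\<dots> \<le> 4 * y powr (- 1 / 4)" using assms ln_le_minus_one[of "y powr (- 1 / 4)"] by simp
  finally have "\<bar>ln y\<bar> \<le> 4 * y powr (- 1 / 4)" using assms ln_le_zero_iff[of y] by simp
  then have "\<bar>ln y\<bar>\<^sup>2 \<le> (4 * y powr (- 1 / 4))\<^sup>2" by (intro power_mono) auto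
  also have "(4 * y powr (- 1 / 4))\<^sup>2 = 16 * (y powr (- 1 / 4) * y powr (- 1 / 4))" by (simp add: power2_eq_square)
  also have "\<dots> = 16 * y powr (- 1 / 2)" by (simp flip: powr_add)
  finally show ?thesis by simp
qed

text \<open>The singularities at 0 and \<open>2 * pi\<close> are compared with
  \<open>t powr (- 1 / 2)\<close> and its reflection. In \<open>key\<close>, \<open>u\<close> is the
  distance to the nearer endpoint, and Jordan's inequality gives
  \<open>u / pi \<le> sin (t / 2)\<close>.\<close>

lemma lsin_sq_integrable: "integrable circ_measure (\<lambda>t. (lsin t)\<^sup>2)"
proof -
  let ?b = "\<lambda>t::real. t powr (- 1 / 2)"
  let ?D = "16 * pi powr (1 / 2)"
  have "?b absolutely_integrable_on {0..2*pi}"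
    by (subst absolutely_integrable_on_iff_nonneg) (auto intro!: integrable_on_powr_from_0)
  then have b1: "integrable circ_measure ?b" by (rule absolutely_integrable_imp_integrable) auto
  have "integrable (lebesgue_on {- (2 * pi)..- 0}) (\<lambda>t. ?b (- t))"
    using b1 integrable_reflect_real[where f = ?b and a = 0 and b = "2 * pi"] by simp
  then have b2: "integrable circ_measure (\<lambda>t. ?b (2 * pi - t))"
    using has_bochner_integral_lebesgue_on_shift[of 0 "- (2 * pi)" "2 * pi" "\<lambda>t. ?b (- t)"]
    by (auto simp: integrable.simps)
  show ?thesis
  proof (rule Bochner_Integration.integrable_bound)
    show "integrable circ_measure (\<lambda>t. ?D * (?b t + ?b (2 * pi - t)))" using b1 b2 by auto
    show "(\<lambda>t. (lsin t)\<^sup>2) \<in> borel_measurable circ_measure" by (rule borel_imp_circ_measurable) measurable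
    have "AE t in circ_measure. t \<notin> {0, 2*pi}" by (rule AE_circ_countable) simp
    then show "AE t in circ_measure. norm ((lsin t)\<^sup>2) \<le> norm (?D * (?b t + ?b (2 * pi - t)))"
      using AE_space
    proof eventually_elim
      case (elim t)
      then have t: "0 < t" "t < 2 * pi" by auto
      have key: "(lsin t)\<^sup>2 \<le> ?D * ?b u" if u: "0 < u" "u \<le> pi" "sin (t / 2) = sin (u / 2)" for u
      proof -
        have s: "sin (t / 2) \<ge> u / pi" using sin_ge_linear[of "u / 2"] u by simp
        have sp: "sin (t / 2) > 0" using s u by (meson divide_pos_pos less_le_trans pi_gt_zero)
        have "(lsin t)\<^sup>2 \<le> 16 * (sin (t / 2)) powr (- 1 / 2)"
          using ln_sq_le[OF sp] sp by (simp add: lsin_def)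
        also have "\<dots> \<le> 16 * (u / pi) powr (- 1 / 2)"
          using s u by (intro mult_left_mono powr_mono2') auto
        also have "\<dots> = ?D * ?b u" using u by (simp add: powr_divide powr_minus field_simps)
        finally show ?thesis .
      qed
      have "(lsin t)\<^sup>2 \<le> ?D * ?b t \<or> (lsin t)\<^sup>2 \<le> ?D * ?b (2 * pi - t)"
      proof (cases "t \<le> pi")
        case True
        then show ?thesis using key[of t] t by simp
      next
        case False
        have "sin (t / 2) = sin ((2 * pi - t) / 2)" by (simp add: diff_divide_distrib sin_diff)
        then show ?thesis using key[of "2 * pi - t"] t False by simp
      qed
      moreover have "?D * ?b t \<ge> 0" "?D * ?b (2 * pi - t) \<ge> 0" by auto
      ultimately have "(lsin t)\<^sup>2 \<le> ?D * ?b t + ?D * ?b (2 * pi - t)" by linarith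
      then show ?case by (simp add: ring_distribs)
    qed
  qed
qed

lemma sqi_lsin_shift:
  "sqi circ_measure (\<lambda>t. of_real (lsin (t - a)))"
  "nrm circ_measure (\<lambda>t. of_real (lsin (t - a))) = nrm circ_measure (\<lambda>t. of_real (lsin t))"
  "integrable circ_measure (\<lambda>t. lsin (t - a))"
proof -
  note * = periodic_shift[OF lsin_sq_integrable, of "- a", simplified, OF arg_cong[OF lsin_periodic]]
  show s: "sqi circ_measure (\<lambda>t. of_real (lsin (t - a)))"
    unfolding sqi_def
    using * borel_imp_circ_measurable[of "\<lambda>t. complex_of_real (lsin (t - a))"] by simp
  show "nrm circ_measure (\<lambda>t. of_real (lsin (t - a))) = nrm circ_measure (\<lambda>t. of_real (lsin t))"
    using * by (simp add: nrm_def)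
  show "integrable circ_measure (\<lambda>t. lsin (t - a))"
    using integrable_Re[OF sqi_integrable[OF s]] by simp
qed

definition lsin_norm :: real where "lsin_norm = nrm circ_measure (\<lambda>t. of_real (lsin t))"

text \<open>The sine is half the length of the corresponding chord of the unit circle.\<close>

definition chord_arc :: "(real \<Rightarrow> complex) \<Rightarrow> real \<Rightarrow> bool" where
  "chord_arc \<gamma> c \<longleftrightarrow> c > 0 \<and> continuous_on UNIV \<gamma> \<and> (\<forall>t s. c * \<bar>sin ((t - s) / 2)\<bar> \<le> cmod (\<gamma> t - \<gamma> s))"

text \<open>For \<open>z\<close> off the curve, a nearest curve point \<open>\<gamma> a\<close>
  stands in for it: by the triangle inequality the chord from \<open>\<gamma> s\<close> to
  \<open>\<gamma> a\<close> is at most twice the distance from \<open>\<gamma> s\<close> to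
  \<open>z\<close>. The constant does not depend on \<open>z\<close>.\<close>

lemma chord_arc_nearest:
  assumes "chord_arc \<gamma> c"
  obtains a where "\<And>s. s \<in> {0..2*pi} \<Longrightarrow> c / 2 * \<bar>sin ((s - a) / 2)\<bar> \<le> cmod (z - \<gamma> s)"
proof -
  have "continuous_on {0..2*pi} (\<lambda>s. cmod (z - \<gamma> s))"
    using assms unfolding chord_arc_def
    by (auto intro!: continuous_on_norm continuous_on_diff continuous_on_const intro: continuous_on_subset)
  then obtain a where a: "a \<in> {0..2*pi}" "\<And>s. s \<in> {0..2*pi} \<Longrightarrow> cmod (z - \<gamma> a) \<le> cmod (z - \<gamma> s)"
    using continuous_attains_inf[of "{0..2*pi}" "\<lambda>s. cmod (z - \<gamma> s)"] by auto
  show thesis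
  proof
    fix s assume s: "s \<in> {0..2*pi}"
    have "c * \<bar>sin ((s - a) / 2)\<bar> \<le> cmod (\<gamma> s - \<gamma> a)" using assms unfolding chord_arc_def by blast
    also have "\<dots> \<le> cmod (z - \<gamma> s) + cmod (z - \<gamma> a)"
      using norm_triangle_ineq4[of "z - \<gamma> a" "z - \<gamma> s"] by (simp add: norm_minus_commute)
    also have "\<dots> \<le> 2 * cmod (z - \<gamma> s)" using a(2)[OF s] by simp
    finally show "c / 2 * \<bar>sin ((s - a) / 2)\<bar> \<le> cmod (z - \<gamma> s)" by simp
  qed
qed

lemma abs_ln_le_bounds:
  fixes x l u :: real
  assumes "0 < l" "l \<le> x" "x \<le> u"
  shows "\<bar>ln x\<bar> \<le> \<bar>ln l\<bar> + \<bar>ln u\<bar>"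
proof -
  have "ln l \<le> ln x" "ln x \<le> ln u" using assms by auto
  then show ?thesis by linarith
qed

lemma log_kernel_measurable:
  assumes "continuous_on UNIV \<gamma>"
  shows "(\<lambda>s. ln (cmod (z - \<gamma> s))) \<in> borel_measurable circ_measure"
  using borel_measurable_continuous_onI[OF assms] by (intro borel_imp_circ_measurable) measurable

text \<open>The bound depends on \<open>z\<close> only through \<open>R\<close>, since shifting
  \<open>lsin\<close> by the nearest parameter keeps its norm. This uniformity makes Symm's operator
  bounded and justifies Fubini's theorem for potentials on circles.\<close>

lemma log_kernel_sqi:
  assumes ca: "chord_arc \<gamma> c" and R: "\<And>s. s \<in> {0..2*pi} \<Longrightarrow> cmod (z - \<gamma> s) \<le> R"
  shows "sqi circ_measure (\<lambda>s. of_real (ln (cmod (z - \<gamma> s))))"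
    "nrm circ_measure (\<lambda>s. of_real (ln (cmod (z - \<gamma> s)))) \<le> lsin_norm + sqrt (2 * pi) * (\<bar>ln (c / 2)\<bar> + \<bar>ln R\<bar>)"
proof -
  obtain a where a: "\<And>s. s \<in> {0..2*pi} \<Longrightarrow> c / 2 * \<bar>sin ((s - a) / 2)\<bar> \<le> cmod (z - \<gamma> s)"
    using chord_arc_nearest[OF ca] by blast
  have c: "c > 0" and cont: "continuous_on UNIV \<gamma>" using ca by (auto simp: chord_arc_def)
  let ?k = "\<lambda>s. complex_of_real (ln (cmod (z - \<gamma> s)))"
  let ?B = "\<bar>ln (c / 2)\<bar> + \<bar>ln R\<bar>"
  let ?g = "\<lambda>s. complex_of_real \<bar>lsin (s - a)\<bar> + complex_of_real ?B"
  have l: "sqi circ_measure (\<lambda>s. complex_of_real \<bar>lsin (s - a)\<bar>)"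
    "nrm circ_measure (\<lambda>s. complex_of_real \<bar>lsin (s - a)\<bar>) = lsin_norm"
    using sqi_lsin_shift(1,2)[of a] borel_imp_circ_measurable[of "\<lambda>t. complex_of_real \<bar>lsin (t - a)\<bar>"]
    by (simp_all add: sqi_def nrm_def lsin_norm_def)
  have B: "sqi circ_measure (\<lambda>s. complex_of_real ?B)"
    "nrm circ_measure (\<lambda>s. complex_of_real ?B) \<le> sqrt (2 * pi) * ?B"
  proof -
    have *: "cmod (complex_of_real ?B) \<le> ?B" unfolding norm_of_real by simp
    show "sqi circ_measure (\<lambda>s. complex_of_real ?B)" by (rule sqi_bounded[OF finite_circ_measure _ *]) simp
    show "nrm circ_measure (\<lambda>s. complex_of_real ?B) \<le> sqrt (2 * pi) * ?B"
      by (rule nrm_circ_bounded[OF _ *]) simp_all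
  qed
  have g: "sqi circ_measure ?g" "nrm circ_measure ?g \<le> lsin_norm + sqrt (2 * pi) * ?B"
    using sqi_add[OF l(1) B(1)] nrm_add[OF l(1) B(1)] B(2) l(2) by simp_all
  \<comment> \<open>At the zeros of the sine the lower bound for the distance degenerates to 0;
    setting the kernel to 0 on this null set makes the majorant \<open>?g\<close> valid at every
    point.\<close>
  define k where "k s = (if sin ((s - a) / 2) = 0 then 0 else ?k s)" for s
  have km: "?k \<in> borel_measurable circ_measure"
    using borel_measurable_continuous_onI[OF cont] by (intro borel_imp_circ_measurable) measurable
  have zeros: "{s. sin ((s - a) / 2) = 0} \<in> sets borel"
    by (intro borel_closed closed_Collect_eq continuous_intros) simp
  have km': "k \<in> borel_measurable circ_measure"
    unfolding k_def
    by (intro borel_imp_circ_measurable measurable_If)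
       (use borel_measurable_continuous_onI[OF cont] zeros in simp_all)
  have ae: "AE s in circ_measure. k s = ?k s"
    using AE_sin_half_nonzero[of a] by eventually_elim (simp add: k_def)
  have le: "cmod (k s) \<le> cmod (?g s)" if s: "s \<in> {0..2*pi}" for s
  proof (cases "sin ((s - a) / 2) = 0")
    case False
    then have p: "0 < c / 2 * \<bar>sin ((s - a) / 2)\<bar>" using c by simp
    have "\<bar>ln (cmod (z - \<gamma> s))\<bar> \<le> \<bar>ln (c / 2 * \<bar>sin ((s - a) / 2)\<bar>)\<bar> + \<bar>ln R\<bar>"
      by (rule abs_ln_le_bounds[OF p a[OF s] R[OF s]])
    also have "ln (c / 2 * \<bar>sin ((s - a) / 2)\<bar>) = ln (c / 2) + lsin (s - a)"
      unfolding lsin_def by (rule ln_mult_pos) (use False c in auto)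
    finally have "\<bar>ln (cmod (z - \<gamma> s))\<bar> \<le> \<bar>lsin (s - a)\<bar> + ?B" by linarith
    also have "\<bar>lsin (s - a)\<bar> + ?B = cmod (?g s)"
      unfolding of_real_add[symmetric] norm_of_real by simp
    finally show ?thesis using False by (simp add: k_def)
  qed (simp add: k_def)
  have "sqi circ_measure k" "nrm circ_measure k \<le> nrm circ_measure ?g"
    using nrm_mono[OF g(1) km'] le by auto
  then show "sqi circ_measure ?k" "nrm circ_measure ?k \<le> lsin_norm + sqrt (2 * pi) * ?B"
    using sqi_cong_AE[OF _ km ae] nrm_cong_AE[OF km' km ae] g(2) by auto
qed

section \<open>Fourier coefficients of the logarithm on the unit circle\<close>

lemma Re_trig_1: "Re (trig 1 t) = cos t" and Im_trig_1: "Im (trig 1 t) = sin t"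
  using cis_conv_exp[of t] by (simp_all add: trig_def flip: cis_conv_exp)

lemma cmod_one_minus_scaled_trig:
  "(cmod (1 - of_real r * trig 1 t))\<^sup>2 = (1 - r)\<^sup>2 + 4 * r * (sin (t / 2))\<^sup>2"
proof -
  have c: "cos t = 1 - 2 * (sin (t / 2))\<^sup>2" using cos_double_sin[of "t / 2"] by simp
  have "(cmod (1 - of_real r * trig 1 t))\<^sup>2 = (1 - r * cos t)\<^sup>2 + (r * sin t)\<^sup>2"
    by (simp add: cmod_power2 Re_trig_1 Im_trig_1)
  also have "\<dots> = 1 - 2 * r * cos t + r\<^sup>2 * ((cos t)\<^sup>2 + (sin t)\<^sup>2)"
    by (simp add: power2_diff power_mult_distrib distrib_left del: sin_cos_squared_add sin_cos_squared_add2)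
  also have "\<dots> = 1 - 2 * r * cos t + r\<^sup>2" by (simp only: sin_cos_squared_add2 mult_1_right)
  also have "\<dots> = (1 - r)\<^sup>2 + 2 * r * (1 - cos t)" by (simp add: power2_diff right_diff_distrib)
  finally show ?thesis by (simp add: c)
qed

lemma cmod_one_minus_trig: "cmod (1 - trig 1 t) = 2 * \<bar>sin (t / 2)\<bar>"
proof -
  have "(cmod (1 - trig 1 t))\<^sup>2 = (2 * \<bar>sin (t / 2)\<bar>)\<^sup>2"
    using cmod_one_minus_scaled_trig[of 1 t] by (simp add: power_mult_distrib)
  then show ?thesis by (rule power2_eq_imp_eq) auto
qed

lemma trig_of_nat_power: "trig 1 t ^ m = trig (int m) t"
  by (induction m) (simp_all add: trig_mult)

lemma continuous_on_ln_one_minus: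
  assumes "0 \<le> r" "r < 1"
  shows "continuous_on A (\<lambda>t. ln (cmod (1 - of_real r * trig 1 t)))"
proof -
  have "1 - of_real r * trig 1 t \<noteq> 0" for t
    using assms by (auto simp: norm_mult dest!: arg_cong[of _ _ cmod])
  then show ?thesis by (intro continuous_intros) auto
qed

text \<open>The real part of the series of \<open>Ln (1 - z)\<close> at
  \<open>z = r * trig 1 t\<close> is integrated term by term under the geometric majorant
  \<open>1 / (1 - r)\<close>.\<close>

lemma integral_ln_one_minus_scaled_trig:
  assumes r: "0 \<le> r" "r < 1"
  shows "(LINT t|circ_measure. of_real (ln (cmod (1 - of_real r * trig 1 t))) * trig k t)
    = of_real (if k = 0 then 0 else - pi * r ^ nat \<bar>k\<bar> / real_of_int \<bar>k\<bar>)"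
proof -
  let ?f = "\<lambda>t. complex_of_real (ln (cmod (1 - of_real r * trig 1 t)))"
  \<comment> \<open>The sum starts at \<open>m = 0\<close>, where division by zero makes the term
    vanish.\<close>
  let ?S = "\<lambda>N t. - (\<Sum>m<N. of_real (r ^ m / (2 * real m)) * (trig (int m) t + trig (- int m) t))"
  have sums: "(\<lambda>N. ?S N t) \<longlonglongrightarrow> ?f t" for t
  proof -
    have n: "cmod (- (of_real r * trig 1 t)) < 1" using r by (simp add: norm_mult)
    have nz: "1 - of_real r * trig 1 t \<noteq> 0" using n by auto
    from Ln_series'[OF n] have "(\<lambda>m. - ((of_real r * trig 1 t) ^ m) / of_nat m) sums Ln (1 - of_real r * trig 1 t)"
      by simp
    from sums_Re[OF this] have *: "(\<lambda>m. Re (- ((of_real r * trig 1 t) ^ m) / of_nat m)) sums ln (cmod (1 - of_real r * trig 1 t))"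
      using nz by simp
    have "complex_of_real (Re (- ((of_real r * trig 1 t) ^ m) / of_nat m))
        = - (of_real (r ^ m / (2 * real m)) * (trig (int m) t + trig (- int m) t))" for m
      by (simp add: power_mult_distrib trig_of_nat_power complex_eq_iff flip: cnj_trig)
    then have "(\<lambda>m. - (complex_of_real (r ^ m / (2 * real m)) * (trig (int m) t + trig (- int m) t))) sums ?f t"
      using sums_of_real[OF *, where 'a=complex] by simp
    then show ?thesis by (simp add: sums_def sum_negf)
  qed
  have "(\<lambda>N. LINT t|circ_measure. ?S N t * trig k t) \<longlonglongrightarrow> (LINT t|circ_measure. ?f t * trig k t)"
  proof (rule integral_dominated_convergence[where w = "\<lambda>t. 1 / (1 - r)"])
    show "(\<lambda>t. ?f t * trig k t) \<in> borel_measurable circ_measure"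
      by (intro continuous_on_circ_measurable continuous_intros continuous_on_ln_one_minus r)
    show "(\<lambda>t. ?S N t * trig k t) \<in> borel_measurable circ_measure" for N
      by (intro continuous_on_circ_measurable continuous_intros)
    show "AE t in circ_measure. (\<lambda>N. ?S N t * trig k t) \<longlonglongrightarrow> ?f t * trig k t"
      by (intro AE_I2 tendsto_mult tendsto_const sums)
    show "AE t in circ_measure. cmod (?S N t * trig k t) \<le> 1 / (1 - r)" for N
    proof (rule AE_I2)
      fix t
      have "cmod (?S N t * trig k t) \<le> (\<Sum>m<N. cmod (of_real (r ^ m / (2 * real m)) * (trig (int m) t + trig (- int m) t)))"
        by (simp only: norm_mult[of "?S N t"] norm_trig norm_minus_cancel mult_1_right) (rule norm_sum)
      also have "\<dots> \<le> (\<Sum>m<N. r ^ m)"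
      proof (rule sum_mono)
        fix m
        have "cmod (trig (int m) t + trig (- int m) t) \<le> 2"
          using norm_triangle_ineq[of "trig (int m) t" "trig (- int m) t"] by simp
        then have "cmod (of_real (r ^ m / (2 * real m)) * (trig (int m) t + trig (- int m) t)) \<le> r ^ m / (2 * real m) * 2"
          unfolding norm_mult norm_of_real using r by (intro mult_mono) auto
        also have "\<dots> \<le> r ^ m"
          using r mult_right_mono[of 1 "real m" "r ^ m"] by (cases "m = 0") (auto simp: field_simps)
        finally show "cmod (of_real (r ^ m / (2 * real m)) * (trig (int m) t + trig (- int m) t)) \<le> r ^ m" .
      qed
      also have "\<dots> \<le> (\<Sum>m. r ^ m)" using r by (intro sum_le_suminf) (auto simp: summable_geometric)
      also have "\<dots> = 1 / (1 - r)" using r by (intro suminf_geometric) simp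
      finally show "cmod (?S N t * trig k t) \<le> 1 / (1 - r)" .
    qed
  qed simp
  moreover have "(\<lambda>N. LINT t|circ_measure. ?S N t * trig k t) \<longlonglongrightarrow> of_real (if k = 0 then 0 else - pi * r ^ nat \<bar>k\<bar> / real_of_int \<bar>k\<bar>)"
  proof (rule tendsto_eventually, unfold eventually_sequentially, intro exI[of _ "Suc (nat \<bar>k\<bar>)"] allI impI)
    fix N assume N: "Suc (nat \<bar>k\<bar>) \<le> N"
    let ?c = "\<lambda>m. complex_of_real (r ^ m / (2 * real m))"
    have "(LINT t|circ_measure. ?S N t * trig k t)
        = (LINT t|circ_measure. (\<Sum>m<N. - ?c m * trig (int m + k) t - ?c m * trig (- int m + k) t))"
    proof (rule Bochner_Integration.integral_cong)
      fix t
      have ring: "- (c * (A + B)) * K = - c * (A * K) - c * (B * K)" for A B c K :: complex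
        by (simp add: algebra_simps)
      show "?S N t * trig k t = (\<Sum>m<N. - ?c m * trig (int m + k) t - ?c m * trig (- int m + k) t)"
        unfolding sum_negf[symmetric] sum_distrib_right trig_mult[symmetric] ring ..
    qed simp
    also have "\<dots> = (\<Sum>m<N. - ?c m * (LINT t|circ_measure. trig (int m + k) t) - ?c m * (LINT t|circ_measure. trig (- int m + k) t))"
      by (subst Bochner_Integration.integral_sum) (auto simp: sqi_integrable[OF sqi_trig] simp del: of_real_divide of_real_mult of_real_power)
    also have "\<dots> = (\<Sum>m<N. if m = nat \<bar>k\<bar> then of_real (if k = 0 then 0 else - pi * r ^ m / real m) else 0)"
    proof (rule sum.cong)
      fix m
      show "- ?c m * (LINT t|circ_measure. trig (int m + k) t) - ?c m * (LINT t|circ_measure. trig (- int m + k) t)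
          = (if m = nat \<bar>k\<bar> then of_real (if k = 0 then 0 else - pi * r ^ m / real m) else 0)"
        unfolding integral_trig by (cases "k = 0"; cases "k > 0") auto
    qed simp
    also have "\<dots> = of_real (if k = 0 then 0 else - pi * r ^ nat \<bar>k\<bar> / real_of_int \<bar>k\<bar>)"
      using N by (simp add: sum.delta)
    finally show "(LINT t|circ_measure. ?S N t * trig k t) = of_real (if k = 0 then 0 else - pi * r ^ nat \<bar>k\<bar> / real_of_int \<bar>k\<bar>)" .
  qed
  ultimately show ?thesis by (rule LIMSEQ_unique)
qed

text \<open>The limit of the previous formula as the radius tends to 1. For radii of at least 1/4
  the coefficient \<open>4 * \<rho>\<close> is at least 1, so the sine bounds the modulus from below
  and \<open>lsin\<close> serves as majorant.\<close>

lemma integral_ln_one_minus_trig: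
  "(LINT t|circ_measure. of_real (ln (cmod (1 - trig 1 t))) * trig k t)
    = of_real (if k = 0 then 0 else - pi / real_of_int \<bar>k\<bar>)"
  "integrable circ_measure (\<lambda>t. ln (cmod (1 - trig 1 t)))"
proof -
  let ?f = "\<lambda>r t. complex_of_real (ln (cmod (1 - of_real r * trig 1 t)))"
  define r where "r n = 1 - 1 / real (n + 2)" for n :: nat
  have r: "1 / 4 \<le> r n" "r n < 1" for n by (auto simp: r_def field_simps)
  have r1: "r \<longlonglongrightarrow> 1"
  proof -
    have "(\<lambda>n. 1 - 1 / real (n + 2)) \<longlonglongrightarrow> 1 - 0"
      by (intro tendsto_intros LIMSEQ_ignore_initial_segment[of "\<lambda>n. 1 / real n"] lim_1_over_n)
    then show ?thesis unfolding r_def[abs_def] by simp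
  qed
  have w: "integrable circ_measure (\<lambda>t. \<bar>lsin t\<bar> + ln 2)"
    using sqi_lsin_shift(3)[of 0] by auto
  have bd: "\<bar>ln (cmod (1 - of_real \<rho> * trig 1 t))\<bar> \<le> \<bar>lsin t\<bar> + ln 2"
    if "1 / 4 \<le> \<rho>" "\<rho> \<le> 1" "sin (t / 2) \<noteq> 0" for \<rho> t
  proof -
    have "\<bar>sin (t / 2)\<bar>\<^sup>2 \<le> (cmod (1 - of_real \<rho> * trig 1 t))\<^sup>2"
      unfolding cmod_one_minus_scaled_trig power2_abs
      using that mult_right_mono[of 1 "4 * \<rho>" "(sin (t / 2))\<^sup>2"] by (simp add: add_increasing)
    then have lo: "\<bar>sin (t / 2)\<bar> \<le> cmod (1 - of_real \<rho> * trig 1 t)" by (rule power2_le_imp_le) simp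
    have "cmod (1 - of_real \<rho> * trig 1 t) \<le> 1 + \<rho>"
      using norm_triangle_ineq4[of 1 "of_real \<rho> * trig 1 t"] that by (simp add: norm_mult)
    then have hi: "cmod (1 - of_real \<rho> * trig 1 t) \<le> 2" using that by simp
    show ?thesis using abs_ln_le_bounds[OF _ lo hi] that by (simp add: lsin_def)
  qed
  have ae: "AE t in circ_measure. sin (t / 2) \<noteq> 0" using AE_sin_half_nonzero[of 0] by simp
  have m1: "(\<lambda>t. ln (cmod (1 - trig 1 t))) \<in> borel_measurable circ_measure"
    unfolding cmod_one_minus_trig by (rule borel_imp_circ_measurable) measurable
  show "integrable circ_measure (\<lambda>t. ln (cmod (1 - trig 1 t)))"
  proof (rule Bochner_Integration.integrable_bound[OF w m1])
    show "AE t in circ_measure. norm (ln (cmod (1 - trig 1 t))) \<le> norm (\<bar>lsin t\<bar> + ln 2)"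
      using ae by eventually_elim (use bd[of 1] in auto)
  qed
  have "(\<lambda>n. LINT t|circ_measure. ?f (r n) t * trig k t) \<longlonglongrightarrow> (LINT t|circ_measure. of_real (ln (cmod (1 - trig 1 t))) * trig k t)"
  proof (rule integral_dominated_convergence[OF _ _ w])
    show "(\<lambda>t. of_real (ln (cmod (1 - trig 1 t))) * trig k t) \<in> borel_measurable circ_measure"
      using m1 by measurable
    show "(\<lambda>t. ?f (r n) t * trig k t) \<in> borel_measurable circ_measure" for n
      using r[of n] by (intro continuous_on_circ_measurable continuous_intros continuous_on_ln_one_minus) auto
    show "AE t in circ_measure. (\<lambda>n. ?f (r n) t * trig k t) \<longlonglongrightarrow> of_real (ln (cmod (1 - trig 1 t))) * trig k t"
      using ae
    proof eventually_elim
      case (elim t)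
      then have "cmod (1 - of_real 1 * trig 1 t) \<noteq> 0" using cmod_one_minus_trig[of t] by auto
      then have "(\<lambda>n. ?f (r n) t * trig k t) \<longlonglongrightarrow> of_real (ln (cmod (1 - of_real 1 * trig 1 t))) * trig k t"
        by (intro tendsto_intros r1)
      then show ?case by simp
    qed
    show "AE t in circ_measure. cmod (?f (r n) t * trig k t) \<le> \<bar>lsin t\<bar> + ln 2" for n
      using ae
    proof eventually_elim
      case (elim t)
      then show ?case using bd[of "r n" t] r[of n] by (simp add: norm_mult)
    qed
  qed
  moreover have "(\<lambda>n. LINT t|circ_measure. ?f (r n) t * trig k t) \<longlonglongrightarrow> of_real (if k = 0 then 0 else - pi / real_of_int \<bar>k\<bar>)"
  proof -
    have "(\<lambda>n. complex_of_real (if k = 0 then 0 else - pi * r n ^ nat \<bar>k\<bar> / real_of_int \<bar>k\<bar>))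
        \<longlonglongrightarrow> of_real (if k = 0 then 0 else - pi * 1 ^ nat \<bar>k\<bar> / real_of_int \<bar>k\<bar>)"
      by (cases "k = 0") (auto intro!: tendsto_eq_intros r1)
    moreover have "(LINT t|circ_measure. ?f (r n) t * trig k t) = complex_of_real (if k = 0 then 0 else - pi * r n ^ nat \<bar>k\<bar> / real_of_int \<bar>k\<bar>)" for n
      using r[of n] by (intro integral_ln_one_minus_scaled_trig) auto
    ultimately show ?thesis by (simp only: power_one mult_1_right)
  qed
  ultimately show "(LINT t|circ_measure. of_real (ln (cmod (1 - trig 1 t))) * trig k t)
    = of_real (if k = 0 then 0 else - pi / real_of_int \<bar>k\<bar>)" by (rule LIMSEQ_unique)
qed

lemma trig_periodic: "trig k (t + 2 * pi) = trig k t"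
  by (simp add: trig_add)

text \<open>By rotation invariance only the modulus of \<open>\<zeta>\<close> matters, and then the
  coefficient formulas at \<open>k = 0\<close> give the value.\<close>

lemma integral_ln_one_minus_mult_trig:
  assumes "cmod \<zeta> \<le> 1"
  shows "has_bochner_integral circ_measure (\<lambda>t. ln (cmod (1 - \<zeta> * trig 1 t))) 0"
proof -
  let ?f = "\<lambda>t. ln (cmod (1 - of_real (cmod \<zeta>) * trig 1 t))"
  have int: "integrable circ_measure ?f"
  proof (cases "cmod \<zeta> = 1")
    case False
    then show ?thesis using assms by (intro continuous_imp_integrable_real continuous_on_ln_one_minus) auto
  qed (simp add: integral_ln_one_minus_trig)
  have "complex_of_real (LINT t|circ_measure. ?f t) = (LINT t|circ_measure. of_real (?f t) * trig 0 t)"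
    by simp
  also have "\<dots> = 0"
    using integral_ln_one_minus_trig(1)[of 0] integral_ln_one_minus_scaled_trig[of "cmod \<zeta>" 0] assms
    by (cases "cmod \<zeta> = 1") auto
  finally have z: "(LINT t|circ_measure. ?f t) = 0" by simp
  have "\<zeta> = of_real (cmod \<zeta>) * trig 1 (Arg \<zeta>)"
    using rcis_cmod_Arg[of \<zeta>] by (simp add: rcis_def trig_def cis_conv_exp)
  then obtain a where a: "\<zeta> = of_real (cmod \<zeta>) * trig 1 a" by blast
  have "?f (t + a) = ln (cmod (1 - \<zeta> * trig 1 t))" for t
    by (subst (2) a) (simp add: trig_add mult_ac)
  then show ?thesis
    using has_bochner_integral_periodic_interval(1)[OF int, of a] z by (simp add: trig_periodic)
qed

lemma AE_trig_neq: "AE t in circ_measure. trig 1 t \<noteq> c"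
proof (cases "\<exists>t0. trig 1 t0 = c")
  case True
  then obtain t0 where t0: "trig 1 t0 = c" by blast
  have *: "trig 1 t = c \<Longrightarrow> sin ((t - t0) / 2) = 0" for t
  proof -
    assume "trig 1 t = c"
    have "trig 1 t = trig 1 (t - t0) * trig 1 t0" using trig_add[of 1 "t - t0" t0] by simp
    then have "trig 1 (t - t0) = 1" using t0 \<open>trig 1 t = c\<close> norm_trig[of 1 t0]
      by (metis mult_cancel_right1 norm_zero zero_neq_one)
    then show "sin ((t - t0) / 2) = 0" using cmod_one_minus_trig[of "t - t0"] by simp
  qed
  show ?thesis using AE_sin_half_nonzero[of t0] by eventually_elim (use * in blast)
qed auto

text \<open>Jensen's formula for a linear function.\<close>

lemma integral_ln_circle:
  assumes "\<rho> > 0"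
  shows "has_bochner_integral circ_measure (\<lambda>t. ln (cmod (p + of_real \<rho> * trig 1 t - w))) (2 * pi * ln (max \<rho> (cmod (w - p))))"
proof (cases "cmod (w - p) > \<rho>")
  case True
  define \<zeta> where "\<zeta> = of_real \<rho> / (w - p)"
  have wp: "w - p \<noteq> 0" using True assms by auto
  have z: "cmod \<zeta> < 1" using True assms wp by (simp add: \<zeta>_def norm_divide divide_less_eq_1)
  have "cmod (p + of_real \<rho> * trig 1 t - w) = cmod (w - p) * cmod (1 - \<zeta> * trig 1 t)" for t
  proof -
    have "(w - p) * (1 - \<zeta> * trig 1 t) = w - (p + of_real \<rho> * trig 1 t)"
      using wp by (simp add: \<zeta>_def right_diff_distrib)
    then show ?thesis by (metis norm_minus_commute norm_mult)
  qed
  moreover have "cmod (1 - \<zeta> * trig 1 t) \<noteq> 0" for t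
    using z by (auto simp: norm_mult dest!: arg_cong[of _ _ cmod])
  ultimately have "ln (cmod (p + of_real \<rho> * trig 1 t - w)) = ln (cmod (w - p)) + ln (cmod (1 - \<zeta> * trig 1 t))" for t
    using wp by (simp add: ln_mult)
  moreover have "has_bochner_integral circ_measure (\<lambda>t. ln (cmod (w - p))) (2 * pi * ln (cmod (w - p)))"
    by (simp add: has_bochner_integral_iff integrable_circ_bounded(1))
  ultimately show ?thesis
    using has_bochner_integral_add[OF _ integral_ln_one_minus_mult_trig[of \<zeta>]] z True by (fastforce simp: max_def)
next
  case False
  \<comment> \<open>For \<open>w\<close> in the closed disc the factor \<open>trig 1 t\<close> is
    taken out; conjugation turns the remaining \<open>trig (-1) t\<close> into the
    \<open>trig 1 t\<close> of the mean value formula.\<close>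
  define \<zeta> where "\<zeta> = cnj ((w - p) / of_real \<rho>)"
  have z: "cmod \<zeta> \<le> 1" using False assms
    by (simp add: \<zeta>_def norm_divide del: complex_cnj_divide complex_cnj_diff)
  have eq: "cmod (p + of_real \<rho> * trig 1 t - w) = \<rho> * cmod (1 - \<zeta> * trig 1 t)" for t
  proof -
    have "trig 1 t * trig (-1) t = 1" by (simp add: trig_mult)
    then have "p + of_real \<rho> * trig 1 t - w = of_real \<rho> * trig 1 t * cnj (1 - \<zeta> * trig 1 t)"
      using assms by (simp add: \<zeta>_def cnj_trig field_simps)
    then show ?thesis using assms by (simp add: norm_mult del: complex_cnj_diff complex_cnj_mult)
  qed
  have nz: "AE t in circ_measure. cmod (1 - \<zeta> * trig 1 t) \<noteq> 0"
    using AE_trig_neq[of "1 / \<zeta>"] by eventually_elim (auto simp: eq_divide_eq mult.commute split: if_splits)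
  have c: "has_bochner_integral circ_measure (\<lambda>t. ln \<rho>) (2 * pi * ln \<rho>)"
    by (simp add: has_bochner_integral_iff integrable_circ_bounded(1))
  have sum: "has_bochner_integral circ_measure (\<lambda>t. ln \<rho> + ln (cmod (1 - \<zeta> * trig 1 t))) (2 * pi * ln (max \<rho> (cmod (w - p))))"
    using has_bochner_integral_add[OF c integral_ln_one_minus_mult_trig[OF z]] False by (simp add: max_def)
  show ?thesis
  proof (rule has_bochner_integralI_AE[OF sum])
    show "(\<lambda>t. ln (cmod (p + of_real \<rho> * trig 1 t - w))) \<in> borel_measurable circ_measure"
      by measurable
    show "AE t in circ_measure. ln \<rho> + ln (cmod (1 - \<zeta> * trig 1 t)) = ln (cmod (p + of_real \<rho> * trig 1 t - w))"
      using nz by eventually_elim (use assms in \<open>simp add: eq ln_mult\<close>)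
  qed
qed

section \<open>The regular part of the kernel\<close>

text \<open>With \<open>m = 0\<close> and \<open>h\<close> the derivative of a curve this is the
  divided difference of the curve between \<open>s\<close> and \<open>s + \<tau>\<close>, in a form
  regular at \<open>\<tau> = 0\<close>; each derivative in \<open>\<tau>\<close> raises
  \<open>m\<close> by one.\<close>

definition chord_avg :: "nat \<Rightarrow> (real \<Rightarrow> complex) \<Rightarrow> real \<Rightarrow> real \<Rightarrow> complex" where
  "chord_avg m h s \<tau> = integral (cbox 0 1) (\<lambda>u. of_real (u ^ m) * h (s + u * \<tau>))"

lemma chord_avg_continuous:
  assumes "continuous_on UNIV h"
  shows "continuous_on UNIV (\<lambda>(s, \<tau>). chord_avg m h s \<tau>)"
proof -
  have "continuous_on (UNIV \<times> cbox 0 1) (\<lambda>(p, u). of_real (u ^ m) * h (fst p + u * snd p))"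
    unfolding split_beta
    by (intro continuous_intros continuous_on_compose2[OF assms]) auto
  from integral_continuous_on_param[OF this] show ?thesis by (simp add: chord_avg_def split_beta)
qed

lemma chord_avg_derivative:
  assumes d: "\<And>t. (h has_vector_derivative h' t) (at t)" and c: "continuous_on UNIV h'"
  shows "(chord_avg m h s has_vector_derivative chord_avg (Suc m) h' s \<tau>) (at \<tau>)"
proof -
  have ch: "continuous_on UNIV h"
    using d by (meson continuous_at_imp_continuous_on has_vector_derivative_continuous)
  have "((\<lambda>\<tau>. integral (cbox 0 1) (\<lambda>u. of_real (u ^ m) * h (s + u * \<tau>))) has_vector_derivative
      integral (cbox 0 1) (\<lambda>u. of_real (u ^ Suc m) * h' (s + u * \<tau>))) (at \<tau> within UNIV)"
  proof (rule leibniz_rule_vector_derivative)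
    fix x t :: real
    have "((\<lambda>x. s + t * x) has_real_derivative t) (at x)" by (auto intro!: derivative_eq_intros)
    then have "((\<lambda>x. s + t * x) has_vector_derivative t) (at x)"
      by (simp add: has_real_derivative_iff_has_vector_derivative)
    from vector_diff_chain_at[OF this d[of "s + t * x"]]
    have "((\<lambda>x. h (s + t * x)) has_vector_derivative t *\<^sub>R h' (s + t * x)) (at x)" by (simp add: o_def)
    from has_vector_derivative_mult_right[OF this, of "of_real (t ^ m)"]
    show "((\<lambda>x. of_real (t ^ m) * h (s + t * x)) has_vector_derivative of_real (t ^ Suc m) * h' (s + t * x)) (at x within UNIV)"
      by (simp add: scaleR_conv_of_real mult_ac)
  next
    fix x :: real
    show "(\<lambda>u. of_real (u ^ m) * h (s + u * x)) integrable_on cbox 0 1"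
      by (intro integrable_continuous continuous_intros continuous_on_compose2[OF ch]) auto
  next
    show "continuous_on (UNIV \<times> cbox 0 1) (\<lambda>(x, u). of_real (u ^ Suc m) * h' (s + u * x))"
      unfolding split_beta by (intro continuous_intros continuous_on_compose2[OF c]) auto
  qed auto
  then show ?thesis by (simp add: chord_avg_def[abs_def])
qed

lemma chord_avg_difference:
  assumes d: "\<And>t. (g has_vector_derivative g1 t) (at t)"
  shows "of_real \<tau> * chord_avg 0 g1 s \<tau> = g (s + \<tau>) - g s"
proof -
  have "((\<lambda>u. of_real \<tau> * g1 (s + u * \<tau>)) has_integral (g (s + 1 * \<tau>) - g (s + 0 * \<tau>))) {0..1}"
  proof (rule fundamental_theorem_of_calculus)
    fix u :: real
    have "((\<lambda>u. s + u * \<tau>) has_real_derivative \<tau>) (at u)" by (auto intro!: derivative_eq_intros)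
    then have "((\<lambda>u. s + u * \<tau>) has_vector_derivative \<tau>) (at u)"
      by (simp add: has_real_derivative_iff_has_vector_derivative)
    from vector_diff_chain_at[OF this d[of "s + u * \<tau>"]]
    have "((\<lambda>u. g (s + u * \<tau>)) has_vector_derivative \<tau> *\<^sub>R g1 (s + u * \<tau>)) (at u)" by (simp add: o_def)
    then show "((\<lambda>u. g (s + u * \<tau>)) has_vector_derivative of_real \<tau> * g1 (s + u * \<tau>)) (at u within {0..1})"
      by (simp add: scaleR_conv_of_real has_vector_derivative_at_within)
  qed simp
  then have "integral {0..1} (\<lambda>u. of_real \<tau> * g1 (s + u * \<tau>)) = g (s + \<tau>) - g s"
    by (simp add: integral_unique del: integral_mult_right)
  then show ?thesis by (simp add: chord_avg_def)
qed

abbreviation strip :: "(real \<times> real) set" where "strip \<equiv> UNIV \<times> {- (2*pi)<..<2*pi}"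

text \<open>The divided difference of \<open>g\<close> is \<open>chord_avg 0 g1\<close>, which has
  two continuous derivatives in \<open>\<tau>\<close> when \<open>g\<close> has three. It vanishes
  nowhere for \<open>|\<tau>| < 2 * pi\<close>, on the diagonal by regularity and elsewhere by
  injectivity, so its logarithm is equally smooth.\<close>

lemma log_chord_smooth:
  assumes d1: "\<And>t. (g has_vector_derivative g1 t) (at t)" and d2: "\<And>t. (g1 has_vector_derivative g2 t) (at t)"
    and d3: "\<And>t. (g2 has_vector_derivative g3 t) (at t)" and c3: "continuous_on UNIV g3"
    and nz: "\<And>t. g1 t \<noteq> 0" and inj: "\<And>a b. g a = g b \<Longrightarrow> \<bar>a - b\<bar> < 2 * pi \<Longrightarrow> a = b"
  obtains L0 L1 L2 :: "real \<Rightarrow> real \<Rightarrow> real" where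
    "\<And>s \<tau>. \<bar>\<tau>\<bar> < 2 * pi \<Longrightarrow> (L0 s has_real_derivative L1 s \<tau>) (at \<tau>)"
    "\<And>s \<tau>. \<bar>\<tau>\<bar> < 2 * pi \<Longrightarrow> (L1 s has_real_derivative L2 s \<tau>) (at \<tau>)"
    "continuous_on strip (\<lambda>(s, \<tau>). L0 s \<tau>)" "continuous_on strip (\<lambda>(s, \<tau>). L1 s \<tau>)" "continuous_on strip (\<lambda>(s, \<tau>). L2 s \<tau>)"
    "\<And>s \<tau>. 0 < \<bar>\<tau>\<bar> \<Longrightarrow> \<bar>\<tau>\<bar> < 2 * pi \<Longrightarrow> L0 s \<tau> = 2 * ln (cmod (g (s + \<tau>) - g s)) - 2 * ln \<bar>\<tau>\<bar>"
proof -
  have c1: "continuous_on UNIV g1" and c2: "continuous_on UNIV g2"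
    using d2 d3 by (meson continuous_at_imp_continuous_on has_vector_derivative_continuous)+
  define G0 G1 G2 where "G0 = chord_avg 0 g1" and "G1 = chord_avg (Suc 0) g2" and "G2 = chord_avg (Suc (Suc 0)) g3"
  have dG0: "(G0 s has_vector_derivative G1 s \<tau>) (at \<tau>)" and dG1: "(G1 s has_vector_derivative G2 s \<tau>) (at \<tau>)" for s \<tau>
    unfolding G0_def G1_def G2_def by (intro chord_avg_derivative d2 d3 c2 c3)+
  have cG: "continuous_on A (\<lambda>(s, \<tau>). G0 s \<tau>)" "continuous_on A (\<lambda>(s, \<tau>). G1 s \<tau>)" "continuous_on A (\<lambda>(s, \<tau>). G2 s \<tau>)" for A
    unfolding G0_def G1_def G2_def by (rule continuous_on_subset[OF chord_avg_continuous]; use c1 c2 c3 in simp)+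
  have G0nz: "G0 s \<tau> \<noteq> 0" if "\<bar>\<tau>\<bar> < 2 * pi" for s \<tau>
  proof (cases "\<tau> = 0")
    case True
    have "((\<lambda>u. of_real (u ^ 0) * g1 (s + u * 0)) has_integral g1 s) (cbox 0 1)"
      using has_integral_const_real[of "g1 s" 0 1] by simp
    then have "G0 s 0 = g1 s" unfolding G0_def chord_avg_def by (rule integral_unique)
    then show ?thesis using nz True by simp
  next
    case False
    then have "g (s + \<tau>) \<noteq> g s" using inj[of "s + \<tau>" s] that by auto
    then show ?thesis using chord_avg_difference[OF d1, of \<tau> s] by (auto simp: G0_def)
  qed
  \<comment> \<open>\<open>N\<close> is the squared modulus of the divided difference, which is
    differentiated without roots; hence the factor 2 in front of the logarithms.\<close>
  define N N1 N2 where "N s \<tau> = (Re (G0 s \<tau>))\<^sup>2 + (Im (G0 s \<tau>))\<^sup>2"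
    and "N1 s \<tau> = 2 * (Re (G0 s \<tau>) * Re (G1 s \<tau>) + Im (G0 s \<tau>) * Im (G1 s \<tau>))"
    and "N2 s \<tau> = 2 * (Re (G1 s \<tau>) * Re (G1 s \<tau>) + Re (G0 s \<tau>) * Re (G2 s \<tau>)
        + (Im (G1 s \<tau>) * Im (G1 s \<tau>) + Im (G0 s \<tau>) * Im (G2 s \<tau>)))" for s \<tau>
  have re: "((\<lambda>\<tau>. Re (G0 s \<tau>)) has_real_derivative Re (G1 s \<tau>)) (at \<tau>)" "((\<lambda>\<tau>. Im (G0 s \<tau>)) has_real_derivative Im (G1 s \<tau>)) (at \<tau>)"
    "((\<lambda>\<tau>. Re (G1 s \<tau>)) has_real_derivative Re (G2 s \<tau>)) (at \<tau>)" "((\<lambda>\<tau>. Im (G1 s \<tau>)) has_real_derivative Im (G2 s \<tau>)) (at \<tau>)" for s \<tau>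
    using dG0[of s \<tau>] dG1[of s \<tau>]
    by (simp_all add: has_real_derivative_iff_has_vector_derivative
        bounded_linear.has_vector_derivative[OF bounded_linear_Re] bounded_linear.has_vector_derivative[OF bounded_linear_Im])
  have dN: "(N s has_real_derivative N1 s \<tau>) (at \<tau>)" for s \<tau>
  proof -
    have "((\<lambda>\<tau>. (a \<tau>)\<^sup>2 + (b \<tau>)\<^sup>2) has_real_derivative 2 * (a \<tau> * a' + b \<tau> * b')) (at \<tau>)"
      if "(a has_real_derivative a') (at \<tau>)" "(b has_real_derivative b') (at \<tau>)" for a b :: "real \<Rightarrow> real" and a' b'
      by (auto intro!: derivative_eq_intros that)
    from this[OF re(1,2)] show ?thesis unfolding N_def[abs_def] N1_def .
  qed
  have dN1: "(N1 s has_real_derivative N2 s \<tau>) (at \<tau>)" for s \<tau>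
  proof -
    have "((\<lambda>\<tau>. 2 * (a \<tau> * c \<tau> + b \<tau> * d \<tau>)) has_real_derivative 2 * (a' * c \<tau> + a \<tau> * c' + (b' * d \<tau> + b \<tau> * d'))) (at \<tau>)"
      if "(a has_real_derivative a') (at \<tau>)" "(b has_real_derivative b') (at \<tau>)" "(c has_real_derivative c') (at \<tau>)" "(d has_real_derivative d') (at \<tau>)"
      for a b c d :: "real \<Rightarrow> real" and a' b' c' d'
      by (auto intro!: derivative_eq_intros that)
    from this[OF re] show ?thesis unfolding N1_def[abs_def] N2_def .
  qed
  have Npos: "N s \<tau> > 0" if "\<bar>\<tau>\<bar> < 2 * pi" for s \<tau>
    using G0nz[OF that, of s] by (auto simp: N_def sum_power2_gt_zero_iff complex_eq_iff)
  have cN: "continuous_on A (\<lambda>(s, \<tau>). N s \<tau>)" "continuous_on A (\<lambda>(s, \<tau>). N1 s \<tau>)" "continuous_on A (\<lambda>(s, \<tau>). N2 s \<tau>)" for A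
    using cG[of A] unfolding N_def N1_def N2_def split_beta by (auto intro!: continuous_intros)
  have nzs: "\<forall>p\<in>strip. N (fst p) (snd p) \<noteq> 0"
  proof
    fix p assume "p \<in> strip"
    then have "\<bar>snd p\<bar> < 2 * pi" by auto
    then show "N (fst p) (snd p) \<noteq> 0" using Npos[of "snd p" "fst p"] by simp
  qed
  show thesis
  proof (rule that)
    show "((\<lambda>\<tau>. ln (N s \<tau>)) has_real_derivative N1 s \<tau> / N s \<tau>) (at \<tau>)" if "\<bar>\<tau>\<bar> < 2 * pi" for s \<tau>
      using Npos[OF that, of s] by (auto intro!: derivative_eq_intros dN)
    show "((\<lambda>\<tau>. N1 s \<tau> / N s \<tau>) has_real_derivative (N2 s \<tau> * N s \<tau> - N1 s \<tau> * N1 s \<tau>) / (N s \<tau> * N s \<tau>)) (at \<tau>)"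
      if "\<bar>\<tau>\<bar> < 2 * pi" for s \<tau>
      using Npos[OF that, of s] by (auto intro!: derivative_eq_intros dN dN1)
    show "continuous_on strip (\<lambda>(s, \<tau>). ln (N s \<tau>))" "continuous_on strip (\<lambda>(s, \<tau>). N1 s \<tau> / N s \<tau>)"
      "continuous_on strip (\<lambda>(s, \<tau>). (N2 s \<tau> * N s \<tau> - N1 s \<tau> * N1 s \<tau>) / (N s \<tau> * N s \<tau>))"
      using cN[of strip] nzs unfolding split_beta by (auto intro!: continuous_intros)
    show "ln (N s \<tau>) = 2 * ln (cmod (g (s + \<tau>) - g s)) - 2 * ln \<bar>\<tau>\<bar>" if t: "0 < \<bar>\<tau>\<bar>" "\<bar>\<tau>\<bar> < 2 * pi" for s \<tau>
    proof -
      have "g (s + \<tau>) - g s = of_real \<tau> * G0 s \<tau>" using chord_avg_difference[OF d1, of \<tau> s] by (simp add: G0_def)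
      then have "ln (cmod (g (s + \<tau>) - g s)) = ln \<bar>\<tau>\<bar> + ln (cmod (G0 s \<tau>))"
        using t G0nz[OF t(2), of s] by (simp add: norm_mult ln_mult)
      moreover have "N s \<tau> = (cmod (G0 s \<tau>))\<^sup>2" by (simp add: N_def cmod_power2)
      ultimately show ?thesis using G0nz[OF t(2), of s] by (simp add: ln_realpow)
    qed
  qed
qed

section \<open>Periodic regular curves compared with the unit circle\<close>

lemma regular_closed_C3_curve_derivatives:
  assumes "regular_closed_C3_curve \<gamma>"
  obtains \<gamma>1 \<gamma>2 \<gamma>3 where "\<And>t. (\<gamma> has_vector_derivative \<gamma>1 t) (at t)" "\<And>t. (\<gamma>1 has_vector_derivative \<gamma>2 t) (at t)"
    "\<And>t. (\<gamma>2 has_vector_derivative \<gamma>3 t) (at t)" "continuous_on UNIV \<gamma>3" "\<And>t. \<gamma>1 t \<noteq> 0"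
proof -
  from assms have "C_diff (Suc (Suc (Suc 0))) \<gamma>" by (simp add: regular_closed_C3_curve_def eval_nat_numeral)
  then obtain \<gamma>1 \<gamma>2 \<gamma>3 where d: "\<And>t. (\<gamma> has_vector_derivative \<gamma>1 t) (at t)" "\<And>t. (\<gamma>1 has_vector_derivative \<gamma>2 t) (at t)"
    "\<And>t. (\<gamma>2 has_vector_derivative \<gamma>3 t) (at t)" "continuous_on UNIV \<gamma>3"
    by auto
  moreover have "\<gamma>1 t \<noteq> 0" for t
    using assms vector_derivative_at[OF d(1)[of t]] by (auto simp: regular_closed_C3_curve_def dest: spec[of _ t])
  ultimately show thesis by (rule that)
qed

lemma periodic_mod_2pi:
  obtains n :: int and a' :: real where "a = a' + 2 * pi * of_int n" "0 \<le> a'" "a' < 2 * pi"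
  using floor_divide_lower[of "2 * pi" a] floor_divide_upper[of "2 * pi" a]
  by (intro that[of "a - 2 * pi * of_int \<lfloor>a / (2 * pi)\<rfloor>" "\<lfloor>a / (2 * pi)\<rfloor>"]) (auto simp: algebra_simps)

text \<open>Injectivity makes the representatives in the half-open period coincide, so
  \<open>a\<close> and \<open>b\<close> differ by a multiple of the period that is smaller than the
  period.\<close>

lemma periodic_inj:
  assumes per: "\<And>t. g (t + 2 * pi) = g t" and inj: "inj_on g {0..<2*pi}"
    and "g a = g b" "\<bar>a - b\<bar> < 2 * pi"
  shows "a = b"
proof -
  obtain n a' where a: "a = a' + 2 * pi * of_int n" "0 \<le> a'" "a' < 2 * pi" by (rule periodic_mod_2pi)
  obtain m b' where b: "b = b' + 2 * pi * of_int m" "0 \<le> b'" "b' < 2 * pi" by (rule periodic_mod_2pi)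
  have "g a' = g b'"
    using assms(3) periodic_int[of g, OF per, of a' n] periodic_int[of g, OF per, of b' m] by (simp add: a(1) b(1))
  then have eq: "a' = b'" by (rule inj_onD[OF inj]) (use a(2,3) b(2,3) in auto)
  then have "a - b = 2 * pi * of_int (n - m)" by (simp add: a(1) b(1) algebra_simps)
  then have "2 * pi * \<bar>of_int (n - m)\<bar> < 2 * pi * (1::real)" using assms(4) by (simp add: abs_mult)
  then have "\<bar>real_of_int (n - m)\<bar> < 1" by (subst (asm) mult_less_cancel_left_pos) auto
  then have "n = m" by linarith
  then show ?thesis using eq a(1) b(1) by simp
qed

text \<open>The kernel of Symm's operator minus that of the unit circle. On the diagonal it has the junk
  value \<open>0\<close>, since \<open>ln 0 = 0\<close>.\<close>

definition reg_kernel :: "(real \<Rightarrow> complex) \<Rightarrow> real \<Rightarrow> real \<Rightarrow> real" where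
  "reg_kernel \<gamma> t s = - 1 / pi * (ln (cmod (\<gamma> t - \<gamma> s)) - ln (cmod (1 - trig 1 (t - s))))"

lemma borel_measurable_trig [measurable]: "trig k \<in> borel_measurable borel"
  by (rule borel_measurable_continuous_onI) (rule continuous_on_trig)

lemma regular_closed_C3_curve_continuous:
  assumes "regular_closed_C3_curve \<gamma>"
  shows "continuous_on UNIV \<gamma>"
  by (rule regular_closed_C3_curve_derivatives[OF assms])
     (blast intro: continuous_at_imp_continuous_on has_vector_derivative_continuous)

lemma reg_kernel_pair_measurable:
  assumes "continuous_on UNIV \<gamma>"
  shows "(\<lambda>p. reg_kernel \<gamma> (fst p) (snd p)) \<in> borel_measurable (borel \<Otimes>\<^sub>M borel)"
proof -
  have [measurable]: "\<gamma> \<in> borel_measurable borel" by (rule borel_measurable_continuous_onI) fact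
  show ?thesis unfolding reg_kernel_def by measurable
qed

lemma reg_kernel_borel_measurable:
  assumes "continuous_on UNIV \<gamma>"
  shows "(\<lambda>t. reg_kernel \<gamma> t s) \<in> borel_measurable borel"
proof -
  have [measurable]: "\<gamma> \<in> borel_measurable borel" by (rule borel_measurable_continuous_onI) fact
  show ?thesis unfolding reg_kernel_def by measurable
qed

lemma reg_kernel_commute: "reg_kernel \<gamma> t s = reg_kernel \<gamma> s t"
proof -
  have "trig 1 (s - t) = trig (- 1) (t - s)" by (simp add: trig_def algebra_simps)
  then have "trig 1 (s - t) = cnj (trig 1 (t - s))" by (simp only: cnj_trig)
  then have "cmod (1 - trig 1 (s - t)) = cmod (cnj (1 - trig 1 (t - s)))" by simp
  then have "cmod (1 - trig 1 (s - t)) = cmod (1 - trig 1 (t - s))" by (simp only: complex_mod_cnj)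
  then show ?thesis by (simp only: reg_kernel_def norm_minus_commute[of "\<gamma> t" "\<gamma> s"])
qed

lemma reg_kernel_periodic:
  assumes "\<And>t. \<gamma> (t + 2 * pi) = \<gamma> t"
  shows "reg_kernel \<gamma> (t + 2 * pi) s = reg_kernel \<gamma> t s" "reg_kernel \<gamma> t (s + 2 * pi) = reg_kernel \<gamma> t s"
proof -
  show *: "reg_kernel \<gamma> (t + 2 * pi) s = reg_kernel \<gamma> t s" for t s
  proof -
    have "t + 2 * pi - s = (t - s) + 2 * pi" by simp
    then show ?thesis by (simp only: reg_kernel_def assms trig_periodic)
  qed
  show "reg_kernel \<gamma> t (s + 2 * pi) = reg_kernel \<gamma> t s"
    using *[of s t] by (simp add: reg_kernel_commute)
qed

text \<open>\<open>log_chord_smooth\<close> is applied to the curve and to the unit circle; in the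
  difference the singular terms \<open>2 * ln \<bar>\<tau>\<bar>\<close> cancel. \<open>D0\<close>
  continues the kernel smoothly across the diagonal, where the kernel itself has its junk
  value.\<close>

lemma reg_kernel_smooth:
  assumes "regular_closed_C3_curve \<gamma>"
  obtains D0 D1 D2 :: "real \<Rightarrow> real \<Rightarrow> real" where
    "\<And>s \<tau>. \<bar>\<tau>\<bar> < 2 * pi \<Longrightarrow> (D0 s has_real_derivative D1 s \<tau>) (at \<tau>)"
    "\<And>s \<tau>. \<bar>\<tau>\<bar> < 2 * pi \<Longrightarrow> (D1 s has_real_derivative D2 s \<tau>) (at \<tau>)"
    "continuous_on strip (\<lambda>(s, \<tau>). D0 s \<tau>)" "continuous_on strip (\<lambda>(s, \<tau>). D1 s \<tau>)" "continuous_on strip (\<lambda>(s, \<tau>). D2 s \<tau>)"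
    "\<And>s \<tau>. 0 < \<bar>\<tau>\<bar> \<Longrightarrow> \<bar>\<tau>\<bar> < 2 * pi \<Longrightarrow> D0 s \<tau> = reg_kernel \<gamma> (s + \<tau>) s"
proof -
  have per: "\<And>t. \<gamma> (t + 2 * pi) = \<gamma> t" and inj: "inj_on \<gamma> {0..<2*pi}"
    using assms by (auto simp: regular_closed_C3_curve_def)
  obtain \<gamma>1 \<gamma>2 \<gamma>3 where d: "\<And>t. (\<gamma> has_vector_derivative \<gamma>1 t) (at t)" "\<And>t. (\<gamma>1 has_vector_derivative \<gamma>2 t) (at t)"
    "\<And>t. (\<gamma>2 has_vector_derivative \<gamma>3 t) (at t)" "continuous_on UNIV \<gamma>3" "\<And>t. \<gamma>1 t \<noteq> 0"
    using regular_closed_C3_curve_derivatives[OF assms] by blast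
  obtain L0 L1 L2 where L: "\<And>s \<tau>. \<bar>\<tau>\<bar> < 2 * pi \<Longrightarrow> (L0 s has_real_derivative L1 s \<tau>) (at \<tau>)"
    "\<And>s \<tau>. \<bar>\<tau>\<bar> < 2 * pi \<Longrightarrow> (L1 s has_real_derivative L2 s \<tau>) (at \<tau>)"
    "continuous_on strip (\<lambda>(s, \<tau>). L0 s \<tau>)" "continuous_on strip (\<lambda>(s, \<tau>). L1 s \<tau>)" "continuous_on strip (\<lambda>(s, \<tau>). L2 s \<tau>)"
    "\<And>s \<tau>. 0 < \<bar>\<tau>\<bar> \<Longrightarrow> \<bar>\<tau>\<bar> < 2 * pi \<Longrightarrow> L0 s \<tau> = 2 * ln (cmod (\<gamma> (s + \<tau>) - \<gamma> s)) - 2 * ln \<bar>\<tau>\<bar>"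
    using log_chord_smooth[OF d periodic_inj[of \<gamma>, OF per inj]] by blast
  have ti: "a = b" if "trig 1 a = trig 1 b" "\<bar>a - b\<bar> < 2 * pi" for a b
  proof (rule periodic_inj[OF trig_periodic _ that])
    have "x = y" if "0 \<le> x" "x < 2 * pi" "0 \<le> y" "y < 2 * pi" "trig 1 x = trig 1 y" for x y
    proof -
      have "Arg2pi (trig 1 z) = z" if "0 \<le> z" "z < 2 * pi" for z
        by (rule Arg2pi_unique[of 1]) (simp_all add: that trig_def)
      then show ?thesis using that by metis
    qed
    then show "inj_on (trig 1) {0..<2*pi}" by (simp add: inj_on_def)
  qed
  have td: "((\<lambda>t. c * trig 1 t) has_vector_derivative (\<i> * c) * trig 1 t) (at t)" for c t
    using has_vector_derivative_mult_right[OF trig_has_vector_derivative[of 1 t UNIV], of c] by (simp add: mult_ac)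
  obtain M0 M1 M2 where M: "\<And>s \<tau>. \<bar>\<tau>\<bar> < 2 * pi \<Longrightarrow> (M0 s has_real_derivative M1 s \<tau>) (at \<tau>)"
    "\<And>s \<tau>. \<bar>\<tau>\<bar> < 2 * pi \<Longrightarrow> (M1 s has_real_derivative M2 s \<tau>) (at \<tau>)"
    "continuous_on strip (\<lambda>(s, \<tau>). M0 s \<tau>)" "continuous_on strip (\<lambda>(s, \<tau>). M1 s \<tau>)" "continuous_on strip (\<lambda>(s, \<tau>). M2 s \<tau>)"
    "\<And>s \<tau>. 0 < \<bar>\<tau>\<bar> \<Longrightarrow> \<bar>\<tau>\<bar> < 2 * pi \<Longrightarrow> M0 s \<tau> = 2 * ln (cmod (1 * trig 1 (s + \<tau>) - 1 * trig 1 s)) - 2 * ln \<bar>\<tau>\<bar>"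
  proof -
    \<comment> \<open>Writing the circle as \<open>1 * trig 1 t\<close> lets the single rule
      \<open>td\<close>, whose results are again of the form \<open>c * trig 1 t\<close>, serve for
      all three derivatives.\<close>
    have c: "continuous_on UNIV (\<lambda>t. (\<i> * (\<i> * (\<i> * 1))) * trig 1 t)" by (intro continuous_intros)
    have nz: "(\<i> * 1) * trig 1 t \<noteq> 0" for t by (simp add: trig_def)
    have ti': "1 * trig 1 a = 1 * trig 1 b \<Longrightarrow> \<bar>a - b\<bar> < 2 * pi \<Longrightarrow> a = b" for a b using ti by simp
    show thesis
      using log_chord_smooth[of "\<lambda>t. 1 * trig 1 t", OF td td td c nz ti'] that by blast
  qed
  show thesis
  proof (rule that)
    show "((\<lambda>\<tau>. - 1 / (2 * pi) * (L0 s \<tau> - M0 s \<tau>)) has_real_derivative - 1 / (2 * pi) * (L1 s \<tau> - M1 s \<tau>)) (at \<tau>)"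
      "((\<lambda>\<tau>. - 1 / (2 * pi) * (L1 s \<tau> - M1 s \<tau>)) has_real_derivative - 1 / (2 * pi) * (L2 s \<tau> - M2 s \<tau>)) (at \<tau>)"
      if "\<bar>\<tau>\<bar> < 2 * pi" for s \<tau>
      by (intro DERIV_cmult DERIV_diff L(1,2)[OF that] M(1,2)[OF that])+
    show "continuous_on strip (\<lambda>(s, \<tau>). - 1 / (2 * pi) * (L0 s \<tau> - M0 s \<tau>))"
      "continuous_on strip (\<lambda>(s, \<tau>). - 1 / (2 * pi) * (L1 s \<tau> - M1 s \<tau>))"
      "continuous_on strip (\<lambda>(s, \<tau>). - 1 / (2 * pi) * (L2 s \<tau> - M2 s \<tau>))"
      using L(3-5) M(3-5) unfolding split_beta by (auto intro!: continuous_intros)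
    show "- 1 / (2 * pi) * (L0 s \<tau> - M0 s \<tau>) = reg_kernel \<gamma> (s + \<tau>) s" if "0 < \<bar>\<tau>\<bar>" "\<bar>\<tau>\<bar> < 2 * pi" for s \<tau>
    proof -
      have "cmod (trig 1 (s + \<tau>) - trig 1 s) = cmod (trig 1 s * (trig 1 \<tau> - 1))"
        by (simp add: trig_add right_diff_distrib)
      also have "\<dots> = cmod (1 - trig 1 \<tau>)" by (simp add: norm_mult norm_minus_commute)
      finally have "L0 s \<tau> - M0 s \<tau> = 2 * (ln (cmod (\<gamma> (s + \<tau>) - \<gamma> s)) - ln (cmod (1 - trig 1 \<tau>)))"
        using L(6)[OF that, of s] M(6)[OF that, of s] by simp
      then show ?thesis by (simp add: reg_kernel_def del: right_diff_distrib_numeral)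
    qed
  qed
qed

section \<open>Decay of the Fourier coefficients of the regular kernel\<close>

lemma interval_pi_bessel:
  fixes f :: "real \<Rightarrow> complex"
  assumes c: "continuous_on {- pi..pi} f" and b: "\<And>t. t \<in> {- pi..pi} \<Longrightarrow> cmod (f t) \<le> C" and F: "finite F"
  shows "(\<Sum>m\<in>F. (cmod (integral\<^sup>L (lebesgue_on {- pi..pi}) (\<lambda>t. f t * trig (- m) t)))\<^sup>2) \<le> (2 * pi * C)\<^sup>2"
proof -
  let ?g = "\<lambda>t. f (t + (- pi))"
  have C0: "C \<ge> 0" using order_trans[OF norm_ge_zero b[of 0]] by simp
  have cg: "continuous_on {0..2*pi} ?g"
    by (intro continuous_on_compose2[OF c] continuous_intros) auto
  have sg: "sqi circ_measure ?g" by (rule sqi_continuous[OF cg])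
  have ng: "nrm circ_measure ?g \<le> sqrt (2 * pi) * C"
    by (rule nrm_circ_bounded[OF continuous_on_circ_measurable[OF cg] _ C0]) (auto intro: b)
  have eq: "cmod (integral\<^sup>L (lebesgue_on {- pi..pi}) (\<lambda>t. f t * trig (- m) t)) = sqrt (2 * pi) * cmod (fourier_coeff ?g m)" for m
  proof -
    let ?h = "\<lambda>t. f t * trig (- m) t"
    have "integrable (lebesgue_on {0 + - pi..2 * pi + - pi}) ?h"
      by (intro continuous_imp_integrable_real continuous_intros) (use c in simp)
    then have "has_bochner_integral (lebesgue_on {0 + - pi..2 * pi + - pi}) ?h (integral\<^sup>L (lebesgue_on {- pi..pi}) ?h)"
      by (simp add: has_bochner_integral_iff)
    then have "has_bochner_integral circ_measure (\<lambda>t. ?h (t + (- pi))) (integral\<^sup>L (lebesgue_on {- pi..pi}) ?h)"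
      by (subst (asm) has_bochner_integral_lebesgue_on_shift)
    then have "integral\<^sup>L (lebesgue_on {- pi..pi}) ?h = (LINT t|circ_measure. trig (- m) (- pi) * (?g t * trig (- m) t))"
      by (simp add: has_bochner_integral_iff trig_add mult_ac flip: diff_conv_add_uminus)
         (simp add: trig_add mult_ac diff_conv_add_uminus del: add_uminus_conv_diff)
    also have "\<dots> = trig (- m) (- pi) * (sq2pi * fourier_coeff ?g m)"
      by (simp add: fourier_coeff_trig)
    finally show ?thesis by (simp add: norm_mult)
  qed
  have "(\<Sum>m\<in>F. (cmod (integral\<^sup>L (lebesgue_on {- pi..pi}) (\<lambda>t. f t * trig (- m) t)))\<^sup>2)
      = 2 * pi * (\<Sum>m\<in>F. (cmod (fourier_coeff ?g m))\<^sup>2)"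
    by (simp add: eq power_mult_distrib sum_distrib_left)
  also have "\<dots> \<le> 2 * pi * (nrm circ_measure ?g)\<^sup>2" using bessel[OF F sg] by simp
  also have "\<dots> \<le> 2 * pi * (sqrt (2 * pi) * C)\<^sup>2" using ng by (intro mult_left_mono power_mono) auto
  also have "\<dots> = (2 * pi * C)\<^sup>2" by (simp add: power_mult_distrib power2_eq_square)
  finally show ?thesis .
qed

lemma trig_pi_eq: "trig m (- pi) = trig m pi"
  using trig_periodic[of m "- pi"] by simp

lemma interval_pi_by_parts:
  fixes f f' :: "real \<Rightarrow> complex"
  assumes d: "\<And>t. t \<in> {- pi..pi} \<Longrightarrow> (f has_vector_derivative f' t) (at t)"
    and c: "continuous_on {- pi..pi} f'" and e: "f pi = f (- pi)"
  shows "integral\<^sup>L (lebesgue_on {- pi..pi}) (\<lambda>t. f' t * trig m t) = - (\<i> * of_int m) * integral\<^sup>L (lebesgue_on {- pi..pi}) (\<lambda>t. f t * trig m t)"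
proof -
  have cf: "continuous_on {- pi..pi} f"
    by (rule continuous_on_vector_derivative) (use d has_vector_derivative_at_within in blast)
  have i1: "integrable (lebesgue_on {- pi..pi}) (\<lambda>t. f' t * trig m t)" and i2: "integrable (lebesgue_on {- pi..pi}) (\<lambda>t. f t * trig m t)"
    by (intro continuous_imp_integrable_real continuous_intros c cf)+
  have "((\<lambda>t. f' t * trig m t + \<i> * of_int m * (f t * trig m t)) has_integral (f pi * trig m pi - f (- pi) * trig m (- pi))) {- pi..pi}"
  proof (rule fundamental_theorem_of_calculus)
    fix t assume "t \<in> {- pi..pi}"
    then have "(f has_vector_derivative f' t) (at t within {- pi..pi})" using d has_vector_derivative_at_within by blast
    from has_vector_derivative_mult[OF this trig_has_vector_derivative[of m]]
    show "((\<lambda>t. f t * trig m t) has_vector_derivative f' t * trig m t + \<i> * of_int m * (f t * trig m t)) (at t within {- pi..pi})"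
      by (simp add: algebra_simps)
  qed simp
  moreover have "((\<lambda>t. f' t * trig m t + \<i> * of_int m * (f t * trig m t)) has_integral
      (integral\<^sup>L (lebesgue_on {- pi..pi}) (\<lambda>t. f' t * trig m t + \<i> * of_int m * (f t * trig m t)))) {- pi..pi}"
    by (rule has_integral_integral_lebesgue_on) (use i1 i2 in auto)
  ultimately have "integral\<^sup>L (lebesgue_on {- pi..pi}) (\<lambda>t. f' t * trig m t + \<i> * of_int m * (f t * trig m t)) = 0"
    using e by (simp add: trig_pi_eq has_integral_unique)
  then show ?thesis using i1 i2 by (simp add: add_eq_0_iff)
qed

text \<open>In the variable \<open>\<tau> = t - s\<close>, a period centred at 0 stays inside the
  strip of the smooth extension and meets the diagonal only at \<open>\<tau> = 0\<close>. Two
  integrations by parts lead to the second derivative, whose coefficients Bessel's inequality bounds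
  uniformly in \<open>s\<close>.\<close>

lemma reg_kernel_bounds:
  assumes reg: "regular_closed_C3_curve \<gamma>"
  obtains B where "B \<ge> 0" "\<And>t s. s \<in> {0..2*pi} \<Longrightarrow> \<bar>reg_kernel \<gamma> t s\<bar> \<le> B"
    "\<And>F s. finite F \<Longrightarrow> s \<in> {0..2*pi} \<Longrightarrow>
      (\<Sum>j\<in>F. (1 + (real_of_int j)\<^sup>2)\<^sup>2 * (cmod (fourier_coeff (\<lambda>t. of_real (reg_kernel \<gamma> t s)) j))\<^sup>2) \<le> B"
proof -
  have per: "\<And>t. \<gamma> (t + 2 * pi) = \<gamma> t" using reg by (auto simp: regular_closed_C3_curve_def)
  note rper = reg_kernel_periodic[of \<gamma>, OF per]
  obtain D0 D1 D2 where D: "\<And>s \<tau>. \<bar>\<tau>\<bar> < 2 * pi \<Longrightarrow> (D0 s has_real_derivative D1 s \<tau>) (at \<tau>)"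
    "\<And>s \<tau>. \<bar>\<tau>\<bar> < 2 * pi \<Longrightarrow> (D1 s has_real_derivative D2 s \<tau>) (at \<tau>)"
    and cD: "continuous_on strip (\<lambda>(s, \<tau>). D0 s \<tau>)" "continuous_on strip (\<lambda>(s, \<tau>). D1 s \<tau>)" "continuous_on strip (\<lambda>(s, \<tau>). D2 s \<tau>)"
    and eq: "\<And>s \<tau>. 0 < \<bar>\<tau>\<bar> \<Longrightarrow> \<bar>\<tau>\<bar> < 2 * pi \<Longrightarrow> D0 s \<tau> = reg_kernel \<gamma> (s + \<tau>) s"
    using reg_kernel_smooth[OF reg] by blast
  let ?R = "{0..2*pi} \<times> {- pi..pi}"
  have "- (2 * pi) < b" "b < 2 * pi" if "- pi \<le> b" "b \<le> pi" for b
    using that pi_gt_zero by linarith+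
  then have sub: "?R \<subseteq> strip" by auto
  have bdd: "\<exists>C. \<forall>s\<in>{0..2*pi}. \<forall>\<tau>\<in>{- pi..pi}. \<bar>f s \<tau>\<bar> \<le> C" if "continuous_on strip (\<lambda>(s, \<tau>). f s \<tau>)" for f :: "real \<Rightarrow> real \<Rightarrow> real"
  proof -
    have "compact ((\<lambda>(s, \<tau>). f s \<tau>) ` ?R)"
      by (rule compact_continuous_image[OF continuous_on_subset[OF that sub]]) (intro compact_Times compact_Icc)
    then obtain C where C: "\<And>y. y \<in> (\<lambda>(s, \<tau>). f s \<tau>) ` ?R \<Longrightarrow> norm y \<le> C"
      using compact_imp_bounded bounded_iff by metis
    then have "\<bar>f s \<tau>\<bar> \<le> C" if "s \<in> {0..2*pi}" "\<tau> \<in> {- pi..pi}" for s \<tau>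
      using C[of "f s \<tau>"] that by force
    then show ?thesis by blast
  qed
  obtain C0 where C0: "\<And>s \<tau>. s \<in> {0..2*pi} \<Longrightarrow> \<tau> \<in> {- pi..pi} \<Longrightarrow> \<bar>D0 s \<tau>\<bar> \<le> C0" using bdd[OF cD(1)] by blast
  obtain C2 where C2: "\<And>s \<tau>. s \<in> {0..2*pi} \<Longrightarrow> \<tau> \<in> {- pi..pi} \<Longrightarrow> \<bar>D2 s \<tau>\<bar> \<le> C2" using bdd[OF cD(3)] by blast
  have C0p: "C0 \<ge> 0" using C0[of 0 0] by auto
  have bound: "\<bar>reg_kernel \<gamma> t s\<bar> \<le> C0" if s: "s \<in> {0..2*pi}" for t s
  proof -
    obtain n t' where t': "t - s + pi = t' + 2 * pi * of_int n" "0 \<le> t'" "t' < 2 * pi" by (rule periodic_mod_2pi)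
    define \<tau> where "\<tau> = t' - pi"
    have "t = s + \<tau> + 2 * pi * of_int n" using t'(1) by (simp add: \<tau>_def algebra_simps)
    then have r: "reg_kernel \<gamma> t s = reg_kernel \<gamma> (s + \<tau>) s"
      using periodic_int[of "\<lambda>t. reg_kernel \<gamma> t s", OF rper(1)] by simp
    have tau: "\<tau> \<in> {- pi..pi}" using t' by (auto simp: \<tau>_def)
    show ?thesis
    \<comment> \<open>On the diagonal the kernel has its junk value 0 instead of the value of
      \<open>D0\<close>, and 0 is within the nonnegative bound \<open>C0\<close>.\<close>
    proof (cases "\<tau> = 0")
      case True
      then show ?thesis using r C0p by (simp add: reg_kernel_def trig_def)
    next
      case False
      have "\<bar>\<tau>\<bar> < 2 * pi" using tau pi_gt_zero by (auto simp: abs_less_iff simp del: pi_gt_zero)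
      then have "D0 s \<tau> = reg_kernel \<gamma> (s + \<tau>) s" using False by (intro eq) auto
      then show ?thesis using C0[OF s tau] r by simp
    qed
  qed
  have coef: "(\<Sum>j\<in>F. (1 + (real_of_int j)\<^sup>2)\<^sup>2 * (cmod (fourier_coeff (\<lambda>t. of_real (reg_kernel \<gamma> t s)) j))\<^sup>2)
      \<le> 4 * pi * (C0\<^sup>2 + C2\<^sup>2)" if F: "finite F" and s: "s \<in> {0..2*pi}" for F s
  proof -
    let ?d0 = "\<lambda>\<tau>. complex_of_real (D0 s \<tau>)" and ?d1 = "\<lambda>\<tau>. complex_of_real (D1 s \<tau>)" and ?d2 = "\<lambda>\<tau>. complex_of_real (D2 s \<tau>)"
    have lt: "\<bar>\<tau>\<bar> < 2 * pi" if "\<tau> \<in> {- pi..pi}" for \<tau>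
      using that pi_gt_zero by (auto simp: abs_less_iff simp del: pi_gt_zero)
    have cs: "continuous_on {- pi..pi} (\<lambda>\<tau>. complex_of_real (f s \<tau>))" if "continuous_on strip (\<lambda>(s, \<tau>). f s \<tau>)" for f :: "real \<Rightarrow> real \<Rightarrow> real"
    proof (rule continuous_on_of_real)
      have "continuous_on {- pi..pi} (\<lambda>\<tau>. (\<lambda>(s, \<tau>). f s \<tau>) (s, \<tau>))"
      proof (rule continuous_on_compose2[OF that])
        show "(\<lambda>\<tau>. (s, \<tau>)) ` {- pi..pi} \<subseteq> strip" by (rule subset_trans[OF _ sub]) (use s in auto)
      qed (intro continuous_intros)
      then show "continuous_on {- pi..pi} (f s)" by simp
    qed
    have vd: "(?d0 has_vector_derivative ?d1 \<tau>) (at \<tau>)" "(?d1 has_vector_derivative ?d2 \<tau>) (at \<tau>)" if "\<tau> \<in> {- pi..pi}" for \<tau>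
      using D[OF lt[OF that], of s] by (auto intro!: has_vector_derivative_of_real simp: has_real_derivative_iff_has_vector_derivative)
    \<comment> \<open>The smooth extension inherits the period of the kernel where both arguments
      are off the diagonal. At \<open>- pi\<close> this and its differentiated form
      \<open>e1\<close> cancel the boundary terms.\<close>
    have shift: "D0 s (\<tau> + 2 * pi) = D0 s \<tau>" if "- (2 * pi) < \<tau>" "\<tau> < 0" for \<tau>
      using eq[of "\<tau> + 2 * pi" s] eq[of \<tau> s] rper(1)[of "s + \<tau>" s] that by (simp add: algebra_simps)
    have e0: "D0 s pi = D0 s (- pi)" using shift[of "- pi"] by simp
    have e1: "D1 s pi = D1 s (- pi)"
    proof (rule DERIV_unique)
      show "(D0 s has_real_derivative D1 s (- pi)) (at (- pi))" by (rule D) simp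
      have "((\<lambda>\<tau>. D0 s (\<tau> + 2 * pi)) has_real_derivative D1 s pi) (at (- pi))"
        using D(1)[of pi s] DERIV_shift[of "D0 s" "D1 s pi" "- pi" "2 * pi"] by simp
      then show "(D0 s has_real_derivative D1 s pi) (at (- pi))"
        by (rule has_field_derivative_transform_within_open[where S = "{- (2 * pi)<..<0}"]) (auto intro: shift)
    qed
    define I0 I2 where "I0 j = integral\<^sup>L (lebesgue_on {- pi..pi}) (\<lambda>t. ?d0 t * trig (- j) t)"
      and "I2 j = integral\<^sup>L (lebesgue_on {- pi..pi}) (\<lambda>t. ?d2 t * trig (- j) t)" for j
    have I2: "cmod (I2 j) = (real_of_int j)\<^sup>2 * cmod (I0 j)" for j
    proof -
      have "I2 j = - (\<i> * of_int (- j)) * (- (\<i> * of_int (- j)) * I0 j)"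
        unfolding I0_def I2_def
        using interval_pi_by_parts[of ?d0 ?d1 "- j", OF vd(1) cs[OF cD(2)]] interval_pi_by_parts[of ?d1 ?d2 "- j", OF vd(2) cs[OF cD(3)]] e0 e1
        by simp
      then show ?thesis by (simp add: norm_mult power2_eq_square abs_mult flip: of_int_mult)
    qed
    have I0: "cmod (fourier_coeff (\<lambda>t. of_real (reg_kernel \<gamma> t s)) j) = cmod (I0 j) / sqrt (2 * pi)" for j
    proof -
      let ?h = "\<lambda>t. complex_of_real (reg_kernel \<gamma> t s) * trig (- j) t"
      have hm: "?h \<in> borel_measurable borel"
        using reg_kernel_borel_measurable[OF regular_closed_C3_curve_continuous[OF reg], of s] borel_measurable_trig by measurable
      have int: "integrable circ_measure ?h"
        by (rule integrable_circ_bounded(1)[OF borel_imp_circ_measurable[OF hm], of C0]) (use bound[OF s] in \<open>simp add: norm_mult\<close>)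
      have hp: "?h (t + 2 * pi) = ?h t" for t by (simp add: rper trig_periodic)
      have "has_bochner_integral (lebesgue_on {- pi + s..pi + s}) ?h (LINT t|circ_measure. ?h t)"
        using has_bochner_integral_periodic_interval(2)[OF int hp, of "- pi + s"] by (simp add: algebra_simps)
      then have "has_bochner_integral (lebesgue_on {- pi..pi}) (\<lambda>t. ?h (t + s)) (LINT t|circ_measure. ?h t)"
        by (subst (asm) has_bochner_integral_lebesgue_on_shift)
      then have "(LINT t|circ_measure. ?h t) = integral\<^sup>L (lebesgue_on {- pi..pi}) (\<lambda>t. ?h (t + s))"
        by (simp add: has_bochner_integral_iff)
      also have "\<dots> = integral\<^sup>L (lebesgue_on {- pi..pi}) (\<lambda>t. trig (- j) s * (?d0 t * trig (- j) t))"
      proof (rule integral_cong_AE)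
        have m: "(\<lambda>t. ?h (t + s)) \<in> borel_measurable borel" using hm by measurable
        have "(\<lambda>t. ?h (t + s)) \<in> borel_measurable lebesgue" using measurable_completion m by (metis measurable_lborel2)
        then show "(\<lambda>t. ?h (t + s)) \<in> borel_measurable (lebesgue_on {- pi..pi})" by (rule measurable_restrict_space1)
        show "(\<lambda>t. trig (- j) s * (?d0 t * trig (- j) t)) \<in> borel_measurable (lebesgue_on {- pi..pi})"
          by (intro continuous_imp_measurable_on_sets_lebesgue continuous_intros cs[OF cD(1)]) auto
        have "AE t in lebesgue. t \<notin> {0::real}" by (rule AE_not_in) simp
        then have "AE t in lebesgue_on {- pi..pi}. t \<notin> {0}" by (subst AE_restrict_space_iff) auto
        then show "AE t in lebesgue_on {- pi..pi}. ?h (t + s) = trig (- j) s * (?d0 t * trig (- j) t)"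
          using AE_space
        proof eventually_elim
          case (elim t)
          then have "D0 s t = reg_kernel \<gamma> (s + t) s" using lt[of t] by (intro eq) auto
          then show ?case by (simp add: trig_add add.commute mult_ac)
        qed
      qed
      also have "\<dots> = trig (- j) s * I0 j" by (simp add: I0_def)
      finally show ?thesis by (simp add: fourier_coeff_trig norm_divide norm_mult)
    qed
    have b0: "(\<Sum>j\<in>F. (cmod (I0 j))\<^sup>2) \<le> (2 * pi * C0)\<^sup>2"
      unfolding I0_def by (rule interval_pi_bessel[OF cs[OF cD(1)] _ F]) (use C0[OF s] in simp)
    have b2: "(\<Sum>j\<in>F. (cmod (I2 j))\<^sup>2) \<le> (2 * pi * C2)\<^sup>2"
      unfolding I2_def by (rule interval_pi_bessel[OF cs[OF cD(3)] _ F]) (use C2[OF s] in simp)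
    have "(\<Sum>j\<in>F. (1 + (real_of_int j)\<^sup>2)\<^sup>2 * (cmod (fourier_coeff (\<lambda>t. of_real (reg_kernel \<gamma> t s)) j))\<^sup>2)
      \<le> (\<Sum>j\<in>F. ((cmod (I0 j))\<^sup>2 + (cmod (I2 j))\<^sup>2) / pi)"
    proof (rule sum_mono)
      fix j
      \<comment> \<open>From \<open>2 * j^2 \<le> 1 + j^4\<close>, so that the bounds for
        \<open>I0\<close> and \<open>I2\<close> suffice.\<close>
      have "(1 + (real_of_int j)\<^sup>2)\<^sup>2 \<le> 2 * (1 + ((real_of_int j)\<^sup>2)\<^sup>2)"
        using sum_squares_bound[of 1 "(real_of_int j)\<^sup>2"] by (simp add: power2_sum)
      then have "(1 + (real_of_int j)\<^sup>2)\<^sup>2 * (cmod (I0 j))\<^sup>2 \<le> 2 * (1 + ((real_of_int j)\<^sup>2)\<^sup>2) * (cmod (I0 j))\<^sup>2"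
        by (intro mult_right_mono) auto
      then show "(1 + (real_of_int j)\<^sup>2)\<^sup>2 * (cmod (fourier_coeff (\<lambda>t. of_real (reg_kernel \<gamma> t s)) j))\<^sup>2
          \<le> ((cmod (I0 j))\<^sup>2 + (cmod (I2 j))\<^sup>2) / pi"
        by (simp add: I0 I2 power_divide power_mult_distrib field_simps)
    qed
    also have "\<dots> = ((\<Sum>j\<in>F. (cmod (I0 j))\<^sup>2) + (\<Sum>j\<in>F. (cmod (I2 j))\<^sup>2)) / pi"
      by (simp add: sum.distrib sum_divide_distrib[symmetric])
    also have "\<dots> \<le> ((2 * pi * C0)\<^sup>2 + (2 * pi * C2)\<^sup>2) / pi"
      using b0 b2 by (intro divide_right_mono) auto
    also have "\<dots> = 4 * pi * (C0\<^sup>2 + C2\<^sup>2)" by (simp add: power_mult_distrib power2_eq_square field_simps)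
    finally show ?thesis .
  qed
  show thesis
  proof
    show "0 \<le> max C0 (4 * pi * (C0\<^sup>2 + C2\<^sup>2))" using C0p by simp
    show "\<bar>reg_kernel \<gamma> t s\<bar> \<le> max C0 (4 * pi * (C0\<^sup>2 + C2\<^sup>2))" if "s \<in> {0..2*pi}" for t s
      using bound[OF that] by (simp add: le_max_iff_disj)
    show "(\<Sum>j\<in>F. (1 + (real_of_int j)\<^sup>2)\<^sup>2 * (cmod (fourier_coeff (\<lambda>t. of_real (reg_kernel \<gamma> t s)) j))\<^sup>2)
      \<le> max C0 (4 * pi * (C0\<^sup>2 + C2\<^sup>2))" if "finite F" "s \<in> {0..2*pi}" for F s
      using coef[OF that] by (simp add: le_max_iff_disj)
  qed
qed

lemma reg_kernel_bounded:
  assumes "regular_closed_C3_curve \<gamma>"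
  shows "\<exists>B. \<forall>t. \<forall>s\<in>{0..2*pi}. \<bar>reg_kernel \<gamma> t s\<bar> \<le> B"
  by (rule reg_kernel_bounds[OF assms]) blast

text \<open>Off the diagonal the regular kernel is \<open>- 1 / pi\<close> times the logarithm of
  the ratio of the chords of the curve and of the circle, so its upper bound \<open>B\<close> keeps
  that ratio above \<open>exp (- pi * B)\<close>. The factor 2 converts the sine into the circle
  chord.\<close>

lemma chord_arc_regular:
  assumes reg: "regular_closed_C3_curve \<gamma>"
  obtains c where "chord_arc \<gamma> c"
proof -
  have per: "\<And>t. \<gamma> (t + 2 * pi) = \<gamma> t" and inj: "inj_on \<gamma> {0..<2*pi}"
    using reg by (auto simp: regular_closed_C3_curve_def)
  obtain B where B: "\<And>t s. s \<in> {0..2*pi} \<Longrightarrow> \<bar>reg_kernel \<gamma> t s\<bar> \<le> B"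
    using reg_kernel_bounded[OF reg] by blast
  have "2 * exp (- pi * B) * \<bar>sin ((t - s) / 2)\<bar> \<le> cmod (\<gamma> t - \<gamma> s)" for t s
  proof -
    obtain n s' where s': "s = s' + 2 * pi * of_int n" "0 \<le> s'" "s' < 2 * pi" by (rule periodic_mod_2pi)
    have gs: "\<gamma> s = \<gamma> s'" using periodic_int[of \<gamma>, OF per] by (simp add: s'(1))
    have "trig 1 (t - s + 2 * pi * of_int n) = trig 1 (t - s)" by (rule periodic_int) (rule trig_periodic)
    then have tr: "trig 1 (t - s') = trig 1 (t - s)" by (simp add: s'(1) algebra_simps)
    show ?thesis
    proof (cases "1 - trig 1 (t - s') = 0")
      case True
      then have "cmod (1 - trig 1 (t - s)) = 0" by (simp add: tr)
      then show ?thesis unfolding cmod_one_minus_trig by simp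
    next
      case False
      have ne: "\<gamma> t \<noteq> \<gamma> s'"
      proof
        assume e: "\<gamma> t = \<gamma> s'"
        obtain m t' where t': "t - s' = t' + 2 * pi * of_int m" "0 \<le> t'" "t' < 2 * pi" by (rule periodic_mod_2pi)
        have "\<gamma> (s' + t' + 2 * pi * of_int m) = \<gamma> (s' + t')" by (rule periodic_int) (rule per)
        moreover have "s' + t' + 2 * pi * of_int m = t" using t'(1) by simp
        ultimately have "\<gamma> (s' + t') = \<gamma> s'" using e by simp
        then have "s' + t' = s'" by (rule periodic_inj[OF per inj]) (use t' in simp)
        then have "t - s' = 0 + 2 * pi * of_int m" using t'(1) by simp
        moreover have "trig 1 (0 + 2 * pi * of_int m) = trig 1 0" by (rule periodic_int) (rule trig_periodic)
        ultimately show False using False by (simp add: trig_def)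
      qed
      have "reg_kernel \<gamma> t s' \<le> B" using B[of s' t] s' by auto
      then have "- (ln (cmod (\<gamma> t - \<gamma> s')) - ln (cmod (1 - trig 1 (t - s')))) \<le> pi * B"
        by (simp add: reg_kernel_def field_simps)
      then have "ln (cmod (1 - trig 1 (t - s'))) + - pi * B \<le> ln (cmod (\<gamma> t - \<gamma> s'))" by simp
      then have "exp (ln (cmod (1 - trig 1 (t - s'))) + - pi * B) \<le> exp (ln (cmod (\<gamma> t - \<gamma> s')))" by (simp only: exp_le_cancel_iff)
      then have "cmod (1 - trig 1 (t - s')) * exp (- pi * B) \<le> cmod (\<gamma> t - \<gamma> s')"
        using False ne by (simp only: exp_add exp_ln zero_less_norm_iff right_minus_eq not_False_eq_True)
      then show ?thesis using tr gs cmod_one_minus_trig[of "t - s"] by (simp add: mult_ac)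
    qed
  qed
  then have "chord_arc \<gamma> (2 * exp (- pi * B))"
    using regular_closed_C3_curve_continuous[OF reg] by (simp add: chord_arc_def)
  then show thesis by (rule that)
qed

lemma cmod_trig_diff: "cmod (trig 1 t - trig 1 s) = cmod (1 - trig 1 (t - s))"
proof -
  have "trig 1 t = trig 1 s * trig 1 (t - s)" by (simp flip: trig_add)
  then have "trig 1 t - trig 1 s = - (trig 1 s * (1 - trig 1 (t - s)))" by (simp add: right_diff_distrib)
  then show ?thesis by (simp add: norm_mult)
qed

lemma chord_arc_trig: "chord_arc (trig 1) 2"
  by (simp add: chord_arc_def continuous_on_trig cmod_trig_diff cmod_one_minus_trig)

lemma curve_bounded:
  assumes "continuous_on UNIV \<gamma>" and "\<And>t. \<gamma> (t + 2 * pi) = \<gamma> t"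
  obtains R where "R > 0" "\<And>t. cmod (\<gamma> t) \<le> R"
proof -
  have "compact (\<gamma> ` {0..2*pi})"
    by (intro compact_continuous_image continuous_on_subset[OF assms(1)]) auto
  then obtain R where R: "R > 0" "\<And>t. t \<in> {0..2*pi} \<Longrightarrow> cmod (\<gamma> t) \<le> R"
    using compact_imp_bounded bounded_pos by (metis imageI)
  have "cmod (\<gamma> t) \<le> R" for t
  proof -
    obtain n t' where t': "t = t' + 2 * pi * of_int n" "0 \<le> t'" "t' < 2 * pi" by (rule periodic_mod_2pi)
    have "\<gamma> t = \<gamma> t'" using periodic_int[of \<gamma>, OF assms(2)] by (simp add: t'(1))
    then show ?thesis using R(2)[of t'] t' by simp
  qed
  with R(1) show thesis by (rule that)
qed

section \<open>Double integrals over the parameter square\<close>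

interpretation circ: finite_measure circ_measure by (rule finite_circ_measure)
interpretation circ2: pair_sigma_finite circ_measure circ_measure by standard
interpretation circ2f: finite_measure "circ_measure \<Otimes>\<^sub>M circ_measure"
  by (rule finite_measure_pair_measure) (rule finite_circ_measure)+

lemma circ_borel_id: "(\<lambda>t. t) \<in> measurable circ_measure borel"
  by (rule borel_imp_circ_measurable) simp

lemma borel_pair_imp_circ_measurable:
  assumes "f \<in> borel_measurable (borel \<Otimes>\<^sub>M borel)"
  shows "f \<in> borel_measurable (circ_measure \<Otimes>\<^sub>M circ_measure)"
proof -
  have "(\<lambda>p. p) \<in> measurable (circ_measure \<Otimes>\<^sub>M circ_measure) (borel \<Otimes>\<^sub>M borel)"
    using measurable_Pair[OF measurable_compose[OF measurable_fst circ_borel_id] measurable_compose[OF measurable_snd circ_borel_id]]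
    by simp
  from measurable_compose[OF this assms] show ?thesis by simp
qed

lemma circ_Fubini_bounded:
  fixes f :: "real \<Rightarrow> real \<Rightarrow> complex"
  assumes "(\<lambda>p. f (fst p) (snd p)) \<in> borel_measurable (circ_measure \<Otimes>\<^sub>M circ_measure)"
    and "\<And>t s. t \<in> {0..2*pi} \<Longrightarrow> s \<in> {0..2*pi} \<Longrightarrow> cmod (f t s) \<le> B"
  shows "(LINT t|circ_measure. LINT s|circ_measure. f t s) = (LINT s|circ_measure. LINT t|circ_measure. f t s)"
proof -
  have "integrable (circ_measure \<Otimes>\<^sub>M circ_measure) (\<lambda>p. f (fst p) (snd p))"
    by (rule circ2f.integrable_const_bound[of _ B])
       (use assms in \<open>auto intro!: AE_I2 simp: space_pair_measure\<close>)
  then have "integrable (circ_measure \<Otimes>\<^sub>M circ_measure) (case_prod f)" by (simp add: split_beta')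
  then show ?thesis by (rule circ2.Fubini_integral[symmetric])
qed

definition reg_matrix :: "(real \<Rightarrow> complex) \<Rightarrow> int \<Rightarrow> int \<Rightarrow> complex" where
  "reg_matrix \<gamma> j k = fourier_coeff (\<lambda>t. LINT s|circ_measure. of_real (reg_kernel \<gamma> t s) * (trig k s / sq2pi)) j"

text \<open>The eigenvalues of Symm's operator of the unit circle. The value 0 at
  \<open>k = 0\<close> says that it annihilates constants, and it forces the separate treatment of
  the zeroth coefficient in \<open>null_sequence_regularity\<close> and
  \<open>symm_op_coercive\<close>.\<close>

definition log_mult :: "int \<Rightarrow> real" where
  "log_mult k = (if k = 0 then 0 else 1 / real_of_int \<bar>k\<bar>)"

lemma fourier_coeff_sum:
  assumes "\<And>i. i \<in> I \<Longrightarrow> integrable circ_measure (f i)"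
  shows "fourier_coeff (\<lambda>t. \<Sum>i\<in>I. c i * f i t) j = (\<Sum>i\<in>I. c i * fourier_coeff (f i) j)"
proof -
  have "(LINT t|circ_measure. (\<Sum>i\<in>I. c i * f i t) * trig (- j) t) = (LINT t|circ_measure. (\<Sum>i\<in>I. c i * (f i t * trig (- j) t)))"
    by (simp add: sum_distrib_right mult.assoc)
  also have "\<dots> = (\<Sum>i\<in>I. c i * (LINT t|circ_measure. f i t * trig (- j) t))"
    by (subst Bochner_Integration.integral_sum) (auto intro!: integrable_mult_right integrable_mult_trig assms)
  finally show ?thesis by (simp add: fourier_coeff_trig sum_divide_distrib)
qed

context
  fixes \<gamma> :: "real \<Rightarrow> complex"
  assumes reg: "regular_closed_C3_curve \<gamma>"
begin

lemma curve_periodic: "\<gamma> (t + 2 * pi) = \<gamma> t"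
  using reg by (simp add: regular_closed_C3_curve_def)

lemma curve_continuous: "continuous_on A \<gamma>"
  using regular_closed_C3_curve_continuous[OF reg] by (rule continuous_on_subset) simp

lemma curve_measurable: "\<gamma> \<in> borel_measurable borel"
  by (rule borel_measurable_continuous_onI) (rule curve_continuous)

lemma reg_kernel_circ_measurable: "(\<lambda>t. complex_of_real (reg_kernel \<gamma> t s)) \<in> borel_measurable circ_measure"
  "(\<lambda>s. complex_of_real (reg_kernel \<gamma> t s)) \<in> borel_measurable circ_measure"
  using reg_kernel_borel_measurable[OF curve_continuous]
  by (auto intro!: borel_imp_circ_measurable borel_measurable_of_real simp: reg_kernel_commute[of _ t])

lemma reg_matrix_integrand_measurable:
  "(\<lambda>p. complex_of_real (reg_kernel \<gamma> (fst p) (snd p)) * trig k (snd p) * trig j (fst p)) \<in> borel_measurable (circ_measure \<Otimes>\<^sub>M circ_measure)"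
proof (rule borel_pair_imp_circ_measurable)
  have [measurable]: "(\<lambda>p. reg_kernel \<gamma> (fst p) (snd p)) \<in> borel_measurable (borel \<Otimes>\<^sub>M borel)"
    by (rule reg_kernel_pair_measurable) (rule curve_continuous)
  show "(\<lambda>p. complex_of_real (reg_kernel \<gamma> (fst p) (snd p)) * trig k (snd p) * trig j (fst p)) \<in> borel_measurable (borel \<Otimes>\<^sub>M borel)"
    by measurable
qed

lemma reg_matrix_double_integral:
  "reg_matrix \<gamma> j k = (LINT t|circ_measure. LINT s|circ_measure. of_real (reg_kernel \<gamma> t s) * trig k s * trig (- j) t) / (2 * pi)"
proof -
  have "reg_matrix \<gamma> j k = (LINT t|circ_measure. (LINT s|circ_measure. of_real (reg_kernel \<gamma> t s) * trig k s * trig (- j) t) / sq2pi) / sq2pi"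
    unfolding reg_matrix_def fourier_coeff_trig by simp
  also have "\<dots> = (LINT t|circ_measure. LINT s|circ_measure. of_real (reg_kernel \<gamma> t s) * trig k s * trig (- j) t) / (sq2pi * sq2pi)"
    by (simp del: of_real_mult)
  finally show ?thesis unfolding sq2pi_sq by simp
qed

lemma reg_matrix_Fubini:
  "(LINT t|circ_measure. LINT s|circ_measure. of_real (reg_kernel \<gamma> t s) * trig k s * trig j t)
    = (LINT s|circ_measure. LINT t|circ_measure. of_real (reg_kernel \<gamma> t s) * trig k s * trig j t)"
proof -
  obtain B where B: "\<And>t s. s \<in> {0..2*pi} \<Longrightarrow> \<bar>reg_kernel \<gamma> t s\<bar> \<le> B"
    using reg_kernel_bounded[OF reg] by blast
  show ?thesis
    by (rule circ_Fubini_bounded[OF reg_matrix_integrand_measurable, where B = B]) (use B in \<open>simp add: norm_mult\<close>)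
qed

text \<open>Exchanging the variables of the symmetric kernel exchanges the frequencies
  \<open>- j\<close> and \<open>k\<close>.\<close>

lemma reg_matrix_symmetric: "reg_matrix \<gamma> (- k) (- j) = reg_matrix \<gamma> j k"
proof -
  have "(LINT t|circ_measure. LINT s|circ_measure. of_real (reg_kernel \<gamma> t s) * trig (- j) s * trig k t)
     = (LINT t|circ_measure. LINT s|circ_measure. of_real (reg_kernel \<gamma> s t) * trig k t * trig (- j) s)"
    by (simp add: reg_kernel_commute mult_ac)
  also have "\<dots> = (LINT s|circ_measure. LINT t|circ_measure. of_real (reg_kernel \<gamma> s t) * trig k t * trig (- j) s)"
    by (rule reg_matrix_Fubini[symmetric])
  finally show ?thesis unfolding reg_matrix_double_integral by simp
qed

text \<open>For fixed \<open>j\<close>, Bessel's inequality in \<open>s\<close> bounds the sum over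
  \<open>k\<close> by the integral of the squared coefficient in \<open>t\<close>; for fixed
  \<open>s\<close>, the weighted sum of these squares over \<open>j\<close> is at most
  \<open>B\<close>.\<close>

lemma reg_matrix_row_bound:
  obtains B where "B \<ge> 0" "\<And>F F'. finite F \<Longrightarrow> finite F' \<Longrightarrow>
    (\<Sum>j\<in>F. \<Sum>k\<in>F'. (1 + (real_of_int j)\<^sup>2)\<^sup>2 * (cmod (reg_matrix \<gamma> j k))\<^sup>2) \<le> B"
proof -
  obtain B where B0: "B \<ge> 0" and B: "\<And>t s. s \<in> {0..2*pi} \<Longrightarrow> \<bar>reg_kernel \<gamma> t s\<bar> \<le> B"
    and C: "\<And>F s. finite F \<Longrightarrow> s \<in> {0..2*pi} \<Longrightarrow>
      (\<Sum>j\<in>F. (1 + (real_of_int j)\<^sup>2)\<^sup>2 * (cmod (fourier_coeff (\<lambda>t. of_real (reg_kernel \<gamma> t s)) j))\<^sup>2) \<le> B"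
    using reg_kernel_bounds[OF reg] by blast
  define q where "q j s = fourier_coeff (\<lambda>t. of_real (reg_kernel \<gamma> t s)) j" for j s
  have qm: "q j \<in> borel_measurable circ_measure" for j
  proof -
    have "(\<lambda>p. complex_of_real (reg_kernel \<gamma> (snd p) (fst p)) * trig (- j) (snd p)) \<in> borel_measurable (circ_measure \<Otimes>\<^sub>M circ_measure)"
      using reg_matrix_integrand_measurable[of "- j" 0] by (simp add: reg_kernel_commute)
    then have "(\<lambda>(s, t). complex_of_real (reg_kernel \<gamma> t s) * trig (- j) t) \<in> borel_measurable (circ_measure \<Otimes>\<^sub>M circ_measure)"
      by (simp add: split_beta')
    then have "(\<lambda>s. LINT t|circ_measure. complex_of_real (reg_kernel \<gamma> t s) * trig (- j) t) \<in> borel_measurable circ_measure"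
      by (rule circ.borel_measurable_lebesgue_integral)
    then show ?thesis unfolding q_def fourier_coeff_trig by measurable
  qed
  have qB: "cmod (q j s) \<le> sqrt (2 * pi) * B" if "s \<in> {0..2*pi}" for j s
  proof -
    have s: "sqi circ_measure (\<lambda>t. complex_of_real (reg_kernel \<gamma> t s))"
      by (rule sqi_bounded[OF finite_circ_measure, of _ B]) (use B[OF that] in \<open>auto intro!: reg_kernel_circ_measurable\<close>)
    have "nrm circ_measure (\<lambda>t. complex_of_real (reg_kernel \<gamma> t s)) \<le> sqrt (2 * pi) * B"
      by (rule nrm_circ_bounded) (use B[OF that] B0 in \<open>auto intro!: reg_kernel_circ_measurable\<close>)
    then show ?thesis using norm_fourier_coeff_le[OF s, of j] by (simp add: q_def)
  qed
  have qs: "sqi circ_measure (q j)" for j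
    by (rule sqi_bounded[OF finite_circ_measure qm, of _ "sqrt (2 * pi) * B"]) (use qB in auto)
  have rm: "reg_matrix \<gamma> j k = fourier_coeff (q j) (- k)" for j k
  proof -
    have "reg_matrix \<gamma> j k = (LINT s|circ_measure. LINT t|circ_measure. of_real (reg_kernel \<gamma> t s) * trig k s * trig (- j) t) / (sq2pi * sq2pi)"
      unfolding reg_matrix_double_integral reg_matrix_Fubini sq2pi_sq by simp
    also have "(\<lambda>s. LINT t|circ_measure. of_real (reg_kernel \<gamma> t s) * trig k s * trig (- j) t)
        = (\<lambda>s. sq2pi * (q j s * trig k s))"
    proof
      fix s
      have "(LINT t|circ_measure. of_real (reg_kernel \<gamma> t s) * trig k s * trig (- j) t)
          = (LINT t|circ_measure. trig k s * (of_real (reg_kernel \<gamma> t s) * trig (- j) t))"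
        by (simp add: mult_ac)
      also have "\<dots> = sq2pi * (q j s * trig k s)" by (simp add: q_def fourier_coeff_trig)
      finally show "(LINT t|circ_measure. of_real (reg_kernel \<gamma> t s) * trig k s * trig (- j) t) = sq2pi * (q j s * trig k s)" .
    qed
    finally show ?thesis by (simp add: fourier_coeff_trig)
  qed
  show thesis
  proof (rule that[of "2 * pi * B"])
    show "0 \<le> 2 * pi * B" using B0 by simp
    fix F F' :: "int set" assume F: "finite F" "finite F'"
    have "(\<Sum>j\<in>F. \<Sum>k\<in>F'. (1 + (real_of_int j)\<^sup>2)\<^sup>2 * (cmod (reg_matrix \<gamma> j k))\<^sup>2)
        = (\<Sum>j\<in>F. (1 + (real_of_int j)\<^sup>2)\<^sup>2 * (\<Sum>k\<in>uminus ` F'. (cmod (fourier_coeff (q j) k))\<^sup>2))"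
      by (simp add: rm sum_distrib_left sum.reindex)
    also have "\<dots> \<le> (\<Sum>j\<in>F. (1 + (real_of_int j)\<^sup>2)\<^sup>2 * (nrm circ_measure (q j))\<^sup>2)"
      by (intro sum_mono mult_left_mono bessel qs) (use F in auto)
    also have "\<dots> = (LINT s|circ_measure. (\<Sum>j\<in>F. (1 + (real_of_int j)\<^sup>2)\<^sup>2 * (cmod (q j s))\<^sup>2))"
      unfolding nrm_sq using qs by (subst Bochner_Integration.integral_sum) (auto simp: sqi_def)
    also have "\<dots> \<le> (LINT s|circ_measure. B)"
    proof (rule integral_mono)
      show "integrable circ_measure (\<lambda>s. (\<Sum>j\<in>F. (1 + (real_of_int j)\<^sup>2)\<^sup>2 * (cmod (q j s))\<^sup>2))"
        using qs by (auto simp: sqi_def)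
      show "(\<Sum>j\<in>F. (1 + (real_of_int j)\<^sup>2)\<^sup>2 * (cmod (q j s))\<^sup>2) \<le> B" if "s \<in> space circ_measure" for s
        using C[OF F(1), of s] that by (simp add: q_def)
    qed simp
    finally show "(\<Sum>j\<in>F. \<Sum>k\<in>F'. (1 + (real_of_int j)\<^sup>2)\<^sup>2 * (cmod (reg_matrix \<gamma> j k))\<^sup>2) \<le> 2 * pi * B" by simp
  qed
qed

text \<open>Symmetry turns the row bound into the same bound with weight \<open>(1 + k^2)^2\<close>,
  and the mixed weight is at most the mean of the two.\<close>

lemma reg_matrix_bounds:
  obtains B where "B \<ge> 0"
    "\<And>F F'. finite F \<Longrightarrow> finite F' \<Longrightarrow> (\<Sum>j\<in>F. \<Sum>k\<in>F'. (1 + (real_of_int j)\<^sup>2)\<^sup>2 * (cmod (reg_matrix \<gamma> j k))\<^sup>2) \<le> B"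
    "\<And>F F'. finite F \<Longrightarrow> finite F' \<Longrightarrow> (\<Sum>j\<in>F. \<Sum>k\<in>F'. (1 + (real_of_int j)\<^sup>2) * (1 + (real_of_int k)\<^sup>2) * (cmod (reg_matrix \<gamma> j k))\<^sup>2) \<le> B"
proof -
  obtain B where B0: "B \<ge> 0" and B: "\<And>F F'. finite F \<Longrightarrow> finite F' \<Longrightarrow>
    (\<Sum>j\<in>F. \<Sum>k\<in>F'. (1 + (real_of_int j)\<^sup>2)\<^sup>2 * (cmod (reg_matrix \<gamma> j k))\<^sup>2) \<le> B"
    using reg_matrix_row_bound by blast
  show thesis
  proof (rule that[OF B0 B])
    fix F F' :: "int set" assume F: "finite F" "finite F'"
    have "(\<Sum>j\<in>F. \<Sum>k\<in>F'. (1 + (real_of_int k)\<^sup>2)\<^sup>2 * (cmod (reg_matrix \<gamma> j k))\<^sup>2)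
        = (\<Sum>k\<in>F'. \<Sum>j\<in>F. (1 + (real_of_int (- k))\<^sup>2)\<^sup>2 * (cmod (reg_matrix \<gamma> (- k) (- j)))\<^sup>2)"
      by (subst sum.swap) (simp add: reg_matrix_symmetric)
    also have "\<dots> = (\<Sum>k\<in>uminus ` F'. \<Sum>j\<in>uminus ` F. (1 + (real_of_int k)\<^sup>2)\<^sup>2 * (cmod (reg_matrix \<gamma> k j))\<^sup>2)"
      by (simp add: sum.reindex)
    also have "\<dots> \<le> B" using F by (intro B) auto
    finally have B': "(\<Sum>j\<in>F. \<Sum>k\<in>F'. (1 + (real_of_int k)\<^sup>2)\<^sup>2 * (cmod (reg_matrix \<gamma> j k))\<^sup>2) \<le> B" .
    have "(\<Sum>j\<in>F. \<Sum>k\<in>F'. (1 + (real_of_int j)\<^sup>2) * (1 + (real_of_int k)\<^sup>2) * (cmod (reg_matrix \<gamma> j k))\<^sup>2)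
        \<le> (\<Sum>j\<in>F. \<Sum>k\<in>F'. ((1 + (real_of_int j)\<^sup>2)\<^sup>2 * (cmod (reg_matrix \<gamma> j k))\<^sup>2 + (1 + (real_of_int k)\<^sup>2)\<^sup>2 * (cmod (reg_matrix \<gamma> j k))\<^sup>2) / 2)"
    proof (intro sum_mono)
      fix j k
      have "(1 + (real_of_int j)\<^sup>2) * (1 + (real_of_int k)\<^sup>2) \<le> ((1 + (real_of_int j)\<^sup>2)\<^sup>2 + (1 + (real_of_int k)\<^sup>2)\<^sup>2) / 2"
      proof -
        have "x * y \<le> (x\<^sup>2 + y\<^sup>2) / 2" for x y :: real using sum_squares_bound[of x y] by simp
        then show ?thesis .
      qed
      then have "(1 + (real_of_int j)\<^sup>2) * (1 + (real_of_int k)\<^sup>2) * (cmod (reg_matrix \<gamma> j k))\<^sup>2 \<le> ((1 + (real_of_int j)\<^sup>2)\<^sup>2 + (1 + (real_of_int k)\<^sup>2)\<^sup>2) / 2 * (cmod (reg_matrix \<gamma> j k))\<^sup>2"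
        by (rule mult_right_mono) simp
      then show "(1 + (real_of_int j)\<^sup>2) * (1 + (real_of_int k)\<^sup>2) * (cmod (reg_matrix \<gamma> j k))\<^sup>2
          \<le> ((1 + (real_of_int j)\<^sup>2)\<^sup>2 * (cmod (reg_matrix \<gamma> j k))\<^sup>2 + (1 + (real_of_int k)\<^sup>2)\<^sup>2 * (cmod (reg_matrix \<gamma> j k))\<^sup>2) / 2"
        by (simp only: add_divide_distrib ring_distribs times_divide_eq_left)
    qed
    also have "\<dots> \<le> B" using B[OF F] B' by (simp add: sum_divide_distrib[symmetric] sum.distrib)
    finally show "(\<Sum>j\<in>F. \<Sum>k\<in>F'. (1 + (real_of_int j)\<^sup>2) * (1 + (real_of_int k)\<^sup>2) * (cmod (reg_matrix \<gamma> j k))\<^sup>2) \<le> B" .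
  qed
qed

section \<open>Symm's operator on square-integrable functions\<close>

lemma symm_op_bounded:
  obtains C where "C > 0" "\<And>\<psi> t. sqi circ_measure \<psi> \<Longrightarrow> cmod (symm_op \<gamma> \<psi> t) \<le> C * nrm circ_measure \<psi>"
proof -
  obtain c where c: "chord_arc \<gamma> c" by (rule chord_arc_regular[OF reg])
  obtain R where R: "R > 0" "\<And>t. cmod (\<gamma> t) \<le> R" using curve_bounded[OF curve_continuous curve_periodic] by blast
  have R2: "cmod (\<gamma> t - \<gamma> s) \<le> 2 * R" for t s
    using norm_triangle_ineq4[of "\<gamma> t" "\<gamma> s"] R(2)[of t] R(2)[of s] by simp
  let ?C = "lsin_norm + sqrt (2 * pi) * (\<bar>ln (c / 2)\<bar> + \<bar>ln (2 * R)\<bar>)"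
  have l: "lsin_norm \<ge> 0" by (simp add: lsin_norm_def)
  show thesis
  \<comment> \<open>Adding 1 makes the constant strictly positive.\<close>
  proof (rule that[of "(?C + 1) / pi"])
    show "(?C + 1) / pi > 0" using l by (intro divide_pos_pos add_nonneg_pos) auto
    fix \<psi> t assume \<psi>: "sqi circ_measure \<psi>"
    note k = log_kernel_sqi[OF c R2, of t]
    have "cmod (symm_op \<gamma> \<psi> t) = 1 / pi * cmod (LINT s|circ_measure. \<psi> s * complex_of_real (ln (cmod (\<gamma> t - \<gamma> s))))"
      by (simp add: symm_op_def norm_mult norm_divide)
    also have "\<dots> \<le> 1 / pi * (nrm circ_measure \<psi> * ?C)"
    proof (rule mult_left_mono)
      have "cmod (LINT s|circ_measure. \<psi> s * complex_of_real (ln (cmod (\<gamma> t - \<gamma> s)))) \<le> nrm circ_measure \<psi> * nrm circ_measure (\<lambda>s. of_real (ln (cmod (\<gamma> t - \<gamma> s))))"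
        by (rule Cauchy_Schwarz_sqi[OF \<psi> k(1)])
      also have "\<dots> \<le> nrm circ_measure \<psi> * ?C" by (rule mult_left_mono[OF k(2)]) simp
      finally show "cmod (LINT s|circ_measure. \<psi> s * complex_of_real (ln (cmod (\<gamma> t - \<gamma> s)))) \<le> nrm circ_measure \<psi> * ?C" .
    qed simp
    also have "\<dots> \<le> (?C + 1) / pi * nrm circ_measure \<psi>"
      by (simp add: field_simps)
    finally show "cmod (symm_op \<gamma> \<psi> t) \<le> (?C + 1) / pi * nrm circ_measure \<psi>" .
  qed
qed

lemma log_kernel_integrable:
  assumes "sqi circ_measure \<psi>"
  shows "integrable circ_measure (\<lambda>s. \<psi> s * complex_of_real (ln (cmod (z - \<gamma> s))))"
proof -
  obtain c where c: "chord_arc \<gamma> c" by (rule chord_arc_regular[OF reg])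
  obtain R where R: "R > 0" "\<And>t. cmod (\<gamma> t) \<le> R" using curve_bounded[OF curve_continuous curve_periodic] by blast
  have "cmod (z - \<gamma> s) \<le> cmod z + R" for s
    using norm_triangle_ineq4[of z "\<gamma> s"] R(2)[of s] by simp
  from log_kernel_sqi(1)[OF c this] show ?thesis by (rule sqi_mult_integrable[OF assms])
qed

lemma symm_op_measurable:
  assumes "sqi circ_measure \<psi>"
  shows "symm_op \<gamma> \<psi> \<in> borel_measurable circ_measure"
proof -
  have [measurable]: "\<gamma> \<in> borel_measurable borel" by (rule curve_measurable)
  have [measurable]: "(\<lambda>p. ln (cmod (\<gamma> (fst p) - \<gamma> (snd p)))) \<in> borel_measurable (circ_measure \<Otimes>\<^sub>M circ_measure)"
    by (rule borel_pair_imp_circ_measurable) measurable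
  have [measurable]: "\<psi> \<in> borel_measurable circ_measure" using assms by (simp add: sqi_def)
  have "(\<lambda>(t, s). \<psi> s * complex_of_real (ln (cmod (\<gamma> t - \<gamma> s)))) \<in> borel_measurable (circ_measure \<Otimes>\<^sub>M circ_measure)"
    unfolding split_beta' by measurable
  then have "(\<lambda>t. LINT s|circ_measure. \<psi> s * complex_of_real (ln (cmod (\<gamma> t - \<gamma> s)))) \<in> borel_measurable circ_measure"
    by (rule circ.borel_measurable_lebesgue_integral)
  then show ?thesis unfolding symm_op_def[abs_def] by measurable
qed

lemma symm_op_sqi:
  assumes "sqi circ_measure \<psi>"
  shows "sqi circ_measure (symm_op \<gamma> \<psi>)"
proof -
  obtain C where "C > 0" "\<And>\<psi> t. sqi circ_measure \<psi> \<Longrightarrow> cmod (symm_op \<gamma> \<psi> t) \<le> C * nrm circ_measure \<psi>"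
    using symm_op_bounded by blast
  then show ?thesis
    using assms by (intro sqi_bounded[OF finite_circ_measure symm_op_measurable, of _ "C * nrm circ_measure \<psi>"]) auto
qed

lemma symm_op_nrm_bounded:
  obtains C where "C > 0" "\<And>\<psi>. sqi circ_measure \<psi> \<Longrightarrow> nrm circ_measure (symm_op \<gamma> \<psi>) \<le> C * nrm circ_measure \<psi>"
proof -
  obtain C where C: "C > 0" "\<And>\<psi> t. sqi circ_measure \<psi> \<Longrightarrow> cmod (symm_op \<gamma> \<psi> t) \<le> C * nrm circ_measure \<psi>"
    using symm_op_bounded by blast
  show thesis
  proof (rule that[of "sqrt (2 * pi) * C"])
    show "nrm circ_measure (symm_op \<gamma> \<psi>) \<le> sqrt (2 * pi) * C * nrm circ_measure \<psi>" if "sqi circ_measure \<psi>" for \<psi>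
      using nrm_circ_bounded[OF symm_op_measurable[OF that] C(2)[OF that]] C(1) by (simp add: mult.assoc)
  qed (use C in simp)
qed

lemma symm_op_diff:
  assumes "sqi circ_measure \<psi>" "sqi circ_measure \<phi>"
  shows "symm_op \<gamma> (\<lambda>s. \<psi> s - \<phi> s) t = symm_op \<gamma> \<psi> t - symm_op \<gamma> \<phi> t"
  using log_kernel_integrable[OF assms(1), of "\<gamma> t"] log_kernel_integrable[OF assms(2), of "\<gamma> t"]
  by (simp add: symm_op_def left_diff_distrib right_diff_distrib)

lemma symm_op_sum:
  assumes "\<And>i. i \<in> I \<Longrightarrow> sqi circ_measure (f i)"
  shows "symm_op \<gamma> (\<lambda>s. \<Sum>i\<in>I. c i * f i s) t = (\<Sum>i\<in>I. c i * symm_op \<gamma> (f i) t)"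
proof -
  have "(LINT s|circ_measure. (\<Sum>i\<in>I. c i * f i s) * complex_of_real (ln (cmod (\<gamma> t - \<gamma> s))))
      = (LINT s|circ_measure. (\<Sum>i\<in>I. c i * (f i s * complex_of_real (ln (cmod (\<gamma> t - \<gamma> s))))))"
    by (simp add: sum_distrib_right mult.assoc)
  also have "\<dots> = (\<Sum>i\<in>I. c i * (LINT s|circ_measure. f i s * complex_of_real (ln (cmod (\<gamma> t - \<gamma> s)))))"
    by (subst Bochner_Integration.integral_sum) (auto intro!: log_kernel_integrable assms)
  finally show ?thesis by (simp add: symm_op_def sum_distrib_left mult_ac)
qed

lemma symm_op_cong_AE:
  assumes "\<psi> \<in> borel_measurable circ_measure" "\<phi> \<in> borel_measurable circ_measure" "AE t in circ_measure. \<psi> t = \<phi> t"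
  shows "symm_op \<gamma> \<psi> = symm_op \<gamma> \<phi>"
proof
  fix t
  have "(\<lambda>s. ln (cmod (\<gamma> t - \<gamma> s))) \<in> borel_measurable circ_measure" by (rule log_kernel_measurable) (rule curve_continuous)
  then have "(LINT s|circ_measure. \<psi> s * complex_of_real (ln (cmod (\<gamma> t - \<gamma> s)))) = (LINT s|circ_measure. \<phi> s * complex_of_real (ln (cmod (\<gamma> t - \<gamma> s))))"
    using assms by (intro integral_cong_AE) auto
  then show "symm_op \<gamma> \<psi> t = symm_op \<gamma> \<phi> t" by (simp add: symm_op_def)
qed

text \<open>The logarithm of the curve chord is split into the regular kernel and the logarithm of
  the circle chord. The latter depends only on \<open>t - s\<close>, so after a shift by
  \<open>t\<close> the exponential factors out and the known coefficients of the logarithm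
  remain.\<close>

lemma symm_op_trig:
  "symm_op \<gamma> (\<lambda>s. trig k s / sq2pi) t = of_real (log_mult k) * (trig k t / sq2pi)
    + (LINT s|circ_measure. of_real (reg_kernel \<gamma> t s) * (trig k s / sq2pi))"
proof -
  let ?l = "\<lambda>s. ln (cmod (1 - trig 1 (t - s)))"
  obtain B where B: "\<And>t s. s \<in> {0..2*pi} \<Longrightarrow> \<bar>reg_kernel \<gamma> t s\<bar> \<le> B"
    using reg_kernel_bounded[OF reg] by blast
  have st: "sqi circ_measure (\<lambda>s. trig k s / sq2pi)"
    using sqi_cmult[OF sqi_trig[of k], of "1 / sq2pi"] by simp
  have ir: "integrable circ_measure (\<lambda>s. complex_of_real (reg_kernel \<gamma> t s) * (trig k s / sq2pi))"
    by (intro sqi_mult_integrable st sqi_bounded[OF finite_circ_measure reg_kernel_circ_measurable(2), of _ B]) (use B in auto)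
  have "cmod (trig 1 t - trig 1 s) \<le> 2" for s
    using norm_triangle_ineq4[of "trig 1 t" "trig 1 s"] by simp
  from log_kernel_sqi(1)[OF chord_arc_trig this]
  have il: "integrable circ_measure (\<lambda>s. complex_of_real (?l s) * (trig k s / sq2pi))"
    unfolding cmod_trig_diff by (rule sqi_mult_integrable[OF _ st])
  have eq: "complex_of_real (- 1 / pi) * (trig k s / sq2pi * complex_of_real (ln (cmod (\<gamma> t - \<gamma> s))))
      = complex_of_real (reg_kernel \<gamma> t s) * (trig k s / sq2pi) + complex_of_real (- 1 / pi) * (complex_of_real (?l s) * (trig k s / sq2pi))" for s
    by (simp add: reg_kernel_def field_simps)
  have "symm_op \<gamma> (\<lambda>s. trig k s / sq2pi) t
     = (LINT s|circ_measure. complex_of_real (- 1 / pi) * (trig k s / sq2pi * complex_of_real (ln (cmod (\<gamma> t - \<gamma> s)))))"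
    by (simp only: symm_op_def integral_mult_right_zero)
  also have "\<dots> = (LINT s|circ_measure. of_real (reg_kernel \<gamma> t s) * (trig k s / sq2pi))
      + complex_of_real (- 1 / pi) * (LINT s|circ_measure. complex_of_real (?l s) * (trig k s / sq2pi))"
    unfolding eq using ir il
    by (subst Bochner_Integration.integral_add) (simp_all only: integral_mult_right_zero integrable_mult_right)
  also have "(LINT s|circ_measure. complex_of_real (?l s) * (trig k s / sq2pi))
      = (LINT s|circ_measure. complex_of_real (?l (s + t)) * (trig k (s + t) / sq2pi))"
  proof -
    have "trig 1 (t - (s + 2 * pi)) = trig 1 (t - s)" for s
      using trig_periodic[of 1 "t - (s + 2 * pi)"] by simp
    then show ?thesis using periodic_shift[OF il, of t] by (simp add: trig_periodic)
  qed
  also have "\<dots> = (trig k t / sq2pi) * (LINT s|circ_measure. of_real (ln (cmod (1 - trig 1 s))) * trig k s)"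
  proof -
    have "cmod (1 - trig 1 (- s)) = cmod (1 - trig 1 s)" for s
      by (simp add: cmod_one_minus_trig)
    then have "complex_of_real (?l (s + t)) * (trig k (s + t) / sq2pi) = (trig k t / sq2pi) * (of_real (ln (cmod (1 - trig 1 s))) * trig k s)" for s
      by (simp add: trig_add mult_ac)
    then show ?thesis by (simp only: integral_mult_right_zero)
  qed
  finally show ?thesis unfolding integral_ln_one_minus_trig(1)
    by (simp add: log_mult_def)
qed

lemma fourier_coeff_symm_op_trig:
  "fourier_coeff (symm_op \<gamma> (\<lambda>s. trig k s / sq2pi)) j = (if j = k then of_real (log_mult k) else 0) + reg_matrix \<gamma> j k"
proof -
  define e where "e = (\<lambda>s. trig k s / sq2pi)"
  define r where "r = (\<lambda>t. LINT s|circ_measure. of_real (reg_kernel \<gamma> t s) * e s)"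
  have se: "sqi circ_measure e"
    using sqi_cmult[OF sqi_trig[of k], of "1 / sq2pi"] by (simp add: e_def)
  have eq: "symm_op \<gamma> e t = of_real (log_mult k) * e t + r t" for t
    using symm_op_trig[of k t] unfolding e_def r_def .
  have "r = (\<lambda>t. symm_op \<gamma> e t - of_real (log_mult k) * e t)" by (simp add: eq)
  then have sr: "sqi circ_measure r" using sqi_diff[OF symm_op_sqi[OF se] sqi_cmult[OF se]] by simp
  have "fourier_coeff e j = (if j = k then 1 else 0)"
    using fourier_coeff_tpoly[of "{k}" "\<lambda>_. 1" j] by (simp add: tpoly_def[abs_def] e_def)
  moreover have "fourier_coeff (symm_op \<gamma> e) j = of_real (log_mult k) * fourier_coeff e j + fourier_coeff r j"
    unfolding eq using fourier_coeff_add[OF sqi_integrable[OF sqi_cmult[OF se]] sqi_integrable[OF sr]]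
    by (simp add: fourier_coeff_cmult)
  moreover have "fourier_coeff r j = reg_matrix \<gamma> j k" by (simp add: reg_matrix_def r_def e_def)
  ultimately show ?thesis by (simp add: e_def)
qed

lemma reg_matrix_row_sqi: "sqi cZ (reg_matrix \<gamma> j)"
proof -
  obtain B where B: "B \<ge> 0" "\<And>F F'. finite F \<Longrightarrow> finite F' \<Longrightarrow>
    (\<Sum>j\<in>F. \<Sum>k\<in>F'. (1 + (real_of_int j)\<^sup>2)\<^sup>2 * (cmod (reg_matrix \<gamma> j k))\<^sup>2) \<le> B"
    using reg_matrix_row_bound by blast
  show ?thesis
  proof (rule sqi_cZ_bounded(1)[where B = "sqrt B"])
    fix F :: "int set" assume F: "finite F"
    have "(\<Sum>k\<in>F. (cmod (reg_matrix \<gamma> j k))\<^sup>2) \<le> (\<Sum>k\<in>F. (1 + (real_of_int j)\<^sup>2)\<^sup>2 * (cmod (reg_matrix \<gamma> j k))\<^sup>2)"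
    proof (rule sum_mono)
      fix k
      have "1 \<le> (1 + (real_of_int j)\<^sup>2)\<^sup>2" by (rule one_le_power) simp
      then show "(cmod (reg_matrix \<gamma> j k))\<^sup>2 \<le> (1 + (real_of_int j)\<^sup>2)\<^sup>2 * (cmod (reg_matrix \<gamma> j k))\<^sup>2"
        using mult_right_mono[of 1 "(1 + (real_of_int j)\<^sup>2)\<^sup>2" "(cmod (reg_matrix \<gamma> j k))\<^sup>2"] by simp
    qed
    also have "\<dots> \<le> B" using B(2)[of "{j}" F] F by simp
    finally show "(\<Sum>k\<in>F. (cmod (reg_matrix \<gamma> j k))\<^sup>2) \<le> (sqrt B)\<^sup>2" using B(1) by simp
  qed (use B in simp)
qed

text \<open>For partial sums this is \<open>fourier_coeff_symm_op_trig\<close> and linearity. In the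
  limit the left side is continuous in the L2 norm of the density, and the right side converges
  because each matrix row is square-summable.\<close>

lemma fourier_coeff_symm_op:
  assumes \<psi>: "sqi circ_measure \<psi>"
  shows "fourier_coeff (symm_op \<gamma> \<psi>) j
    = of_real (log_mult j) * fourier_coeff \<psi> j + (LINT k|cZ. reg_matrix \<gamma> j k * fourier_coeff \<psi> k)"
proof -
  let ?a = "fourier_coeff \<psi>"
  let ?s = "\<lambda>n. tpoly {- int n..int n} ?a"
  obtain C where "C > 0" and C: "\<And>\<psi>. sqi circ_measure \<psi> \<Longrightarrow> nrm circ_measure (symm_op \<gamma> \<psi>) \<le> C * nrm circ_measure \<psi>"
    using symm_op_nrm_bounded by blast
  have st: "sqi circ_measure (\<lambda>s. trig k s / sq2pi)" for k
    using sqi_cmult[OF sqi_trig[of k], of "1 / sq2pi"] by simp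
  have sn: "symm_op \<gamma> (?s n) = (\<lambda>t. \<Sum>k\<in>{- int n..int n}. ?a k * symm_op \<gamma> (\<lambda>s. trig k s / sq2pi) t)" for n
  proof
    fix t
    have "?s n = (\<lambda>s. \<Sum>k\<in>{- int n..int n}. ?a k * (trig k s / sq2pi))"
      by (simp add: tpoly_def[abs_def] sum_divide_distrib)
    then show "symm_op \<gamma> (?s n) t = (\<Sum>k\<in>{- int n..int n}. ?a k * symm_op \<gamma> (\<lambda>s. trig k s / sq2pi) t)"
      by (simp only:) (rule symm_op_sum, rule st)
  qed
  have cn: "fourier_coeff (symm_op \<gamma> (?s n)) j
      = (\<Sum>k\<in>{- int n..int n}. (if j = k then of_real (log_mult k) * ?a k else 0) + reg_matrix \<gamma> j k * ?a k)" for n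
  proof -
    have "fourier_coeff (\<lambda>t. \<Sum>k\<in>{- int n..int n}. ?a k * symm_op \<gamma> (\<lambda>s. trig k s / sq2pi) t) j
       = (\<Sum>k\<in>{- int n..int n}. ?a k * fourier_coeff (symm_op \<gamma> (\<lambda>s. trig k s / sq2pi)) j)"
      by (intro fourier_coeff_sum sqi_integrable symm_op_sqi st)
    then show ?thesis unfolding sn fourier_coeff_symm_op_trig by (auto intro!: sum.cong simp: algebra_simps)
  qed
  have L1: "(\<lambda>n. fourier_coeff (symm_op \<gamma> (?s n)) j) \<longlonglongrightarrow> fourier_coeff (symm_op \<gamma> \<psi>) j"
  proof (rule LIM_zero_cancel, rule tendsto_norm_zero_cancel)
    have lim: "(\<lambda>n. C * nrm circ_measure (\<lambda>t. ?s n t - \<psi> t)) \<longlonglongrightarrow> C * 0"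
      by (intro tendsto_intros parseval_tendsto(2) \<psi>)
    show "(\<lambda>n. cmod (fourier_coeff (symm_op \<gamma> (?s n)) j - fourier_coeff (symm_op \<gamma> \<psi>) j)) \<longlonglongrightarrow> 0"
    proof (rule tendsto_sandwich[OF _ _ tendsto_const lim[simplified]])
      show "\<forall>\<^sub>F n in sequentially. cmod (fourier_coeff (symm_op \<gamma> (?s n)) j - fourier_coeff (symm_op \<gamma> \<psi>) j) \<le> C * nrm circ_measure (\<lambda>t. ?s n t - \<psi> t)"
      proof (rule always_eventually, rule allI)
        fix n
        have d: "sqi circ_measure (\<lambda>t. ?s n t - \<psi> t)" by (intro sqi_diff sqi_tpoly \<psi>)
        have "fourier_coeff (symm_op \<gamma> (?s n)) j - fourier_coeff (symm_op \<gamma> \<psi>) j = fourier_coeff (symm_op \<gamma> (\<lambda>t. ?s n t - \<psi> t)) j"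
        proof -
          have "symm_op \<gamma> (\<lambda>t. ?s n t - \<psi> t) = (\<lambda>t. symm_op \<gamma> (?s n) t - symm_op \<gamma> \<psi> t)"
            by (rule ext) (rule symm_op_diff[OF sqi_tpoly \<psi>])
          then show ?thesis
            by (simp only:) (intro fourier_coeff_diff[symmetric] sqi_integrable symm_op_sqi sqi_tpoly \<psi>)
        qed
        then show "cmod (fourier_coeff (symm_op \<gamma> (?s n)) j - fourier_coeff (symm_op \<gamma> \<psi>) j) \<le> C * nrm circ_measure (\<lambda>t. ?s n t - \<psi> t)"
          using norm_fourier_coeff_le[OF symm_op_sqi[OF d], of j] C[OF d] by simp
      qed
    qed simp
  qed
  have L2: "(\<lambda>n. fourier_coeff (symm_op \<gamma> (?s n)) j) \<longlonglongrightarrow> (LINT k|cZ. (if j = k then of_real (log_mult k) * ?a k else 0) + reg_matrix \<gamma> j k * ?a k)"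
    unfolding cn
  proof (rule tendsto_symmetric_sum, rule Bochner_Integration.integrable_add)
    show "integrable cZ (\<lambda>k. if j = k then of_real (log_mult k) * ?a k else 0)"
      by (rule integral_cZ_finite_support(1)[of "{j}"]) auto
    show "integrable cZ (\<lambda>k. reg_matrix \<gamma> j k * ?a k)"
      by (intro sqi_mult_integrable reg_matrix_row_sqi sqi_fourier_coeff \<psi>)
  qed
  have L3: "(LINT k|cZ. (if j = k then of_real (log_mult k) * ?a k else 0) + reg_matrix \<gamma> j k * ?a k)
      = of_real (log_mult j) * ?a j + (LINT k|cZ. reg_matrix \<gamma> j k * ?a k)"
    using integral_cZ_finite_support[of "{j}" "\<lambda>k. if j = k then of_real (log_mult k) * ?a k else 0"]
    by (subst Bochner_Integration.integral_add) (auto intro!: sqi_mult_integrable reg_matrix_row_sqi sqi_fourier_coeff \<psi>)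
  show ?thesis using LIMSEQ_unique[OF L1 L2] unfolding L3 .
qed

end

section \<open>Hilbert--Schmidt perturbations of the identity\<close>

lemma integral_cZ_restrict:
  fixes f :: "int \<Rightarrow> 'b :: {banach, second_countable_topology}"
  assumes "finite F"
  shows "integrable cZ (\<lambda>k. if k \<in> F then f k else 0)" "(LINT k|cZ. (if k \<in> F then f k else 0)) = (\<Sum>k\<in>F. f k)"
  by (rule integral_cZ_finite_support(1)[OF assms], simp)
     (subst integral_cZ_finite_support(2)[OF assms], auto)

lemma nrm_cZ_tail_tendsto:
  assumes h: "sqi cZ h"
  shows "(\<lambda>N. nrm cZ (\<lambda>k. if k \<in> {- int N..int N} then 0 else h k)) \<longlonglongrightarrow> 0"
proof -
  have "(nrm cZ (\<lambda>k. if k \<in> {- int N..int N} then 0 else h k))\<^sup>2 = (nrm cZ h)\<^sup>2 - (\<Sum>k\<in>{- int N..int N}. (cmod (h k))\<^sup>2)" for N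
  proof -
    let ?f = "\<lambda>k. if k \<in> {- int N..int N} then (cmod (h k))\<^sup>2 else 0"
    have f: "integrable cZ ?f" "(LINT k|cZ. ?f k) = (\<Sum>k\<in>{- int N..int N}. (cmod (h k))\<^sup>2)"
      by (rule integral_cZ_restrict; simp)+
    have "(\<lambda>k. (cmod (if k \<in> {- int N..int N} then 0 else h k))\<^sup>2) = (\<lambda>k. (cmod (h k))\<^sup>2 - ?f k)" by auto
    then show ?thesis unfolding nrm_sq using h f by (simp add: sqi_def)
  qed
  then have "(\<lambda>N. (nrm cZ (\<lambda>k. if k \<in> {- int N..int N} then 0 else h k))\<^sup>2) \<longlonglongrightarrow> 0"
    using nrm_tail_tendsto[OF h] by simp
  from tendsto_real_sqrt[OF this] show ?thesis by simp
qed

text \<open>Square-summability of \<open>h\<close> makes the tail of the pairing uniformly small,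
  and in the remaining finite sum coordinatewise convergence is enough.\<close>

lemma weak_null_tendsto:
  assumes h: "sqi cZ h" and x: "\<And>n. sqi cZ (x n)" and b: "\<And>n. nrm cZ (x n) \<le> C" and p: "\<And>k. (\<lambda>n. x n k) \<longlonglongrightarrow> 0"
  shows "(\<lambda>n. LINT k|cZ. h k * x n k) \<longlonglongrightarrow> 0"
proof (rule LIMSEQ_I)
  fix e :: real assume e: "e > 0"
  have C0: "C \<ge> 0" using order_trans[OF nrm_nonneg b] .
  define t where "t N k = (if k \<in> {- int N..int N} then 0 else h k)" for N k
  have "(\<lambda>N. nrm cZ (t N) * C) \<longlonglongrightarrow> 0 * C"
    using nrm_cZ_tail_tendsto[OF h] unfolding t_def by (intro tendsto_intros)
  then have "\<forall>\<^sub>F N in sequentially. nrm cZ (t N) * C < e / 2"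
    using e by (intro order_tendstoD(2)[of _ "0 * C"]) auto
  then obtain N where N: "nrm cZ (t N) * C < e / 2" by (auto simp: eventually_sequentially)
  let ?F = "{- int N..int N}"
  have tN: "sqi cZ (t N)" by (rule nrm_mono(1)[OF h]) (auto simp: t_def)
  have split: "(LINT k|cZ. h k * x n k) = (\<Sum>k\<in>?F. h k * x n k) + (LINT k|cZ. t N k * x n k)" for n
  proof -
    let ?f = "\<lambda>k. if k \<in> ?F then h k * x n k else 0"
    have f: "integrable cZ ?f" "(LINT k|cZ. ?f k) = (\<Sum>k\<in>?F. h k * x n k)"
      by (rule integral_cZ_restrict; simp)+
    have "(\<lambda>k. h k * x n k) = (\<lambda>k. ?f k + t N k * x n k)" by (auto simp: t_def)
    then show ?thesis using f sqi_mult_integrable[OF tN x[of n]] by simp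
  qed
  have tail: "cmod (LINT k|cZ. t N k * x n k) < e / 2" for n
  proof -
    have "cmod (LINT k|cZ. t N k * x n k) \<le> nrm cZ (t N) * nrm cZ (x n)" by (rule Cauchy_Schwarz_sqi[OF tN x])
    also have "\<dots> \<le> nrm cZ (t N) * C" by (intro mult_left_mono b) simp
    finally show ?thesis using N by simp
  qed
  have "(\<lambda>n. \<Sum>k\<in>?F. h k * x n k) \<longlonglongrightarrow> (\<Sum>k\<in>?F. h k * 0)" by (intro tendsto_intros p)
  then have "(\<lambda>n. \<Sum>k\<in>?F. h k * x n k) \<longlonglongrightarrow> 0" by simp
  from LIMSEQ_D[OF this, of "e / 2"] obtain n0 where n0: "\<And>n. n \<ge> n0 \<Longrightarrow> cmod (\<Sum>k\<in>?F. h k * x n k) < e / 2"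
    using e by auto
  show "\<exists>no. \<forall>n\<ge>no. norm ((LINT k|cZ. h k * x n k) - 0) < e"
  proof (intro exI allI impI)
    fix n assume "n0 \<le> n"
    have "cmod (LINT k|cZ. h k * x n k) \<le> cmod (\<Sum>k\<in>?F. h k * x n k) + cmod (LINT k|cZ. t N k * x n k)"
      unfolding split by (rule norm_triangle_ineq)
    also have "\<dots> < e / 2 + e / 2" by (intro add_strict_mono n0 tail) fact
    finally show "norm ((LINT k|cZ. h k * x n k) - 0) < e" by simp
  qed
qed

text \<open>\<open>B\<close> bounds the square of the Hilbert-Schmidt norm. Testing on finite
  rectangles means that no summability has to be established beforehand.\<close>

definition hilbert_schmidt :: "(int \<Rightarrow> int \<Rightarrow> complex) \<Rightarrow> real \<Rightarrow> bool" where
  "hilbert_schmidt H B \<longleftrightarrow> B \<ge> 0 \<and> (\<forall>F F'. finite F \<longrightarrow> finite F' \<longrightarrow> (\<Sum>j\<in>F. \<Sum>k\<in>F'. (cmod (H j k))\<^sup>2) \<le> B)"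

lemma hilbert_schmidt_bounds:
  assumes hs: "hilbert_schmidt H B"
  shows "sqi cZ (H j)" "integrable cZ (\<lambda>j. (nrm cZ (H j))\<^sup>2)" "(LINT j|cZ. (nrm cZ (H j))\<^sup>2) \<le> B"
    "sqi cZ x \<Longrightarrow> cmod (LINT k|cZ. H j k * x k) \<le> nrm cZ (H j) * nrm cZ x"
    "sqi cZ x \<Longrightarrow> sqi cZ (\<lambda>j. LINT k|cZ. H j k * x k)"
    "sqi cZ x \<Longrightarrow> nrm cZ (\<lambda>j. LINT k|cZ. H j k * x k) \<le> sqrt B * nrm cZ x"
proof -
  have B: "B \<ge> 0" and H: "\<And>F F'. finite F \<Longrightarrow> finite F' \<Longrightarrow> (\<Sum>j\<in>F. \<Sum>k\<in>F'. (cmod (H j k))\<^sup>2) \<le> B"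
    using hs by (auto simp: hilbert_schmidt_def)
  show sH: "sqi cZ (H j)" for j
    by (rule sqi_cZ_bounded(1)[where B = "sqrt B"]) (use H[of "{j}"] B in auto)
  have fin: "(\<Sum>j\<in>F. (nrm cZ (H j))\<^sup>2) \<le> B" if F: "finite F" for F
  proof (rule LIMSEQ_le_const2)
    show "(\<lambda>n. \<Sum>j\<in>F. \<Sum>k\<in>{- int n..int n}. (cmod (H j k))\<^sup>2) \<longlonglongrightarrow> (\<Sum>j\<in>F. (nrm cZ (H j))\<^sup>2)"
      unfolding nrm_sq by (intro tendsto_sum tendsto_symmetric_sum) (use sH in \<open>simp add: sqi_def\<close>)
    show "\<exists>N. \<forall>n\<ge>N. (\<Sum>j\<in>F. \<Sum>k\<in>{- int n..int n}. (cmod (H j k))\<^sup>2) \<le> B" using H[OF F] by auto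
  qed
  show "integrable cZ (\<lambda>j. (nrm cZ (H j))\<^sup>2)" "(LINT j|cZ. (nrm cZ (H j))\<^sup>2) \<le> B"
    using integrable_cZ_bounded[of "\<lambda>j. (nrm cZ (H j))\<^sup>2", OF _ fin] by auto
  show cs: "cmod (LINT k|cZ. H j k * x k) \<le> nrm cZ (H j) * nrm cZ x" if "sqi cZ x" for j x
    by (rule Cauchy_Schwarz_sqi[OF sH that])
  have *: "(\<Sum>j\<in>F. (cmod (LINT k|cZ. H j k * x k))\<^sup>2) \<le> (sqrt B * nrm cZ x)\<^sup>2" if x: "sqi cZ x" and F: "finite F" for x F
  proof -
    have "(\<Sum>j\<in>F. (cmod (LINT k|cZ. H j k * x k))\<^sup>2) \<le> (\<Sum>j\<in>F. (nrm cZ (H j) * nrm cZ x)\<^sup>2)"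
      by (intro sum_mono power_mono cs x) simp
    also have "\<dots> = (\<Sum>j\<in>F. (nrm cZ (H j))\<^sup>2) * (nrm cZ x)\<^sup>2"
      by (simp add: power_mult_distrib sum_distrib_right)
    also have "\<dots> \<le> B * (nrm cZ x)\<^sup>2" by (intro mult_right_mono fin F) simp
    finally show ?thesis using B by (simp add: power_mult_distrib)
  qed
  show "sqi cZ (\<lambda>j. LINT k|cZ. H j k * x k)" "nrm cZ (\<lambda>j. LINT k|cZ. H j k * x k) \<le> sqrt B * nrm cZ x" if "sqi cZ x"
    using sqi_cZ_bounded[OF *[OF that]] B by auto
qed

text \<open>A normalized sequence violating the bound
  has a coordinatewise convergent subsequence; compactness makes the convergence strong.\<close>

lemma hilbert_schmidt_bounded_below:
  assumes H: "hilbert_schmidt H B"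
    and inj: "\<And>x k. sqi cZ x \<Longrightarrow> (\<And>j. x j + (LINT k|cZ. H j k * x k) = 0) \<Longrightarrow> x k = 0"
  obtains c where "c > 0" "\<And>x. sqi cZ x \<Longrightarrow> c * nrm cZ x \<le> nrm cZ (\<lambda>j. x j + (LINT k|cZ. H j k * x k))"
proof (rule ccontr)
  assume no: "\<not> thesis"
  have step: "c > 0 \<longrightarrow> \<not> (\<forall>x. sqi cZ x \<longrightarrow> c * nrm cZ x \<le> nrm cZ (\<lambda>j. x j + (LINT k|cZ. H j k * x k)))" for c
    using no that[of c] by blast
  note hs = hilbert_schmidt_bounds[OF H]
  define T where "T x j = (LINT k|cZ. H j k * x k)" for x :: "int \<Rightarrow> complex" and j
  have Tint: "integrable cZ (\<lambda>k. H j k * x k)" if "sqi cZ x" for j x by (rule sqi_mult_integrable[OF hs(1) that])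
  have Tc: "T (\<lambda>k. c * x k) j = c * T x j" for c x j
    unfolding T_def by (simp add: mult.left_commute flip: integral_mult_right_zero)
  have Td: "T (\<lambda>k. x k - y k) j = T x j - T y j" if "sqi cZ x" "sqi cZ y" for x y j
    unfolding T_def using Tint[OF that(1)] Tint[OF that(2)] by (simp add: right_diff_distrib)
  have "\<exists>x. sqi cZ x \<and> nrm cZ (\<lambda>j. x j + T x j) < c * nrm cZ x" if "c > 0" for c
    using step[of c] that unfolding T_def by (auto simp: not_le)
  then have "\<exists>x. sqi cZ x \<and> nrm cZ (\<lambda>j. x j + T x j) < inverse (real (Suc n)) * nrm cZ x" for n by simp
  then obtain w where w: "\<And>n. sqi cZ (w n)" "\<And>n. nrm cZ (\<lambda>j. w n j + T (w n) j) < inverse (real (Suc n)) * nrm cZ (w n)"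
    by metis
  have wp: "nrm cZ (w n) > 0" for n
    using le_less_trans[OF nrm_nonneg w(2)[of n]] by (simp add: zero_less_mult_iff)
  define y where "y n k = complex_of_real (inverse (nrm cZ (w n))) * w n k" for n k
  have sy: "sqi cZ (y n)" for n unfolding y_def by (rule sqi_cmult[OF w(1)])
  have ny: "nrm cZ (y n) = 1" for n
    unfolding y_def nrm_cmult using wp[of n] by (simp add: norm_inverse)
  have sT: "sqi cZ (T x)" if "sqi cZ x" for x unfolding T_def by (rule hs(5)[OF that])
  have res: "nrm cZ (\<lambda>j. y n j + T (y n) j) \<le> inverse (real (Suc n))" for n
  proof -
    have "(\<lambda>j. y n j + T (y n) j) = (\<lambda>j. complex_of_real (inverse (nrm cZ (w n))) * (w n j + T (w n) j))"
      unfolding y_def Tc by (simp add: distrib_left)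
    then have "nrm cZ (\<lambda>j. y n j + T (y n) j) = inverse (nrm cZ (w n)) * nrm cZ (\<lambda>j. w n j + T (w n) j)"
      using wp[of n] by (simp add: nrm_cmult norm_inverse)
    also have "\<dots> \<le> inverse (nrm cZ (w n)) * (inverse (real (Suc n)) * nrm cZ (w n))"
      using w(2)[of n] wp[of n] by (intro mult_left_mono) auto
    also have "\<dots> = inverse (real (Suc n))" using wp[of n] by simp
    finally show ?thesis .
  qed
  \<comment> \<open>All coordinates of the unit vectors \<open>y n\<close> lie in the unit disc, so
    a diagonal subsequence converges at every index.\<close>
  obtain r :: "nat \<Rightarrow> nat" where r: "strict_mono r" and conv: "\<And>k. k \<in> (UNIV :: int set) \<Longrightarrow> \<exists>l. (\<lambda>n. y (r n) k) \<longlonglongrightarrow> l"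
  proof (rule function_convergent_subsequence[of "UNIV :: int set" y 1])
    show "cmod (y n k) \<le> 1" for n k using cmod_le_nrm_cZ[OF sy[of n], of k] ny by simp
  qed auto
  define l where "l k = lim (\<lambda>n. y (r n) k)" for k
  have l: "(\<lambda>n. y (r n) k) \<longlonglongrightarrow> l k" for k
    using conv[of k] unfolding l_def by (simp add: convergent_def[symmetric] convergent_LIMSEQ_iff)
  have sl: "sqi cZ l" "nrm cZ l \<le> 1"
  proof -
    have "(\<Sum>k\<in>F. (cmod (l k))\<^sup>2) \<le> 1\<^sup>2" if "finite F" for F
    proof (rule LIMSEQ_le_const2)
      show "(\<lambda>n. \<Sum>k\<in>F. (cmod (y (r n) k))\<^sup>2) \<longlonglongrightarrow> (\<Sum>k\<in>F. (cmod (l k))\<^sup>2)" by (intro tendsto_intros l)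
      show "\<exists>N. \<forall>n\<ge>N. (\<Sum>k\<in>F. (cmod (y (r n) k))\<^sup>2) \<le> 1\<^sup>2"
        using sum_le_nrm_cZ[OF sy that] ny by simp
    qed
    from sqi_cZ_bounded[OF this] show "sqi cZ l" "nrm cZ l \<le> 1" by auto
  qed
  define d where "d n k = y (r n) k - l k" for n k
  have sd: "sqi cZ (d n)" for n unfolding d_def by (intro sqi_diff sy sl)
  have nd: "nrm cZ (d n) \<le> 2" for n
    using nrm_diff_le[OF sy[of "r n"] sl(1)] sl(2) ny[of "r n"] unfolding d_def by simp
  have pd: "(\<lambda>n. d n k) \<longlonglongrightarrow> 0" for k
    using tendsto_diff[OF l[of k] tendsto_const[of "l k"]] by (simp add: d_def)
  have Td0: "(\<lambda>n. T (d n) j) \<longlonglongrightarrow> 0" for j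
    unfolding T_def by (rule weak_null_tendsto[OF hs(1) sd nd pd])
  \<comment> \<open>Dominated convergence in the row index: \<open>T (d n) j\<close> is at most
    \<open>2 * nrm cZ (H j)\<close>, and the squares of these bounds are summable. This is the
    compactness of \<open>T\<close>.\<close>
  have Td_nrm: "(\<lambda>n. nrm cZ (T (d n))) \<longlonglongrightarrow> 0"
  proof -
    have "(\<lambda>n. LINT j|cZ. (cmod (T (d n) j))\<^sup>2) \<longlonglongrightarrow> (LINT j|cZ. 0)"
    proof (rule integral_dominated_convergence)
      show "integrable cZ (\<lambda>j. 4 * (nrm cZ (H j))\<^sup>2)" using hs(2) by simp
      show "AE j in cZ. (\<lambda>n. (cmod (T (d n) j))\<^sup>2) \<longlonglongrightarrow> 0"
        using Td0 by (intro AE_I2) (auto intro!: tendsto_eq_intros)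
      show "AE j in cZ. norm ((cmod (T (d n) j))\<^sup>2) \<le> 4 * (nrm cZ (H j))\<^sup>2" for n
      proof (rule AE_I2)
        fix j
        have "cmod (T (d n) j) \<le> nrm cZ (H j) * nrm cZ (d n)" unfolding T_def by (rule hs(4)[OF sd])
        also have "\<dots> \<le> nrm cZ (H j) * 2" by (intro mult_left_mono nd) simp
        finally have "(cmod (T (d n) j))\<^sup>2 \<le> (nrm cZ (H j) * 2)\<^sup>2" by (intro power_mono) auto
        then show "norm ((cmod (T (d n) j))\<^sup>2) \<le> 4 * (nrm cZ (H j))\<^sup>2" by (simp add: power_mult_distrib)
      qed
    qed auto
    then have "(\<lambda>n. sqrt (LINT j|cZ. (cmod (T (d n) j))\<^sup>2)) \<longlonglongrightarrow> sqrt 0"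
      by (intro tendsto_real_sqrt) simp
    then show ?thesis by (simp add: nrm_def)
  qed
  have res0: "(\<lambda>n. nrm cZ (\<lambda>j. y (r n) j + T (y (r n)) j)) \<longlonglongrightarrow> 0"
  proof (rule tendsto_sandwich[OF _ _ tendsto_const])
    show "(\<lambda>n. inverse (real (Suc (r n)))) \<longlonglongrightarrow> 0"
      using LIMSEQ_subseq_LIMSEQ[OF LIMSEQ_inverse_real_of_nat r] by (simp add: o_def)
    show "\<forall>\<^sub>F n in sequentially. nrm cZ (\<lambda>j. y (r n) j + T (y (r n)) j) \<le> inverse (real (Suc (r n)))"
      using res by (intro always_eventually) blast
  qed simp
  have "l j + T l j = 0" for j
  proof -
    have "(\<lambda>n. y (r n) j + T (y (r n)) j) \<longlonglongrightarrow> 0"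
    proof (rule tendsto_norm_zero_cancel, rule tendsto_sandwich[OF _ _ tendsto_const res0])
      show "\<forall>\<^sub>F n in sequentially. norm (y (r n) j + T (y (r n)) j) \<le> nrm cZ (\<lambda>j. y (r n) j + T (y (r n)) j)"
        using cmod_le_nrm_cZ[OF sqi_add[OF sy sT[OF sy]]] by (intro always_eventually) auto
    qed simp
    moreover have "y (r n) j + T (y (r n)) j = (d n j + T (d n) j) + (l j + T l j)" for n
      using Td[OF sy[of "r n"] sl(1), of j] by (simp add: d_def[abs_def])
    moreover have "(\<lambda>n. (d n j + T (d n) j) + (l j + T l j)) \<longlonglongrightarrow> (0 + 0) + (l j + T l j)"
      by (intro tendsto_intros pd Td0)
    ultimately show ?thesis using LIMSEQ_unique by fastforce
  qed
  then have l0: "l k = 0" for k using inj[OF sl(1), of k] by (simp add: T_def)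
  then have "d n = y (r n)" for n by (simp add: d_def[abs_def])
  then have "(\<lambda>n. nrm cZ (T (y (r n)))) \<longlonglongrightarrow> 0" using Td_nrm by simp
  from tendsto_add[OF res0 this]
  have lim: "(\<lambda>n. nrm cZ (\<lambda>j. y (r n) j + T (y (r n)) j) + nrm cZ (T (y (r n)))) \<longlonglongrightarrow> 0" by simp
  \<comment> \<open>The unit norm of \<open>y (r n)\<close> is at most the residual plus the norm of
    its image under \<open>T\<close>, and both tend to 0.\<close>
  have "1 \<le> nrm cZ (\<lambda>j. y (r n) j + T (y (r n)) j) + nrm cZ (T (y (r n)))" for n
    using nrm_diff_le[OF sqi_add[OF sy sT[OF sy]] sT[OF sy], of "r n" "r n" "r n"] ny[of "r n"] by simp
  then have "1 \<le> (0::real)" by (intro LIMSEQ_le_const[OF lim]) auto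
  then show False by simp
qed

section \<open>Absolutely convergent Fourier series\<close>

text \<open>The summable moduli are the majorant both for the continuity of the sum and for
  integrating its partial sums against an exponential.\<close>

lemma abs_summable_fourier_series:
  assumes a: "integrable cZ (\<lambda>k. cmod (a k))"
  obtains \<psi> where "continuous_on UNIV \<psi>" "fourier_coeff \<psi> = a"
proof -
  define \<psi> where "\<psi> t = (LINT k|cZ. a k * trig k t) / sq2pi" for t
  have ia: "integrable cZ (\<lambda>k. a k * trig k t)" for t
    by (rule Bochner_Integration.integrable_bound[OF a]) (auto simp: norm_mult)
  have c: "continuous_on UNIV \<psi>"
  proof (rule continuous_on_sequentiallyI)
    fix u :: "nat \<Rightarrow> real" and t assume u: "u \<longlonglongrightarrow> t"
    have "(\<lambda>n. LINT k|cZ. a k * trig k (u n)) \<longlonglongrightarrow> (LINT k|cZ. a k * trig k t)"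
    proof (rule integral_dominated_convergence[OF _ _ a])
      show "AE k in cZ. (\<lambda>n. a k * trig k (u n)) \<longlonglongrightarrow> a k * trig k t"
        unfolding trig_def by (intro AE_I2 tendsto_intros u)
    qed (auto simp: norm_mult)
    then show "(\<lambda>n. \<psi> (u n)) \<longlonglongrightarrow> \<psi> t" unfolding \<psi>_def by (intro tendsto_intros) auto
  qed
  have p: "(\<lambda>n. tpoly {- int n..int n} a t) \<longlonglongrightarrow> \<psi> t" for t
    unfolding tpoly_def \<psi>_def by (intro tendsto_intros tendsto_symmetric_sum ia) auto
  have "fourier_coeff \<psi> j = a j" for j
  proof -
    have "(\<lambda>n. LINT t|circ_measure. tpoly {- int n..int n} a t * trig (- j) t) \<longlonglongrightarrow> (LINT t|circ_measure. \<psi> t * trig (- j) t)"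
    proof (rule integral_dominated_convergence[where w = "\<lambda>t. LINT k|cZ. cmod (a k)"])
      show "(\<lambda>t. \<psi> t * trig (- j) t) \<in> borel_measurable circ_measure"
        by (intro continuous_on_circ_measurable continuous_intros continuous_on_subset[OF c]) auto
      show "(\<lambda>t. tpoly {- int n..int n} a t * trig (- j) t) \<in> borel_measurable circ_measure" for n
        by (intro continuous_on_circ_measurable continuous_intros)
      show "AE t in circ_measure. (\<lambda>n. tpoly {- int n..int n} a t * trig (- j) t) \<longlonglongrightarrow> \<psi> t * trig (- j) t"
        by (intro AE_I2 tendsto_intros p)
      show "AE t in circ_measure. cmod (tpoly {- int n..int n} a t * trig (- j) t) \<le> (LINT k|cZ. cmod (a k))" for n
      proof (rule AE_I2)
        fix t
        have "sqrt (2 * pi) \<ge> 1" using pi_ge_two by (intro real_le_rsqrt) simp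
        then have "cmod (\<Sum>k\<in>{- int n..int n}. a k * trig k t) / sqrt (2 * pi) \<le> cmod (\<Sum>k\<in>{- int n..int n}. a k * trig k t)"
          by (simp add: divide_le_eq mult_le_cancel_left1)
        also have "\<dots> \<le> (\<Sum>k\<in>{- int n..int n}. cmod (a k))"
          using norm_sum[of "\<lambda>k. a k * trig k t" "{- int n..int n}"] by (simp add: norm_mult)
        also have "\<dots> \<le> (LINT k|cZ. cmod (a k))" by (intro sum_le_integral_cZ a) auto
        finally show "cmod (tpoly {- int n..int n} a t * trig (- j) t) \<le> (LINT k|cZ. cmod (a k))"
          by (simp add: tpoly_def norm_mult norm_divide)
      qed
    qed simp
    then have "(\<lambda>n. fourier_coeff (tpoly {- int n..int n} a) j) \<longlonglongrightarrow> fourier_coeff \<psi> j"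
      unfolding fourier_coeff_trig by (intro tendsto_intros) auto
    moreover have "(\<lambda>n. fourier_coeff (tpoly {- int n..int n} a) j) \<longlonglongrightarrow> a j"
    proof (rule tendsto_eventually, unfold eventually_sequentially, intro exI[of _ "nat \<bar>j\<bar>"] allI impI)
      show "fourier_coeff (tpoly {- int n..int n} a) j = a j" if "nat \<bar>j\<bar> \<le> n" for n
        using that by (auto simp: fourier_coeff_tpoly)
    qed
    ultimately show ?thesis by (rule LIMSEQ_unique)
  qed
  with c show thesis by (intro that) auto
qed

lemma inverse_weight_sqi: "sqi cZ (\<lambda>k. of_real (1 / sqrt (1 + (real_of_int k)\<^sup>2)))"
proof (rule sqi_cZ_bounded(1)[where B = "sqrt 5"])
  fix F :: "int set" assume F: "finite F"
  obtain N where N: "F \<subseteq> {- int N..int N}"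
  proof (cases "F = {}")
    case False
    show ?thesis
    proof (rule that[of "nat (Max (abs ` F))"])
      have "\<bar>k\<bar> \<le> Max (abs ` F)" if "k \<in> F" for k using F that by auto
      then show "F \<subseteq> {- int (nat (Max (abs ` F)))..int (nat (Max (abs ` F)))}" by (force simp: abs_le_iff)
    qed
  qed auto
  \<comment> \<open>Telescoping as an induction: for \<open>N = 0\<close> both sides equal 1, and
    the two new terms together are at most \<open>4 / (N + 1) - 4 / (N + 2)\<close>.\<close>
  have tele: "(\<Sum>k\<in>{- int N..int N}. 1 / (1 + (real_of_int k)\<^sup>2)) \<le> 5 - 4 / (real N + 1)"
  proof (induction N)
    case (Suc N)
    have eq: "{- int (Suc N)..int (Suc N)} = insert (- int (Suc N)) (insert (int (Suc N)) {- int N..int N})" by auto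
    have "(\<Sum>k\<in>{- int (Suc N)..int (Suc N)}. 1 / (1 + (real_of_int k)\<^sup>2))
        = 2 / (1 + (real N + 1)\<^sup>2) + (\<Sum>k\<in>{- int N..int N}. 1 / (1 + (real_of_int k)\<^sup>2))"
      unfolding eq by (subst sum.insert; simp add: add.commute power2_eq_square algebra_simps)
    also have "\<dots> \<le> 2 / (1 + (real N + 1)\<^sup>2) + (5 - 4 / (real N + 1))" using Suc by simp
    also have "\<dots> \<le> 5 - 4 / (real (Suc N) + 1)"
    proof -
      define x where "x = real N"
      have x: "x \<ge> 0" by (simp add: x_def)
      have "2 / y = 4 / (2 * y)" for y :: real by simp
      then have "2 / (1 + (x + 1)\<^sup>2) = 4 / (2 * (1 + (x + 1)\<^sup>2))" .
      also have "\<dots> \<le> 4 / ((x + 1) * (x + 2))"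
      proof (rule divide_left_mono)
        show "(x + 1) * (x + 2) \<le> 2 * (1 + (x + 1)\<^sup>2)" using x by (simp add: power2_eq_square algebra_simps)
        show "0 < 2 * (1 + (x + 1)\<^sup>2) * ((x + 1) * (x + 2))"
          using x zero_le_power2[of "x + 1"] by (intro mult_pos_pos) linarith+
      qed simp
      also have "\<dots> = 4 / (x + 1) - 4 / (x + 2)" using x by (simp add: field_simps)
      finally show ?thesis by (simp add: x_def add.commute)
    qed
    finally show ?case .
  qed simp
  have "(\<Sum>k\<in>F. (cmod (complex_of_real (1 / sqrt (1 + (real_of_int k)\<^sup>2))))\<^sup>2) = (\<Sum>k\<in>F. 1 / (1 + (real_of_int k)\<^sup>2))"
    by (simp only: norm_of_real power2_abs) (simp add: power_divide)
  also have "\<dots> \<le> (\<Sum>k\<in>{- int N..int N}. 1 / (1 + (real_of_int k)\<^sup>2))"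
    by (intro sum_mono2 N) auto
  also have "\<dots> \<le> 5" using tele by (rule order_trans) simp
  finally show "(\<Sum>k\<in>F. (cmod (complex_of_real (1 / sqrt (1 + (real_of_int k)\<^sup>2))))\<^sup>2) \<le> (sqrt 5)\<^sup>2" by simp
qed simp

text \<open>Cauchy-Schwarz against the square-summable inverse weights.\<close>

lemma sobolev_1_summable:
  assumes "sqi cZ (\<lambda>k. of_real (sqrt (1 + (real_of_int k)\<^sup>2)) * a k)"
  shows "integrable cZ (\<lambda>k. cmod (a k))"
proof -
  have p: "1 + (real_of_int k)\<^sup>2 > 0" for k by (simp add: add_pos_nonneg)
  have "cmod (complex_of_real (1 / sqrt (1 + (real_of_int k)\<^sup>2))) * cmod (of_real (sqrt (1 + (real_of_int k)\<^sup>2)) * a k) = cmod (a k)" for k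
    using p[of k] by (simp add: norm_mult norm_divide del: of_real_divide)
  then show ?thesis using sqi_norm_mult_integrable[OF inverse_weight_sqi assms] by simp
qed

section \<open>Maximum principle for functions with the mean value property\<close>

text \<open>Harmonicity in terms of circle means: for logarithmic potentials these follow from
  Jensen's formula and Fubini's theorem, without any differentiation.\<close>

definition mean_value_on :: "complex set \<Rightarrow> (complex \<Rightarrow> real) \<Rightarrow> bool" where
  "mean_value_on E v \<longleftrightarrow> (\<forall>p \<rho>. \<rho> > 0 \<longrightarrow> cball p \<rho> \<subseteq> E \<longrightarrow>
     (LINT t|circ_measure. v (p + of_real \<rho> * trig 1 t)) = 2 * pi * v p)"

lemma mean_value_on_uminus: "mean_value_on E v \<Longrightarrow> mean_value_on E (\<lambda>z. - v z)"
  by (simp add: mean_value_on_def)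

lemma circle_subset_cball: "\<rho> \<ge> 0 \<Longrightarrow> p + of_real \<rho> * trig 1 t \<in> cball p \<rho>"
  by (simp add: dist_norm norm_mult)

lemma continuous_integral_zero_imp_zero:
  fixes f :: "real \<Rightarrow> real"
  assumes c: "continuous_on {0..2*pi} f" and n: "\<And>t. t \<in> {0..2*pi} \<Longrightarrow> f t \<ge> 0"
    and z: "(LINT t|circ_measure. f t) = 0" and t: "t \<in> {0..2*pi}"
  shows "f t = 0"
proof -
  have "(f has_integral (LINT t|circ_measure. f t)) {0..2*pi}"
    by (rule has_integral_integral_lebesgue_on) (auto intro: continuous_imp_integrable_real c)
  then have "(f has_integral 0) (cbox 0 (2*pi))" using z by simp
  then show ?thesis using has_integral_0_cbox_imp_0[of 0 "2*pi" f t] c n t by (auto simp: not_le)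
qed

text \<open>Take the point of the set where the maximum is attained that is closest to some
  boundary point: a small circle around it contains a still closer point.\<close>

lemma strong_maximum_principle:
  assumes E: "open E" "E \<noteq> UNIV" and c: "continuous_on (closure E) v" and mv: "mean_value_on E v"
    and le: "\<And>z. z \<in> closure E \<Longrightarrow> v z \<le> M" and p: "p \<in> E" "v p = M"
  obtains q where "q \<in> frontier E" "v q = M"
proof (rule ccontr)
  assume no: "\<not> thesis"
  define S where "S = {z \<in> closure E. v z = M}"
  have S: "closed S" unfolding S_def
    using continuous_closed_preimage_constant[OF c closed_closure, of M] by (simp add: vimage_def Int_def conj_commute)
  have SE: "S \<subseteq> E"
    using no that E(1) by (auto simp: S_def frontier_def interior_open)
  have "p \<in> S" using p closure_subset by (auto simp: S_def)
  have "frontier E \<noteq> {}" using frontier_eq_empty[of E] p(1) E(2) by auto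
  then obtain f0 where f0: "f0 \<in> frontier E" by auto
  obtain p' where p': "p' \<in> S" "\<And>y. y \<in> S \<Longrightarrow> dist f0 p' \<le> dist f0 y"
    using distance_attains_inf[OF S, of f0] \<open>p \<in> S\<close> by blast
  have f0S: "f0 \<notin> E" using f0 E(1) by (simp add: frontier_def interior_open)
  have "p' \<in> E" using p'(1) SE by auto
  then obtain r where r: "r > 0" "cball p' r \<subseteq> E" using E(1) open_contains_cball by blast
  have d: "r < dist f0 p'" using r(2) f0S by (auto simp: subset_eq dist_commute not_le[symmetric])
  \<comment> \<open>The unit vector from \<open>p'\<close> towards \<open>f0\<close>: the point of
    the circle in this direction is nearer to \<open>f0\<close> than \<open>p'\<close> by the radius
    \<open>r\<close>.\<close>
  define w where "w = (f0 - p') / of_real (cmod (f0 - p'))"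
  have nz: "f0 - p' \<noteq> 0" using d r(1) by (auto simp: dist_norm)
  have "cmod w = 1" using nz by (simp add: w_def norm_divide)
  then have w: "w = trig 1 (Arg2pi w)" using Arg2pi_eq[of w] by (simp add: trig_def)
  have on: "p' + of_real r * trig 1 t \<in> E" for t using circle_subset_cball[of r p' t] r by auto
  \<comment> \<open>The mean of \<open>v\<close> over the circle equals its maximum
    \<open>M\<close>, so the nonnegative continuous function \<open>M - v\<close> vanishes on the
    whole circle.\<close>
  have "(LINT t|circ_measure. M - v (p' + of_real r * trig 1 t)) = 0"
  proof -
    have cv: "continuous_on {0..2*pi} (\<lambda>t. v (p' + of_real r * trig 1 t))"
      by (rule continuous_on_compose2[OF c]) (use on closure_subset in \<open>auto intro!: continuous_intros\<close>)
    have "(LINT t|circ_measure. v (p' + of_real r * trig 1 t)) = 2 * pi * M"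
      using mv r p'(1) by (auto simp: mean_value_on_def S_def)
    then show ?thesis using continuous_imp_integrable_real[OF cv] by simp
  qed
  then have "M - v (p' + of_real r * trig 1 (Arg2pi w)) = 0"
  proof (rule continuous_integral_zero_imp_zero[rotated 2])
    show "continuous_on {0..2*pi} (\<lambda>t. M - v (p' + of_real r * trig 1 t))"
      by (intro continuous_intros continuous_on_compose2[OF c]) (use on closure_subset in \<open>auto intro!: continuous_intros\<close>)
    show "Arg2pi w \<in> {0..2*pi}" using Arg2pi_ge_0[of w] Arg2pi_lt_2pi[of w] by auto
    show "0 \<le> M - v (p' + of_real r * trig 1 t)" for t using le[of "p' + of_real r * trig 1 t"] on[of t] closure_subset by auto
  qed
  then have "v (p' + of_real r * w) = M" using w by simp
  moreover have "p' + of_real r * w \<in> closure E" using on[of "Arg2pi w"] w closure_subset by (metis subsetD)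
  ultimately have "p' + of_real r * w \<in> S" by (simp add: S_def)
  then have "dist f0 p' \<le> dist f0 (p' + of_real r * w)" by (rule p'(2))
  also have "f0 - (p' + of_real r * w) = (of_real (cmod (f0 - p')) - of_real r) * w"
  proof -
    have "of_real (cmod (f0 - p')) * w = f0 - p'" using nz by (simp add: w_def)
    then show ?thesis by (simp add: left_diff_distrib)
  qed
  then have "dist f0 (p' + of_real r * w) = \<bar>cmod (f0 - p') - r\<bar>"
    using \<open>cmod w = 1\<close> by (simp add: dist_norm norm_mult flip: of_real_diff)
  finally show False using d r(1) by (simp add: dist_norm)
qed

text \<open>\<open>E\<close> may be unbounded; the decay hypothesis makes the superlevel set of a
  positive value \<open>v p\<close> compact, so a positive maximum would be attained, and the strong
  principle would carry it to the frontier.\<close>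

lemma weak_maximum_principle:
  assumes E: "open E" "E \<noteq> UNIV" and c: "continuous_on (closure E) v" and mv: "mean_value_on E v"
    and fr: "\<And>z. z \<in> frontier E \<Longrightarrow> v z \<le> 0"
    and dec: "\<And>e. e > 0 \<Longrightarrow> \<exists>R. \<forall>z\<in>closure E. cmod z > R \<longrightarrow> v z < e"
    and p: "p \<in> E"
  shows "v p \<le> 0"
proof (rule ccontr)
  assume "\<not> v p \<le> 0"
  then have pos: "v p > 0" by simp
  define S where "S = {z \<in> closure E. v z \<ge> v p}"
  have "closed S" unfolding S_def
    using continuous_on_closed_Collect_le[OF continuous_on_const c closed_closure, of "v p"] by simp
  moreover have "bounded S"
  proof -
    obtain R where "\<forall>z\<in>closure E. cmod z > R \<longrightarrow> v z < v p" using dec[OF pos] by blast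
    then have "\<forall>z\<in>S. cmod z \<le> R" by (force simp: S_def not_less[symmetric])
    then show ?thesis by (auto simp: bounded_iff)
  qed
  ultimately have "compact S" by (simp add: compact_eq_bounded_closed)
  moreover have pS: "p \<in> S" using p closure_subset by (auto simp: S_def)
  moreover have "continuous_on S v" using c by (rule continuous_on_subset) (auto simp: S_def)
  ultimately obtain m where m: "m \<in> S" "\<And>z. z \<in> S \<Longrightarrow> v z \<le> v m"
    using continuous_attains_sup[of S v] by auto
  have vm: "v m > 0" using m(2)[OF pS] pos by simp
  have le: "v z \<le> v m" if "z \<in> closure E" for z
    using m(2)[of z] m(2)[OF pS] that by (cases "v z \<ge> v p") (auto simp: S_def)
  have mE: "m \<in> E"
  proof (rule ccontr)
    assume "m \<notin> E"
    then have "m \<in> frontier E" using m(1) E(1) by (auto simp: S_def frontier_def interior_open)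
    then show False using fr vm by force
  qed
  obtain q where "q \<in> frontier E" "v q = v m"
    by (rule strong_maximum_principle[OF E c mv le mE refl])
  then show False using fr[of q] vm by simp
qed

section \<open>Logarithmic potentials\<close>

context
  fixes \<gamma> :: "real \<Rightarrow> complex" and \<phi> :: "real \<Rightarrow> real"
  assumes reg: "regular_closed_C3_curve \<gamma>" and cphi: "continuous_on {0..2*pi} \<phi>"
begin

definition log_pot :: "complex \<Rightarrow> real" where
  "log_pot z = (LINT s|circ_measure. \<phi> s * ln (cmod (z - \<gamma> s)))"

lemma phi_sqi: "sqi circ_measure (\<lambda>s. complex_of_real (\<phi> s))"
  by (rule sqi_continuous) (intro continuous_intros cphi)

lemma phi_bounded:
  obtains B where "B \<ge> 0" "\<And>s. s \<in> {0..2*pi} \<Longrightarrow> \<bar>\<phi> s\<bar> \<le> B"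
proof -
  have "compact (\<phi> ` {0..2*pi})" by (intro compact_continuous_image cphi) auto
  then obtain B where "B > 0" "\<And>y. y \<in> \<phi> ` {0..2*pi} \<Longrightarrow> norm y \<le> B"
    using compact_imp_bounded bounded_pos by metis
  then show thesis by (intro that[of B]) auto
qed

lemma phi_measurable: "\<phi> \<in> borel_measurable circ_measure"
  by (rule continuous_on_circ_measurable) (rule cphi)

lemma phi_integrable: "integrable circ_measure \<phi>"
  by (rule continuous_imp_integrable_real) (rule cphi)

lemma log_pot_integrable: "integrable circ_measure (\<lambda>s. \<phi> s * ln (cmod (z - \<gamma> s)))"
  using integrable_Re[OF log_kernel_integrable[OF reg phi_sqi, of z]] by simp

text \<open>Fubini's theorem reduces the integral to Jensen's formula for each curve point. The
  circle may cross the curve, which \<open>log_pot_zero_imp_density_zero\<close> exploits.\<close>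

lemma circle_log_integral:
  assumes "\<rho> > 0"
  shows "(LINT t|circ_measure. log_pot (p + of_real \<rho> * trig 1 t))
    = (LINT s|circ_measure. \<phi> s * (2 * pi * ln (max \<rho> (cmod (\<gamma> s - p)))))"
proof -
  have [measurable]: "\<gamma> \<in> borel_measurable borel" by (rule curve_measurable[OF reg])
  have [measurable]: "\<phi> \<in> borel_measurable circ_measure" by (rule phi_measurable)
  let ?f = "\<lambda>t s. \<phi> s * ln (cmod (p + of_real \<rho> * trig 1 t - \<gamma> s))"
  have [measurable]: "(\<lambda>q. ln (cmod (p + of_real \<rho> * trig 1 (fst q) - \<gamma> (snd q)))) \<in> borel_measurable (circ_measure \<Otimes>\<^sub>M circ_measure)"
    by (rule borel_pair_imp_circ_measurable) measurable
  have fm: "case_prod ?f \<in> borel_measurable (circ_measure \<Otimes>\<^sub>M circ_measure)"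
    unfolding split_beta' by measurable
  obtain c where c: "chord_arc \<gamma> c" by (rule chord_arc_regular[OF reg])
  obtain R where R: "R > 0" "\<And>t. cmod (\<gamma> t) \<le> R"
    using curve_bounded[OF curve_continuous[OF reg] curve_periodic[OF reg]] by blast
  define D where "D = lsin_norm + sqrt (2 * pi) * (\<bar>ln (c / 2)\<bar> + \<bar>ln (cmod p + \<rho> + R)\<bar>)"
  have b: "cmod (p + of_real \<rho> * trig 1 t - \<gamma> s) \<le> cmod p + \<rho> + R" for t s
    using norm_triangle_ineq4[of "p + of_real \<rho> * trig 1 t" "\<gamma> s"] norm_triangle_ineq[of p "of_real \<rho> * trig 1 t"] R(2)[of s] assms
    by (simp add: norm_mult)
  have bound: "(LINT s|circ_measure. norm (?f t s)) \<le> nrm circ_measure (\<lambda>s. complex_of_real (\<phi> s)) * D" for t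
  proof -
    note k = log_kernel_sqi[OF c b, of t]
    have "(LINT s|circ_measure. norm (?f t s))
        = (LINT s|circ_measure. cmod (complex_of_real (\<phi> s)) * cmod (complex_of_real (ln (cmod (p + of_real \<rho> * trig 1 t - \<gamma> s)))))"
      by (simp add: abs_mult)
    also have "\<dots> \<le> nrm circ_measure (\<lambda>s. complex_of_real (\<phi> s)) * nrm circ_measure (\<lambda>s. complex_of_real (ln (cmod (p + of_real \<rho> * trig 1 t - \<gamma> s))))"
      by (rule Cauchy_Schwarz_sqi_norm[OF phi_sqi k(1)])
    also have "\<dots> \<le> nrm circ_measure (\<lambda>s. complex_of_real (\<phi> s)) * D"
      unfolding D_def by (rule mult_left_mono[OF k(2)]) simp
    finally show ?thesis .
  qed
  have int: "integrable (circ_measure \<Otimes>\<^sub>M circ_measure) (case_prod ?f)"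
  proof (rule circ2.Fubini_integrable[OF fm])
    have m: "(\<lambda>t. LINT s|circ_measure. norm (case_prod ?f (t, s))) \<in> borel_measurable circ_measure"
      by (rule circ.borel_measurable_lebesgue_integral) (use fm in measurable)
    show "integrable circ_measure (\<lambda>t. LINT s|circ_measure. norm (case_prod ?f (t, s)))"
    proof (rule integrable_circ_bounded(1)[OF m])
      show "norm (LINT s|circ_measure. norm (case_prod ?f (t, s))) \<le> nrm circ_measure (\<lambda>s. complex_of_real (\<phi> s)) * D" for t
        using bound[of t] by (simp add: integral_nonneg_AE)
    qed
    show "AE t in circ_measure. integrable circ_measure (\<lambda>s. case_prod ?f (t, s))"
      using log_pot_integrable by simp
  qed
  have "(LINT t|circ_measure. log_pot (p + of_real \<rho> * trig 1 t)) = (LINT s|circ_measure. LINT t|circ_measure. ?f t s)"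
    unfolding log_pot_def using circ2.Fubini_integral[OF int] by simp
  also have "(\<lambda>s. LINT t|circ_measure. ?f t s) = (\<lambda>s. \<phi> s * (2 * pi * ln (max \<rho> (cmod (\<gamma> s - p)))))"
    using integral_ln_circle[OF assms, of p "\<gamma> s" for s] by (simp add: has_bochner_integral_iff)
  finally show ?thesis .
qed

lemma log_pot_mean_value:
  assumes "\<And>s. \<gamma> s \<notin> E"
  shows "mean_value_on E log_pot"
  unfolding mean_value_on_def
proof (intro allI impI)
  fix p \<rho> assume \<rho>: "\<rho> > (0::real)" and sub: "cball p \<rho> \<subseteq> E"
  have "cmod (\<gamma> s - p) > \<rho>" for s
    using sub assms[of s] by (auto simp: subset_eq dist_norm norm_minus_commute not_le[symmetric])
  then have "max \<rho> (cmod (\<gamma> s - p)) = cmod (p - \<gamma> s)" for s by (simp add: norm_minus_commute less_imp_le max_def not_le)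
  then have "(LINT t|circ_measure. log_pot (p + of_real \<rho> * trig 1 t)) = (LINT s|circ_measure. (2 * pi) * (\<phi> s * ln (cmod (p - \<gamma> s))))"
    unfolding circle_log_integral[OF \<rho>] by (simp add: mult_ac)
  then show "(LINT t|circ_measure. log_pot (p + of_real \<rho> * trig 1 t)) = 2 * pi * log_pot p"
    by (simp only: integral_mult_right_zero log_pot_def)
qed

text \<open>The potentials \<open>U n\<close>, with the kernel truncated at distance
  \<open>\<epsilon> n\<close>, are continuous and converge uniformly on the plane.\<close>

lemma log_pot_continuous: "continuous_on A log_pot"
proof -
  obtain c where c: "chord_arc \<gamma> c" by (rule chord_arc_regular[OF reg])
  then have c0: "c > 0" by (simp add: chord_arc_def)
  obtain B where B: "B \<ge> 0" "\<And>s. s \<in> {0..2*pi} \<Longrightarrow> \<bar>\<phi> s\<bar> \<le> B" using phi_bounded by blast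
  have [measurable]: "\<gamma> \<in> borel_measurable borel" by (rule curve_measurable[OF reg])
  have [measurable]: "\<phi> \<in> borel_measurable circ_measure" by (rule phi_measurable)
  define \<epsilon> where "\<epsilon> n = 1 / real (Suc n)" for n
  have e0: "\<epsilon> n > 0" for n by (simp add: \<epsilon>_def)
  define U where "U n z = (LINT s|circ_measure. \<phi> s * ln (max (\<epsilon> n) (cmod (z - \<gamma> s))))" for n z
  have cs: "continuous_on {0..2*pi} (\<lambda>s. \<phi> s * ln (max (\<epsilon> n) (cmod (z - \<gamma> s))))" for n z
    using e0[of n] by (intro continuous_intros cphi curve_continuous[OF reg]) auto
  have Ui: "integrable circ_measure (\<lambda>s. \<phi> s * ln (max (\<epsilon> n) (cmod (z - \<gamma> s))))" for n z
    by (rule continuous_imp_integrable_real[OF cs])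
  have cU: "continuous_on UNIV (U n)" for n
  proof -
    have "continuous_on (UNIV \<times> cbox 0 (2*pi)) (\<lambda>(z, s). \<phi> s * ln (max (\<epsilon> n) (cmod (z - \<gamma> s))))"
      unfolding split_beta using e0[of n]
      by (intro continuous_intros continuous_on_compose2[OF cphi] continuous_on_compose2[OF curve_continuous[OF reg, of UNIV]]) (auto simp: less_max_iff_disj)
    from integral_continuous_on_param[OF this]
    have "continuous_on UNIV (\<lambda>z. integral {0..2*pi} (\<lambda>s. \<phi> s * ln (max (\<epsilon> n) (cmod (z - \<gamma> s)))))" by simp
    moreover have "U n z = integral {0..2*pi} (\<lambda>s. \<phi> s * ln (max (\<epsilon> n) (cmod (z - \<gamma> s))))" for z
      unfolding U_def by (rule lebesgue_integral_eq_integral[OF Ui]) simp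
    ultimately show ?thesis by simp
  qed
  \<comment> \<open>By the chord-arc bound \<open>g n (s - a)\<close> dominates the change of the
    kernel caused by the truncation, where \<open>a\<close> is the parameter of a point nearest to
    \<open>z\<close>. The integral of \<open>g n\<close> over a period does not see the shift,
    whence the uniformity in \<open>z\<close>.\<close>
  define g where "g n s = max 0 (ln (\<epsilon> n) - ln (c / 2) - lsin s)" for n s
  have gper: "g n (s + 2 * pi) = g n s" for n s by (simp add: g_def lsin_periodic)
  have gi: "integrable circ_measure (g n)" for n
    unfolding g_def using sqi_lsin_shift(3)[of 0] by auto
  have diff: "\<bar>log_pot z - U n z\<bar> \<le> B * (LINT s|circ_measure. g n s)" for n z
  proof -
    obtain a where a: "\<And>s. s \<in> {0..2*pi} \<Longrightarrow> c / 2 * \<bar>sin ((s - a) / 2)\<bar> \<le> cmod (z - \<gamma> s)"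
      using chord_arc_nearest[OF c] by blast
    note ga = periodic_shift[OF gi[of n] gper, of "- a"]
    have "\<bar>log_pot z - U n z\<bar> = \<bar>LINT s|circ_measure. \<phi> s * ln (cmod (z - \<gamma> s)) - \<phi> s * ln (max (\<epsilon> n) (cmod (z - \<gamma> s)))\<bar>"
      unfolding log_pot_def U_def using log_pot_integrable[of z] Ui[of n z] by simp
    also have "\<dots> \<le> (LINT s|circ_measure. \<bar>\<phi> s * ln (cmod (z - \<gamma> s)) - \<phi> s * ln (max (\<epsilon> n) (cmod (z - \<gamma> s)))\<bar>)"
      by (rule integral_abs_bound)
    also have "\<dots> \<le> (LINT s|circ_measure. B * g n (s + - a))"
    proof (rule integral_mono_AE)
      show "integrable circ_measure (\<lambda>s. \<bar>\<phi> s * ln (cmod (z - \<gamma> s)) - \<phi> s * ln (max (\<epsilon> n) (cmod (z - \<gamma> s)))\<bar>)"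
        using log_pot_integrable[of z] Ui[of n z] by auto
      show "integrable circ_measure (\<lambda>s. B * g n (s + - a))" using ga by simp
      show "AE s in circ_measure. \<bar>\<phi> s * ln (cmod (z - \<gamma> s)) - \<phi> s * ln (max (\<epsilon> n) (cmod (z - \<gamma> s)))\<bar> \<le> B * g n (s + - a)"
        using AE_sin_half_nonzero[of a] AE_space
      proof eventually_elim
        case (elim s)
        then have s: "s \<in> {0..2*pi}" and nz: "sin ((s - a) / 2) \<noteq> 0" by auto
        have p: "0 < c / 2 * \<bar>sin ((s - a) / 2)\<bar>" using c0 nz by simp
        have lo: "ln (c / 2) + lsin (s - a) \<le> ln (cmod (z - \<gamma> s))"
        proof -
          have "ln (c / 2) + lsin (s - a) = ln (c / 2 * \<bar>sin ((s - a) / 2)\<bar>)"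
            unfolding lsin_def by (rule ln_mult_pos[symmetric]) (use c0 nz in auto)
          also have "\<dots> \<le> ln (cmod (z - \<gamma> s))" using p a[OF s] by (subst ln_le_cancel_iff) auto
          finally show ?thesis .
        qed
        have "\<bar>ln (cmod (z - \<gamma> s)) - ln (max (\<epsilon> n) (cmod (z - \<gamma> s)))\<bar> \<le> g n (s + - a)"
        proof (cases "cmod (z - \<gamma> s) \<ge> \<epsilon> n")
          case True
          then show ?thesis by (simp add: g_def max_def)
        next
          case False
          have "cmod (z - \<gamma> s) > 0" by (rule less_le_trans[OF p a[OF s]])
          then have "ln (cmod (z - \<gamma> s)) \<le> ln (\<epsilon> n)" using False e0[of n] by (subst ln_le_cancel_iff) auto
          then show ?thesis using False lo by (simp add: g_def max_def)
        qed
        then have "\<bar>\<phi> s\<bar> * \<bar>ln (cmod (z - \<gamma> s)) - ln (max (\<epsilon> n) (cmod (z - \<gamma> s)))\<bar> \<le> B * g n (s + - a)"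
          using B(2)[OF s] B(1) by (intro mult_mono) auto
        then show ?case by (simp add: abs_mult flip: right_diff_distrib)
      qed
    qed
    also have "\<dots> = B * (LINT s|circ_measure. g n s)" using ga by simp
    finally show ?thesis .
  qed
  have g0: "(\<lambda>n. LINT s|circ_measure. g n s) \<longlonglongrightarrow> (LINT s|circ_measure. 0)"
  proof (rule integral_dominated_convergence)
    show "integrable circ_measure (\<lambda>s. \<bar>ln (c / 2)\<bar> + \<bar>lsin s\<bar>)"
      using sqi_lsin_shift(3)[of 0] by auto
    show "g n \<in> borel_measurable circ_measure" for n using gi by simp
    show "AE s in circ_measure. norm (g n s) \<le> \<bar>ln (c / 2)\<bar> + \<bar>lsin s\<bar>" for n
    proof (rule AE_I2)
      fix s
      have "ln (\<epsilon> n) \<le> 0" by (simp add: \<epsilon>_def ln_div)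
      then show "norm (g n s) \<le> \<bar>ln (c / 2)\<bar> + \<bar>lsin s\<bar>" unfolding g_def real_norm_def by linarith
    qed
    show "AE s in circ_measure. (\<lambda>n. g n s) \<longlonglongrightarrow> 0"
    proof (rule AE_I2)
      fix s
      have "filterlim (\<lambda>n. ln (\<epsilon> n)) at_bot sequentially"
        unfolding \<epsilon>_def
        by (rule filterlim_compose[OF ln_at_0]) (simp add: filterlim_at LIMSEQ_Suc[OF lim_1_over_n] del: of_nat_Suc)
      then have "\<forall>\<^sub>F n in sequentially. ln (\<epsilon> n) \<le> ln (c / 2) + lsin s" by (simp add: filterlim_at_bot)
      then have "\<forall>\<^sub>F n in sequentially. g n s = 0" by eventually_elim (simp add: g_def)
      then show "(\<lambda>n. g n s) \<longlonglongrightarrow> 0" by (rule tendsto_eventually)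
    qed
  qed simp
  have "uniform_limit UNIV U log_pot sequentially"
  proof (rule uniform_limitI)
    fix e :: real assume e: "e > 0"
    have "(\<lambda>n. B * (LINT s|circ_measure. g n s)) \<longlonglongrightarrow> B * 0" using g0 by (intro tendsto_intros) simp
    then have "\<forall>\<^sub>F n in sequentially. B * (LINT s|circ_measure. g n s) < e"
      using e by (intro order_tendstoD(2)[of _ "B * 0"]) auto
    then show "\<forall>\<^sub>F n in sequentially. \<forall>z\<in>UNIV. dist (U n z) (log_pot z) < e"
    proof eventually_elim
      case (elim n)
      then show ?case using diff[of _ n] by (auto simp: dist_real_def abs_minus_commute intro: le_less_trans)
    qed
  qed
  then have "continuous_on UNIV log_pot"
    by (rule uniform_limit_theorem[rotated]) (use cU in auto)
  then show ?thesis by (rule continuous_on_subset) simp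
qed

text \<open>From far away all curve points have nearly the same distance, so up to order
  \<open>1 / cmod (z - z0)\<close> the potential is that of its total charge placed at
  \<open>z0\<close>.\<close>

lemma log_pot_at_infinity:
  assumes "e > 0"
  obtains R where "\<And>z. cmod z > R \<Longrightarrow> \<bar>log_pot z - (LINT s|circ_measure. \<phi> s) * ln (cmod (z - z0))\<bar> < e"
proof -
  obtain B where B: "B \<ge> 0" "\<And>s. s \<in> {0..2*pi} \<Longrightarrow> \<bar>\<phi> s\<bar> \<le> B" using phi_bounded by blast
  obtain R where R: "R > 0" "\<And>t. cmod (\<gamma> t) \<le> R"
    using curve_bounded[OF curve_continuous[OF reg] curve_periodic[OF reg]] by blast
  define d where "d = R + cmod z0"
  have d: "cmod (\<gamma> s - z0) \<le> d" for s using norm_triangle_ineq4[of "\<gamma> s" z0] R(2)[of s] by (simp add: d_def)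
  have d0: "d > 0" using R by (simp add: d_def add_pos_nonneg)
  define C where "C = 2 * pi * (B * (2 * d))"
  have C0: "C \<ge> 0" using B d0 by (simp add: C_def)
  show thesis
  \<comment> \<open>The summand \<open>2 * d\<close> makes the relative deviation \<open>x\<close>
    at most 1/2, as the estimate of the logarithm requires; \<open>(C + 1) / e\<close> makes the
    error \<open>C / r\<close> smaller than \<open>e\<close>.\<close>
  proof (rule that[of "cmod z0 + 2 * d + (C + 1) / e"])
    fix z assume z: "cmod z0 + 2 * d + (C + 1) / e < cmod z"
    define r where "r = cmod (z - z0)"
    have r: "r > 2 * d + (C + 1) / e" using norm_triangle_ineq2[of z z0] z by (simp add: r_def)
    have Ce: "(C + 1) / e > 0" using C0 assms by simp
    have r0: "r > 2 * d" "r > 0" using r Ce d0 by auto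
    have zz: "z - z0 \<noteq> 0" using r0 by (auto simp: r_def)
    have pt: "\<bar>ln (cmod (z - \<gamma> s)) - ln (cmod (z - z0))\<bar> \<le> 2 * d / r" for s
    proof -
      define x where "x = cmod (z - \<gamma> s) / r - 1"
      have "cmod (z - \<gamma> s) - r \<le> d" "r - cmod (z - \<gamma> s) \<le> d"
        using norm_triangle_ineq3[of "z - \<gamma> s" "z - z0"] d[of s] by (auto simp: r_def norm_minus_commute abs_le_iff)
      then have xd: "\<bar>x\<bar> \<le> d / r" using r0 by (auto simp: x_def abs_le_iff field_simps)
      have half: "d / r < 1 / 2" using r0 by (simp add: field_simps)
      have q: "cmod (z - \<gamma> s) = r * (1 + x)" using r0 by (simp add: x_def)
      have "ln (cmod (z - \<gamma> s)) - ln r = ln (1 + x)"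
        unfolding q
      proof (subst ln_mult_pos)
        show "0 < 1 + x" using xd half by linarith
      qed (use r0 in auto)
      moreover have "\<bar>ln (1 + x)\<bar> \<le> 2 * \<bar>x\<bar>"
        using abs_ln_one_plus_x_minus_x_bound[of x] xd half
      proof -
        have x2: "\<bar>x\<bar> \<le> 1 / 2" using xd half by linarith
        have "\<bar>ln (1 + x) - x\<bar> \<le> 2 * x\<^sup>2" by (rule abs_ln_one_plus_x_minus_x_bound[OF x2])
        moreover have "2 * x\<^sup>2 \<le> \<bar>x\<bar>"
          using mult_left_mono[OF x2, of "2 * \<bar>x\<bar>"] by (simp add: power2_eq_square abs_mult_self_eq flip: abs_mult)
        ultimately show ?thesis by linarith
      qed
      ultimately show ?thesis using xd by (simp add: r_def)
    qed
    have "log_pot z - (LINT s|circ_measure. \<phi> s) * ln (cmod (z - z0))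
       = (LINT s|circ_measure. \<phi> s * (ln (cmod (z - \<gamma> s)) - ln (cmod (z - z0))))"
      unfolding log_pot_def using log_pot_integrable[of z] phi_integrable by (simp add: right_diff_distrib)
    also have "\<bar>\<dots>\<bar> \<le> 2 * pi * (B * (2 * d / r))"
    proof -
      have m: "(\<lambda>s. \<phi> s * (ln (cmod (z - \<gamma> s)) - ln (cmod (z - z0)))) \<in> borel_measurable circ_measure"
        using phi_measurable log_kernel_measurable[OF curve_continuous[OF reg], of z] by measurable
      have "norm (LINT s|circ_measure. \<phi> s * (ln (cmod (z - \<gamma> s)) - ln (cmod (z - z0)))) \<le> 2 * pi * (B * (2 * d / r))"
      proof (rule integrable_circ_bounded(2)[OF m])
        fix s assume s: "s \<in> {0..2*pi}"
        show "norm (\<phi> s * (ln (cmod (z - \<gamma> s)) - ln (cmod (z - z0)))) \<le> B * (2 * d / r)"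
          unfolding real_norm_def abs_mult by (intro mult_mono B(2)[OF s] pt[of s] B(1)) simp
      qed
      then show ?thesis by simp
    qed
    also have "\<dots> = C / r" by (simp add: C_def)
    also have "\<dots> < e"
    proof -
      have "(C + 1) / e < r" using r d0 by simp
      then have "C + 1 < r * e" using assms by (simp add: field_simps)
      then show ?thesis using r0 by (simp add: field_simps)
    qed
    finally show "\<bar>log_pot z - (LINT s|circ_measure. \<phi> s) * ln (cmod (z - z0))\<bar> < e" .
  qed
qed

end

section \<open>Injectivity of Symm's operator\<close>

text \<open>The difference of the circle means with radii \<open>2\<rho>\<close> and \<open>\<rho>\<close> around a boundary point integrates the
  density against the bump function \<open>ln (max (2\<rho>) d) - ln (max \<rho> d)\<close> of the distance \<open>d\<close>.\<close>

lemma log_pot_zero_imp_density_zero: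
  assumes reg: "regular_closed_C3_curve \<gamma>" and c: "continuous_on {0..2*pi} \<phi>"
    and z: "\<And>z. log_pot \<gamma> \<phi> z = 0" and s0: "0 < s0" "s0 < 2 * pi"
  shows "\<phi> s0 \<le> 0"
proof (rule ccontr)
  assume "\<not> \<phi> s0 \<le> 0"
  then have pos: "\<phi> s0 > 0" by simp
  have "isCont \<phi> s0"
    using c s0 by (intro continuous_on_interior[of "{0..2*pi}"]) auto
  then have "(\<phi> \<longlongrightarrow> \<phi> s0) (at s0)" by (simp add: isCont_def)
  from order_tendstoD(1)[OF this pos] have "\<forall>\<^sub>F s in at s0. \<phi> s > 0" .
  then obtain \<delta> where \<delta>: "\<delta> > 0" "\<And>s. s \<noteq> s0 \<Longrightarrow> dist s s0 < \<delta> \<Longrightarrow> \<phi> s > 0"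
    unfolding eventually_at by auto
  \<comment> \<open>\<open>\<eta>\<close> keeps the interval around \<open>s0\<close> on which
    \<open>\<phi>\<close> is positive inside the period, so that its complement \<open>?C\<close>
    contains 0.\<close>
  define \<eta> where "\<eta> = min \<delta> (min s0 (2 * pi - s0))"
  have \<eta>: "\<eta> > 0" using \<delta>(1) s0 by (simp add: \<eta>_def)
  have near: "\<phi> s > 0" if "\<bar>s - s0\<bar> < \<eta>" for s
    using \<delta>(2)[of s] pos that by (cases "s = s0") (auto simp: \<eta>_def dist_real_def)
  let ?D = "\<lambda>s. cmod (\<gamma> s - \<gamma> s0)"
  let ?C = "{0..2*pi} - {s0 - \<eta><..<s0 + \<eta>}"
  have inj: "?D s > 0" if "s \<in> ?C" for s
  proof -
    have "\<gamma> s \<noteq> \<gamma> s0"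
    proof
      assume "\<gamma> s = \<gamma> s0"
      moreover have "\<bar>s - s0\<bar> < 2 * pi" using that s0 by auto
      ultimately have "s = s0"
        using periodic_inj[of \<gamma> s s0] reg by (simp add: regular_closed_C3_curve_def)
      then show False using that \<eta> by auto
    qed
    then show ?thesis by simp
  qed
  have "compact ?C" by (intro compact_diff) auto
  moreover have "0 \<in> ?C" using \<eta> s0 by (auto simp: \<eta>_def)
  moreover have cD: "continuous_on A ?D" for A by (intro continuous_intros curve_continuous[OF reg])
  ultimately obtain m where m: "m \<in> ?C" "\<And>s. s \<in> ?C \<Longrightarrow> ?D m \<le> ?D s"
    using continuous_attains_inf[of ?C ?D] by blast
  \<comment> \<open>The bump vanishes at distance \<open>2 * \<rho>\<close> and beyond, and by the
    choice of \<open>m\<close> the curve comes closer to \<open>\<gamma> s0\<close> only at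
    parameters where \<open>\<phi>\<close> is positive.\<close>
  define \<rho> where "\<rho> = ?D m / 2"
  have \<rho>: "\<rho> > 0" using inj[OF m(1)] by (simp add: \<rho>_def)
  let ?b = "\<lambda>s. ln (max (2 * \<rho>) (?D s)) - ln (max \<rho> (?D s))"
  have cb: "continuous_on {0..2*pi} (\<lambda>s. \<phi> s * (2 * pi * ln (max r (?D s))))" if "r > 0" for r
    using that by (intro continuous_intros c cD) (auto simp: less_max_iff_disj)
  have "(LINT s|circ_measure. \<phi> s * (2 * pi * ln (max r (?D s)))) = 0" if "r > 0" for r
    using circle_log_integral[OF reg c that, of "\<gamma> s0"] z by simp
  then have "(LINT s|circ_measure. \<phi> s * (2 * pi * ln (max (2 * \<rho>) (?D s))) - \<phi> s * (2 * pi * ln (max \<rho> (?D s)))) = 0"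
    using continuous_imp_integrable_real[OF cb[of \<rho>]] continuous_imp_integrable_real[OF cb[of "2 * \<rho>"]] \<rho> by simp
  then have "\<phi> s0 * (2 * pi * ln (max (2 * \<rho>) (?D s0))) - \<phi> s0 * (2 * pi * ln (max \<rho> (?D s0))) = 0"
  proof (rule continuous_integral_zero_imp_zero[rotated 2])
    show "continuous_on {0..2*pi} (\<lambda>s. \<phi> s * (2 * pi * ln (max (2 * \<rho>) (?D s))) - \<phi> s * (2 * pi * ln (max \<rho> (?D s))))"
      using \<rho> by (intro continuous_on_diff cb) auto
    fix s assume s: "s \<in> {0..2*pi}"
    show "0 \<le> \<phi> s * (2 * pi * ln (max (2 * \<rho>) (?D s))) - \<phi> s * (2 * pi * ln (max \<rho> (?D s)))"
    proof (cases "\<bar>s - s0\<bar> < \<eta>")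
      case True
      have "ln (max \<rho> (?D s)) \<le> ln (max (2 * \<rho>) (?D s))" using \<rho> by (subst ln_le_cancel_iff) auto
      then show ?thesis using near[OF True] by (simp add: mult_left_mono)
    next
      case False
      then have "s \<in> ?C" using s by (auto simp: abs_less_iff)
      then have "?D s \<ge> 2 * \<rho>" using m(2) by (simp add: \<rho>_def)
      then show ?thesis using \<rho> by (simp add: max_def)
    qed
  qed (use s0 in auto)
  then have "\<phi> s0 * (2 * pi) * (ln (2 * \<rho>) - ln \<rho>) = 0" using \<rho> by (simp add: max_def algebra_simps)
  moreover have "ln (2 * \<rho>) > ln \<rho>" using \<rho> by (subst ln_less_cancel_iff) auto
  ultimately show False using pos by simp
qed

lemma continuous_on_Icc_eq_zero:
  fixes \<phi> :: "real \<Rightarrow> real"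
  assumes c: "continuous_on {a..b} \<phi>" and ab: "a < b" and z: "\<And>s. a < s \<Longrightarrow> s < b \<Longrightarrow> \<phi> s = 0" and s: "s \<in> {a..b}"
  shows "\<phi> s = 0"
proof -
  have "closure {a<..<b} = {a..b}" using ab by simp
  then show ?thesis
    using continuous_constant_on_closure[of "{a<..<b}" \<phi> 0 s] c z s by auto
qed

text \<open>Serves both for \<open>\<Omega>\<close>, where boundedness makes the decay hypothesis
  vacuous, and for the complement of its closure. The maximum principle is applied to the potential
  and to its negative.\<close>

lemma interior_potential_zero:
  assumes reg: "regular_closed_C3_curve \<gamma>" and c: "continuous_on {0..2*pi} \<phi>"
    and E: "open E" "E \<noteq> UNIV" and fr: "\<And>z. z \<in> frontier E \<Longrightarrow> log_pot \<gamma> \<phi> z = 0" and g: "\<And>s. \<gamma> s \<notin> E"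
    and dec: "\<And>e. e > 0 \<Longrightarrow> \<exists>R. \<forall>z\<in>closure E. cmod z > R \<longrightarrow> \<bar>log_pot \<gamma> \<phi> z\<bar> < e"
    and p: "p \<in> E"
  shows "log_pot \<gamma> \<phi> p = 0"
proof -
  note mv = log_pot_mean_value[OF reg c g]
  have "log_pot \<gamma> \<phi> p \<le> 0"
  proof (rule weak_maximum_principle[OF E log_pot_continuous[OF reg c] mv _ _ p])
    show "\<exists>R. \<forall>z\<in>closure E. R < cmod z \<longrightarrow> log_pot \<gamma> \<phi> z < e" if "e > 0" for e
      using dec[OF that] by (meson abs_less_iff)
  qed (use fr in auto)
  moreover have "- log_pot \<gamma> \<phi> p \<le> 0"
  proof (rule weak_maximum_principle[OF E _ mean_value_on_uminus[OF mv] _ _ p])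
    show "continuous_on (closure E) (\<lambda>z. - log_pot \<gamma> \<phi> z)" by (intro continuous_intros log_pot_continuous[OF reg c])
    show "\<exists>R. \<forall>z\<in>closure E. R < cmod z \<longrightarrow> - log_pot \<gamma> \<phi> z < e" if "e > 0" for e
      using dec[OF that] by (meson abs_less_iff)
  qed (use fr in auto)
  ultimately show ?thesis by simp
qed

lemma frontier_compl_closure_subset: "frontier (- closure S) \<subseteq> frontier S"
  unfolding frontier_complement
  by (auto simp: frontier_def dest: interior_mono[OF closure_subset, THEN subsetD])

lemma mean_value_on_ln:
  assumes "z0 \<notin> E"
  shows "mean_value_on E (\<lambda>z. ln (cmod (z - z0)))"
  unfolding mean_value_on_def
proof (intro allI impI)
  fix p \<rho> assume \<rho>: "\<rho> > (0::real)" and sub: "cball p \<rho> \<subseteq> E"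
  have "cmod (z0 - p) > \<rho>"
    using sub assms by (auto simp: subset_eq dist_norm norm_minus_commute not_le[symmetric])
  then show "(LINT t|circ_measure. ln (cmod (p + of_real \<rho> * trig 1 t - z0))) = 2 * pi * ln (cmod (p - z0))"
    using integral_ln_circle[OF \<rho>, of p z0] by (simp add: has_bochner_integral_iff norm_minus_commute max_def not_le)
qed

lemma curve_in_image:
  assumes "regular_closed_C3_curve \<gamma>"
  shows "\<gamma> s \<in> \<gamma> ` {0..2*pi}"
proof -
  obtain n s' where s': "s = s' + 2 * pi * of_int n" "0 \<le> s'" "s' < 2 * pi" by (rule periodic_mod_2pi)
  have "\<gamma> s = \<gamma> s'" using periodic_int[of \<gamma>, OF curve_periodic[OF assms]] by (simp add: s'(1))
  then show ?thesis using s' by auto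
qed

text \<open>Otherwise the potential minus that of a point charge at \<open>z0\<close> would
  have a strict sign on the boundary, decay at infinity, and have mean zero over a large circle.\<close>

lemma total_charge_zero:
  assumes \<Omega>: "bounded \<Omega>" and reg: "regular_closed_C3_curve \<gamma>" and fr: "frontier \<Omega> = \<gamma> ` {0..2*pi}"
    and op: "open \<Omega>" and z0: "z0 \<in> \<Omega>" and unit: "\<forall>x\<in>frontier \<Omega>. norm (x - z0) \<noteq> 1"
    and c: "continuous_on {0..2*pi} \<phi>" and zero: "\<And>x. x \<in> frontier \<Omega> \<Longrightarrow> log_pot \<gamma> \<phi> x = 0"
  shows "(LINT s|circ_measure. \<phi> s) = 0"
proof (rule ccontr)
  define m where "m = (LINT s|circ_measure. \<phi> s)"
  assume "(LINT s|circ_measure. \<phi> s) \<noteq> 0"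
  then have m0: "m \<noteq> 0" by (simp add: m_def)
  define E where "E = - closure \<Omega>"
  have E: "open E" "E \<noteq> UNIV" using z0 closure_subset by (auto simp: E_def)
  have frE: "frontier E \<subseteq> frontier \<Omega>" unfolding E_def by (rule frontier_compl_closure_subset)
  have gE: "\<gamma> s \<notin> E" for s
    using curve_in_image[OF reg, of s] fr closure_Un_frontier[of \<Omega>] by (auto simp: E_def)
  have z0E: "z0 \<notin> closure E"
  proof -
    have "z0 \<in> interior (closure \<Omega>)" using z0 op closure_subset by (metis interior_maximal subsetD)
    then show ?thesis by (simp add: E_def closure_complement)
  qed
  have z0E': "z0 \<notin> E" using z0E closure_subset by auto
  \<comment> \<open>Subtracting the point charge removes the logarithmic growth at infinity; on the
    boundary, where the potential vanishes, \<open>v x\<close> is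
    \<open>- (m * ln (cmod (x - z0)))\<close>.\<close>
  define v where "v z = log_pot \<gamma> \<phi> z - m * ln (cmod (z - z0))" for z
  have cv: "continuous_on (closure E) v"
    unfolding v_def using z0E by (intro continuous_intros log_pot_continuous[OF reg c]) auto
  have iv: "integrable circ_measure (\<lambda>t. log_pot \<gamma> \<phi> (p + of_real \<rho> * trig 1 t))" for p \<rho>
    by (intro continuous_imp_integrable_real continuous_on_compose2[OF log_pot_continuous[OF reg c, of UNIV]]) (auto intro!: continuous_intros)
  have mvv: "mean_value_on E v"
    using log_pot_mean_value[OF reg c gE] mean_value_on_ln[OF z0E'] integral_ln_circle[of _ _ z0] iv
    unfolding mean_value_on_def v_def by (simp add: has_bochner_integral_iff right_diff_distrib)
  \<comment> \<open>The sign makes \<open>\<sigma> * v\<close> negative at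
    \<open>\<gamma> 0\<close>. As the curve is connected, its distance to \<open>z0\<close> stays on
    one side of 1, so the product is negative on the whole boundary.\<close>
  define \<sigma> :: real where "\<sigma> = (if m * ln (cmod (\<gamma> 0 - z0)) > 0 then 1 else - 1)"
  have \<sigma>2: "\<sigma> = 1 \<or> \<sigma> = - 1" by (simp add: \<sigma>_def)
  have nz: "cmod (x - z0) > 0" if "x \<in> frontier \<Omega>" for x
    using that z0 op by (auto simp: frontier_def interior_open)
  have sign: "\<sigma> * v x < 0" if x: "x \<in> frontier \<Omega>" for x
  proof -
    have same: "(cmod (x - z0) < 1 \<and> cmod (\<gamma> 0 - z0) < 1) \<or> (cmod (x - z0) > 1 \<and> cmod (\<gamma> 0 - z0) > 1)"
    proof (rule ccontr)
      assume n: "\<not> ?thesis"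
      let ?A = "(\<lambda>s. cmod (\<gamma> s - z0)) ` {0..2*pi}"
      have A: "connected ?A"
        by (intro connected_continuous_image continuous_intros curve_continuous[OF reg]) auto
      obtain s where s: "s \<in> {0..2*pi}" "x = \<gamma> s" using x fr by auto
      have in1: "cmod (x - z0) \<in> ?A" using s by auto
      have in2: "cmod (\<gamma> 0 - z0) \<in> ?A" by (rule imageI) simp
      have "cmod (x - z0) \<noteq> 1" "cmod (\<gamma> 0 - z0) \<noteq> 1" using unit x fr by (auto simp del: One_nat_def)
      then have "1 \<in> {cmod (x - z0)..cmod (\<gamma> 0 - z0)} \<or> 1 \<in> {cmod (\<gamma> 0 - z0)..cmod (x - z0)}" using n by auto
      then have "1 \<in> ?A" using connected_contains_Icc[OF A in1 in2] connected_contains_Icc[OF A in2 in1] by auto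
      then show False using unit fr by auto
    qed
    have px: "cmod (x - z0) > 0" by (rule nz[OF x])
    have p0: "cmod (\<gamma> 0 - z0) > 0" using nz[of "\<gamma> 0"] fr by auto
    have vx: "v x = - (m * ln (cmod (x - z0)))" using zero[OF x] by (simp add: v_def)
    from same show ?thesis
    proof
      assume *: "cmod (x - z0) < 1 \<and> cmod (\<gamma> 0 - z0) < 1"
      then have "ln (cmod (x - z0)) < 0" "ln (cmod (\<gamma> 0 - z0)) < 0" using px p0 by (auto simp: ln_less_zero)
      then show ?thesis unfolding vx \<sigma>_def using m0 by (auto simp: zero_less_mult_iff mult_less_0_iff)
    next
      assume *: "cmod (x - z0) > 1 \<and> cmod (\<gamma> 0 - z0) > 1"
      then have "ln (cmod (x - z0)) > 0" "ln (cmod (\<gamma> 0 - z0)) > 0" by (auto intro: ln_gt_zero)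
      then show ?thesis unfolding vx \<sigma>_def using m0 by (auto simp: zero_less_mult_iff mult_less_0_iff)
    qed
  qed
  define w where "w z = \<sigma> * v z" for z
  have cw: "continuous_on (closure E) w" unfolding w_def by (intro continuous_intros cv)
  have mw: "mean_value_on E w"
    using mvv unfolding mean_value_on_def w_def by (simp add: mult.left_commute)
  have dec: "\<exists>R. \<forall>z\<in>closure E. cmod z > R \<longrightarrow> w z < e" if e: "e > 0" for e
  proof -
    obtain R where R: "\<And>z. cmod z > R \<Longrightarrow> \<bar>log_pot \<gamma> \<phi> z - m * ln (cmod (z - z0))\<bar> < e"
      using log_pot_at_infinity[OF reg c e, of z0] unfolding m_def by blast
    have "w z < e" if "cmod z > R" for z using R[OF that] \<sigma>2 by (auto simp: w_def v_def)
    then show ?thesis by blast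
  qed
  have le: "w z \<le> 0" if "z \<in> closure E" for z
  proof (cases "z \<in> E")
    case True
    then show ?thesis
      using weak_maximum_principle[OF E cw mw _ dec] sign frE by (force simp: w_def)
  next
    case False
    then have "z \<in> frontier E" using that E(1) by (simp add: frontier_def interior_open)
    then show ?thesis using sign[of z] frE by (auto simp: w_def)
  qed
  \<comment> \<open>Over a circle around \<open>z0\<close> that encloses the curve, the potential
    and \<open>m\<close> times the logarithm both have mean \<open>m * ln R0\<close>. So the
    nonpositive function \<open>w\<close> has mean 0 there and vanishes on the circle, and the
    strong maximum principle yields a boundary zero, against the strict sign.\<close>
  obtain R0 where R0: "R0 > 0" "closure \<Omega> \<subseteq> ball z0 R0"
    using bounded_closure[OF \<Omega>] bounded_subset_ballD by blast
  have onE: "z0 + of_real R0 * trig 1 t \<in> E" for t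
    using R0 by (auto simp: E_def dist_norm norm_mult)
  have "(LINT t|circ_measure. w (z0 + of_real R0 * trig 1 t)) = 0"
  proof -
    have "cmod (\<gamma> s - z0) \<le> R0" for s
    proof -
      have "\<gamma> s \<in> closure \<Omega>" using gE[of s] by (simp add: E_def)
      then show ?thesis using R0(2) by (auto simp: dist_norm norm_minus_commute)
    qed
    then have "max R0 (cmod (\<gamma> s - z0)) = R0" for s by (simp add: max_absorb1)
    then have A: "(LINT t|circ_measure. log_pot \<gamma> \<phi> (z0 + of_real R0 * trig 1 t)) = 2 * pi * ln R0 * m"
      unfolding circle_log_integral[OF reg c R0(1)] m_def by (simp add: mult.commute)
    have "ln (cmod (z0 + of_real R0 * trig 1 t - z0)) = ln R0" for t using R0 by (simp add: norm_mult)
    then have "w (z0 + of_real R0 * trig 1 t) = \<sigma> * (log_pot \<gamma> \<phi> (z0 + of_real R0 * trig 1 t) - m * ln R0)" for t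
      by (simp add: w_def v_def)
    then show ?thesis using A iv[of z0 R0] by simp
  qed
  then have "(LINT t|circ_measure. - w (z0 + of_real R0 * trig 1 t)) = 0" by simp
  then have "- w (z0 + of_real R0 * trig 1 0) = 0"
  proof (rule continuous_integral_zero_imp_zero[rotated 2])
    show "continuous_on {0..2*pi} (\<lambda>t. - w (z0 + of_real R0 * trig 1 t))"
      by (intro continuous_intros continuous_on_compose2[OF cw]) (use onE closure_subset in \<open>auto intro!: continuous_intros\<close>)
    show "0 \<le> - w (z0 + of_real R0 * trig 1 t)" for t using le onE[of t] closure_subset by force
  qed auto
  then have "w (z0 + of_real R0 * trig 1 0) = 0" by simp
  then obtain q where "q \<in> frontier E" "w q = 0"
    using strong_maximum_principle[OF E cw mw le onE] by blast
  then show False using sign[of q] frE by (auto simp: w_def)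
qed

lemma log_pot_injective:
  assumes \<Omega>: "bounded \<Omega>" and reg: "regular_closed_C3_curve \<gamma>" and fr: "frontier \<Omega> = \<gamma> ` {0..2*pi}"
    and op: "open \<Omega>" and z0: "z0 \<in> \<Omega>" and unit: "\<forall>x\<in>frontier \<Omega>. norm (x - z0) \<noteq> 1"
    and c: "continuous_on {0..2*pi} \<phi>" and zero: "\<And>x. x \<in> frontier \<Omega> \<Longrightarrow> log_pot \<gamma> \<phi> x = 0"
    and s: "s \<in> {0..2*pi}"
  shows "\<phi> s = 0"
proof -
  have m: "(LINT s|circ_measure. \<phi> s) = 0" by (rule total_charge_zero[OF \<Omega> reg fr op z0 unit c zero])
  have gfr: "\<gamma> s \<in> frontier \<Omega>" for s using curve_in_image[OF reg] fr by simp
  obtain R where R: "\<And>z. z \<in> closure \<Omega> \<Longrightarrow> cmod z \<le> R"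
    using bounded_closure[OF \<Omega>] by (auto simp: bounded_iff)
  have inside: "log_pot \<gamma> \<phi> p = 0" if "p \<in> \<Omega>" for p
  proof (rule interior_potential_zero[OF reg c op _ zero _ _ that])
    show "\<Omega> \<noteq> UNIV" using \<Omega> not_bounded_UNIV by auto
    show "\<gamma> s \<notin> \<Omega>" for s using gfr[of s] op by (auto simp: frontier_def interior_open)
    show "\<exists>R. \<forall>z\<in>closure \<Omega>. R < cmod z \<longrightarrow> \<bar>log_pot \<gamma> \<phi> z\<bar> < e" for e
      using R by (intro exI[of _ R]) force
  qed
  have outside: "log_pot \<gamma> \<phi> p = 0" if "p \<in> - closure \<Omega>" for p
  proof (rule interior_potential_zero[OF reg c _ _ zero _ _ that])
    show "- closure \<Omega> \<noteq> UNIV" using z0 closure_subset by auto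
    show "z \<in> frontier \<Omega>" if "z \<in> frontier (- closure \<Omega>)" for z using that frontier_compl_closure_subset by blast
    show "\<gamma> s \<notin> - closure \<Omega>" for s using gfr[of s] by (auto simp: frontier_def)
    \<comment> \<open>With total charge zero the logarithmic term drops out, and the potential
      decays at infinity.\<close>
    show "\<exists>R. \<forall>z\<in>closure (- closure \<Omega>). R < cmod z \<longrightarrow> \<bar>log_pot \<gamma> \<phi> z\<bar> < e" if "e > 0" for e
      using log_pot_at_infinity[OF reg c that, of z0] unfolding m by (metis diff_zero mult_zero_left)
  qed auto
  have all: "log_pot \<gamma> \<phi> z = 0" for z
    using inside[of z] outside[of z] zero[of z] closure_Un_frontier[of \<Omega>] by blast
  have "\<phi> s = 0" if "0 < s" "s < 2 * pi" for s
  proof -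
    have "\<phi> s \<le> 0" by (rule log_pot_zero_imp_density_zero[OF reg c all that])
    moreover have "- \<phi> s \<le> 0"
    proof (rule log_pot_zero_imp_density_zero[OF reg _ _ that])
      show "continuous_on {0..2*pi} (\<lambda>s. - \<phi> s)" by (intro continuous_intros c)
      then show "log_pot \<gamma> (\<lambda>s. - \<phi> s) z = 0" for z
        using all[of z] by (simp add: log_pot_def[OF reg] c)
    qed
    ultimately show ?thesis by simp
  qed
  then show ?thesis using continuous_on_Icc_eq_zero[OF c _ _ s] by simp
qed

text \<open>Continuity of the potential upgrades vanishing almost everywhere to vanishing on the
  whole curve; as the kernel is real, the real and imaginary parts of the density separate.\<close>

lemma symm_op_injective:
  assumes \<Omega>: "bounded \<Omega>" and reg: "regular_closed_C3_curve \<gamma>" and fr: "frontier \<Omega> = \<gamma> ` {0..2*pi}"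
    and op: "open \<Omega>" and z0: "z0 \<in> \<Omega>" and unit: "\<forall>x\<in>frontier \<Omega>. norm (x - z0) \<noteq> 1"
    and c: "continuous_on {0..2*pi} \<psi>" and zero: "AE t in circ_measure. symm_op \<gamma> \<psi> t = 0"
    and s: "s \<in> {0..2*pi}"
  shows "\<psi> s = 0"
proof -
  let ?r = "\<lambda>s. Re (\<psi> s)" and ?i = "\<lambda>s. Im (\<psi> s)"
  have cr: "continuous_on {0..2*pi} ?r" and ci: "continuous_on {0..2*pi} ?i" by (intro continuous_intros c)+
  have eq: "symm_op \<gamma> \<psi> t = of_real (- 1 / pi) * (of_real (log_pot \<gamma> ?r (\<gamma> t)) + \<i> * of_real (log_pot \<gamma> ?i (\<gamma> t)))" for t
  proof -
    have "\<psi> s * complex_of_real (ln (cmod (\<gamma> t - \<gamma> s)))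
       = complex_of_real (?r s * ln (cmod (\<gamma> t - \<gamma> s))) + \<i> * complex_of_real (?i s * ln (cmod (\<gamma> t - \<gamma> s)))" for s
      by (simp add: complex_eq_iff)
    then show ?thesis
      using log_pot_integrable[OF reg cr, of "\<gamma> t"] log_pot_integrable[OF reg ci, of "\<gamma> t"]
      by (simp add: symm_op_def log_pot_def[OF reg cr] log_pot_def[OF reg ci] del: of_real_mult)
  qed
  have cK: "continuous_on {0..2*pi} (symm_op \<gamma> \<psi>)"
    unfolding eq
    by (intro continuous_intros continuous_on_compose2[OF log_pot_continuous[OF reg cr, of UNIV]]
        continuous_on_compose2[OF log_pot_continuous[OF reg ci, of UNIV]] curve_continuous[OF reg]) auto
  have "cmod (symm_op \<gamma> \<psi> t) = 0" if "t \<in> {0..2*pi}" for t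
  proof (rule continuous_integral_zero_imp_zero[OF _ _ _ that])
    show "continuous_on {0..2*pi} (\<lambda>t. cmod (symm_op \<gamma> \<psi> t))" by (intro continuous_intros cK)
    have "AE t in circ_measure. cmod (symm_op \<gamma> \<psi> t) = 0" using zero by simp
    then show "(LINT t|circ_measure. cmod (symm_op \<gamma> \<psi> t)) = 0" by (rule integral_eq_zero_AE)
  qed simp
  then have "log_pot \<gamma> ?r x = 0 \<and> log_pot \<gamma> ?i x = 0" if "x \<in> frontier \<Omega>" for x
    using that unfolding fr eq by (auto simp: complex_eq_iff)
  then have "Re (\<psi> s) = 0" "Im (\<psi> s) = 0"
    using log_pot_injective[OF \<Omega> reg fr op z0 unit cr _ s] log_pot_injective[OF \<Omega> reg fr op z0 unit ci _ s] by auto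
  then show ?thesis by (simp add: complex_eq_iff)
qed

section \<open>Sobolev norms as weighted square sums\<close>

text \<open>With this weight the Sobolev norm of order \<open>r\<close> is a plain square-sum norm,
  so all orders share the lemmas on \<open>nrm cZ\<close>.\<close>

definition sobolev_weight :: "real \<Rightarrow> (int \<Rightarrow> complex) \<Rightarrow> int \<Rightarrow> complex" where
  "sobolev_weight r a k = of_real ((1 + (real_of_int k)\<^sup>2) powr (r / 2)) * a k"

lemma one_plus_sq_pos [simp]: "0 < 1 + (real_of_int k)\<^sup>2"
  by (simp add: add_pos_nonneg)

lemma cmod_sobolev_weight_sq: "(cmod (sobolev_weight r a k))\<^sup>2 = (1 + (real_of_int k)\<^sup>2) powr r * (cmod (a k))\<^sup>2"
proof -
  have "((1 + (real_of_int k)\<^sup>2) powr (r / 2))\<^sup>2 = (1 + (real_of_int k)\<^sup>2) powr r"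
    by (simp add: power2_eq_square flip: powr_add)
  then show ?thesis by (simp add: sobolev_weight_def norm_mult power_mult_distrib)
qed

lemma sobolev_iff_sqi: "a \<in> sobolev r \<longleftrightarrow> sqi cZ (sobolev_weight r a)"
  by (simp add: sobolev_def sqi_def cmod_sobolev_weight_sq summable_iff_integrable_cZ)

lemma sobolev_norm_eq_nrm: "a \<in> sobolev r \<Longrightarrow> sobolev_norm r a = nrm cZ (sobolev_weight r a)"
  unfolding sobolev_iff_sqi sobolev_norm_def nrm_def
  by (subst infsum_eq_integral_cZ) (simp_all add: sqi_def cmod_sobolev_weight_sq)

lemma powr_minus_half:
  fixes x :: real
  assumes "x > 0"
  shows "x powr (- 1 / 2) = 1 / sqrt x"
proof -
  have "x powr (- 1 / 2) = x powr (- (1 / 2))" by simp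
  also have "\<dots> = inverse (x powr (1 / 2))" by (rule powr_minus)
  also have "x powr (1 / 2) = sqrt x" using assms by (intro powr_half_sqrt) simp
  finally show ?thesis by (simp only: inverse_eq_divide)
qed

lemma cmod_sobolev_weight_minus_1: "cmod (sobolev_weight (- 1) a k) = cmod (a k) / sqrt (1 + (real_of_int k)\<^sup>2)"
  unfolding sobolev_weight_def powr_minus_half[OF one_plus_sq_pos] norm_mult norm_of_real by simp

lemma sqrt_one_plus_sq_ge: "sqrt (1 + (real_of_int k)\<^sup>2) \<ge> 1" "sqrt (1 + (real_of_int k)\<^sup>2) \<ge> \<bar>real_of_int k\<bar>"
proof -
  show "sqrt (1 + (real_of_int k)\<^sup>2) \<ge> 1" by simp
  show "sqrt (1 + (real_of_int k)\<^sup>2) \<ge> \<bar>real_of_int k\<bar>" by (rule real_le_rsqrt) simp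
qed

lemma sqi_imp_sobolev_minus_1: "sqi cZ a \<Longrightarrow> a \<in> sobolev (- 1)"
  unfolding sobolev_iff_sqi
proof (rule nrm_mono(1))
  fix k
  have "cmod (a k) / sqrt (1 + (real_of_int k)\<^sup>2) \<le> cmod (a k) / 1"
    by (rule divide_left_mono) (use sqrt_one_plus_sq_ge(1)[of k] in simp_all)
  then show "cmod (sobolev_weight (- 1) a k) \<le> cmod (a k)" by (simp add: cmod_sobolev_weight_minus_1)
qed simp_all

lemma hilbert_schmidt_dominated:
  assumes "B \<ge> 0" "\<And>F F'. finite F \<Longrightarrow> finite F' \<Longrightarrow> (\<Sum>j\<in>F. \<Sum>k\<in>F'. w j k) \<le> B" "\<And>j k. (cmod (H j k))\<^sup>2 \<le> w j k"
  shows "hilbert_schmidt H B"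
  unfolding hilbert_schmidt_def
proof (intro conjI allI impI assms(1))
  fix F F' :: "int set" assume F: "finite F" "finite F'"
  have "(\<Sum>j\<in>F. \<Sum>k\<in>F'. (cmod (H j k))\<^sup>2) \<le> (\<Sum>j\<in>F. \<Sum>k\<in>F'. w j k)" by (intro sum_mono assms(3))
  also have "\<dots> \<le> B" by (rule assms(2)[OF F])
  finally show "(\<Sum>j\<in>F. \<Sum>k\<in>F'. (cmod (H j k))\<^sup>2) \<le> B" .
qed

section \<open>Coercivity of Symm's operator in the norm of order -1\<close>

context
  fixes \<gamma> :: "real \<Rightarrow> complex"
  assumes reg: "regular_closed_C3_curve \<gamma>"
begin

text \<open>The first weight expresses that the smoothing part maps square-summable sequences to
  order 2, the second that it maps order -1 to order 1; these are the two gains of the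
  bootstrap.\<close>

lemma reg_matrix_hilbert_schmidt:
  obtains B where "hilbert_schmidt (\<lambda>j k. of_real (1 + (real_of_int j)\<^sup>2) * reg_matrix \<gamma> j k) B"
    "hilbert_schmidt (\<lambda>j k. of_real (sqrt (1 + (real_of_int j)\<^sup>2) * sqrt (1 + (real_of_int k)\<^sup>2)) * reg_matrix \<gamma> j k) B"
proof -
  obtain B where B: "B \<ge> 0"
    "\<And>F F'. finite F \<Longrightarrow> finite F' \<Longrightarrow> (\<Sum>j\<in>F. \<Sum>k\<in>F'. (1 + (real_of_int j)\<^sup>2)\<^sup>2 * (cmod (reg_matrix \<gamma> j k))\<^sup>2) \<le> B"
    "\<And>F F'. finite F \<Longrightarrow> finite F' \<Longrightarrow> (\<Sum>j\<in>F. \<Sum>k\<in>F'. (1 + (real_of_int j)\<^sup>2) * (1 + (real_of_int k)\<^sup>2) * (cmod (reg_matrix \<gamma> j k))\<^sup>2) \<le> B"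
    using reg_matrix_bounds[OF reg] by blast
  show thesis
  proof
    show "hilbert_schmidt (\<lambda>j k. of_real (1 + (real_of_int j)\<^sup>2) * reg_matrix \<gamma> j k) B"
    proof (rule hilbert_schmidt_dominated[OF B(1,2)])
      show "(cmod (of_real (1 + (real_of_int j)\<^sup>2) * reg_matrix \<gamma> j k))\<^sup>2 \<le> (1 + (real_of_int j)\<^sup>2)\<^sup>2 * (cmod (reg_matrix \<gamma> j k))\<^sup>2" for j k
        unfolding norm_mult norm_of_real by (simp add: power_mult_distrib)
    qed
    show "hilbert_schmidt (\<lambda>j k. of_real (sqrt (1 + (real_of_int j)\<^sup>2) * sqrt (1 + (real_of_int k)\<^sup>2)) * reg_matrix \<gamma> j k) B"
    proof (rule hilbert_schmidt_dominated[OF B(1,3)])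
      show "(cmod (of_real (sqrt (1 + (real_of_int j)\<^sup>2) * sqrt (1 + (real_of_int k)\<^sup>2)) * reg_matrix \<gamma> j k))\<^sup>2
          \<le> (1 + (real_of_int j)\<^sup>2) * (1 + (real_of_int k)\<^sup>2) * (cmod (reg_matrix \<gamma> j k))\<^sup>2" for j k
        unfolding norm_mult norm_of_real by (simp add: power_mult_distrib abs_mult)
    qed
  qed
qed

lemma hilbert_schmidt_scale_le:
  assumes "hilbert_schmidt H B" "\<And>j k. cmod (G j k) \<le> cmod (H j k)"
  shows "hilbert_schmidt G B"
proof (rule hilbert_schmidt_dominated[where w = "\<lambda>j k. (cmod (H j k))\<^sup>2"])
  show "(cmod (G j k))\<^sup>2 \<le> (cmod (H j k))\<^sup>2" for j k using assms(2) by (simp add: power_mono)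
qed (use assms(1) in \<open>auto simp: hilbert_schmidt_def\<close>)

text \<open>Comparable with \<open>sqrt (1 + k^2)\<close>, but exactly reciprocal to
  \<open>log_mult k\<close> for \<open>k\<close> other than 0, so that the principal part becomes
  the identity.\<close>

definition nu :: "int \<Rightarrow> real" where "nu k = max 1 \<bar>real_of_int k\<bar>"

lemma nu_bounds: "1 \<le> nu k" "0 < nu k" "nu k \<le> sqrt (1 + (real_of_int k)\<^sup>2)"
  using sqrt_one_plus_sq_ge[of k] by (auto simp: nu_def)

text \<open>Symm's operator on coefficient sequences. Unlike the integral it makes sense for
  sequences of order -1, and the extension is built from it.\<close>

definition symm_coeffs :: "(int \<Rightarrow> complex) \<Rightarrow> int \<Rightarrow> complex" where
  "symm_coeffs a j = of_real (log_mult j) * a j + (LINT k|cZ. reg_matrix \<gamma> j k * a k)"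

lemma fourier_coeff_symm_op': "sqi circ_measure \<psi> \<Longrightarrow> fourier_coeff (symm_op \<gamma> \<psi>) = symm_coeffs (fourier_coeff \<psi>)"
  using fourier_coeff_symm_op[OF reg] by (auto simp: symm_coeffs_def fun_eq_iff)

text \<open>A null vector in the Sobolev space of order \<open>-1\<close> first gains one
  order and then another one, so that its Fourier series converges absolutely.\<close>

lemma null_sequence_regularity:
  assumes x: "sqi cZ x" and z: "\<And>j. symm_coeffs (\<lambda>k. of_real (nu k) * x k) j = 0"
  shows "integrable cZ (\<lambda>k. cmod (of_real (nu k) * x k))" "sqi cZ (\<lambda>k. of_real (nu k) * x k)"
proof -
  obtain B where B1: "hilbert_schmidt (\<lambda>j k. of_real (1 + (real_of_int j)\<^sup>2) * reg_matrix \<gamma> j k) B"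
    and B2: "hilbert_schmidt (\<lambda>j k. of_real (sqrt (1 + (real_of_int j)\<^sup>2) * sqrt (1 + (real_of_int k)\<^sup>2)) * reg_matrix \<gamma> j k) B"
    using reg_matrix_hilbert_schmidt by blast
  define a where "a = (\<lambda>k. of_real (nu k) * x k)"
  define S where "S j = (LINT k|cZ. reg_matrix \<gamma> j k * a k)" for j
  let ?s = "\<lambda>j. sqrt (1 + (real_of_int j)\<^sup>2)"
  \<comment> \<open>The null equation solved for \<open>a j\<close>. The zeroth coefficient cannot
    be recovered from it, because \<open>log_mult 0 = 0\<close>, and is carried along as a single
    entry.\<close>
  have aj: "a j = (if j = 0 then a 0 else 0) - of_real \<bar>real_of_int j\<bar> * S j" for j
  proof (cases "j = 0")
    case False
    have "of_real (log_mult j) * a j + S j = 0" using z[of j] by (simp add: symm_coeffs_def a_def S_def)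
    then have "of_real \<bar>real_of_int j\<bar> * (of_real (log_mult j) * a j + S j) = 0" by simp
    moreover have "complex_of_real \<bar>real_of_int j\<bar> * of_real (log_mult j) = 1"
      using False by (simp add: log_mult_def flip: of_real_mult)
    ultimately have "a j + of_real \<bar>real_of_int j\<bar> * S j = 0" by (simp add: distrib_left flip: mult.assoc)
    then show ?thesis using False by (simp add: add_eq_0_iff)
  qed simp
  have e0: "sqi cZ (\<lambda>j. if j = 0 then c else 0)" for c :: complex
    by (rule sqi_cZ_finite_support(1)[of "{0}"]) auto
  have hs2: "hilbert_schmidt (\<lambda>j k. of_real (?s j * nu k) * reg_matrix \<gamma> j k) B"
  proof (rule hilbert_schmidt_scale_le[OF B2])
    show "cmod (of_real (?s j * nu k) * reg_matrix \<gamma> j k) \<le> cmod (of_real (?s j * ?s k) * reg_matrix \<gamma> j k)" for j k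
      unfolding norm_mult norm_of_real abs_mult using nu_bounds[of k] by (intro mult_mono) auto
  qed
  have "sqi cZ (\<lambda>j. LINT k|cZ. (of_real (?s j * nu k) * reg_matrix \<gamma> j k) * x k)"
    by (rule hilbert_schmidt_bounds(5)[OF hs2 x])
  moreover have "(LINT k|cZ. (of_real (?s j * nu k) * reg_matrix \<gamma> j k) * x k) = of_real (?s j) * S j" for j
    unfolding S_def a_def by (simp add: mult_ac flip: integral_mult_right_zero)
  ultimately have s1: "sqi cZ (\<lambda>j. of_real (?s j) * S j)" by simp
  have "sqi cZ (\<lambda>j. of_real \<bar>real_of_int j\<bar> * S j)"
    by (rule nrm_mono(1)[OF s1]) (auto simp: norm_mult sqrt_one_plus_sq_ge intro!: mult_right_mono)
  from sqi_diff[OF e0[of "a 0"] this] have sa: "sqi cZ a" by (subst ext[of a, OF aj])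
  then show "sqi cZ (\<lambda>k. of_real (nu k) * x k)" by (simp add: a_def)
  have "sqi cZ (\<lambda>j. LINT k|cZ. (of_real (1 + (real_of_int j)\<^sup>2) * reg_matrix \<gamma> j k) * a k)"
    by (rule hilbert_schmidt_bounds(5)[OF B1 sa])
  moreover have "(LINT k|cZ. (of_real (1 + (real_of_int j)\<^sup>2) * reg_matrix \<gamma> j k) * a k) = of_real (1 + (real_of_int j)\<^sup>2) * S j" for j
    unfolding S_def by (simp add: mult.assoc del: of_real_add)
  ultimately have s2: "sqi cZ (\<lambda>j. of_real (1 + (real_of_int j)\<^sup>2) * S j)" by simp
  have "sqi cZ (\<lambda>j. of_real (?s j) * (of_real \<bar>real_of_int j\<bar> * S j))"
  proof (rule nrm_mono(1)[OF s2])
    fix j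
    have "?s j * \<bar>real_of_int j\<bar> \<le> ?s j * ?s j" using sqrt_one_plus_sq_ge[of j] by (intro mult_left_mono) auto
    then have "?s j * \<bar>real_of_int j\<bar> \<le> 1 + (real_of_int j)\<^sup>2" by simp
    then have "(?s j * \<bar>real_of_int j\<bar>) * cmod (S j) \<le> (1 + (real_of_int j)\<^sup>2) * cmod (S j)" by (rule mult_right_mono) simp
    then show "cmod (of_real (?s j) * (of_real \<bar>real_of_int j\<bar> * S j)) \<le> cmod (of_real (1 + (real_of_int j)\<^sup>2) * S j)"
      unfolding norm_mult norm_of_real by (simp add: mult.assoc)
  qed simp
  from sqi_diff[OF e0[of "a 0"] this]
  have "sqi cZ (\<lambda>j. (if j = 0 then a 0 else 0) - of_real (?s j) * (of_real \<bar>real_of_int j\<bar> * S j))" .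
  moreover have "(if j = 0 then a 0 else 0) - of_real (?s j) * (of_real \<bar>real_of_int j\<bar> * S j) = of_real (?s j) * a j" for j
    by (subst (2) aj) (simp add: right_diff_distrib)
  ultimately have "sqi cZ (\<lambda>j. of_real (?s j) * a j)" by simp
  then show "integrable cZ (\<lambda>k. cmod (of_real (nu k) * x k))" using sobolev_1_summable[of a] by (simp add: a_def)
qed

text \<open>The substitution \<open>a k = nu k * x k\<close> turns a lower bound in the norm of
  order -1 into one for a Hilbert-Schmidt perturbation of the identity in plain square sums.\<close>

lemma symm_op_coercive:
  assumes inj: "\<forall>\<psi>. continuous_on {0..2*pi} \<psi> \<longrightarrow> (AE t in circ_measure. symm_op \<gamma> \<psi> t = 0) \<longrightarrow> (\<forall>s\<in>{0..2*pi}. \<psi> s = 0)"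
  obtains c where "c > 0"
    "\<And>\<psi>. sqi circ_measure \<psi> \<Longrightarrow> c * nrm cZ (sobolev_weight (- 1) (fourier_coeff \<psi>)) \<le> nrm circ_measure (symm_op \<gamma> \<psi>)"
proof -
  obtain B where B2: "hilbert_schmidt (\<lambda>j k. of_real (sqrt (1 + (real_of_int j)\<^sup>2) * sqrt (1 + (real_of_int k)\<^sup>2)) * reg_matrix \<gamma> j k) B"
    using reg_matrix_hilbert_schmidt by blast
  let ?s = "\<lambda>j. sqrt (1 + (real_of_int j)\<^sup>2)"
  define G where "G j k = of_real (nu k) * reg_matrix \<gamma> j k" for j k
  have hsG: "hilbert_schmidt G B"
  proof (rule hilbert_schmidt_scale_le[OF B2])
    fix j k
    have "1 * nu k \<le> ?s j * ?s k" using nu_bounds[of k] sqrt_one_plus_sq_ge[of j] by (intro mult_mono) auto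
    then have "nu k * cmod (reg_matrix \<gamma> j k) \<le> (?s j * ?s k) * cmod (reg_matrix \<gamma> j k)" by (intro mult_right_mono) auto
    then show "cmod (G j k) \<le> cmod (of_real (?s j * ?s k) * reg_matrix \<gamma> j k)"
      unfolding G_def norm_mult norm_of_real using nu_bounds(2)[of k] by (simp add: abs_mult)
  qed
  \<comment> \<open>The subtracted 1 removes the diagonal entry of the identity at 0, which Symm's
    operator lacks since \<open>log_mult 0 = 0\<close>.\<close>
  define H where "H j k = G j k - (if j = 0 \<and> k = 0 then 1 else 0)" for j k
  have hsH: "hilbert_schmidt H (2 * B + 2)"
  proof (rule hilbert_schmidt_dominated)
    have B0: "B \<ge> 0" using hsG by (simp add: hilbert_schmidt_def)
    then show "0 \<le> 2 * B + 2" by simp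
    let ?d = "\<lambda>j k. if j = 0 \<and> k = (0::int) then 1 else (0::real)"
    show "(cmod (H j k))\<^sup>2 \<le> 2 * (cmod (G j k))\<^sup>2 + 2 * ?d j k" for j k
      using cmod_add_sq_le[of "G j k" "- (if j = 0 \<and> k = 0 then 1 else 0)"] by (auto simp: H_def)
    fix F F' :: "int set" assume F: "finite F" "finite F'"
    have "(\<Sum>j\<in>F. \<Sum>k\<in>F'. ?d j k) \<le> (\<Sum>j\<in>F. if j = 0 then 1 else 0)"
      using F by (intro sum_mono) (auto simp: sum.delta)
    also have "\<dots> \<le> 1" using F by (simp add: sum.delta)
    finally have "(\<Sum>j\<in>F. \<Sum>k\<in>F'. ?d j k) \<le> 1" .
    moreover have "(\<Sum>j\<in>F. \<Sum>k\<in>F'. (cmod (G j k))\<^sup>2) \<le> B" using hsG F by (simp add: hilbert_schmidt_def)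
    moreover have "(\<Sum>j\<in>F. \<Sum>k\<in>F'. 2 * (cmod (G j k))\<^sup>2 + 2 * ?d j k)
        = 2 * (\<Sum>j\<in>F. \<Sum>k\<in>F'. (cmod (G j k))\<^sup>2) + 2 * (\<Sum>j\<in>F. \<Sum>k\<in>F'. ?d j k)"
      by (simp only: sum.distrib sum_distrib_left)
    ultimately show "(\<Sum>j\<in>F. \<Sum>k\<in>F'. 2 * (cmod (G j k))\<^sup>2 + 2 * ?d j k) \<le> 2 * B + 2" by linarith
  qed
  have key: "x j + (LINT k|cZ. H j k * x k) = symm_coeffs (\<lambda>k. of_real (nu k) * x k) j" if x: "sqi cZ x" for x j
  proof -
    let ?e = "\<lambda>k. if k \<in> (if j = 0 then {0} else {}) then x k else 0"
    have e: "integrable cZ ?e" "(LINT k|cZ. ?e k) = (\<Sum>k\<in>(if j = 0 then {0} else {}). x k)"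
      by (rule integral_cZ_restrict; simp)+
    have "(\<lambda>k. H j k * x k) = (\<lambda>k. G j k * x k - ?e k)" by (auto simp: H_def left_diff_distrib)
    then have "(LINT k|cZ. H j k * x k) = (LINT k|cZ. G j k * x k) - (if j = 0 then x 0 else 0)"
      using e sqi_mult_integrable[OF hilbert_schmidt_bounds(1)[OF hsG] x, of j] by auto
    moreover have "(LINT k|cZ. G j k * x k) = (LINT k|cZ. reg_matrix \<gamma> j k * (of_real (nu k) * x k))"
      by (simp add: G_def mult_ac)
    moreover have "of_real (log_mult j) * (of_real (nu j) * x j) = x j - (if j = 0 then x 0 else 0)"
    proof (cases "j = 0")
      case False
      then have "log_mult j * nu j = 1" by (auto simp: log_mult_def nu_def max_def field_simps)
      then have "complex_of_real (log_mult j) * of_real (nu j) = 1" by (simp flip: of_real_mult)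
      then show ?thesis using False by (simp flip: mult.assoc)
    qed (simp add: log_mult_def)
    ultimately show ?thesis by (simp add: symm_coeffs_def)
  qed
  obtain c where c: "c > 0" "\<And>x. sqi cZ x \<Longrightarrow> c * nrm cZ x \<le> nrm cZ (\<lambda>j. x j + (LINT k|cZ. H j k * x k))"
  proof (rule hilbert_schmidt_bounded_below[OF hsH])
    \<comment> \<open>By regularity a null sequence consists of the coefficients of a continuous
      density, to which the injectivity hypothesis applies.\<close>
    fix x k assume x: "sqi cZ x" and z: "\<And>j. x j + (LINT k|cZ. H j k * x k) = 0"
    have z': "symm_coeffs (\<lambda>k. of_real (nu k) * x k) j = 0" for j using z[of j] key[OF x] by simp
    obtain \<psi> where \<psi>: "continuous_on UNIV \<psi>" "fourier_coeff \<psi> = (\<lambda>k. of_real (nu k) * x k)"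
      by (rule abs_summable_fourier_series[OF null_sequence_regularity(1)[OF x z']])
    have c\<psi>: "continuous_on {0..2*pi} \<psi>" by (rule continuous_on_subset[OF \<psi>(1)]) simp
    have s\<psi>: "sqi circ_measure \<psi>" by (rule sqi_continuous[OF c\<psi>])
    have "AE t in circ_measure. symm_op \<gamma> \<psi> t = 0"
      by (rule fourier_uniqueness[OF sqi_integrable[OF symm_op_sqi[OF reg s\<psi>]]])
         (simp add: fourier_coeff_symm_op'[OF s\<psi>] \<psi>(2) z')
    then have zz: "\<psi> s = 0" if "s \<in> {0..2*pi}" for s using inj c\<psi> that by blast
    have "(LINT t|circ_measure. \<psi> t * trig (- k) t) = (LINT t|circ_measure. 0)"
      by (rule Bochner_Integration.integral_cong) (auto simp: zz)
    then have "fourier_coeff \<psi> k = 0" by (simp add: fourier_coeff_trig)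
    then show "x k = 0" using \<psi>(2) nu_bounds(2)[of k] by simp
  qed blast
  show thesis
  proof (rule that[OF c(1)])
    fix \<psi> assume \<psi>: "sqi circ_measure \<psi>"
    let ?a = "fourier_coeff \<psi>"
    define x where "x k = ?a k / of_real (nu k)" for k
    have sx: "sqi cZ x"
      by (rule nrm_mono(1)[OF sqi_fourier_coeff[OF \<psi>]])
         (use nu_bounds in \<open>auto simp: x_def norm_divide divide_le_eq mult_le_cancel_left1 abs_of_pos\<close>)
    have xa: "(\<lambda>k. of_real (nu k) * x k) = ?a" using nu_bounds(2) by (auto simp: x_def fun_eq_iff less_imp_neq[symmetric])
    have "nrm cZ (sobolev_weight (- 1) ?a) \<le> nrm cZ x"
    proof (rule nrm_mono(2)[OF sx])
      fix k
      have "cmod (?a k) / sqrt (1 + (real_of_int k)\<^sup>2) \<le> cmod (?a k) / nu k"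
        using nu_bounds[of k] by (intro divide_left_mono mult_pos_pos) auto
      then show "cmod (sobolev_weight (- 1) ?a k) \<le> cmod (x k)"
        using nu_bounds(2)[of k] by (simp add: cmod_sobolev_weight_minus_1 x_def norm_divide)
    qed simp
    then have "c * nrm cZ (sobolev_weight (- 1) ?a) \<le> c * nrm cZ x" using c(1) by simp
    also have "\<dots> \<le> nrm cZ (\<lambda>j. x j + (LINT k|cZ. H j k * x k))" by (rule c(2)[OF sx])
    also have "\<dots> = nrm cZ (fourier_coeff (symm_op \<gamma> \<psi>))"
      by (simp add: key[OF sx] xa fourier_coeff_symm_op'[OF \<psi>])
    also have "\<dots> = nrm circ_measure (symm_op \<gamma> \<psi>)" by (rule parseval_tendsto(1)[symmetric, OF symm_op_sqi[OF reg \<psi>]])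
    finally show "c * nrm cZ (sobolev_weight (- 1) ?a) \<le> nrm circ_measure (symm_op \<gamma> \<psi>)" .
  qed
qed

section \<open>The extension to the Sobolev space of order \<open>-1\<close>\<close>

text \<open>For the diagonal part \<open>log_mult j * sqrt (1 + j^2)\<close> is at most 2, since
  \<open>1 + j^2 \<le> 4 * j^2\<close> unless \<open>j = 0\<close>; the rest is Hilbert-Schmidt,
  with bound \<open>sqrt B\<close>.\<close>

lemma symm_coeffs_bounded:
  obtains M where "M \<ge> 0" "\<And>a. a \<in> sobolev (- 1) \<Longrightarrow> sqi cZ (symm_coeffs a)"
    "\<And>a. a \<in> sobolev (- 1) \<Longrightarrow> nrm cZ (symm_coeffs a) \<le> M * sobolev_norm (- 1) a"
    "\<And>a j. a \<in> sobolev (- 1) \<Longrightarrow> integrable cZ (\<lambda>k. reg_matrix \<gamma> j k * a k)"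
proof -
  obtain B where B2: "hilbert_schmidt (\<lambda>j k. of_real (sqrt (1 + (real_of_int j)\<^sup>2) * sqrt (1 + (real_of_int k)\<^sup>2)) * reg_matrix \<gamma> j k) B"
    using reg_matrix_hilbert_schmidt by blast
  let ?s = "\<lambda>j. sqrt (1 + (real_of_int j)\<^sup>2)"
  have B0: "B \<ge> 0" using B2 by (simp add: hilbert_schmidt_def)
  have hs: "hilbert_schmidt (\<lambda>j k. of_real (?s k) * reg_matrix \<gamma> j k) B"
  proof (rule hilbert_schmidt_scale_le[OF B2])
    fix j k
    have "1 * ?s k \<le> ?s j * ?s k" using sqrt_one_plus_sq_ge[of j] by (intro mult_right_mono) auto
    then have "?s k * cmod (reg_matrix \<gamma> j k) \<le> (?s j * ?s k) * cmod (reg_matrix \<gamma> j k)" by (intro mult_right_mono) auto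
    then show "cmod (of_real (?s k) * reg_matrix \<gamma> j k) \<le> cmod (of_real (?s j * ?s k) * reg_matrix \<gamma> j k)"
      unfolding norm_mult norm_of_real by (simp add: abs_mult)
  qed
  have main: "sqi cZ (symm_coeffs a) \<and> nrm cZ (symm_coeffs a) \<le> (2 + sqrt B) * sobolev_norm (- 1) a
      \<and> (\<forall>j. integrable cZ (\<lambda>k. reg_matrix \<gamma> j k * a k))" if a: "a \<in> sobolev (- 1)" for a
  proof -
    define x where "x = sobolev_weight (- 1) a"
    have sx: "sqi cZ x" using a by (simp add: sobolev_iff_sqi x_def)
    have nx: "sobolev_norm (- 1) a = nrm cZ x" using sobolev_norm_eq_nrm[OF a] by (simp add: x_def)
    have ak: "a k = of_real (?s k) * x k" for k
    proof -
      have "?s k \<noteq> 0" using sqrt_one_plus_sq_ge(1)[of k] by linarith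
      from right_inverse[OF this] have "?s k * (1 / ?s k) = 1" by (simp only: inverse_eq_divide)
      then have "complex_of_real (?s k) * complex_of_real (1 / ?s k) = 1" by (simp only: of_real_mult[symmetric] of_real_1)
      then show ?thesis unfolding x_def sobolev_weight_def powr_minus_half[OF one_plus_sq_pos] by (simp only: mult.assoc[symmetric] mult_1_left)
    qed
    have eq: "reg_matrix \<gamma> j k * a k = (of_real (?s k) * reg_matrix \<gamma> j k) * x k" for j k by (simp add: ak)
    define y1 where "y1 j = of_real (log_mult j) * a j" for j
    define y2 where "y2 j = (LINT k|cZ. reg_matrix \<gamma> j k * a k)" for j
    have y2: "sqi cZ y2" "nrm cZ y2 \<le> sqrt B * nrm cZ x"
      using hilbert_schmidt_bounds(5,6)[OF hs sx] unfolding y2_def eq by auto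
    have le: "cmod (y1 j) \<le> cmod (2 * x j)" for j
    proof -
      have "log_mult j * ?s j \<le> 2"
      proof (cases "j = 0")
        case False
        then have "1 \<le> \<bar>real_of_int j\<bar>" by (metis of_int_1_le_iff of_int_abs zero_less_abs_iff zless_imp_add1_zle add_0)
        then have "1 + (real_of_int j)\<^sup>2 \<le> (2 * \<bar>real_of_int j\<bar>)\<^sup>2"
          using power_mono[of 1 "\<bar>real_of_int j\<bar>" 2] by (simp add: power_mult_distrib)
        then have "?s j \<le> 2 * \<bar>real_of_int j\<bar>" by (intro real_le_lsqrt) auto
        then show ?thesis using False by (simp add: log_mult_def field_simps)
      qed (simp add: log_mult_def)
      then have "(log_mult j * ?s j) * cmod (x j) \<le> 2 * cmod (x j)" by (rule mult_right_mono) simp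
      moreover have "log_mult j \<ge> 0" by (simp add: log_mult_def)
      ultimately show ?thesis by (simp add: y1_def ak norm_mult mult.assoc)
    qed
    have y1: "sqi cZ y1" "nrm cZ y1 \<le> 2 * nrm cZ x"
      using nrm_mono[OF sqi_cmult[OF sx, of 2] _ le] by (auto simp: nrm_cmult)
    have sc: "symm_coeffs a = (\<lambda>j. y1 j + y2 j)" by (simp add: symm_coeffs_def[abs_def] y1_def y2_def)
    have "nrm cZ (symm_coeffs a) \<le> 2 * nrm cZ x + sqrt B * nrm cZ x"
      unfolding sc using nrm_add[OF y1(1) y2(1)] y1(2) y2(2) by linarith
    moreover have "integrable cZ (\<lambda>k. reg_matrix \<gamma> j k * a k)" for j
      unfolding eq by (rule sqi_mult_integrable[OF hilbert_schmidt_bounds(1)[OF hs] sx])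
    ultimately show ?thesis using sqi_add[OF y1(1) y2(1)] by (simp add: sc nx distrib_right)
  qed
  show thesis by (rule that[of "2 + sqrt B"]) (use main B0 in auto)
qed

text \<open>\<open>symm_extension\<close> is a choice, so all its properties rest on this.
  Riesz-Fischer realises \<open>symm_coeffs a\<close> by a function, and uniqueness of coefficients
  gives the linearity relations almost everywhere.\<close>

lemma symm_extension_exists: "\<exists>T. is_symm_extension \<gamma> T"
proof -
  obtain M where M: "M \<ge> 0" "\<And>a. a \<in> sobolev (- 1) \<Longrightarrow> sqi cZ (symm_coeffs a)"
    "\<And>a. a \<in> sobolev (- 1) \<Longrightarrow> nrm cZ (symm_coeffs a) \<le> M * sobolev_norm (- 1) a"
    "\<And>a j. a \<in> sobolev (- 1) \<Longrightarrow> integrable cZ (\<lambda>k. reg_matrix \<gamma> j k * a k)"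
    using symm_coeffs_bounded by blast
  define T where "T a = (SOME f. sqi circ_measure f \<and> fourier_coeff f = symm_coeffs a)" for a
  have T: "sqi circ_measure (T a)" "fourier_coeff (T a) = symm_coeffs a" if a: "a \<in> sobolev (- 1)" for a
  proof -
    obtain f where "sqi circ_measure f" "fourier_coeff f = symm_coeffs a" by (rule riesz_fischer[OF M(2)[OF a]])
    then have "\<exists>f. sqi circ_measure f \<and> fourier_coeff f = symm_coeffs a" by blast
    from someI_ex[OF this] show "sqi circ_measure (T a)" "fourier_coeff (T a) = symm_coeffs a" by (auto simp: T_def)
  qed
  have add: "(\<lambda>k. a k + b k) \<in> sobolev (- 1)" if "a \<in> sobolev (- 1)" "b \<in> sobolev (- 1)" for a b
    using sqi_add[of cZ "sobolev_weight (- 1) a" "sobolev_weight (- 1) b"] that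
    by (simp add: sobolev_iff_sqi sobolev_weight_def[abs_def] distrib_left)
  have mult: "(\<lambda>k. c * a k) \<in> sobolev (- 1)" if "a \<in> sobolev (- 1)" for a c
    using sqi_cmult[of cZ "sobolev_weight (- 1) a" c] that
    by (simp add: sobolev_iff_sqi sobolev_weight_def[abs_def] mult.left_commute)
  have "is_symm_extension \<gamma> T"
    unfolding is_symm_extension_def
  proof (intro conjI ballI allI)
    show "T a \<in> L2" if "a \<in> sobolev (- 1)" for a using T(1)[OF that] by (simp add: L2_iff_sqi)
    show "l2_eq (T (\<lambda>k. a k + b k)) (\<lambda>t. T a t + T b t)" if a: "a \<in> sobolev (- 1)" and b: "b \<in> sobolev (- 1)" for a b
      unfolding l2_eq_def
    proof (rule fourier_eq_AE[OF T(1)[OF add[OF a b]] sqi_add[OF T(1)[OF a] T(1)[OF b]]])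
      show "fourier_coeff (T (\<lambda>k. a k + b k)) = fourier_coeff (\<lambda>t. T a t + T b t)"
      proof
        fix j
        have "fourier_coeff (T (\<lambda>k. a k + b k)) j = symm_coeffs a j + symm_coeffs b j"
          unfolding T(2)[OF add[OF a b]] symm_coeffs_def
          using M(4)[OF a, of j] M(4)[OF b, of j] by (simp add: distrib_left)
        then show "fourier_coeff (T (\<lambda>k. a k + b k)) j = fourier_coeff (\<lambda>t. T a t + T b t) j"
          using T[OF a] T[OF b] by (simp add: fourier_coeff_add sqi_integrable)
      qed
    qed
    show "l2_eq (T (\<lambda>k. c * a k)) (\<lambda>t. c * T a t)" if a: "a \<in> sobolev (- 1)" for a c
      unfolding l2_eq_def
    proof (rule fourier_eq_AE[OF T(1)[OF mult[OF a]] sqi_cmult[OF T(1)[OF a]]])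
      have "(LINT k|cZ. reg_matrix \<gamma> j k * (c * a k)) = c * (LINT k|cZ. reg_matrix \<gamma> j k * a k)" for j
        by (simp add: mult.left_commute)
      then show "fourier_coeff (T (\<lambda>k. c * a k)) = fourier_coeff (\<lambda>t. c * T a t)"
        unfolding T(2)[OF mult[OF a]] by (auto simp: fun_eq_iff fourier_coeff_cmult T(2)[OF a] symm_coeffs_def algebra_simps)
    qed
    show "\<exists>M. \<forall>a\<in>sobolev (- 1). l2_norm (T a) \<le> M * sobolev_norm (- 1) a"
      using M(3) T by (intro exI[of _ M]) (auto simp: l2_norm_eq_nrm parseval_tendsto(1))
    show "l2_eq (T (fourier_coeff \<Psi>)) (symm_op \<gamma> \<Psi>)" if "\<Psi> \<in> L2" for \<Psi>
    proof -
      have s: "sqi circ_measure \<Psi>" using that by (simp add: L2_iff_sqi)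
      have a: "fourier_coeff \<Psi> \<in> sobolev (- 1)" by (rule sqi_imp_sobolev_minus_1[OF sqi_fourier_coeff[OF s]])
      show ?thesis unfolding l2_eq_def
        by (rule fourier_eq_AE[OF T(1)[OF a] symm_op_sqi[OF reg s]]) (simp add: T(2)[OF a] fourier_coeff_symm_op'[OF s])
    qed
  qed
  then show ?thesis by blast
qed

lemma l2_eq_norm:
  assumes "l2_eq f g" "f \<in> L2" "g \<in> L2"
  shows "l2_norm f = l2_norm g"
  using assms by (simp add: l2_norm_eq_nrm L2_iff_sqi l2_eq_def nrm_cong_AE sqi_measurable)

text \<open>The real supremum over the unit ball says something only once the set is known to be
  bounded; then the estimate follows by scaling. A sequence of norm 0 cannot be scaled and is
  handled by the bound \<open>M\<close>.\<close>

lemma symm_ext_norm_bound: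
  assumes a: "a \<in> sobolev (- 1)"
  shows "l2_norm (symm_extension \<gamma> a) \<le> symm_ext_norm \<gamma> * sobolev_norm (- 1) a" and "0 \<le> symm_ext_norm \<gamma>"
proof -
  define T where "T = symm_extension \<gamma>"
  have ext: "is_symm_extension \<gamma> T"
    unfolding T_def symm_extension_def by (rule someI_ex[OF symm_extension_exists])
  have TL: "\<And>a. a \<in> sobolev (- 1) \<Longrightarrow> T a \<in> L2" and Tc: "\<And>c a. a \<in> sobolev (- 1) \<Longrightarrow> l2_eq (T (\<lambda>k. c * a k)) (\<lambda>t. c * T a t)"
    using ext by (auto simp: is_symm_extension_def)
  obtain M where M: "\<And>a. a \<in> sobolev (- 1) \<Longrightarrow> l2_norm (T a) \<le> M * sobolev_norm (- 1) a"
    using ext unfolding is_symm_extension_def by blast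
  let ?U = "{a \<in> sobolev (- 1). sobolev_norm (- 1) a \<le> 1}"
  have nn: "sobolev_norm (- 1) a \<ge> 0" if "a \<in> sobolev (- 1)" for a using sobolev_norm_eq_nrm[OF that] by simp
  have bdd: "bdd_above ((\<lambda>a. l2_norm (T a)) ` ?U)"
  proof (rule bdd_aboveI2[where M = "\<bar>M\<bar>"])
    fix a assume a: "a \<in> ?U"
    have "l2_norm (T a) \<le> M * sobolev_norm (- 1) a" using M a by simp
    also have "\<dots> \<le> \<bar>M\<bar> * 1" using a nn by (intro mult_mono) auto
    finally show "l2_norm (T a) \<le> \<bar>M\<bar>" by simp
  qed
  have N: "symm_ext_norm \<gamma> = (SUP a\<in>?U. l2_norm (T a))" by (simp add: symm_ext_norm_def T_def)
  have up: "l2_norm (T a) \<le> symm_ext_norm \<gamma>" if "a \<in> ?U" for a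
    unfolding N by (rule cSUP_upper[OF that bdd])
  have zero: "(\<lambda>k. 0) \<in> sobolev (- 1)" by (simp add: sobolev_def)
  have "sobolev_norm (- 1) (\<lambda>k. 0) = 0" by (simp add: sobolev_norm_def)
  then have "l2_norm (T (\<lambda>k. 0)) \<le> symm_ext_norm \<gamma>" using zero by (intro up) simp
  then show "0 \<le> symm_ext_norm \<gamma>" by (rule order_trans[rotated]) (simp add: l2_norm_eq_nrm)
  have mult: "(\<lambda>k. c * a k) \<in> sobolev (- 1)" "sobolev_norm (- 1) (\<lambda>k. c * a k) = cmod c * sobolev_norm (- 1) a" for c
  proof -
    have eq: "sobolev_weight (- 1) (\<lambda>k. c * a k) = (\<lambda>k. c * sobolev_weight (- 1) a k)"
      by (auto simp: sobolev_weight_def)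
    show m: "(\<lambda>k. c * a k) \<in> sobolev (- 1)" using a by (simp add: sobolev_iff_sqi eq sqi_cmult)
    show "sobolev_norm (- 1) (\<lambda>k. c * a k) = cmod c * sobolev_norm (- 1) a"
      by (simp add: sobolev_norm_eq_nrm[OF m] sobolev_norm_eq_nrm[OF a] eq nrm_cmult)
  qed
  show "l2_norm (symm_extension \<gamma> a) \<le> symm_ext_norm \<gamma> * sobolev_norm (- 1) a"
  proof (cases "sobolev_norm (- 1) a = 0")
    case True
    then show ?thesis using M[OF a] by (simp add: T_def)
  next
    case False
    define s where "s = sobolev_norm (- 1) a"
    have s: "s > 0" using False nn[OF a] by (simp add: s_def)
    let ?c = "complex_of_real (inverse s)"
    have "cmod ?c = inverse s" using s by (simp only: norm_of_real) simp
    then have "(\<lambda>k. ?c * a k) \<in> ?U" using mult[of ?c] s by (simp add: s_def)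
    then have "l2_norm (T (\<lambda>k. ?c * a k)) \<le> symm_ext_norm \<gamma>" by (rule up)
    moreover have "l2_norm (T (\<lambda>k. ?c * a k)) = l2_norm (\<lambda>t. ?c * T a t)"
      using TL[OF a] TL[OF mult(1)] by (intro l2_eq_norm[OF Tc[OF a]]) (auto simp: L2_iff_sqi sqi_cmult)
    moreover have "l2_norm (\<lambda>t. ?c * T a t) = inverse s * l2_norm (T a)"
      unfolding l2_norm_eq_nrm nrm_cmult \<open>cmod ?c = inverse s\<close> ..
    ultimately have "inverse s * l2_norm (T a) \<le> symm_ext_norm \<gamma>" by simp
    then show ?thesis using s by (simp add: T_def s_def field_simps)
  qed
qed

lemma symm_op_nrm_le_symm_ext_norm:
  assumes \<psi>: "sqi circ_measure \<psi>"
  shows "nrm circ_measure (symm_op \<gamma> \<psi>) \<le> symm_ext_norm \<gamma> * nrm cZ (sobolev_weight (- 1) (fourier_coeff \<psi>))"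
proof -
  have ext: "is_symm_extension \<gamma> (symm_extension \<gamma>)"
    unfolding symm_extension_def by (rule someI_ex[OF symm_extension_exists])
  have a: "fourier_coeff \<psi> \<in> sobolev (- 1)" by (rule sqi_imp_sobolev_minus_1[OF sqi_fourier_coeff[OF \<psi>]])
  have "l2_norm (symm_extension \<gamma> (fourier_coeff \<psi>)) = l2_norm (symm_op \<gamma> \<psi>)"
    using ext a \<psi> symm_op_sqi[OF reg \<psi>] by (intro l2_eq_norm) (auto simp: is_symm_extension_def L2_iff_sqi)
  then show ?thesis using symm_ext_norm_bound(1)[OF a] by (simp add: l2_norm_eq_nrm sobolev_norm_eq_nrm[OF a])
qed

end

section \<open>Orthogonal projections onto finite-dimensional spaces\<close>

lemma l2_inner_add_left:
  assumes "sqi circ_measure f" "sqi circ_measure g" "sqi circ_measure h"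
  shows "l2_inner (\<lambda>t. f t + g t) h = l2_inner f h + l2_inner g h"
  using sqi_mult_integrable[OF assms(1) sqi_cnj[OF assms(3)]] sqi_mult_integrable[OF assms(2) sqi_cnj[OF assms(3)]]
  by (simp add: l2_inner_def distrib_right)

lemma l2_inner_diff_left:
  assumes "sqi circ_measure f" "sqi circ_measure g" "sqi circ_measure h"
  shows "l2_inner (\<lambda>t. f t - g t) h = l2_inner f h - l2_inner g h"
  using sqi_mult_integrable[OF assms(1) sqi_cnj[OF assms(3)]] sqi_mult_integrable[OF assms(2) sqi_cnj[OF assms(3)]]
  by (simp add: l2_inner_def left_diff_distrib)

lemma l2_inner_cmult_left: "l2_inner (\<lambda>t. c * f t) h = c * l2_inner f h"
  by (simp add: l2_inner_def mult.assoc)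

lemma cnj_l2_inner: "cnj (l2_inner f h) = l2_inner h f"
proof -
  have "cnj (l2_inner f h) = (LINT t|circ_measure. cnj (f t * cnj (h t)))"
    unfolding l2_inner_def by (rule Bochner_Integration.integral_cnj[symmetric])
  then show ?thesis by (simp add: l2_inner_def mult.commute)
qed

lemma l2_inner_sum_left:
  assumes "finite I" "\<And>i. sqi circ_measure (f i)" "sqi circ_measure h"
  shows "l2_inner (\<lambda>t. \<Sum>i\<in>I. c i * f i t) h = (\<Sum>i\<in>I. c i * l2_inner (f i) h)"
  using assms
proof (induction I rule: finite_induct)
  case empty
  then show ?case by (simp add: l2_inner_def)
next
  case (insert i I)
  then have "l2_inner (\<lambda>t. c i * f i t + (\<Sum>j\<in>I. c j * f j t)) h = l2_inner (\<lambda>t. c i * f i t) h + l2_inner (\<lambda>t. \<Sum>j\<in>I. c j * f j t) h"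
    by (intro l2_inner_add_left sqi_cmult sqi_sum) auto
  then show ?case using insert by (simp add: l2_inner_cmult_left)
qed

lemma l2_inner_sum_right_zero:
  assumes "finite I" "\<And>i. sqi circ_measure (f i)" "sqi circ_measure h" "\<And>i. i \<in> I \<Longrightarrow> l2_inner h (f i) = 0"
  shows "l2_inner h (\<lambda>t. \<Sum>i\<in>I. c i * f i t) = 0"
proof -
  have "l2_inner (f i) h = 0" if "i \<in> I" for i using assms(4)[OF that] cnj_l2_inner[of h "f i"] by simp
  then have "l2_inner (\<lambda>t. \<Sum>i\<in>I. c i * f i t) h = 0" using assms by (simp add: l2_inner_sum_left)
  then show ?thesis using cnj_l2_inner[of "\<lambda>t. \<Sum>i\<in>I. c i * f i t" h] by simp
qed

lemma l2_inner_self: "l2_inner f f = of_real ((nrm circ_measure f)\<^sup>2)"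
  unfolding l2_inner_def nrm_sq integral_complex_of_real[symmetric] by (simp add: complex_norm_square del: of_real_power)

lemma l2_inner_le_nrm:
  assumes "sqi circ_measure f" "sqi circ_measure h"
  shows "cmod (l2_inner f h) \<le> nrm circ_measure f * nrm circ_measure h"
proof -
  have "nrm circ_measure (\<lambda>t. cnj (h t)) = nrm circ_measure h" by (simp add: nrm_def)
  then show ?thesis using Cauchy_Schwarz_sqi[OF assms(1) sqi_cnj[OF assms(2)]] by (simp add: l2_inner_def)
qed

text \<open>Gram-Schmidt as an induction, with the hypothesis used for the new function
  \<open>f k\<close> as well as for \<open>g\<close>; hence \<open>g\<close> is arbitrary.\<close>

lemma orthogonal_decomposition:
  assumes "finite I" and sf: "\<And>i. sqi circ_measure (f i)" and "sqi circ_measure g"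
  shows "\<exists>c. \<forall>i\<in>I. l2_inner (\<lambda>t. g t - (\<Sum>j\<in>I. c j * f j t)) (f i) = 0"
  using assms(1,3)
proof (induction I arbitrary: g rule: finite_induct)
  case (insert k I)
  note sk = sf[of k]
  obtain p where p: "\<And>i. i \<in> I \<Longrightarrow> l2_inner (\<lambda>t. f k t - (\<Sum>j\<in>I. p j * f j t)) (f i) = 0"
    using insert.IH[OF sk] by blast
  obtain q where q: "\<And>i. i \<in> I \<Longrightarrow> l2_inner (\<lambda>t. g t - (\<Sum>j\<in>I. q j * f j t)) (f i) = 0"
    using insert.IH[OF insert.prems] by blast
  define P where "P t = (\<Sum>j\<in>I. p j * f j t)" for t
  define u where "u t = f k t - P t" for t
  define r where "r t = g t - (\<Sum>j\<in>I. q j * f j t)" for t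
  have sP: "sqi circ_measure P" unfolding P_def by (intro sqi_sum sqi_cmult sf)
  have su: "sqi circ_measure u" unfolding u_def by (intro sqi_diff sk sP)
  have sr: "sqi circ_measure r" unfolding r_def by (intro sqi_diff sqi_sum sqi_cmult sf insert.prems)
  define \<alpha> where "\<alpha> = (if nrm circ_measure u = 0 then 0 else l2_inner r u / of_real ((nrm circ_measure u)\<^sup>2))"
  define h where "h t = r t - \<alpha> * u t" for t
  have sh: "sqi circ_measure h" unfolding h_def by (intro sqi_diff sr sqi_cmult su)
  have hI: "l2_inner h (f i) = 0" if "i \<in> I" for i
  proof -
    have "l2_inner h (f i) = l2_inner r (f i) - \<alpha> * l2_inner u (f i)"
      unfolding h_def using sf[of i] by (simp add: l2_inner_diff_left sr su sqi_cmult l2_inner_cmult_left)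
    then show ?thesis using p[OF that] q[OF that] by (simp add: r_def[abs_def] u_def[abs_def] P_def)
  qed
  have hu: "l2_inner h u = 0"
  proof (cases "nrm circ_measure u = 0")
    case True
    then show ?thesis using l2_inner_le_nrm[OF sh su] by simp
  next
    case False
    have "l2_inner h u = l2_inner r u - \<alpha> * l2_inner u u"
      unfolding h_def by (simp add: l2_inner_diff_left sr su sqi_cmult l2_inner_cmult_left)
    then show ?thesis using False by (simp add: \<alpha>_def l2_inner_self del: of_real_power)
  qed
  have hk: "l2_inner h (f k) = 0"
  proof -
    have "l2_inner (f k) h = l2_inner u h + l2_inner P h"
      using l2_inner_add_left[OF su sP sh] by (simp add: u_def)
    moreover have "l2_inner u h = 0" using hu cnj_l2_inner[of h u] by simp
    moreover have "l2_inner h P = 0" unfolding P_def[abs_def] by (rule l2_inner_sum_right_zero[OF insert.hyps(1) sf sh hI])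
    then have "l2_inner P h = 0" using cnj_l2_inner[of h P] by simp
    ultimately have "l2_inner (f k) h = 0" by simp
    then show ?thesis using cnj_l2_inner[of "f k" h] by simp
  qed
  define c where "c j = (if j = k then \<alpha> else q j - \<alpha> * p j)" for j
  have "h t = g t - (\<Sum>j\<in>insert k I. c j * f j t)" for t
  proof -
    have "(\<Sum>j\<in>I. c j * f j t) = (\<Sum>j\<in>I. q j * f j t) - \<alpha> * (\<Sum>j\<in>I. p j * f j t)"
      unfolding sum_distrib_left sum_subtractf[symmetric]
      using insert.hyps(2) by (intro sum.cong) (auto simp: c_def algebra_simps)
    then show ?thesis using insert.hyps by (simp add: h_def r_def u_def P_def c_def algebra_simps)
  qed
  then have "h = (\<lambda>t. g t - (\<Sum>j\<in>insert k I. c j * f j t))" by auto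
  then show ?case using hI hk by (intro exI[of _ c]) auto
qed simp

lemma orth_proj_properties:
  assumes V: "V = {\<lambda>t. \<Sum>i\<in>I. c i * f i t | c. c \<in> UNIV}" and I: "finite I" and f: "\<And>i. sqi circ_measure (f i)"
    and g: "sqi circ_measure g"
  shows "orth_proj V g \<in> V" "\<And>h. h \<in> V \<Longrightarrow> l2_inner (\<lambda>t. g t - orth_proj V g t) h = 0"
proof -
  obtain c where c: "\<And>i. i \<in> I \<Longrightarrow> l2_inner (\<lambda>t. g t - (\<Sum>j\<in>I. c j * f j t)) (f i) = 0"
    using orthogonal_decomposition[of I f g, OF I f g] by blast
  have s: "sqi circ_measure (\<lambda>t. g t - (\<Sum>j\<in>I. c j * f j t))" by (intro sqi_diff g sqi_sum sqi_cmult f)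
  have "(\<lambda>t. \<Sum>j\<in>I. c j * f j t) \<in> V \<and> (\<forall>h\<in>V. l2_inner (\<lambda>t. g t - (\<Sum>j\<in>I. c j * f j t)) h = 0)"
    unfolding V by (auto intro: l2_inner_sum_right_zero[OF I f s c])
  from someI[of "\<lambda>q. q \<in> V \<and> (\<forall>h\<in>V. l2_inner (\<lambda>t. g t - q t) h = 0)", OF this]
  show "orth_proj V g \<in> V" "\<And>h. h \<in> V \<Longrightarrow> l2_inner (\<lambda>t. g t - orth_proj V g t) h = 0"
    unfolding orth_proj_def by blast+
qed

text \<open>The difference lies in \<open>V\<close> and is orthogonal to \<open>V\<close>, hence to
  itself. The equality is only almost everywhere because \<open>orth_proj\<close> chooses among
  representatives.\<close>

lemma orth_proj_self:
  assumes V: "V = {\<lambda>t. \<Sum>i\<in>I. c i * f i t | c. c \<in> UNIV}" and I: "finite I" and f: "\<And>i. sqi circ_measure (f i)"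
    and g: "g \<in> V"
  shows "AE t in circ_measure. orth_proj V g t = g t"
proof -
  have sV: "sqi circ_measure h" if "h \<in> V" for h using that f unfolding V by (auto intro!: sqi_sum sqi_cmult)
  note op = orth_proj_properties[OF V I f sV[OF g]]
  have "(\<lambda>t. g t - orth_proj V g t) \<in> V"
  proof -
    obtain c d where c: "g = (\<lambda>t. \<Sum>i\<in>I. c i * f i t)" and d: "orth_proj V g = (\<lambda>t. \<Sum>i\<in>I. d i * f i t)"
      using g op(1) unfolding V by auto
    have eq: "(\<lambda>t. g t - orth_proj V g t) = (\<lambda>t. \<Sum>i\<in>I. (c i - d i) * f i t)"
      using fun_cong[OF c] fun_cong[OF d] by (simp add: sum_subtractf left_diff_distrib fun_eq_iff)
    have "(\<lambda>t. \<Sum>i\<in>I. (c i - d i) * f i t) \<in> V"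
      unfolding V by (rule CollectI, rule exI[of _ "\<lambda>i. c i - d i"]) simp
    then show ?thesis by (rule subst[OF eq[symmetric], where P = "\<lambda>h. h \<in> V"])
  qed
  from op(2)[OF this] have "nrm circ_measure (\<lambda>t. g t - orth_proj V g t) = 0" by (simp add: l2_inner_self)
  then have "AE t in circ_measure. g t - orth_proj V g t = 0"
    using nrm_eq_0_iff[OF sqi_diff[OF sV[OF g] sV[OF op(1)]]] by blast
  then show ?thesis by auto
qed

section \<open>The least squares method\<close>

lemma X_LS_trig: "X_LS n = {\<lambda>t. \<Sum>k\<in>{- int n..int n}. c k * trig k t | c. c \<in> UNIV}"
  by (simp add: X_LS_def trig_def)

lemma X_LS_sqi: "z \<in> X_LS n \<Longrightarrow> sqi circ_measure z"
  unfolding X_LS_trig by (auto intro!: sqi_sum sqi_cmult sqi_trig)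

lemma X_LS_diff: "z \<in> X_LS n \<Longrightarrow> w \<in> X_LS n \<Longrightarrow> (\<lambda>t. z t - w t) \<in> X_LS n"
proof -
  assume "z \<in> X_LS n" "w \<in> X_LS n"
  then obtain c d where "z = (\<lambda>t. \<Sum>k\<in>{- int n..int n}. c k * trig k t)" "w = (\<lambda>t. \<Sum>k\<in>{- int n..int n}. d k * trig k t)"
    unfolding X_LS_trig by auto
  then have "(\<lambda>t. z t - w t) = (\<lambda>t. \<Sum>k\<in>{- int n..int n}. (c k - d k) * trig k t)"
    by (simp add: sum_subtractf left_diff_distrib)
  then show ?thesis unfolding X_LS_trig by auto
qed

lemma tpoly_X_LS: "tpoly {- int n..int n} a \<in> X_LS n"
  unfolding X_LS_trig
  by (rule CollectI, rule exI[of _ "\<lambda>k. a k / sq2pi"]) (auto simp: tpoly_def sum_divide_distrib)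

lemma X_LS_fourier_coeff:
  assumes "z \<in> X_LS n" "k \<notin> {- int n..int n}"
  shows "fourier_coeff z k = 0"
proof -
  obtain c where c: "z = (\<lambda>t. \<Sum>k\<in>{- int n..int n}. c k * trig k t)" using assms(1) unfolding X_LS_trig by auto
  have "z = tpoly {- int n..int n} (\<lambda>k. c k * sq2pi)" by (simp add: c tpoly_def[abs_def] sum_divide_distrib)
  then show ?thesis using assms(2) by (auto simp: fourier_coeff_tpoly)
qed

lemma approximation_error_coeff:
  assumes x: "sqi circ_measure x"
  shows "fourier_coeff (\<lambda>t. x t - tpoly {- int n..int n} (fourier_coeff x) t) k
    = (if k \<in> {- int n..int n} then 0 else fourier_coeff x k)"
  by (subst fourier_coeff_diff) (auto simp: sqi_integrable x sqi_tpoly fourier_coeff_tpoly)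

text \<open>An element of \<open>X_LS n\<close> changes no coefficient outside
  \<open>{- int n..int n}\<close>, and inside that range the error of the partial sum has
  none.\<close>

lemma partial_sum_best_approximation:
  assumes x: "sqi circ_measure x" and z: "z \<in> X_LS n"
  shows "nrm circ_measure (\<lambda>t. x t - tpoly {- int n..int n} (fourier_coeff x) t) \<le> nrm circ_measure (\<lambda>t. x t - z t)"
proof -
  have d: "sqi circ_measure (\<lambda>t. x t - tpoly {- int n..int n} (fourier_coeff x) t)" "sqi circ_measure (\<lambda>t. x t - z t)"
    by (intro sqi_diff x sqi_tpoly X_LS_sqi[OF z])+
  show ?thesis
    unfolding parseval_tendsto(1)[OF d(1)] parseval_tendsto(1)[OF d(2)]
  proof (rule nrm_mono(2)[OF sqi_fourier_coeff[OF d(2)]])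
    fix k
    show "cmod (fourier_coeff (\<lambda>t. x t - tpoly {- int n..int n} (fourier_coeff x) t) k) \<le> cmod (fourier_coeff (\<lambda>t. x t - z t) k)"
      using X_LS_fourier_coeff[OF z, of k]
      by (simp add: approximation_error_coeff[OF x] fourier_coeff_diff sqi_integrable x X_LS_sqi[OF z])
  qed simp
qed

lemma partial_sum_sobolev_error:
  assumes x: "sqi circ_measure x" and r: "r \<ge> 0" and n: "n \<ge> 1" and s: "fourier_coeff x \<in> sobolev r"
  shows "nrm circ_measure (\<lambda>t. x t - tpoly {- int n..int n} (fourier_coeff x) t) \<le> 1 / real n powr r * sobolev_norm r (fourier_coeff x)"
proof -
  let ?w = "\<lambda>k. complex_of_real (1 / real n powr r) * sobolev_weight r (fourier_coeff x) k"
  have d: "sqi circ_measure (\<lambda>t. x t - tpoly {- int n..int n} (fourier_coeff x) t)" by (intro sqi_diff x sqi_tpoly)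
  have sw: "sqi cZ ?w" using s by (intro sqi_cmult) (simp add: sobolev_iff_sqi)
  have np: "real n powr r > 0" using n by simp
  have "nrm circ_measure (\<lambda>t. x t - tpoly {- int n..int n} (fourier_coeff x) t) \<le> nrm cZ ?w"
    unfolding parseval_tendsto(1)[OF d]
  proof (rule nrm_mono(2)[OF sw])
    fix k
    show "cmod (fourier_coeff (\<lambda>t. x t - tpoly {- int n..int n} (fourier_coeff x) t) k) \<le> cmod (?w k)"
    proof (cases "k \<in> {- int n..int n}")
      case True
      then show ?thesis by (simp add: approximation_error_coeff[OF x])
    next
      case False
      then have "int n \<le> \<bar>k\<bar>" by auto
      then have "real n \<le> \<bar>real_of_int k\<bar>" by linarith
      then have "(real n)\<^sup>2 \<le> (real_of_int k)\<^sup>2" using power_mono[of "real n" "\<bar>real_of_int k\<bar>" 2] by simp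
      then have "((real n)\<^sup>2) powr (r / 2) \<le> (1 + (real_of_int k)\<^sup>2) powr (r / 2)" using r by (intro powr_mono2) auto
      moreover have "((real n)\<^sup>2) powr (r / 2) = real n powr r"
        using n by (simp add: powr_powr flip: powr_numeral)
      ultimately have "1 \<le> 1 / real n powr r * (1 + (real_of_int k)\<^sup>2) powr (r / 2)" using np by simp
      then have "1 * cmod (fourier_coeff x k) \<le> 1 / real n powr r * (1 + (real_of_int k)\<^sup>2) powr (r / 2) * cmod (fourier_coeff x k)"
        by (rule mult_right_mono) simp
      moreover have "cmod (?w k) = 1 / real n powr r * (1 + (real_of_int k)\<^sup>2) powr (r / 2) * cmod (fourier_coeff x k)"
        unfolding sobolev_weight_def norm_mult norm_of_real by simp
      ultimately show ?thesis using False by (simp add: approximation_error_coeff[OF x])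
    qed
  qed simp
  also have "nrm cZ ?w = 1 / real n powr r * sobolev_norm r (fourier_coeff x)"
    unfolding nrm_cmult norm_of_real sobolev_norm_eq_nrm[OF s] by simp
  finally show ?thesis .
qed

text \<open>The error has only frequencies of modulus above \<open>n\<close>, where the weight of
  order -1 is at most \<open>1 / n\<close>. This gain offsets the loss in
  \<open>X_LS_inverse_estimate\<close>.\<close>

lemma partial_sum_negative_norm:
  assumes x: "sqi circ_measure x" and n: "n \<ge> 1"
  defines "e \<equiv> \<lambda>t. x t - tpoly {- int n..int n} (fourier_coeff x) t"
  shows "nrm cZ (sobolev_weight (- 1) (fourier_coeff e)) \<le> 1 / real n * nrm circ_measure e"
proof -
  have se: "sqi circ_measure e" unfolding e_def by (intro sqi_diff x sqi_tpoly)
  have "nrm cZ (sobolev_weight (- 1) (fourier_coeff e)) \<le> nrm cZ (\<lambda>k. complex_of_real (1 / real n) * fourier_coeff e k)"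
  proof (rule nrm_mono(2)[OF sqi_cmult[OF sqi_fourier_coeff[OF se]]])
    fix k
    show "cmod (sobolev_weight (- 1) (fourier_coeff e) k) \<le> cmod (complex_of_real (1 / real n) * fourier_coeff e k)"
    proof (cases "k \<in> {- int n..int n}")
      case True
      then have "fourier_coeff e k = 0" unfolding e_def by (simp add: approximation_error_coeff[OF x])
      then show ?thesis by (simp add: sobolev_weight_def)
    next
      case False
      then have "int n \<le> \<bar>k\<bar>" by auto
      then have "real n \<le> sqrt (1 + (real_of_int k)\<^sup>2)" using sqrt_one_plus_sq_ge(2)[of k] by linarith
      then have "cmod (fourier_coeff e k) / sqrt (1 + (real_of_int k)\<^sup>2) \<le> cmod (fourier_coeff e k) / real n"
        using n by (intro divide_left_mono mult_pos_pos) auto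
      then show ?thesis unfolding cmod_sobolev_weight_minus_1 norm_mult norm_of_real by simp
    qed
  qed simp
  also have "\<dots> = 1 / real n * nrm circ_measure e"
    unfolding nrm_cmult norm_of_real parseval_tendsto(1)[OF se] by simp
  finally show ?thesis .
qed

text \<open>A Bernstein-type inequality: frequencies of modulus at most \<open>n\<close> satisfy
  \<open>1 + k^2 \<le> (2 * n)^2\<close> once \<open>n \<ge> 1\<close>.\<close>

lemma X_LS_inverse_estimate:
  assumes z: "z \<in> X_LS n" and n: "n \<ge> 1"
  shows "nrm circ_measure z \<le> 2 * real n * nrm cZ (sobolev_weight (- 1) (fourier_coeff z))"
proof -
  have sz: "sqi circ_measure z" by (rule X_LS_sqi[OF z])
  have sw: "sqi cZ (sobolev_weight (- 1) (fourier_coeff z))"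
    using sqi_imp_sobolev_minus_1[OF sqi_fourier_coeff[OF sz]] by (simp add: sobolev_iff_sqi)
  have "nrm circ_measure z \<le> nrm cZ (\<lambda>k. complex_of_real (2 * real n) * sobolev_weight (- 1) (fourier_coeff z) k)"
    unfolding parseval_tendsto(1)[OF sz]
  proof (rule nrm_mono(2)[OF sqi_cmult[OF sw]])
    fix k
    show "cmod (fourier_coeff z k) \<le> cmod (complex_of_real (2 * real n) * sobolev_weight (- 1) (fourier_coeff z) k)"
    proof (cases "k \<in> {- int n..int n}")
      case False
      then show ?thesis using X_LS_fourier_coeff[OF z] by simp
    next
      case True
      then have "\<bar>k\<bar> \<le> int n" by auto
      then have "\<bar>real_of_int k\<bar> \<le> real n" by linarith
      then have "(real_of_int k)\<^sup>2 \<le> (real n)\<^sup>2" using power_mono[of "\<bar>real_of_int k\<bar>" "real n" 2] by simp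
      moreover have "1 \<le> (real n)\<^sup>2" using n by (simp add: one_le_power)
      ultimately have "1 + (real_of_int k)\<^sup>2 \<le> (2 * real n)\<^sup>2" unfolding power_mult_distrib by simp
      then have s: "sqrt (1 + (real_of_int k)\<^sup>2) \<le> 2 * real n" by (rule real_le_lsqrt[rotated]) simp
      have "cmod (fourier_coeff z k) * 1 \<le> cmod (fourier_coeff z k) * (2 * real n / sqrt (1 + (real_of_int k)\<^sup>2))"
        using s by (intro mult_left_mono) (simp_all add: le_divide_eq)
      moreover have "cmod (complex_of_real (2 * real n) * sobolev_weight (- 1) (fourier_coeff z) k)
          = cmod (fourier_coeff z k) * (2 * real n / sqrt (1 + (real_of_int k)\<^sup>2))"
        unfolding norm_mult[of "complex_of_real _"] norm_of_real cmod_sobolev_weight_minus_1 by simp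
      ultimately show ?thesis by simp
    qed
  qed simp
  also have "\<dots> = 2 * real n * nrm cZ (sobolev_weight (- 1) (fourier_coeff z))"
    unfolding nrm_cmult norm_of_real by simp
  finally show ?thesis .
qed

context
  fixes \<gamma> :: "real \<Rightarrow> complex"
  assumes reg: "regular_closed_C3_curve \<gamma>"
begin

lemma Y_LS_span: "Y_LS \<gamma> n = {\<lambda>t. \<Sum>k\<in>{- int n..int n}. c k * symm_op \<gamma> (trig k) t | c. c \<in> UNIV}"
proof -
  have *: "symm_op \<gamma> (\<lambda>s. \<Sum>k\<in>{- int n..int n}. c k * trig k s) = (\<lambda>t. \<Sum>k\<in>{- int n..int n}. c k * symm_op \<gamma> (trig k) t)" for c
    by (rule ext) (rule symm_op_sum[OF reg sqi_trig])
  show ?thesis unfolding Y_LS_def X_LS_trig using * by (auto simp: image_iff) metis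
qed

lemma symm_inverse_properties:
  assumes "b \<in> l2_image (symm_op \<gamma>) L2"
  shows "sqi circ_measure (symm_inverse \<gamma> b)" "AE t in circ_measure. symm_op \<gamma> (symm_inverse \<gamma> b) t = b t" "sqi circ_measure b"
proof -
  have "\<exists>x. x \<in> L2 \<and> l2_eq (symm_op \<gamma> x) b" and b: "b \<in> L2" using assms by (auto simp: l2_image_def)
  from someI_ex[OF this(1)]
  show "sqi circ_measure (symm_inverse \<gamma> b)" "AE t in circ_measure. symm_op \<gamma> (symm_inverse \<gamma> b) t = b t"
    by (auto simp: symm_inverse_def l2_inverse_def L2_iff_sqi l2_eq_def)
  show "sqi circ_measure b" using b by (simp add: L2_iff_sqi)
qed

text \<open>\<open>P_LS n\<close> fixes \<open>X_LS n\<close> and \<open>Q_LS \<gamma> n\<close>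
  fixes its image, almost everywhere. So any preimage of \<open>Q_LS \<gamma> n d\<close> in
  \<open>X_LS n\<close> solves the discrete equation, and the chosen solution satisfies the normal
  equations.\<close>

lemma LS_solution_properties:
  fixes n :: nat
  assumes d: "sqi circ_measure d"
  defines "z \<equiv> K_LS_inverse \<gamma> n (Q_LS \<gamma> n d)"
  shows "z \<in> X_LS n" "\<And>w. w \<in> X_LS n \<Longrightarrow> l2_inner (\<lambda>t. d t - symm_op \<gamma> z t) (symm_op \<gamma> w) = 0"
proof -
  have sK: "sqi circ_measure (symm_op \<gamma> (trig k))" for k by (rule symm_op_sqi[OF reg sqi_trig])
  note Q = orth_proj_properties[OF Y_LS_span[of n] finite_atLeastAtMost_int sK d, folded Q_LS_def]
  have K: "AE t in circ_measure. K_LS \<gamma> n x t = symm_op \<gamma> x t" if x: "x \<in> X_LS n" for x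
  proof -
    have P: "P_LS n x \<in> X_LS n" "AE t in circ_measure. P_LS n x t = x t"
      unfolding P_LS_def
      using orth_proj_properties(1)[OF X_LS_trig[of n] finite_atLeastAtMost_int sqi_trig X_LS_sqi[OF x]]
        orth_proj_self[OF X_LS_trig[of n] finite_atLeastAtMost_int sqi_trig x] by auto
    have "symm_op \<gamma> (P_LS n x) = symm_op \<gamma> x"
      by (rule symm_op_cong_AE[OF reg sqi_measurable[OF X_LS_sqi[OF P(1)]] sqi_measurable[OF X_LS_sqi[OF x]] P(2)])
    then show ?thesis
      unfolding K_LS_def Q_LS_def
      using orth_proj_self[OF Y_LS_span[of n] finite_atLeastAtMost_int sK, of "symm_op \<gamma> x"] x by (simp add: Y_LS_def)
  qed
  obtain x where x: "x \<in> X_LS n" "Q_LS \<gamma> n d = symm_op \<gamma> x" using Q(1) by (auto simp: Y_LS_def)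
  have "x \<in> X_LS n \<and> l2_eq (K_LS \<gamma> n x) (Q_LS \<gamma> n d)" using x K[OF x(1)] by (simp add: l2_eq_def)
  from someI[of "\<lambda>x. x \<in> X_LS n \<and> l2_eq (K_LS \<gamma> n x) (Q_LS \<gamma> n d)", OF this]
  have z: "z \<in> X_LS n" "l2_eq (K_LS \<gamma> n z) (Q_LS \<gamma> n d)" by (auto simp: z_def K_LS_inverse_def l2_inverse_def)
  show "z \<in> X_LS n" by (rule z(1))
  fix w assume w: "w \<in> X_LS n"
  have ae: "AE t in circ_measure. symm_op \<gamma> z t = Q_LS \<gamma> n d t"
    using z(2) K[OF z(1)] unfolding l2_eq_def by eventually_elim simp
  have sz: "sqi circ_measure (symm_op \<gamma> z)" and sw: "sqi circ_measure (symm_op \<gamma> w)" and sx: "sqi circ_measure (symm_op \<gamma> x)"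
    by (intro symm_op_sqi[OF reg] X_LS_sqi[of _ n] z w x)+
  have "l2_inner (\<lambda>t. d t - symm_op \<gamma> z t) (symm_op \<gamma> w) = l2_inner (\<lambda>t. d t - Q_LS \<gamma> n d t) (symm_op \<gamma> w)"
    unfolding l2_inner_def
  proof (rule integral_cong_AE)
    show "AE t in circ_measure. (d t - symm_op \<gamma> z t) * cnj (symm_op \<gamma> w t) = (d t - Q_LS \<gamma> n d t) * cnj (symm_op \<gamma> w t)"
      using ae by eventually_elim simp
  qed (use sz sx d sqi_cnj[OF sw] in \<open>auto simp: sqi_def x(2)\<close>)
  also have "\<dots> = 0" using w by (intro Q(2)) (simp add: Y_LS_def)
  finally show "l2_inner (\<lambda>t. d t - symm_op \<gamma> z t) (symm_op \<gamma> w) = 0" .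
qed

text \<open>The error is split at the partial sum \<open>p\<close>. On the polynomial
  \<open>e\<close> the inverse estimate costs \<open>2 * n\<close> and coercivity
  \<open>1 / c\<close>; in the approximation part this \<open>n\<close> cancels against the
  \<open>1 / n\<close> of the negative norm.\<close>

lemma LS_error_estimate:
  assumes c: "c > 0" "\<And>\<psi>. sqi circ_measure \<psi> \<Longrightarrow> c * nrm cZ (sobolev_weight (- 1) (fourier_coeff \<psi>)) \<le> nrm circ_measure (symm_op \<gamma> \<psi>)"
    and n: "n \<ge> 1" and b: "b \<in> l2_image (symm_op \<gamma>) L2" and d: "d \<in> L2" "l2_dist d b \<le> \<delta>"
  defines "x \<equiv> symm_inverse \<gamma> b"
  defines "D \<equiv> nrm circ_measure (\<lambda>t. x t - tpoly {- int n..int n} (fourier_coeff x) t)"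
  shows "LS_error \<gamma> n b d \<le> 2 / c * real n * \<delta> + (1 + 2 / c * symm_ext_norm \<gamma>) * D"
proof -
  define p where "p = tpoly {- int n..int n} (fourier_coeff x)"
  define z where "z = K_LS_inverse \<gamma> n (Q_LS \<gamma> n d)"
  define e where "e t = z t - p t" for t
  note xp = symm_inverse_properties[OF b, folded x_def]
  have sd: "sqi circ_measure d" using d(1) by (simp add: L2_iff_sqi)
  note zp = LS_solution_properties[where n = n, OF sd, folded z_def]
  have pX: "p \<in> X_LS n" unfolding p_def by (rule tpoly_X_LS)
  have sp: "sqi circ_measure p" and sz: "sqi circ_measure z" using X_LS_sqi pX zp(1) by auto
  have eX: "e \<in> X_LS n" unfolding e_def by (rule X_LS_diff[OF zp(1) pX])
  have se: "sqi circ_measure e" by (rule X_LS_sqi[OF eX])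
  let ?K = "symm_op \<gamma>"
  note sK = symm_op_sqi[OF reg]
  have Ke: "?K e t = ?K z t - ?K p t" for t unfolding e_def by (rule symm_op_diff[OF reg sz sp])
  have "nrm circ_measure (\<lambda>t. d t - ?K p t) \<le> \<delta> + symm_ext_norm \<gamma> * (1 / real n * D)"
  proof -
    have "nrm circ_measure (\<lambda>t. d t - ?K p t) \<le> nrm circ_measure (\<lambda>t. d t - b t) + nrm circ_measure (\<lambda>t. b t - ?K p t)"
      by (rule nrm_triangle_mid[OF sd xp(3) sK[OF sp]])
    also have "nrm circ_measure (\<lambda>t. d t - b t) \<le> \<delta>" using d(2) by (simp add: l2_dist_def l2_norm_eq_nrm)
    also have "nrm circ_measure (\<lambda>t. b t - ?K p t) = nrm circ_measure (?K (\<lambda>t. x t - p t))"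
    proof (rule nrm_cong_AE)
      show "AE t in circ_measure. b t - ?K p t = ?K (\<lambda>t. x t - p t) t"
        using xp(2) by eventually_elim (simp add: symm_op_diff[OF reg xp(1) sp])
    qed (intro sqi_measurable sqi_diff sK xp sp)+
    also have "\<dots> \<le> symm_ext_norm \<gamma> * nrm cZ (sobolev_weight (- 1) (fourier_coeff (\<lambda>t. x t - p t)))"
      by (intro symm_op_nrm_le_symm_ext_norm[OF reg] sqi_diff xp sp)
    also have "\<dots> \<le> symm_ext_norm \<gamma> * (1 / real n * D)"
      unfolding p_def D_def
      by (intro mult_left_mono partial_sum_negative_norm xp n symm_ext_norm_bound(2)[OF reg sqi_imp_sobolev_minus_1[OF sqi_zero]])
    finally show ?thesis by simp
  qed
  \<comment> \<open>Since the residual of \<open>z\<close> is orthogonal to \<open>?K e\<close>, the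
    squared norm of \<open>?K e\<close> is the inner product of \<open>d - ?K p\<close> with
    \<open>?K e\<close>; Cauchy-Schwarz lets one factor cancel.\<close>
  moreover have "nrm circ_measure (?K e) \<le> nrm circ_measure (\<lambda>t. d t - ?K p t)"
  proof -
    have s1: "sqi circ_measure (\<lambda>t. d t - ?K z t)" and s2: "sqi circ_measure (\<lambda>t. d t - ?K p t)"
      by (intro sqi_diff sd sK sz sp)+
    have "?K e = (\<lambda>t. (d t - ?K p t) - (d t - ?K z t))" by (auto simp: Ke)
    then have "l2_inner (?K e) (?K e) = l2_inner (\<lambda>t. d t - ?K p t) (?K e) - l2_inner (\<lambda>t. d t - ?K z t) (?K e)"
      using l2_inner_diff_left[OF s2 s1 sK[OF se]] by simp
    then have "complex_of_real ((nrm circ_measure (?K e))\<^sup>2) = l2_inner (\<lambda>t. d t - ?K p t) (?K e)"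
      unfolding zp(2)[OF eX] l2_inner_self by simp
    then have "cmod (complex_of_real ((nrm circ_measure (?K e))\<^sup>2)) \<le> nrm circ_measure (\<lambda>t. d t - ?K p t) * nrm circ_measure (?K e)"
      using l2_inner_le_nrm[OF s2 sK[OF se]] by simp
    then have "nrm circ_measure (?K e) * nrm circ_measure (?K e) \<le> nrm circ_measure (\<lambda>t. d t - ?K p t) * nrm circ_measure (?K e)"
      unfolding norm_of_real by (simp add: power2_eq_square)
    then show ?thesis
      using nrm_nonneg[of circ_measure "?K e"] nrm_nonneg[of circ_measure "\<lambda>t. d t - ?K p t"]
      by (cases "nrm circ_measure (?K e) = 0") (auto simp: mult_le_cancel_right)
  qed
  ultimately have Kb: "nrm circ_measure (?K e) \<le> \<delta> + symm_ext_norm \<gamma> * (1 / real n * D)" by linarith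
  have "nrm circ_measure e \<le> 2 * real n * nrm cZ (sobolev_weight (- 1) (fourier_coeff e))"
    by (rule X_LS_inverse_estimate[OF eX n])
  also have "nrm cZ (sobolev_weight (- 1) (fourier_coeff e)) \<le> nrm circ_measure (?K e) / c"
    using c(2)[OF se] c(1) by (simp add: field_simps)
  also have "\<dots> \<le> (\<delta> + symm_ext_norm \<gamma> * (1 / real n * D)) / c" using Kb c(1) by (simp add: divide_right_mono)
  finally have "nrm circ_measure e \<le> 2 * real n * ((\<delta> + symm_ext_norm \<gamma> * (1 / real n * D)) / c)"
    by (simp add: mult_left_mono)
  also have "\<dots> = 2 / c * real n * \<delta> + 2 / c * symm_ext_norm \<gamma> * D"
    using n c(1) by (simp add: field_simps)
  finally have e: "nrm circ_measure e \<le> 2 / c * real n * \<delta> + 2 / c * symm_ext_norm \<gamma> * D" .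
  have "LS_error \<gamma> n b d = nrm circ_measure (\<lambda>t. x t - z t)"
    by (simp add: LS_error_def l2_dist_def l2_norm_eq_nrm x_def z_def)
  also have "\<dots> \<le> nrm circ_measure (\<lambda>t. x t - p t) + nrm circ_measure (\<lambda>t. p t - z t)"
    by (rule nrm_triangle_mid[OF xp(1) sp sz])
  also have "nrm circ_measure (\<lambda>t. p t - z t) = nrm circ_measure e" unfolding e_def by (rule nrm_minus_commute)
  finally have "LS_error \<gamma> n b d \<le> D + nrm circ_measure e" by (simp add: D_def p_def)
  also have "\<dots> \<le> D + (2 / c * real n * \<delta> + 2 / c * symm_ext_norm \<gamma> * D)" using e by simp
  also have "\<dots> = 2 / c * real n * \<delta> + (1 + 2 / c * symm_ext_norm \<gamma>) * D" by (simp add: distrib_right)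
  finally show ?thesis .
qed

end

text \<open>The choice of \<open>n\<close> balances \<open>n * \<delta>\<close> against
  \<open>n powr (- r)\<close>: both become \<open>\<delta> powr (r / (r + 1))\<close> up to a
  constant.\<close>

lemma a_priori_choice_bigo:
  fixes E :: "nat \<Rightarrow> real \<Rightarrow> real"
  assumes r: "r \<ge> 0" and C: "C \<ge> 0" "S \<ge> 0"
    and E: "\<And>n \<delta>. n \<ge> 1 \<Longrightarrow> \<delta> > 0 \<Longrightarrow> 0 \<le> E n \<delta> \<and> E n \<delta> \<le> C * real n * \<delta> + S / real n powr r"
  shows "(\<lambda>\<delta>. E (nat \<lceil>\<delta> powr (- 1 / (r + 1))\<rceil>) \<delta>) \<in> O[at_right 0](\<lambda>\<delta>. \<delta> powr (r / (r + 1)))"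
proof (rule bigoI[where c = "2 * C + S"])
  have "\<forall>\<^sub>F \<delta> in at_right (0::real). \<delta> \<in> {0<..<1}" by (rule eventually_at_right_real) simp
  then show "\<forall>\<^sub>F \<delta> in at_right 0. norm (E (nat \<lceil>\<delta> powr (- 1 / (r + 1))\<rceil>) \<delta>) \<le> (2 * C + S) * norm (\<delta> powr (r / (r + 1)))"
  proof eventually_elim
    case (elim \<delta>)
    then have \<delta>: "0 < \<delta>" "\<delta> < 1" by auto
    define y where "y = \<delta> powr (- 1 / (r + 1))"
    define n where "n = nat \<lceil>y\<rceil>"
    have y1: "y \<ge> 1"
    proof -
      have "1 powr (- 1 / (r + 1)) \<le> \<delta> powr (- 1 / (r + 1))" using \<delta> r by (intro powr_mono2') (auto simp: field_simps)
      then show ?thesis by (simp add: y_def)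
    qed
    \<comment> \<open>Rounding up at most doubles \<open>y\<close> because \<open>y \<ge> 1\<close>;
      hence the restriction to \<open>\<delta> < 1\<close> and the factor 2 in front of
      \<open>C\<close>.\<close>
    have ny: "y \<le> real n" "real n \<le> 2 * y" using y1 unfolding n_def by linarith+
    have n1: "n \<ge> 1" using y1 ny by linarith
    have a: "y * \<delta> = \<delta> powr (r / (r + 1))"
    proof -
      have "y * \<delta> = \<delta> powr (- 1 / (r + 1)) * \<delta> powr 1" using \<delta> by (simp add: y_def)
      also have "\<dots> = \<delta> powr (- 1 / (r + 1) + 1)" by (rule powr_add[symmetric])
      also have "- 1 / (r + 1) + 1 = r / (r + 1)" using r by (simp add: field_simps)
      finally show ?thesis .
    qed
    have bb: "1 / y powr r = \<delta> powr (r / (r + 1))"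
    proof -
      have "y powr r = \<delta> powr (- (r / (r + 1)))" by (simp add: y_def powr_powr)
      then show ?thesis by (simp add: powr_minus_divide)
    qed
    have "E n \<delta> \<le> C * real n * \<delta> + S / real n powr r" using E[OF n1 \<delta>(1)] by simp
    also have "\<dots> \<le> C * (2 * y) * \<delta> + S / y powr r"
    proof (rule add_mono)
      show "C * real n * \<delta> \<le> C * (2 * y) * \<delta>" using ny C \<delta> by (intro mult_right_mono mult_left_mono) auto
      have "y powr r \<le> real n powr r" using ny y1 r by (intro powr_mono2) auto
      then show "S / real n powr r \<le> S / y powr r" using C y1 n1 by (intro divide_left_mono mult_pos_pos) auto
    qed
    also have "\<dots> = 2 * C * (y * \<delta>) + S * (1 / y powr r)" by simp
    also have "\<dots> = (2 * C + S) * \<delta> powr (r / (r + 1))" unfolding a bb by (simp add: distrib_right)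
    finally show ?case using E[OF n1 \<delta>(1)] by (simp add: n_def y_def)
  qed
qed

theorem mainTheorem2:
  fixes \<Omega> :: "complex set" and \<gamma> :: "real \<Rightarrow> complex" and z\<^sub>0 :: complex
  assumes "open \<Omega>" and "connected \<Omega>" and "bounded \<Omega>" and "simply_connected \<Omega>"
    and "regular_closed_C3_curve \<gamma>"
    and "frontier \<Omega> = \<gamma> ` {0..2*pi}"
    and "z\<^sub>0 \<in> \<Omega>" and "\<forall>x\<in>frontier \<Omega>. norm (x - z\<^sub>0) \<noteq> 1"
  shows "\<exists>C>0. let C\<^sub>1 = 3 + C * symm_ext_norm \<gamma> in
    (\<forall>(n::nat) (\<delta>::real) b b\<^sub>\<delta>.
       n \<ge> 1 \<longrightarrow> \<delta> \<ge> 0 \<longrightarrow> b \<in> l2_image (symm_op \<gamma>) L2 \<longrightarrow> b\<^sub>\<delta> \<in> L2 \<longrightarrow> l2_dist b\<^sub>\<delta> b \<le> \<delta> \<longrightarrow>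
         LS_error \<gamma> n b b\<^sub>\<delta>
           \<le> C * real n * \<delta> + C\<^sub>1 * (INF z\<in>X_LS n. l2_dist (symm_inverse \<gamma> b) z) \<and>
         (\<forall>r::real. 0 \<le> r \<longrightarrow> r \<le> 2 \<longrightarrow> fourier_coeff (symm_inverse \<gamma> b) \<in> sobolev r \<longrightarrow>
            LS_error \<gamma> n b b\<^sub>\<delta>
              \<le> C * real n * \<delta>
                 + C\<^sub>1 / real n powr r * sobolev_norm r (fourier_coeff (symm_inverse \<gamma> b)))) \<and>
    (\<forall>(r::real) b (bd :: real \<Rightarrow> (real \<Rightarrow> complex)).
       0 \<le> r \<longrightarrow> r \<le> 2 \<longrightarrow> b \<in> l2_image (symm_op \<gamma>) L2 \<longrightarrow>
       fourier_coeff (symm_inverse \<gamma> b) \<in> sobolev r \<longrightarrow>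
       (\<forall>\<delta>>0. bd \<delta> \<in> L2 \<and> l2_dist (bd \<delta>) b \<le> \<delta>) \<longrightarrow>
         (\<lambda>\<delta>. LS_error \<gamma> (nat \<lceil>\<delta> powr (- 1 / (r + 1))\<rceil>) b (bd \<delta>))
           \<in> O[at_right 0](\<lambda>\<delta>. \<delta> powr (r / (r + 1))))"
proof -
  note reg = \<open>regular_closed_C3_curve \<gamma>\<close>
  have inj: "\<forall>\<psi>. continuous_on {0..2*pi} \<psi> \<longrightarrow> (AE t in circ_measure. symm_op \<gamma> \<psi> t = 0) \<longrightarrow> (\<forall>s\<in>{0..2*pi}. \<psi> s = 0)"
    using symm_op_injective[OF assms(3,5,6,1,7,8)] by blast
  obtain c where c: "c > 0"
    "\<And>\<psi>. sqi circ_measure \<psi> \<Longrightarrow> c * nrm cZ (sobolev_weight (- 1) (fourier_coeff \<psi>)) \<le> nrm circ_measure (symm_op \<gamma> \<psi>)"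
    using symm_op_coercive[OF reg inj] by blast
  \<comment> \<open>The 2 is that of the inverse estimate. \<open>C\<close> depends on the curve
    alone, so \<open>n\<close>, \<open>r\<close> and the data can be quantified after it.\<close>
  define C where "C = 2 / c"
  define C\<^sub>1 where "C\<^sub>1 = 3 + C * symm_ext_norm \<gamma>"
  have C0: "C > 0" using c(1) by (simp add: C_def)
  have N0: "0 \<le> symm_ext_norm \<gamma>"
    by (rule symm_ext_norm_bound(2)[OF reg sqi_imp_sobolev_minus_1[OF sqi_zero]])
  have C1: "C\<^sub>1 \<ge> 0" using C0 N0 by (simp add: C\<^sub>1_def)
  define D where "D n b = nrm circ_measure (\<lambda>t. symm_inverse \<gamma> b t - tpoly {- int n..int n} (fourier_coeff (symm_inverse \<gamma> b)) t)" for n :: nat and b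
  have D0: "D n b \<ge> 0" for n b by (simp add: D_def)
  have err: "LS_error \<gamma> n b d \<le> C * real n * \<delta> + C\<^sub>1 * D n b"
    if "n \<ge> 1" "b \<in> l2_image (symm_op \<gamma>) L2" "d \<in> L2" "l2_dist d b \<le> \<delta>" for n b d \<delta>
  proof -
    have "LS_error \<gamma> n b d \<le> C * real n * \<delta> + (1 + C * symm_ext_norm \<gamma>) * D n b"
      unfolding C_def D_def by (rule LS_error_estimate[OF reg c that])
    \<comment> \<open>The estimate yields 1 where \<open>C\<^sub>1\<close> has 3.\<close>
    also have "\<dots> \<le> C * real n * \<delta> + C\<^sub>1 * D n b"
      by (intro add_left_mono mult_right_mono D0) (simp add: C\<^sub>1_def)
    finally show ?thesis .
  qed
  \<comment> \<open>The partial sum does at least as well as every competitor, so its error is below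
    the infimum by which the statement expresses the minimum.\<close>
  have best: "D n b \<le> (INF z\<in>X_LS n. l2_dist (symm_inverse \<gamma> b) z)"
    if b: "b \<in> l2_image (symm_op \<gamma>) L2" for n b
  proof (rule cINF_greatest)
    show "X_LS n \<noteq> {}" using tpoly_X_LS by blast
    show "D n b \<le> l2_dist (symm_inverse \<gamma> b) z" if "z \<in> X_LS n" for z
      unfolding D_def l2_dist_def l2_norm_eq_nrm
      by (rule partial_sum_best_approximation[OF symm_inverse_properties(1)[OF reg b] that])
  qed
  have smooth: "LS_error \<gamma> n b d \<le> C * real n * \<delta> + C\<^sub>1 / real n powr r * sobolev_norm r (fourier_coeff (symm_inverse \<gamma> b))"
    if n: "n \<ge> 1" and b: "b \<in> l2_image (symm_op \<gamma>) L2" and d: "d \<in> L2" "l2_dist d b \<le> \<delta>"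
      and r: "0 \<le> r" "fourier_coeff (symm_inverse \<gamma> b) \<in> sobolev r" for n b d \<delta> r
  proof -
    have "D n b \<le> 1 / real n powr r * sobolev_norm r (fourier_coeff (symm_inverse \<gamma> b))"
      unfolding D_def by (rule partial_sum_sobolev_error[OF symm_inverse_properties(1)[OF reg b] r(1) n r(2)])
    then have "C\<^sub>1 * D n b \<le> C\<^sub>1 * (1 / real n powr r * sobolev_norm r (fourier_coeff (symm_inverse \<gamma> b)))"
      by (rule mult_left_mono[OF _ C1])
    then show ?thesis using err[OF n b d] by simp
  qed
  show ?thesis
    unfolding Let_def
  proof (rule exI[of _ C], intro conjI allI impI C0, goal_cases)
    case (1 n \<delta> b d)
    have "C\<^sub>1 * D n b \<le> C\<^sub>1 * (INF z\<in>X_LS n. l2_dist (symm_inverse \<gamma> b) z)"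
      by (rule mult_left_mono[OF best[OF 1(3)] C1])
    then show ?case using err[OF 1(1,3,4,5)] by (simp add: C\<^sub>1_def)
  next
    case (2 n \<delta> b d r)
    then show ?case using smooth[of n b d \<delta> r] by (simp add: C\<^sub>1_def)
  next
    case (3 r b bd)
    define S where "S = sobolev_norm r (fourier_coeff (symm_inverse \<gamma> b))"
    have S0: "S \<ge> 0" using sobolev_norm_eq_nrm[OF 3(4)] by (simp add: S_def)
    show ?case
    proof (rule a_priori_choice_bigo[of r C "C\<^sub>1 * S" "\<lambda>n \<delta>. LS_error \<gamma> n b (bd \<delta>)"])
      fix n :: nat and \<delta> :: real assume n: "n \<ge> 1" and \<delta>: "\<delta> > 0"
      have d: "bd \<delta> \<in> L2" "l2_dist (bd \<delta>) b \<le> \<delta>" using 3(5) \<delta> by auto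
      have "LS_error \<gamma> n b (bd \<delta>) \<le> C * real n * \<delta> + C\<^sub>1 * S / real n powr r"
        using smooth[OF n 3(3) d 3(1) 3(4)] by (simp add: S_def)
      moreover have "0 \<le> LS_error \<gamma> n b (bd \<delta>)" by (simp add: LS_error_def l2_dist_def l2_norm_eq_nrm)
      ultimately show "0 \<le> LS_error \<gamma> n b (bd \<delta>) \<and> LS_error \<gamma> n b (bd \<delta>) \<le> C * real n * \<delta> + C\<^sub>1 * S / real n powr r" by simp
    qed (use 3(1) C0 C1 S0 in simp_all)
  qed
qed

end
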